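(* Suppose the Boundedness, Demand-shock, (enlarged) Link-function, Independent-covariates, and Feasibility-and-tractability assumptions stated in the context hold and $T\ge6$. Then the regret of the inventory-constrained Thompson sampling algorithm (described in the context) run with regularization parameter $\lambda=1$ is at most $$40\,\bar g\,\bar p\,\bar\gamma\sqrt{2e\pi\, dT\log\left(\frac{2d+T}{2d}\right)\log(4T^2)}+\bar p\sqrt{(\bar D^2+\bar\sigma^2)T}+7\bar D\bar p+\sqrt2(\bar p+\bar p^2)\,\bar g\,\bar\theta\,\mathcal W_T(\mathcal P_1,\dots,\mathcal P_T)$$ $$=\tilde O\big(d\sqrt T+\mathcal W_T(\mathcal P_1,\dots,\mathcal P_T)\big),$$ where $\bar\gamma=2\bar\theta+\frac{2\bar\sigma}{\underline g}\sqrt{2\log T+2d\log\left(\frac{2d+T}{2d}\right)}$ and $\tilde O$ hides logarithmic factors.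
   Context: Model. At each period $t=1,\dots,T$ the seller observes a covariate $X_t=x_t\in\mathcal X\subset\mathbb R^d$, sets a price $p_t\in[\underline p,\bar p]$ with $0\le\underline p\le\bar p$, and the true demand is $D_t=g(x_t^\top\alpha^*+x_t^\top\beta^*p_t)+\epsilon_t$, with $g:\mathbb R\to\mathbb R$ known and $\theta^*=(\alpha^*,\beta^* )\in\mathbb R^{2d}$ unknown. The initial inventory is $C_1=C=cT$; the realized sale is $\tilde D_t=\min\{C_t,D_t\}$, with $C_t=C_1-\sum_{s<t}\tilde D_s$. Put $z_t=(x_t,p_tx_t)$. Independent covariates. $X_t\sim\mathcal P_t$ with unknown $\mathcal P_t$ supported on $\mathcal X$; the $X_t$ are independent of each other and of the shocks. Boundedness. $\theta^*\in\Theta:=\{\theta\in\mathbb R^{2d}:\|\theta\|_2\le\bar\theta\}$, $\bar\theta>0$; $0\le g(x^\top\alpha^*+x^\top\beta^*p)\le\bar D$ and $\|(x,px)\|_2\le1$ for all $x\in\mathcal X$, $p\in[\underline p,\bar p]$. Enlarged link-function assumption. Let $\tilde\Theta$ be the set of $\theta\in\mathbb R^{2d}$ such that $\|\theta-\tilde\theta\|_2\le4\bar\theta\sqrt{\log(4T^2)}+\frac{4\bar\sigma}{\underline g}\sqrt{(2\log T+2d\log(\frac{2d+T}{2d}))\log(4T^2)}$ for some $\tilde\theta\in\Theta$. $g$ is strictly increasing and differentiable, and $0<\underline g\le g'(z)\le\bar g<\infty$ for all $z=x^\top\alpha+x^\top\beta p$ with $x\in\mathcal X$, $(\alpha,\beta)\in\tilde\Theta$,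 $p\in[\underline p,\bar p]$. Demand shock. With $\mathcal H_t=\sigma(p_1,\dots,p_t,\epsilon_1,\dots,\epsilon_t,X_1,\dots,X_{t+1})$, $\mathbb E[\epsilon_t|\mathcal H_{t-1}]=0$ and $\log\mathbb E[e^{s\epsilon_t}|\mathcal H_{t-1}]\le\bar\sigma^2s^2/2$ for all $s\in\mathbb R$ and all $t$; $\bar\sigma$ is known. The algorithm's randomization is independent of the past and of shocks and covariates. Feasibility and tractability. (a) $c=C/T\in[0,\bar D]$. (b) For all $x\in\mathcal X$: $x^\top\beta^*<0$ and $g(x^\top\alpha^*+x^\top\beta^*\bar p)<c$. (c) $y\mapsto y\,g^{-1}(y)$ is convex on $[0,\bar D]$. Benchmark and regret. $\mathrm{OPT}(x_1,\dots,x_T,C)=\max_{\pi\in\Pi_{\mathrm{hind}}}\mathbb E[\sum_{t=1}^Tp_t^\pi\tilde D_t]$, where $\Pi_{\mathrm{hind}}$ is the set of policies choosing $p_t\in[\underline p,\bar p]$ from $x_1,\dots,x_T$, $D_1,\dots,D_{t-1}$, $p_1,\dots,p_{t-1}$, $\theta^*$, $C$ (possibly randomized), the expectation being over shocks and policy randomness. $\mathrm{Reg}_T^\pi(\mathcal P_1,\dots,\mathcal P_T)=\mathbb E[\mathrm{OPT}(X_1,\dots,X_T,C)-\sum_{t=1}^Tp_t^\pi\tilde D_t]$. Variation. $\mathcal W_T(\mathcal P_1,\dots,\mathcal P_T)=\sum_{t=1}^T\mathcal W(\mathcal P_t,\bar{\mathcal P}_T)$, where $\bar{\mathcal P}_T=\frac1T\sum_t\mathcal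 P_t$ and $\mathcal W$ is the (1-)Wasserstein distance with Euclidean ground metric. Estimator. $M_t=\lambda I_{2d}+\sum_{s=1}^tz_sz_s^\top$; $l_t(\theta)=-\int_{D_t}^{g(z_t^\top\theta)}\frac{u-D_t}{h(u)}du$ with $h(u)=g'(g^{-1}(u))$ (up to a constant not depending on $\theta$, the function with gradient $(D_t-g(z_t^\top\theta))z_t$); $\hat\theta_t=(\hat\alpha_t,\hat\beta_t)=\arg\max_{\theta\in\Theta}\{-\frac{\lambda\underline g}{2}\|\theta\|_2^2+\sum_{s=1}^tl_s(\theta)\}$. Algorithm. Initialize the dual variable $\mu_1=0$. At each $t$: compute $\hat\theta_{t-1}$, observe $X_t=x_t$, set $(\hat a_t,\hat b_t)=(x_t^\top\hat\alpha_{t-1},x_t^\top\hat\beta_{t-1})$. Let $\tilde M_{t-1}=(Y_t^\top M_{t-1}^{-1}Y_t)^{-1}$ with $Y_t=\begin{pmatrix}x_t&\mathbf 0\\ \mathbf 0&x_t\end{pmatrix}\in\mathbb R^{2d\times2}$ (so $\tilde M_{t-1}^{-1/2}$ is the symmetric square root of $Y_t^\top M_{t-1}^{-1}Y_t$). Draw $\eta_t\sim\mathcal N(0,I_2)$ and set $(\tilde a_t,\tilde b_t)=(\hat a_t,\hat b_t)+\big(2\sqrt\lambda\bar\theta+\frac{2\bar\sigma}{\underline g}\sqrt{2\log T+2d\log(\frac{2d\lambda+T}{2d\lambda})}\big)\tilde M_{t-1}^{-1/2}\eta_t$. Set $p_t\in\arg\max_{p\in[\mu_t,\bar p]\cap[\underline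 p,\bar p]}(p-\mu_t)\,g(\tilde a_t+\tilde b_tp)$ (maximizers assumed to exist) and observe $D_t$. If $D_t\ge C_t$ the algorithm stops (the sale in that period is $C_t$, and no further revenue is earned). Otherwise $\mu_{t+1}=\mathrm{Proj}_{[0,\bar p]}\big(\mu_t+\frac{\bar p}{\sqrt{(\bar D^2+\bar\sigma^2)T}}(D_t-c)\big)$ and $C_{t+1}=C_t-D_t$.
   Formalization: The realized sale is min{C_t,D_t} only while C_t>0 and is 0 once inventory is exhausted, for the benchmark policies in OPT as well as the algorithm; otherwise negative demands would let OPT restock an empty inventory and the claimed bound fails. *)

theory Defs
  imports "HOL-Probability.Probability"
begin

text \<open>
  The covariate dimension is \<open>d = CARD('n)\<close>.  A parameter \<open>\<theta> = (\<alpha>, \<beta>)\<close> of dimension \<open>2 * d\<close>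
  is a vector indexed by \<^typ>\<open>'n + 'n\<close>, so that \<^const>\<open>norm\<close> is the Euclidean norm.
\<close>

definition stack :: "real^'n \<Rightarrow> real^'n \<Rightarrow> real^('n + 'n)" where
  "stack a b = (\<chi> k. case k of Inl i \<Rightarrow> a $ i | Inr i \<Rightarrow> b $ i)"

definition alpha_part :: "real^('n + 'n) \<Rightarrow> real^'n" where
  "alpha_part \<theta> = (\<chi> i. \<theta> $ Inl i)"

definition beta_part :: "real^('n + 'n) \<Rightarrow> real^'n" where
  "beta_part \<theta> = (\<chi> i. \<theta> $ Inr i)"

definition lin_index :: "real^('n::finite + 'n) \<Rightarrow> real^'n \<Rightarrow> real \<Rightarrow> real" where
  "lin_index \<theta> x q = x \<bullet> alpha_part \<theta> + (x \<bullet> beta_part \<theta>) * q"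

lemma inner_stack: "stack x (q *\<^sub>R x) \<bullet> \<theta> = lin_index \<theta> (x :: real^'n::finite) q"
proof -
  have "stack x (q *\<^sub>R x) \<bullet> \<theta> =
      (\<Sum>k\<in>(UNIV :: 'n set) <+> (UNIV :: 'n set). stack x (q *\<^sub>R x) $ k * \<theta> $ k)"
    by (simp add: inner_vec_def)
  also have "\<dots> = lin_index \<theta> x q"
    by (subst sum.Plus)
       (simp_all add: lin_index_def stack_def alpha_part_def beta_part_def inner_vec_def
          sum_distrib_right sum_distrib_left mult_ac)
  finally show ?thesis .
qed

definition Theta_enlarged ::
    "real \<Rightarrow> real \<Rightarrow> real \<Rightarrow> nat \<Rightarrow> (real^('n::finite + 'n)) set" where
  "Theta_enlarged \<theta>bar \<sigma>bar glow T =
    (let d = real CARD('n) in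
     {\<theta>. \<exists>\<theta>'. norm \<theta>' \<le> \<theta>bar \<and>
        norm (\<theta> - \<theta>') \<le> 4 * \<theta>bar * sqrt (ln (4 * real T ^ 2))
          + 4 * \<sigma>bar / glow *
            sqrt ((2 * ln (real T) + 2 * d * ln ((2 * d + real T) / (2 * d)))
                  * ln (4 * real T ^ 2))})"

text \<open>
  Additive shocks may make a demand negative.  The selling season ends, for every policy, when
  the inventory is exhausted: the sale is \<open>min k y\<close> while there is stock and \<open>0\<close> afterwards.  For
  \<open>k \<ge> 0\<close> this differs from \<open>min k y\<close> only if \<open>k = 0\<close> and \<open>y < 0\<close>; without the convention a
  policy could restock an empty inventory through negative sales at a low price.
\<close>

definition sale :: "real \<Rightarrow> real \<Rightarrow> real" where
  "sale k y = (if k \<le> 0 then 0 else min k y)"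

text \<open>
  \<open>stock C D t\<close> is the inventory at the beginning of period \<open>t\<close>; periods are numbered from 1.
\<close>

fun stock :: "real \<Rightarrow> (nat \<Rightarrow> real) \<Rightarrow> nat \<Rightarrow> real" where
  "stock C D 0 = C"
| "stock C D (Suc t) = (if t = 0 then C else stock C D t - sale (stock C D t) (D t))"

definition revenue :: "real \<Rightarrow> nat \<Rightarrow> (nat \<Rightarrow> real) \<Rightarrow> (nat \<Rightarrow> real) \<Rightarrow> real" where
  "revenue C T q D = (\<Sum>t=1..T. q t * sale (stock C D t) (D t))"

text \<open>
  Everything known in advance (the covariates, the true parameter, the inventory) is fixed here,
  so that a policy only has to map the past demands, the past prices and its own random seed to
  a price.  The seed is uniform on the unit interval and independent of the shocks; it encodes
  an arbitrary randomization.
\<close>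

type_synonym hind_policy = "nat \<Rightarrow> (nat \<Rightarrow> real) \<times> (nat \<Rightarrow> real) \<times> real \<Rightarrow> real"

definition hind_policies :: "real \<Rightarrow> real \<Rightarrow> nat \<Rightarrow> hind_policy set" where
  "hind_policies plo pbar T =
    {\<pi>. \<forall>t\<in>{1..T}.
        \<pi> t \<in> borel_measurable
          (PiM {1..<t} (\<lambda>_. borel) \<Otimes>\<^sub>M PiM {1..<t} (\<lambda>_. borel) \<Otimes>\<^sub>M borel) \<and>
        (\<forall>h. \<pi> t h \<in> {plo..pbar})}"

text \<open>
  \<open>hind_path m \<pi> e u t\<close> is the pair of the demands and the prices of periods \<open>1..t\<close>, where \<open>m s q\<close>
  is the mean demand of period \<open>s\<close> at price \<open>q\<close>, \<open>e\<close> are the shocks and \<open>u\<close> is the seed.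
\<close>

primrec hind_path ::
    "(nat \<Rightarrow> real \<Rightarrow> real) \<Rightarrow> hind_policy \<Rightarrow> (nat \<Rightarrow> real) \<Rightarrow> real \<Rightarrow> nat
      \<Rightarrow> (nat \<Rightarrow> real) \<times> (nat \<Rightarrow> real)" where
  "hind_path m \<pi> e u 0 = ((\<lambda>_. undefined), (\<lambda>_. undefined))"
| "hind_path m \<pi> e u (Suc t) =
    (let (D, P) = hind_path m \<pi> e u t; q = \<pi> (Suc t) (D, P, u)
     in (D(Suc t := m (Suc t) q + e (Suc t)), P(Suc t := q)))"

text \<open>
  \<open>N\<close> is the joint law of the shocks of periods \<open>1..T\<close>.
\<close>

definition hind_value ::
    "(nat \<Rightarrow> real) measure \<Rightarrow> (nat \<Rightarrow> real \<Rightarrow> real) \<Rightarrow> real \<Rightarrow> nat \<Rightarrow> hind_policy \<Rightarrow> real" where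
  "hind_value N m C T \<pi> =
    (\<integral>(e, u). (let (D, P) = hind_path m \<pi> e u T in revenue C T P D)
        \<partial>(N \<Otimes>\<^sub>M uniform_measure lborel {0..1}))"

definition OPT ::
    "(nat \<Rightarrow> real) measure \<Rightarrow> (real \<Rightarrow> real) \<Rightarrow> real^('n::finite + 'n) \<Rightarrow> real \<Rightarrow> real
      \<Rightarrow> nat \<Rightarrow> (nat \<Rightarrow> real^'n) \<Rightarrow> real \<Rightarrow> real" where
  "OPT N g \<theta> plo pbar T x C =
    (SUP \<pi>\<in>hind_policies plo pbar T. hind_value N (\<lambda>t q. g (lin_index \<theta> (x t) q)) C T \<pi>)"

text \<open>
  The benchmark is a supremum over an uncountable class of policies.  So that the regret does not
  collapse to the default value \<open>0\<close> of a non-integrable function, expectations of such quantities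
  are upper expectations; these agree with the integral on integrable functions.
\<close>

definition upper_expectation :: "'a measure \<Rightarrow> ('a \<Rightarrow> real) \<Rightarrow> ereal" where
  "upper_expectation M f =
    (INF h\<in>{h. integrable M h \<and> (AE \<omega> in M. f \<omega> \<le> h \<omega>)}. ereal (\<integral>\<omega>. h \<omega> \<partial>M))"

lemma upper_expectation_integrable:
  assumes "integrable M f"
  shows "upper_expectation M f = ereal (\<integral>\<omega>. f \<omega> \<partial>M)"
  unfolding upper_expectation_def
proof (rule antisym)
  show "(INF h\<in>{h. integrable M h \<and> (AE \<omega> in M. f \<omega> \<le> h \<omega>)}. ereal (\<integral>\<omega>. h \<omega> \<partial>M))
      \<le> ereal (\<integral>\<omega>. f \<omega> \<partial>M)"
    using assms by (intro INF_lower) auto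
  show "ereal (\<integral>\<omega>. f \<omega> \<partial>M)
      \<le> (INF h\<in>{h. integrable M h \<and> (AE \<omega> in M. f \<omega> \<le> h \<omega>)}. ereal (\<integral>\<omega>. h \<omega> \<partial>M))"
    using assms by (intro INF_greatest) (auto intro: integral_mono_AE)
qed

definition regret ::
    "'a measure \<Rightarrow> (real \<Rightarrow> real) \<Rightarrow> real^('n::finite + 'n) \<Rightarrow> real \<Rightarrow> real \<Rightarrow> nat \<Rightarrow> real
      \<Rightarrow> (nat \<Rightarrow> 'a \<Rightarrow> real^'n) \<Rightarrow> (nat \<Rightarrow> 'a \<Rightarrow> real) \<Rightarrow> (nat \<Rightarrow> 'a \<Rightarrow> real)
      \<Rightarrow> (nat \<Rightarrow> 'a \<Rightarrow> real) \<Rightarrow> ereal" where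
  "regret M g \<theta> plo pbar T C X \<epsilon> p D =
    upper_expectation M (\<lambda>\<omega>.
      OPT (distr M (PiM {1..T} (\<lambda>_. borel)) (\<lambda>\<omega>. \<lambda>t\<in>{1..T}. \<epsilon> t \<omega>))
          g \<theta> plo pbar T (\<lambda>t. X t \<omega>) C
      - revenue C T (\<lambda>t. p t \<omega>) (\<lambda>t. D t \<omega>))"

definition couplings ::
    "'a::metric_space measure \<Rightarrow> 'a measure \<Rightarrow> ('a \<times> 'a) measure set" where
  "couplings P Q =
    {\<gamma>. sets \<gamma> = sets (borel \<Otimes>\<^sub>M borel) \<and> distr \<gamma> borel fst = P \<and> distr \<gamma> borel snd = Q}"

definition wasserstein :: "'a::metric_space measure \<Rightarrow> 'a measure \<Rightarrow> ennreal" where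
  "wasserstein P Q = (INF \<gamma>\<in>couplings P Q. \<integral>\<^sup>+z. ennreal (dist (fst z) (snd z)) \<partial>\<gamma>)"

definition avg_measure :: "nat \<Rightarrow> (nat \<Rightarrow> 'a::topological_space measure) \<Rightarrow> 'a measure" where
  "avg_measure T P =
    measure_of UNIV (sets borel) (\<lambda>A. (\<Sum>t=1..T. emeasure (P t) A) / of_nat T)"

text \<open>
  The laws considered live on a bounded set, so the distances are finite and \<^const>\<open>enn2real\<close> loses nothing.
\<close>

definition variation :: "nat \<Rightarrow> (nat \<Rightarrow> 'a::metric_space measure) \<Rightarrow> real" where
  "variation T P = (\<Sum>t=1..T. enn2real (wasserstein (P t) (avg_measure T P)))"

text \<open>
  Substituting \<open>u = g v\<close> in \<open>- \<integral> (u - D) / g' (g\<inverse> u) du\<close>, taken from \<open>D\<close> to \<open>g (z \<bullet> \<theta>)\<close>, gives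
  the oriented integral of \<open>D - g v\<close> from \<open>g\<inverse> D\<close> to \<open>z \<bullet> \<theta>\<close>.  Starting at \<open>0\<close> instead changes it by
  a constant in \<open>\<theta>\<close> and also makes sense when the realized demand is outside the range of \<open>g\<close>.
\<close>

definition log_lik :: "(real \<Rightarrow> real) \<Rightarrow> 'v::euclidean_space \<Rightarrow> real \<Rightarrow> 'v \<Rightarrow> real" where
  "log_lik g z y \<theta> = (LBINT v=0..(z \<bullet> \<theta>). y - g v)"

lemma log_lik_gradient:
  assumes "continuous_on UNIV g"
  shows "GDERIV (log_lik g z y) \<theta> :> (y - g (z \<bullet> \<theta>)) *\<^sub>R z"
proof -
  define a b where "a = min 0 (z \<bullet> \<theta>) - 1" and "b = max 0 (z \<bullet> \<theta>) + 1"
  have "((\<lambda>u. LBINT v=0..u. y - g v) has_vector_derivative (y - g (z \<bullet> \<theta>)))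
      (at (z \<bullet> \<theta>) within {a..b})"
    unfolding zero_ereal_def
    by (rule interval_integral_FTC2)
       (auto simp: a_def b_def intro!: continuous_intros continuous_on_subset[OF assms])
  moreover have "at (z \<bullet> \<theta>) within {a..b} = at (z \<bullet> \<theta>)"
    by (rule at_within_interior) (auto simp: a_def b_def)
  ultimately have "((\<lambda>u. LBINT v=0..u. y - g v) has_derivative (\<lambda>h. h * (y - g (z \<bullet> \<theta>))))
      (at (z \<bullet> \<theta>))"
    by (simp add: has_vector_derivative_def)
  then have "((\<lambda>\<theta>. LBINT v=0..(z \<bullet> \<theta>). y - g v) has_derivative
      (\<lambda>h. (z \<bullet> h) * (y - g (z \<bullet> \<theta>)))) (at \<theta>)"
    by (rule has_derivative_compose[rotated]) (auto intro!: derivative_eq_intros)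
  then show ?thesis
    unfolding gderiv_def log_lik_def by (simp add: inner_commute mult.commute)
qed

definition mle_objective ::
    "(real \<Rightarrow> real) \<Rightarrow> real \<Rightarrow> real \<Rightarrow> (nat \<Rightarrow> real^'n::finite) \<Rightarrow> (nat \<Rightarrow> real) \<Rightarrow> (nat \<Rightarrow> real)
      \<Rightarrow> nat \<Rightarrow> real^('n + 'n) \<Rightarrow> real" where
  "mle_objective g glow lam x D p t \<theta> =
    - (lam * glow / 2) * (norm \<theta>)\<^sup>2
    + (\<Sum>s=1..t. log_lik g (stack (x s) (p s *\<^sub>R x s)) (D s) \<theta>)"

definition design_matrix ::
    "real \<Rightarrow> (nat \<Rightarrow> real^'n::finite) \<Rightarrow> (nat \<Rightarrow> real) \<Rightarrow> nat \<Rightarrow> real^('n + 'n)^('n + 'n)" where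
  "design_matrix lam x p t =
    lam *\<^sub>R mat 1
    + (\<Sum>s=1..t. let z = stack (x s) (p s *\<^sub>R x s) in (\<chi> i j. z $ i * z $ j))"

definition Y_matrix :: "real^'n \<Rightarrow> real^2^('n + 'n)" where
  "Y_matrix x = (\<chi> k j. (if j = 1 then stack x 0 else stack 0 x) $ k)"

definition psd_sqrt :: "real^'m^'m \<Rightarrow> real^'m^'m" where
  "psd_sqrt A = (THE B. transpose B = B \<and> (\<forall>v. 0 \<le> v \<bullet> (B *v v)) \<and> B ** B = A)"

definition explore_scale :: "real \<Rightarrow> real \<Rightarrow> real \<Rightarrow> real \<Rightarrow> nat \<Rightarrow> nat \<Rightarrow> real" where
  "explore_scale lam \<theta>bar \<sigma>bar glow d T =
    2 * sqrt lam * \<theta>bar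
    + 2 * \<sigma>bar / glow *
      sqrt (2 * ln (real T)
            + 2 * real d * ln ((2 * real d * lam + real T) / (2 * real d * lam)))"

definition sampled_coeffs ::
    "real \<Rightarrow> real \<Rightarrow> (nat \<Rightarrow> real^'n::finite) \<Rightarrow> (nat \<Rightarrow> real) \<Rightarrow> real^('n + 'n) \<Rightarrow> real^2 \<Rightarrow> nat
      \<Rightarrow> real^2" where
  "sampled_coeffs lam \<gamma> x p \<theta> noise t =
    vector [x t \<bullet> alpha_part \<theta>, x t \<bullet> beta_part \<theta>]
    + \<gamma> *\<^sub>R
      (psd_sqrt (transpose (Y_matrix (x t)) ** matrix_inv (design_matrix lam x p (t - 1))
                   ** Y_matrix (x t)) *v noise)"

fun dual :: "real \<Rightarrow> real \<Rightarrow> real \<Rightarrow> (nat \<Rightarrow> real) \<Rightarrow> nat \<Rightarrow> real" where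
  "dual stepsize c pbar D 0 = 0"
| "dual stepsize c pbar D (Suc t) =
    (if t = 0 then 0
     else closest_point {0..pbar} (dual stepsize c pbar D t + stepsize * (D t - c)))"

text \<open>
  The run of the algorithm along one sample path.  It is still running in period \<open>t\<close> iff
  \<open>stock C D t > 0\<close>: by definition of \<^const>\<open>sale\<close>, \<open>D s \<ge> stock C D s\<close> in some earlier period \<open>s\<close>
  is what makes the stock vanish.  Nothing is required of the prices and estimates after that.
\<close>

definition inventory_TS ::
    "(real \<Rightarrow> real) \<Rightarrow> real \<Rightarrow> real \<Rightarrow> real \<Rightarrow> real \<Rightarrow> real \<Rightarrow> real \<Rightarrow> nat \<Rightarrow> real \<Rightarrow> real
      \<Rightarrow> (nat \<Rightarrow> real^'n::finite) \<Rightarrow> (nat \<Rightarrow> real) \<Rightarrow> (nat \<Rightarrow> real^2) \<Rightarrow> (nat \<Rightarrow> real^('n + 'n))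
      \<Rightarrow> (nat \<Rightarrow> real) \<Rightarrow> bool" where
  "inventory_TS g glow \<theta>bar \<sigma>bar Dbar plo pbar T C lam x D \<eta> \<theta>hat p \<longleftrightarrow>
    (\<forall>t\<in>{1..T}. stock C D t > 0 \<longrightarrow>
      is_arg_max (mle_objective g glow lam x D p (t - 1)) (\<lambda>\<theta>. norm \<theta> \<le> \<theta>bar) (\<theta>hat (t - 1)) \<and>
      (let \<mu> = dual (pbar / sqrt ((Dbar\<^sup>2 + \<sigma>bar\<^sup>2) * real T)) (C / real T) pbar D t;
           ab = sampled_coeffs lam (explore_scale lam \<theta>bar \<sigma>bar glow CARD('n) T)
                  x p (\<theta>hat (t - 1)) (\<eta> t) t
       in is_arg_max (\<lambda>q. (q - \<mu>) * g (ab $ 1 + ab $ 2 * q))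
            (\<lambda>q. q \<in> {\<mu>..pbar} \<inter> {plo..pbar}) (p t)))"

definition cyl :: "'a measure \<Rightarrow> (nat \<Rightarrow> 'a \<Rightarrow> 'b::topological_space) \<Rightarrow> nat set \<Rightarrow> 'a set set" where
  "cyl M Y I = {Y s -` B \<inter> space M | s B. s \<in> I \<and> B \<in> sets borel}"

definition shock_filtration ::
    "'a measure \<Rightarrow> (nat \<Rightarrow> 'a \<Rightarrow> real) \<Rightarrow> (nat \<Rightarrow> 'a \<Rightarrow> real)
      \<Rightarrow> (nat \<Rightarrow> 'a \<Rightarrow> 'b::topological_space) \<Rightarrow> nat \<Rightarrow> 'a measure" where
  "shock_filtration M p \<epsilon> X t =
    sigma (space M) (cyl M p {1..t} \<union> cyl M \<epsilon> {1..t} \<union> cyl M X {1..Suc t})"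

definition std_normal2 :: "real^2 \<Rightarrow> ennreal" where
  "std_normal2 v = ennreal (\<Prod>i\<in>UNIV. std_normal_density (v $ i))"

definition regret_bound ::
    "real \<Rightarrow> real \<Rightarrow> real \<Rightarrow> real \<Rightarrow> real \<Rightarrow> real \<Rightarrow> nat \<Rightarrow> nat \<Rightarrow> real \<Rightarrow> real" where
  "regret_bound gbar glow pbar \<theta>bar \<sigma>bar Dbar d T W =
    (let L = ln ((2 * real d + real T) / (2 * real d));
         \<gamma>bar = 2 * \<theta>bar + 2 * \<sigma>bar / glow * sqrt (2 * ln (real T) + 2 * real d * L)
     in 40 * gbar * pbar * \<gamma>bar
          * sqrt (2 * exp 1 * pi * real d * real T * L * ln (4 * real T ^ 2))
        + pbar * sqrt ((Dbar\<^sup>2 + \<sigma>bar\<^sup>2) * real T)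
        + 7 * Dbar * pbar
        + sqrt 2 * (pbar + pbar\<^sup>2) * gbar * \<theta>bar * W)"

end

theory Submission
  imports Defs
begin

text \<open>
  Let \<open>f\<^sub>m(x) = max\<^sub>q (q - m) g(x \<bullet> \<alpha> + (x \<bullet> \<beta>) q)\<close> be the optimal revenue of one round when a unit of
  inventory costs \<open>m\<close>, and let \<open>F(m)\<close> be its mean under the averaged covariate law.  By weak duality,
  every hindsight policy earns at most \<open>\<Sum>\<^sub>t f\<^sub>m(x\<^sub>t) + m C\<close> up to \<open>pbar\<close> times one overshoot of the
  inventory, for every \<open>m\<close>; so the benchmark is at most \<open>T V\<close> with \<open>V = inf\<^sub>m F(m) + m c\<close>.

  Online gradient descent on the dual variable lets the algorithm earn \<open>T V\<close> up to \<open>O(sqrt T)\<close>,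
  except for two losses.  The covariate of round \<open>t\<close> is independent of \<open>\<mu>\<^sub>t\<close> but has law \<open>P\<^sub>t\<close> instead of
  the average, which costs the Lipschitz constant of \<open>f\<^sub>m\<close> times a Wasserstein distance.  And the
  posted price maximizes \<open>(q - \<mu>\<^sub>t) g\<close> at a sampled instead of the true parameter: on the event that the
  confidence ellipsoid holds, an optimistic sample has probability at least \<open>1/25\<close>, which bounds the
  expected loss of a round by a multiple of the expected width of the ellipsoid in the direction
  played; the widths sum to \<open>O(sqrt (d T ln T))\<close> by the elliptical potential argument.

  Sub-Gaussianity is only assumed for shocks given the past, so the self-normalized tail bound for the
  score is obtained by integrating out one shock at a time (the determinant of the design matrix turns
  the bound into a supermartingale).
\<close>

subsection \<open>Positive definite matrices\<close>

text \<open>Prices are the obstacle in two places. Shocks are sub-Gaussian given a past that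
  contains the earlier prices but not the noise about to be drawn, while the score uses the price
  set with that noise. \<open>subgaussian_shock\<close> therefore conditions down to covariates and
  shocks and then adjoins the sampling noise, which is independent of both.

  Also, Gaussian samples are unbounded, whereas the slope of \<open>g\<close> is controlled only on
  \<open>Theta_enlarged\<close>. Noise of norm above \<open>rho\<close> is discarded; below it,
  centre, truth and sample stay within reach of the slope bounds. The sampling scale
  \<open>expl\<close> is twice the confidence radius, so noise whose component in one direction is
  at least \<open>1/2\<close> suffices for optimism.

  The factor \<open>51 * rho + 1/2\<close> of the expected loss is \<open>25 * 2 * rho\<close>, from
  averaging over optimistic samples, plus \<open>rho + 1/2\<close> from playing the price of a
  sample instead of the optimum. With \<open>rho = sqrt 2 * rho0\<close> it is finally compared with
  \<open>40 * sqrt (2 * exp 1 * pi) * rho0\<close>; the slack also absorbs the shock part of the two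
  overshoots.\<close>

lemma selfadjoint_orthonormal_eigenbasis:
  fixes f :: "'a::euclidean_space \<Rightarrow> 'a"
  assumes "linear f" and adj: "\<And>x y. f x \<bullet> y = x \<bullet> f y"
    and "subspace S" and "f ` S \<subseteq> S"
  shows "\<exists>B. B \<subseteq> S \<and> pairwise orthogonal B \<and> (\<forall>b\<in>B. norm b = 1) \<and> span B = S
            \<and> (\<forall>b\<in>B. \<exists>c. f b = c *\<^sub>R b)"
  using assms(3,4)
proof (induction "dim S" arbitrary: S rule: less_induct)
  case less
  show ?case
  proof (cases "S = {0}")
    case True
    then show ?thesis by (intro exI[of _ "{}"]) auto
  next
    case False
    have S: "subspace S" and fS: "f ` S \<subseteq> S" by (fact less.prems)+
    \<comment> \<open>A maximizer of the Rayleigh quotient on the unit sphere of \<open>S\<close> is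
      an eigenvector, and its orthogonal complement inside \<open>S\<close> is invariant and of
      smaller dimension.\<close>
    let ?K = "sphere 0 1 \<inter> S"
    obtain y where y: "y \<in> S" "y \<noteq> 0" using False S subspace_0 by blast
    have "(1 / norm y) *\<^sub>R y \<in> ?K"
      using y S by (auto simp: subspace_scale)
    moreover have "compact ?K"
      using S by (intro compact_Int_closed closed_subspace) auto
    moreover have "continuous_on ?K (\<lambda>x. x \<bullet> f x)"
      using \<open>linear f\<close> by (intro continuous_intros linear_continuous_on linear_conv_bounded_linear[THEN iffD1])
    ultimately obtain v where v: "v \<in> S" "norm v = 1"
      and vmax: "\<And>x. x \<in> S \<Longrightarrow> norm x = 1 \<Longrightarrow> x \<bullet> f x \<le> v \<bullet> f v"
      using continuous_attains_sup[of ?K "\<lambda>x. x \<bullet> f x"] by fastforce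
    define m where "m = v \<bullet> f v"
    have quad: "x \<bullet> f x \<le> m * (norm x)\<^sup>2" if "x \<in> S" for x
    proof (cases "x = 0")
      case True
      then show ?thesis using \<open>linear f\<close> by (simp add: linear_0)
    next
      case False
      have "((1 / norm x) *\<^sub>R x) \<bullet> f ((1 / norm x) *\<^sub>R x) \<le> m"
        unfolding m_def using False that S by (intro vmax) (auto simp: subspace_scale)
      also have "((1 / norm x) *\<^sub>R x) \<bullet> f ((1 / norm x) *\<^sub>R x) = (x \<bullet> f x) / (norm x)\<^sup>2"
        using \<open>linear f\<close> by (simp add: linear_scale power2_eq_square)
      finally show ?thesis using False by (simp add: divide_le_eq)
    qed
    have vv: "v \<bullet> v = 1" using v by (simp add: norm_eq_1)
    \<comment> \<open>The residual \<open>u\<close> is orthogonal to \<open>v\<close>. Moving from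
      \<open>v\<close> along \<open>u\<close> changes the quadratic form to first order in
      \<open>t\<close> but the squared norm only to second order, which is impossible at a maximum
      unless \<open>u = 0\<close>.\<close>
    have eig: "f v = m *\<^sub>R v"
    proof -
      define u where "u = f v - m *\<^sub>R v"
      have uS: "u \<in> S" unfolding u_def using v fS S
        by (auto intro!: subspace_diff subspace_scale)
      have uv: "u \<bullet> v = 0" by (simp add: u_def inner_diff_left vv m_def inner_commute[of "f v" v])
      have uf: "u \<bullet> f v = u \<bullet> u"
      proof -
        have "u \<bullet> f v = u \<bullet> (u + m *\<^sub>R v)" by (simp add: u_def)
        then show ?thesis by (simp add: inner_add_right uv)
      qed
      define a where "a = m * (u \<bullet> u) - u \<bullet> f u"
      have main: "2 * t * (u \<bullet> u) \<le> t\<^sup>2 * a" for t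
      proof -
        have "(v + t *\<^sub>R u) \<bullet> f (v + t *\<^sub>R u) \<le> m * (norm (v + t *\<^sub>R u))\<^sup>2"
          using v uS S by (intro quad) (auto intro!: subspace_add subspace_scale)
        moreover have "f u \<bullet> v = u \<bullet> u" using adj[of u v] uf by simp
        then have "v \<bullet> f u = u \<bullet> u" by (simp add: inner_commute)
        then have "(v + t *\<^sub>R u) \<bullet> f (v + t *\<^sub>R u) = m + 2 * t * (u \<bullet> u) + t\<^sup>2 * (u \<bullet> f u)"
          using uf \<open>linear f\<close>
          by (simp add: linear_add linear_scale inner_add_left inner_add_right
              m_def[symmetric] power2_eq_square algebra_simps)
        moreover have "v \<bullet> u = 0" using uv by (simp add: inner_commute)
        then have "(norm (v + t *\<^sub>R u))\<^sup>2 = 1 + t\<^sup>2 * (u \<bullet> u)"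
          unfolding power2_norm_eq_inner using uv vv
          by (simp add: inner_add_left inner_add_right power2_eq_square)
        ultimately show ?thesis
          by (simp add: a_def algebra_simps)
      qed
      have "u \<bullet> u = 0"
      proof (rule ccontr)
        assume "u \<bullet> u \<noteq> 0"
        then have pos: "u \<bullet> u > 0" by simp
        have "2 * (u \<bullet> u) \<le> a" using main[of 1] by simp
        then have "a > 0" using pos by linarith
        \<comment> \<open>This \<open>t\<close> makes the quadratic right-hand side half of the
          linear left-hand side.\<close>
        have "2 * (u \<bullet> u / a) * (u \<bullet> u) \<le> (u \<bullet> u / a)\<^sup>2 * a" by (rule main)
        then have "2 * (u \<bullet> u)\<^sup>2 / a \<le> (u \<bullet> u)\<^sup>2 / a"
          using \<open>a > 0\<close> by (simp add: power2_eq_square field_simps)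
        then show False using \<open>a > 0\<close> pos by (simp add: field_simps)
      qed
      then show ?thesis by (simp add: u_def)
    qed
    define T where "T = S \<inter> {x. x \<bullet> v = 0}"
    have T: "subspace T" unfolding T_def
      using S by (intro subspace_inter) (auto simp: subspace_def inner_add_left)
    have fT: "f ` T \<subseteq> T"
      unfolding T_def using fS by (auto simp: adj eig)
    have "v \<notin> T" by (simp add: T_def vv)
    moreover have "T \<subseteq> S" by (simp add: T_def)
    ultimately have "T \<subset> S" using v by blast
    then have "dim T < dim S"
      using S T by (intro dim_psubset) (simp add: span_eq_iff[THEN iffD2])
    from less.hyps[OF this T fT] obtain B where B: "B \<subseteq> T" "pairwise orthogonal B"
      "\<forall>b\<in>B. norm b = 1" "span B = T" "\<forall>b\<in>B. \<exists>c. f b = c *\<^sub>R b" by blast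
    have "S \<subseteq> span (insert v B)"
    proof
      fix x assume x: "x \<in> S"
      have "x - (x \<bullet> v) *\<^sub>R v \<in> T"
        using x v S by (auto simp: T_def inner_diff_left vv intro!: subspace_diff subspace_scale)
      then have "x - (x \<bullet> v) *\<^sub>R v \<in> span B" using B(4) by simp
      then show "x \<in> span (insert v B)" unfolding span_breakdown_eq by blast
    qed
    moreover have "span (insert v B) \<subseteq> S"
      using v B(1) S by (intro span_minimal) (auto simp: T_def)
    moreover have "pairwise orthogonal (insert v B)"
      using B(1,2) by (auto simp: pairwise_insert orthogonal_def T_def inner_commute)
    ultimately show ?thesis
      using v B eig by (intro exI[of _ "insert v B"]) (auto simp: T_def)
  qed
qed

lemma symmetric_matrix_inner:
  fixes A :: "real^'n^'n"
  assumes "transpose A = A"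
  shows "(A *v x) \<bullet> y = x \<bullet> (A *v y)"
  using dot_lmul_matrix[of x A y] transpose_matrix_vector[of A x] assms by simp

text \<open>The arithmetic-geometric mean inequality for the eigenvalues, which are the diagonal of
  the matrix in an orthonormal eigenbasis. It converts bounded feature norms, hence a bounded trace,
  into logarithmic growth of the log-determinant of the design matrix.\<close>

lemma det_le_trace_power:
  fixes A :: "real^'n^'n"
  assumes sym: "transpose A = A" and psd: "\<And>v. 0 \<le> v \<bullet> (A *v v)"
  shows "det A \<le> (trace A / real CARD('n)) ^ CARD('n)"
proof -
  have adj: "(A *v x) \<bullet> y = x \<bullet> (A *v y)" for x y
    by (rule symmetric_matrix_inner[OF sym])
  obtain B where B: "pairwise orthogonal B" "\<forall>b\<in>B. norm b = 1" "span B = (UNIV :: (real^'n) set)"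
      "\<forall>b\<in>B. \<exists>c. A *v b = c *\<^sub>R b"
    using selfadjoint_orthonormal_eigenbasis[of "\<lambda>x. A *v x" UNIV, OF _ adj] by auto
  have B0: "0 \<notin> B" using B(2) norm_zero zero_neq_one by metis
  have ind: "independent B"
    using B(1) B0 by (rule pairwise_orthogonal_independent)
  then have fin: "finite B" by (rule independent_imp_finite)
  have "card B = CARD('n)"
    using basis_card_eq_dim[of B UNIV] ind B(3) by (simp add: dim_UNIV[where 'a="real^'n"])
  then obtain h where h: "bij_betw h (UNIV :: 'n set) B"
    using finite_same_card_bij[of "UNIV :: 'n set" B] fin by auto
  have hB: "h i \<in> B" for i using h by (auto simp: bij_betw_def)
  from B(4) hB have "\<forall>i. \<exists>c. A *v h i = c *\<^sub>R h i" by blast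
  then obtain c where c: "\<And>i. A *v h i = c i *\<^sub>R h i" by metis
  have orth: "h i \<bullet> h j = (if i = j then 1 else 0)" for i j
  proof (cases "i = j")
    case False
    then have "h i \<noteq> h j" using h by (auto simp: bij_betw_def inj_def)
    then show ?thesis using False B(1) hB by (auto simp: pairwise_def orthogonal_def)
  qed (use B(2) hB in \<open>simp add: norm_eq_1\<close>)
  define Q :: "real^'n^'n" where "Q = (\<chi> i j. h j $ i)"
  have QQ: "transpose Q ** Q = mat 1"
    using orth by (simp add: matrix_matrix_mult_def transpose_def Q_def mat_def vec_eq_iff inner_vec_def)
  have D: "transpose Q ** (A ** Q) = (\<chi> i j. if i = j then c i else 0)"
  proof -
    have "(A ** Q) $ i $ j = c j * h j $ i" for i j
    proof -
      have "(A ** Q) $ i $ j = (A *v h j) $ i"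
        by (simp add: matrix_matrix_mult_def matrix_vector_mult_def Q_def)
      then show ?thesis by (simp add: c)
    qed
    then have "(transpose Q ** (A ** Q)) $ i $ j = c j * (h i \<bullet> h j)" for i j
      unfolding matrix_matrix_mult_def[of "transpose Q"]
      by (simp add: transpose_def inner_vec_def sum_distrib_left mult_ac) (simp add: Q_def mult_ac)
    then show ?thesis by (auto simp: vec_eq_iff orth)
  qed
  have QQ': "Q ** transpose Q = mat 1" using QQ by (simp add: matrix_left_right_inverse)
  have "det Q * det Q = 1"
    using arg_cong[OF QQ, of det] by (simp add: det_mul)
  moreover have "det (transpose Q ** (A ** Q)) = det A * (det Q * det Q)"
    by (simp add: det_mul)
  ultimately have "det A = det (\<chi> i j. if i = j then c i else 0)" using D by simp
  also have "\<dots> = (\<Prod>i\<in>UNIV. c i)" by (subst det_diagonal) auto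
  finally have det: "det A = (\<Prod>i\<in>UNIV. c i)" .
  have "trace A = trace (transpose Q ** (A ** Q))"
    by (subst trace_mul_sym) (simp add: matrix_mul_assoc[symmetric] QQ')
  also have "\<dots> = (\<Sum>i\<in>UNIV. c i)" unfolding D by (simp add: trace_def)
  finally have tr: "trace A = (\<Sum>i\<in>UNIV. c i)" .
  have c0: "0 \<le> c i" for i using psd[of "h i"] by (simp add: c orth)
  have "(\<Prod>i\<in>UNIV. c i) powr (1 / real CARD('n)) \<le> trace A / real CARD('n)"
    using arith_geom_mean[of "UNIV :: 'n set" c] c0 tr by (simp add: sum_divide_distrib)
  then have "((\<Prod>i\<in>UNIV. c i) powr (1 / real CARD('n))) ^ CARD('n) \<le> (trace A / real CARD('n)) ^ CARD('n)"
    by (intro power_mono) auto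
  moreover have "(y powr (1 / real CARD('n))) ^ CARD('n) = y" if "0 \<le> y" for y :: real
    using that by (cases "y = 0") (auto simp: powr_realpow[symmetric] powr_powr)
  then have "((\<Prod>i\<in>UNIV. c i) powr (1 / real CARD('n))) ^ CARD('n) = (\<Prod>i\<in>UNIV. c i)"
    using c0 by (simp add: prod_nonneg)
  ultimately show ?thesis by (simp add: det)
qed

section \<open>Rank-one updates of matrices above the identity\<close>

lemma rank_one_mult_vec:
  fixes u v :: "real^'m"
  shows "(\<chi> i j. u $ i * v $ j) *v x = (v \<bullet> x) *\<^sub>R u"
  by (simp add: vec_eq_iff matrix_vector_mult_def inner_vec_def sum_distrib_left mult_ac)

text \<open>With \<open>C\<close> the identity whose column \<open>k\<close> is replaced by
  \<open>u\<close>, and \<open>a\<close> the transpose of \<open>C\<close> applied to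
  \<open>v\<close>, one has \<open>(1 + u v^T) C = C (1 + e_k a^T)\<close>. The last factor is the
  identity with one row replaced, so its determinant is \<open>1 + a_k\<close>, and
  \<open>a_k = u \<bullet> v\<close>; choosing \<open>k\<close> with \<open>u $ k\<close> nonzero
  makes \<open>det C\<close> cancel.\<close>

lemma det_mat_1_plus_rank_one:
  fixes u v :: "real^'m"
  shows "det (mat 1 + (\<chi> i j. u $ i * v $ j)) = 1 + u \<bullet> v"
proof (cases "u = 0")
  case True
  then have "(\<chi> i j. u $ i * v $ j) = 0" by (simp add: vec_eq_iff)
  then show ?thesis using True by simp
next
  case False
  then obtain k where k: "u $ k \<noteq> 0" by (auto simp: vec_eq_iff)
  define col where "col x = (\<chi> i j. if j = k then x $ i else (mat 1 :: real^'m^'m) $ i $ j)" for x :: "real^'m"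
  have det_col: "det (col x) = x $ k" for x
    using cramer_lemma[of k "mat 1 :: real^'m^'m" x] unfolding matrix_vector_mul_lid by (simp add: col_def)
  define a where "a = transpose (col u) *v v"
  have au: "a $ k = u \<bullet> v"
    by (simp add: a_def col_def matrix_vector_mult_def transpose_def inner_vec_def)
  have "(mat 1 + (\<chi> i j. u $ i * v $ j)) ** col u = col u + (\<chi> i j. u $ i * a $ j)"
  proof -
    have "(\<Sum>l\<in>UNIV. ((if i = l then 1 else 0) + u $ i * v $ l) * col u $ l $ j) =
        (\<Sum>l\<in>UNIV. (if i = l then col u $ l $ j else 0) + u $ i * (col u $ l $ j * v $ l))" for i j
      by (intro sum.cong) (auto simp: distrib_right)
    then show ?thesis
      by (simp add: vec_eq_iff matrix_matrix_mult_def mat_def a_def matrix_vector_mult_def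
          transpose_def sum.distrib sum_distrib_left)
  qed
  also have "\<dots> = col u ** transpose (col (axis k 1 + a))"
  proof -
    have "(\<Sum>l\<in>UNIV. col u $ i $ l * col (axis k 1 + a) $ j $ l) =
        (if j = k then u $ i else if i = j then 1 else 0) + u $ i * a $ j" for i j
    proof -
      have "(\<Sum>l\<in>UNIV - {k}. col u $ i $ l * col (axis k 1 + a) $ j $ l) =
          (\<Sum>l\<in>UNIV - {k}. if l = j then (if i = j then 1 else 0) else 0)"
        by (intro sum.cong) (auto simp: col_def mat_def)
      also have "\<dots> = (if j = k then 0 else if i = j then 1 else 0)"
        by (subst sum.delta) auto
      finally show ?thesis
        by (subst sum.remove[of UNIV k]) (auto simp: col_def axis_def algebra_simps)
    qed
    then show ?thesis
      by (simp add: vec_eq_iff matrix_matrix_mult_def transpose_def) (simp add: col_def mat_def)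
  qed
  finally have "det (mat 1 + (\<chi> i j. u $ i * v $ j)) * det (col u) = det (col u) * (1 + a $ k)"
    by (metis det_mul det_transpose det_col vector_add_component axis_nth)
  then show ?thesis using k by (simp add: det_col au)
qed

text \<open>The Loewner order relation \<open>A >= 1\<close>. Design matrices with regularization
  parameter 1 satisfy it, it survives rank-one updates, and it yields both invertibility and an
  inverse below the identity.\<close>

definition dominates_id :: "real^'m^'m \<Rightarrow> bool" where
  "dominates_id A \<longleftrightarrow> transpose A = A \<and> (\<forall>v. (norm v)\<^sup>2 \<le> v \<bullet> (A *v v))"

context
  fixes A W :: "real^'m^'m"
  assumes dom: "dominates_id A"
  defines "W \<equiv> matrix_inv A"
begin

lemma dominates_id_sym: "(A *v x) \<bullet> y = x \<bullet> (A *v y)"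
  using dom by (auto simp: dominates_id_def intro: symmetric_matrix_inner)

lemma dominates_id_ge: "(norm v)\<^sup>2 \<le> v \<bullet> (A *v v)"
  using dom by (simp add: dominates_id_def)

lemma dominates_id_invertible: "invertible A"
proof -
  have "inj ((*v) A)"
  proof (rule injI)
    fix x y assume "A *v x = A *v y"
    then have "A *v (x - y) = 0" by (simp add: matrix_vector_mult_diff_distrib)
    then have "(norm (x - y))\<^sup>2 \<le> 0" using dominates_id_ge[of "x - y"] by simp
    then show "x = y" by simp
  qed
  then show ?thesis
    by (simp add: matrix_left_invertible_injective invertible_left_inverse inj_on_def)
qed

lemma mult_matrix_inv: "A ** W = mat 1" and matrix_inv_mult: "W ** A = mat 1"
proof -
  have "\<exists>B. A ** B = mat 1 \<and> B ** A = mat 1"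
    using dominates_id_invertible by (simp add: invertible_def)
  from someI_ex[OF this] show "A ** W = mat 1" "W ** A = mat 1"
    by (simp_all add: W_def matrix_inv_def)
qed

lemma mult_matrix_inv_vec [simp]: "A *v (W *v v) = v" and matrix_inv_mult_vec [simp]: "W *v (A *v v) = v"
  by (simp_all add: matrix_vector_mul_assoc mult_matrix_inv matrix_inv_mult)

lemma matrix_inv_sym: "(W *v x) \<bullet> y = x \<bullet> (W *v y)"
  using dominates_id_sym[of "W *v x" "W *v y"] by simp

lemma transpose_matrix_inv: "transpose W = W"
proof -
  have "transpose W *v x = W *v x" for x
  proof (rule vector_eq_ldot[THEN iffD1], rule allI)
    fix y
    have "y \<bullet> (transpose W *v x) = (W *v y) \<bullet> x"
      using dot_lmul_matrix[of y "transpose W" x] transpose_matrix_vector[of "transpose W" y] by simp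
    then show "y \<bullet> (transpose W *v x) = y \<bullet> (W *v x)" by (simp add: matrix_inv_sym)
  qed
  then show ?thesis by (simp add: matrix_eq)
qed

lemma matrix_inv_quad_nonneg: "0 \<le> v \<bullet> (W *v v)"
  using dominates_id_ge[of "W *v v"] by (simp add: inner_commute[of v] order_trans[OF zero_le_power2])

lemma matrix_inv_quad_le: "v \<bullet> (W *v v) \<le> (norm v)\<^sup>2"
proof -
  define y where "y = W *v v"
  have v: "v = A *v y" by (simp add: y_def)
  have 1: "(norm y)\<^sup>2 \<le> v \<bullet> y" using dominates_id_ge[of y] by (simp add: v inner_commute)
  have 2: "v \<bullet> y \<le> norm v * norm y" by (rule norm_cauchy_schwarz)
  have "norm y \<le> norm v"
  proof (cases "norm y = 0")
    case False
    have "norm y * norm y \<le> norm v * norm y" using 1 2 by (simp add: power2_eq_square)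
    then show ?thesis using False by (simp add: mult_le_cancel_right)
  qed simp
  then have "norm v * norm y \<le> (norm v)\<^sup>2"
    by (simp add: power2_eq_square mult_left_mono)
  then show ?thesis using 2 by (simp add: y_def)
qed

text \<open>Cauchy-Schwarz for the norms of \<open>A\<close> and of its inverse: the form of the
  inverse is nonnegative at \<open>a - t A b\<close> for every \<open>t\<close>. It relates the
  error of the estimate, measured by the design matrix, to the width in the direction of a feature,
  measured by the inverse.\<close>

lemma inner_le_dual_quad: "(a \<bullet> b)\<^sup>2 \<le> (a \<bullet> (W *v a)) * (b \<bullet> (A *v b))"
proof -
  define y where "y = A *v b"
  define p q r where "p = a \<bullet> (W *v a)" and "q = a \<bullet> b" and "r = b \<bullet> (A *v b)"
  have *: "0 \<le> p - 2 * t * q + t\<^sup>2 * r" for t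
  proof -
    have "0 \<le> (a - t *\<^sub>R y) \<bullet> (W *v (a - t *\<^sub>R y))" by (rule matrix_inv_quad_nonneg)
    also have "W *v (a - t *\<^sub>R y) = W *v a - t *\<^sub>R b"
      by (simp add: matrix_vector_mult_diff_distrib y_def matrix_vector_mult_scaleR)
    also have "(a - t *\<^sub>R y) \<bullet> (W *v a - t *\<^sub>R b) = p - 2 * t * q + t\<^sup>2 * r"
    proof -
      have "y \<bullet> (W *v a) = q"
        using dominates_id_sym[of b "W *v a"] by (simp add: y_def q_def inner_commute)
      moreover have "y \<bullet> b = r" by (simp add: y_def r_def inner_commute)
      ultimately show ?thesis
        by (simp add: inner_diff_left inner_diff_right p_def q_def power2_eq_square algebra_simps)
    qed
    finally show ?thesis .
  qed
  show ?thesis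
  proof (cases "b = 0")
    case False
    have "0 < (norm b)\<^sup>2" using False by simp
    then have r: "r > 0" using dominates_id_ge[of b] unfolding r_def by linarith
    \<comment> \<open>\<open>t = q / r\<close> minimizes the quadratic.\<close>
    have "0 \<le> p - 2 * (q / r) * q + (q / r)\<^sup>2 * r" by (rule *)
    also have "\<dots> = p - q\<^sup>2 / r" using r by (simp add: field_simps power2_eq_square)
    finally show ?thesis using r by (simp add: p_def q_def r_def field_simps)
  qed simp
qed

end

context
  fixes A W :: "real^'m^'m" and z :: "real^'m" and A' W' w
  assumes dom: "dominates_id A"
  defines "W \<equiv> matrix_inv A"
  defines "A' \<equiv> A + (\<chi> i j. z $ i * z $ j)" and "W' \<equiv> matrix_inv A'" and "w \<equiv> z \<bullet> (W *v z)"
begin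

lemmas inv_facts = mult_matrix_inv_vec[OF dom, folded W_def] matrix_inv_mult_vec[OF dom, folded W_def]
  matrix_inv_sym[OF dom, folded W_def] matrix_inv_quad_nonneg[OF dom, folded W_def]

lemma rank_one_update_mult_vec: "A' *v x = A *v x + (z \<bullet> x) *\<^sub>R z"
  by (simp add: A'_def matrix_vector_mult_add_rdistrib rank_one_mult_vec)

lemma dominates_id_rank_one_update: "dominates_id A'"
proof -
  have "transpose A' = A'"
  proof -
    have "transpose A $ i $ j = A $ i $ j" for i j using dom by (simp add: dominates_id_def)
    then have "A $ j $ i = A $ i $ j" for i j by (simp add: transpose_def)
    then show ?thesis unfolding vec_eq_iff by (auto simp: A'_def transpose_def mult.commute)
  qed
  moreover have "(norm v)\<^sup>2 \<le> v \<bullet> (A' *v v)" for v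
  proof -
    have "v \<bullet> (A' *v v) = v \<bullet> (A *v v) + (z \<bullet> v)\<^sup>2"
      by (simp add: rank_one_update_mult_vec inner_add_right inner_commute[of v z] power2_eq_square)
    then show ?thesis using dominates_id_ge[OF dom, of v] by (simp add: add_increasing2)
  qed
  ultimately show ?thesis by (simp add: dominates_id_def)
qed

lemma det_rank_one_update: "det A' = det A * (1 + w)"
proof -
  have "A' = A ** (mat 1 + (\<chi> i j. (W *v z) $ i * z $ j))"
  proof -
    have "(A ** (mat 1 + (\<chi> i j. (W *v z) $ i * z $ j))) *v x = A' *v x" for x
    proof -
      show ?thesis
        by (simp add: matrix_vector_mul_assoc[symmetric] rank_one_update_mult_vec rank_one_mult_vec
            matrix_vector_mult_add_rdistrib matrix_vector_right_distrib
            matrix_vector_mult_scaleR inv_facts(1))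
    qed
    then show ?thesis by (simp add: matrix_eq)
  qed
  then show ?thesis
    by (simp add: det_mul det_mat_1_plus_rank_one w_def inner_commute)
qed

text \<open>Verified by multiplying with \<open>A'\<close>. Besides updating quadratic forms, it
  later gives a recursion for the entries of the inverse design matrix, from which their
  measurability follows.\<close>

lemma sherman_morrison:
  "W' *v u = W *v u - ((z \<bullet> (W *v u)) / (1 + w)) *\<^sub>R (W *v z)"
proof -
  have w: "1 + w > 0" using inv_facts(4)[of z] by (simp add: w_def)
  define c where "c = (z \<bullet> (W *v u)) / (1 + w)"
  have c: "z \<bullet> (W *v u) = c * (1 + w)" using w by (simp add: c_def)
  have "A' *v (W *v u - c *\<^sub>R (W *v z)) = u - c *\<^sub>R z + (z \<bullet> (W *v u) - c * w) *\<^sub>R z"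
    by (simp add: rank_one_update_mult_vec matrix_vector_mult_diff_distrib
        matrix_vector_mult_scaleR inner_diff_right w_def scaleR_diff_left scaleR_add_right inv_facts(1))
  also have "\<dots> = u" by (simp add: c algebra_simps)
  finally have "A' *v (W *v u - c *\<^sub>R (W *v z)) = u" .
  then show ?thesis
    using matrix_inv_mult_vec[OF dominates_id_rank_one_update] W'_def c_def by metis
qed

text \<open>The updated score is \<open>S + e z\<close> with \<open>e\<close> the latest shock. The
  coefficients of \<open>e\<close> and of its square do not involve \<open>e\<close>, so that a
  single shock can be integrated out while the rest is held fixed.\<close>

lemma quad_rank_one_update:
  defines "a \<equiv> \<lambda>S. z \<bullet> (W *v S)"
  shows "(S + e *\<^sub>R z) \<bullet> (W' *v (S + e *\<^sub>R z)) =
    S \<bullet> (W *v S) - (a S)\<^sup>2 / (1 + w) + 2 * e * a S / (1 + w) + e\<^sup>2 * w / (1 + w)"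
proof -
  have w: "1 + w > 0" using inv_facts(4)[of z] by (simp add: w_def)
  have sym: "S \<bullet> (W *v z) = a S"
    unfolding a_def by (metis inner_commute inv_facts(3))
  have eq: "W *v (S + e *\<^sub>R z) = W *v S + e *\<^sub>R (W *v z)"
    by (simp add: matrix_vector_right_distrib matrix_vector_mult_scaleR)
  have zq: "z \<bullet> (W *v S + e *\<^sub>R (W *v z)) = a S + e * w"
    by (simp add: inner_add_right a_def w_def)
  have "(S + e *\<^sub>R z) \<bullet> (W' *v (S + e *\<^sub>R z)) =
     S \<bullet> (W *v S) + 2 * e * a S + e\<^sup>2 * w - (a S + e * w)\<^sup>2 / (1 + w)"
    unfolding sherman_morrison eq zq
    by (simp add: inner_add_left inner_diff_right inner_add_right sym w_def[symmetric]
        a_def[symmetric] power2_eq_square algebra_simps)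
      (simp add: a_def add_divide_distrib[symmetric] algebra_simps power2_eq_square diff_divide_distrib)
  also have "\<dots> = S \<bullet> (W *v S) - (a S)\<^sup>2 / (1 + w) + 2 * e * a S / (1 + w) + e\<^sup>2 * w / (1 + w)"
  proof -
    have "y + 2 * e * x + e\<^sup>2 * w - (x + e * w)\<^sup>2 / (1 + w) =
        y - x\<^sup>2 / (1 + w) + 2 * e * x / (1 + w) + e\<^sup>2 * w / (1 + w)" for x y
      using w by (simp add: divide_simps) (simp add: power2_eq_square algebra_simps)
    then show ?thesis .
  qed
  finally show ?thesis .
qed

end

text \<open>For a root \<open>D\<close> of \<open>A\<close>, Cayley-Hamilton reads
  \<open>A = \<tau> D - \<delta>\<close> with \<open>\<tau>\<close> the trace and
  \<open>\<delta>\<close> the determinant of \<open>D\<close>, and both are determined by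
  \<open>A\<close>. The closed form is what makes the sampled coefficients measurable, since
  \<open>psd_sqrt\<close> is a definite description.\<close>

lemma psd_sqrt_2:
  fixes A :: "real^2^2"
  assumes sym: "transpose A = A" and psd: "\<And>v. 0 \<le> v \<bullet> (A *v v)"
  defines "\<delta> \<equiv> sqrt (A $ 1 $ 1 * A $ 2 $ 2 - A $ 1 $ 2 * A $ 1 $ 2)"
  defines "\<tau> \<equiv> sqrt (A $ 1 $ 1 + A $ 2 $ 2 + 2 * \<delta>)"
  shows "psd_sqrt A = (\<chi> i j. (A $ i $ j + (if i = j then \<delta> else 0)) / \<tau>)"
    and "transpose (psd_sqrt A) = psd_sqrt A" and "psd_sqrt A ** psd_sqrt A = A"
proof -
  define a b d where "a = A $ 1 $ 1" and "b = A $ 1 $ 2" and "d = A $ 2 $ 2"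
  have b': "A $ 2 $ 1 = b"
    using arg_cong[OF sym, of "\<lambda>B. B $ 1 $ 2"] by (simp add: transpose_def b_def)
  have q: "0 \<le> a * x\<^sup>2 + 2 * b * x * y + d * y\<^sup>2" for x y
    using psd[of "vector [x, y]"]
    by (simp add: inner_vec_def matrix_vector_mult_def sum_2 a_def[symmetric] b_def[symmetric]
        d_def[symmetric] b' algebra_simps power2_eq_square)
  have a0: "0 \<le> a" using q[of 1 0] by simp
  have d0: "0 \<le> d" using q[of 0 1] by simp
  have det0: "0 \<le> a * d - b * b"
  proof (cases "a = 0")
    case True
    have "b = 0"
    proof (rule ccontr)
      assume "b \<noteq> 0"
      \<comment> \<open>With \<open>a = 0\<close> this argument gives the quadratic form the value
        \<open>- 1\<close>.\<close>
      have "0 \<le> 2 * b * (- (d + 1) / (2 * b)) * 1 + d * 1\<^sup>2"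
        using q[of "- (d + 1) / (2 * b)" 1] True by simp
      then show False using \<open>b \<noteq> 0\<close> by simp
    qed
    then show ?thesis using True by simp
  next
    case False
    have "0 \<le> a * (- b)\<^sup>2 + 2 * b * (- b) * a + d * a\<^sup>2" by (rule q)
    also have "\<dots> = a * (a * d - b * b)" by (simp add: power2_eq_square algebra_simps)
    finally show ?thesis using False a0 by (simp add: zero_le_mult_iff)
  qed
  have \<delta>: "\<delta> = sqrt (a * d - b * b)" by (simp add: \<delta>_def a_def b_def d_def)
  have \<delta>0: "0 \<le> \<delta>" and \<delta>2: "\<delta> * \<delta> = a * d - b * b" using det0 by (simp_all add: \<delta>)
  have \<tau>: "\<tau> = sqrt (a + d + 2 * \<delta>)" by (simp add: \<tau>_def a_def d_def)
  have \<tau>0: "0 \<le> \<tau>" and \<tau>2: "\<tau> * \<tau> = a + d + 2 * \<delta>" using a0 d0 \<delta>0 by (simp_all add: \<tau>)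
  define B :: "real^2^2" where "B = (\<chi> i j. (A $ i $ j + (if i = j then \<delta> else 0)) / \<tau>)"
  have Bsym: "transpose B = B"
    by (simp add: B_def transpose_def vec_eq_iff forall_2 b' b_def)
  have BB: "B ** B = A"
  proof (cases "\<tau> = 0")
    \<comment> \<open>Here \<open>A = 0\<close>, and division by zero makes \<open>B\<close> zero as
      well.\<close>
    case True
    then have "a = 0" "d = 0" "\<delta> = 0" using \<tau>2 a0 d0 \<delta>0 by auto
    then have "b = 0" using \<delta>2 by simp
    have "A = 0" using \<open>a = 0\<close> \<open>d = 0\<close> \<open>b = 0\<close> b'
      by (simp add: vec_eq_iff forall_2 a_def b_def d_def)
    then show ?thesis using True by (simp add: B_def vec_eq_iff matrix_matrix_mult_def)
  next
    case False
    have e1: "(a + \<delta>) * (a + \<delta>) + b * b = a * (\<tau> * \<tau>)" using \<delta>2 by (simp add: \<tau>2 algebra_simps)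
    have e2: "(d + \<delta>) * (d + \<delta>) + b * b = d * (\<tau> * \<tau>)" using \<delta>2 by (simp add: \<tau>2 algebra_simps)
    have e3: "(a + \<delta>) * b + b * (d + \<delta>) = b * (\<tau> * \<tau>)" by (simp add: \<tau>2 algebra_simps)
    have B: "B $ 1 $ 1 = (a + \<delta>) / \<tau>" "B $ 1 $ 2 = b / \<tau>" "B $ 2 $ 1 = b / \<tau>" "B $ 2 $ 2 = (d + \<delta>) / \<tau>"
      by (simp_all add: B_def a_def b_def d_def b')
    show ?thesis
      using False e1 e2 e3
      by (simp add: vec_eq_iff forall_2 matrix_matrix_mult_def sum_2 B b' a_def[symmetric]
          b_def[symmetric] d_def[symmetric] add_divide_distrib[symmetric] mult.commute nonzero_divide_eq_eq)
        (simp add: algebra_simps)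
  qed
  have Bpsd: "0 \<le> v \<bullet> (B *v v)" for v
  proof -
    have "v \<bullet> (B *v v) = (v \<bullet> (A *v v) + \<delta> * (v \<bullet> v)) / \<tau>"
      by (simp add: B_def inner_vec_def matrix_vector_mult_def sum_2 add_divide_distrib algebra_simps)
    then show ?thesis using psd[of v] \<delta>0 \<tau>0 by simp
  qed
  have uniq: "D = B" if D: "transpose D = D" "\<forall>v. 0 \<le> v \<bullet> (D *v v)" "D ** D = A" for D
  proof -
    define x y w where "x = D $ 1 $ 1" and "y = D $ 1 $ 2" and "w = D $ 2 $ 2"
    have y': "D $ 2 $ 1 = y"
      using arg_cong[OF D(1), of "\<lambda>B. B $ 1 $ 2"] by (simp add: transpose_def y_def)
    have qD: "0 \<le> x * s\<^sup>2 + 2 * y * s * t + w * t\<^sup>2" for s t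
      using D(2)[rule_format, of "vector [s, t]"]
      by (simp add: inner_vec_def matrix_vector_mult_def sum_2 x_def[symmetric] y_def[symmetric]
          w_def[symmetric] y' algebra_simps power2_eq_square)
    have x0: "0 \<le> x" and w0: "0 \<le> w" using qD[of 1 0] qD[of 0 1] by simp_all
    have ea: "a = x * x + y * y" and eb: "b = x * y + y * w" and ed: "d = y * y + w * w"
      unfolding a_def b_def d_def D(3)[symmetric]
      by (simp_all add: matrix_matrix_mult_def sum_2 x_def y_def w_def y'[unfolded y_def])
    have detD: "0 \<le> x * w - y * y"
    proof (cases "x = 0")
      case True
      have "y = 0"
      proof (rule ccontr)
        assume "y \<noteq> 0"
        have "0 \<le> 2 * y * (- (w + 1) / (2 * y)) * 1 + w * 1\<^sup>2"
          using qD[of "- (w + 1) / (2 * y)" 1] True by simp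
        then show False using \<open>y \<noteq> 0\<close> by simp
      qed
      then show ?thesis using True by simp
    next
      case False
      have "0 \<le> x * (- y)\<^sup>2 + 2 * y * (- y) * x + w * x\<^sup>2" by (rule qD)
      also have "\<dots> = x * (x * w - y * y)" by (simp add: power2_eq_square algebra_simps)
      finally show ?thesis using False x0 by (simp add: zero_le_mult_iff)
    qed
    \<comment> \<open>Determinant and trace of an arbitrary root agree with \<open>\<delta>\<close>
      and \<open>\<tau>\<close>, after which Cayley-Hamilton determines its entries.\<close>
    have "a * d - b * b = (x * w - y * y)\<^sup>2"
      by (simp add: ea eb ed power2_eq_square algebra_simps)
    then have \<delta>': "\<delta> = x * w - y * y" using detD by (simp add: \<delta>)
    then have "a + d + 2 * \<delta> = (x + w)\<^sup>2" by (simp add: ea ed power2_eq_square algebra_simps)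
    then have \<tau>': "\<tau> = x + w" using x0 w0 by (simp add: \<tau>)
    have "D $ i $ j * \<tau> = A $ i $ j + (if i = j then \<delta> else 0)" for i j
    proof -
      have "\<forall>i j. D $ i $ j * \<tau> = A $ i $ j + (if i = j then \<delta> else 0)"
        unfolding forall_2
        using ea eb ed \<delta>' \<tau>' by (simp add: a_def[symmetric] b_def[symmetric] d_def[symmetric] b' y'
            x_def[symmetric] y_def[symmetric] w_def[symmetric] algebra_simps)
      then show ?thesis by blast
    qed
    moreover have "D = 0" if "\<tau> = 0"
    proof -
      have "x = 0" "w = 0" using that \<tau>' x0 w0 by auto
      then have "y * y \<le> 0" using detD by simp
      then have "y = 0" by (auto simp: mult_le_0_iff)
      then show ?thesis using \<open>x = 0\<close> \<open>w = 0\<close> y'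
        by (simp add: vec_eq_iff forall_2 x_def y_def w_def)
    qed
    ultimately show ?thesis
      by (cases "\<tau> = 0") (simp_all add: B_def vec_eq_iff nonzero_eq_divide_eq)
  qed
  have "psd_sqrt A = B"
    unfolding psd_sqrt_def
  proof (rule the_equality)
    show "transpose B = B \<and> (\<forall>v. 0 \<le> v \<bullet> (B *v v)) \<and> B ** B = A" using Bsym Bpsd BB by blast
  qed (use uniq in blast)
  then show "psd_sqrt A = (\<chi> i j. (A $ i $ j + (if i = j then \<delta> else 0)) / \<tau>)"
    "transpose (psd_sqrt A) = psd_sqrt A" "psd_sqrt A ** psd_sqrt A = A"
    using Bsym BB by (simp_all add: B_def)
qed

subsection \<open>Gaussian integrals\<close>

text \<open>Completing the square leaves a multiple of the normal density with mean
  \<open>b / (1 - a)\<close> and variance \<open>1 / (1 - a)\<close>.\<close>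

lemma nn_integral_std_normal_exp_quadratic:
  fixes a b :: real
  assumes "a < 1"
  shows "(\<integral>\<^sup>+x. ennreal (std_normal_density x * exp (b * x + a * x\<^sup>2 / 2)) \<partial>lborel) =
    ennreal (exp (b\<^sup>2 / (2 * (1 - a))) / sqrt (1 - a))"
proof -
  define s m where "s = 1 / sqrt (1 - a)" and "m = b / (1 - a)"
  have s: "s > 0" and s2: "s\<^sup>2 = 1 / (1 - a)" using assms by (auto simp: s_def power_divide)
  define K where "K = exp (b\<^sup>2 / (2 * (1 - a))) / sqrt (1 - a)"
  have eq: "std_normal_density x * exp (b * x + a * x\<^sup>2 / 2) = K * normal_density m s x" for x
  proof -
    have "- x\<^sup>2 / 2 + (b * x + a * x\<^sup>2 / 2) = b\<^sup>2 / (2 * (1 - a)) + - (x - m)\<^sup>2 / (2 * s\<^sup>2)"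
    proof -
      have "(x - m)\<^sup>2 / (2 * s\<^sup>2) = (1 - a) * (x - m)\<^sup>2 / 2" using assms by (simp add: s2)
      also have "\<dots> = (1 - a) * x\<^sup>2 / 2 - b * x + b\<^sup>2 / (2 * (1 - a))"
      proof -
        have b: "b = m * (1 - a)" using assms by (simp add: m_def)
        have b2: "b\<^sup>2 / (2 * (1 - a)) = m\<^sup>2 * (1 - a) / 2"
        proof -
          have "(m * k)\<^sup>2 / (2 * k) = m\<^sup>2 * k / 2" if "k > 0" for k
            using that by (simp add: power2_eq_square)
          then show ?thesis unfolding b using assms by (metis diff_gt_0_iff_gt)
        qed
        show ?thesis unfolding b2 by (simp add: b power2_eq_square algebra_simps diff_divide_distrib add_divide_distrib)
      qed
      finally show ?thesis by (simp add: algebra_simps diff_divide_distrib)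
    qed
    moreover have "sqrt (2 * pi * s\<^sup>2) = sqrt (2 * pi) * s"
      using s by (simp add: real_sqrt_mult)
    ultimately show ?thesis
      using s assms unfolding std_normal_density_def normal_density_def K_def
      by (simp add: s_def exp_add[symmetric])
  qed
  have "K \<ge> 0" using assms by (simp add: K_def)
  then have "(\<integral>\<^sup>+x. ennreal (K * normal_density m s x) \<partial>lborel) = ennreal (\<integral>x. K * normal_density m s x \<partial>lborel)"
    using s by (intro nn_integral_eq_integral) auto
  also have "\<dots> = ennreal K" using s by simp
  finally show ?thesis unfolding eq K_def .
qed

lemma nn_integral_lborel_vec2:
  assumes [measurable]: "f \<in> borel_measurable borel" "h \<in> borel_measurable borel"
    and "\<And>x. 0 \<le> f x" "\<And>x. 0 \<le> h x"
  shows "(\<integral>\<^sup>+v. ennreal (f (v $ 1) * h (v $ 2)) \<partial>(lborel :: (real^2) measure)) =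
    (\<integral>\<^sup>+x. ennreal (f x) \<partial>lborel) * (\<integral>\<^sup>+x. ennreal (h x) \<partial>lborel)"
proof -
  have ne: "axis 1 (1::real) \<noteq> (axis 2 1 :: real^2)" by (simp add: axis_eq_axis)
  have B: "(Basis :: (real^2) set) = {axis 1 1, axis 2 1}"
    by (auto simp: Basis_vec_def) (metis exhaust_2)
  define F where "F b = (if b = axis 1 1 then f else h)" for b :: "real^2"
  have "(\<integral>\<^sup>+v. (\<Prod>b\<in>Basis. ennreal (F b (v \<bullet> b))) \<partial>(lborel :: (real^2) measure)) =
      (\<Prod>b\<in>Basis. (\<integral>\<^sup>+x. ennreal (F b x) \<partial>lborel))"
    by (rule nn_integral_lborel_prod) (auto simp: F_def)
  moreover have "(\<Prod>b\<in>Basis. ennreal (F b (v \<bullet> b))) = ennreal (f (v $ 1) * h (v $ 2))" for v :: "real^2"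
    using ne assms by (simp add: B F_def inner_axis ennreal_mult')
  ultimately show ?thesis using ne by (simp add: B F_def)
qed

text \<open>Chernoff bound with the weight \<open>exp ((norm y)\<^sup>2 / 4)\<close>: each of the
  two coordinates contributes a factor \<open>sqrt 2\<close>.\<close>

lemma std_normal_tail:
  "(\<integral>\<^sup>+y. std_normal2 y * indicator {y. norm y > r} y \<partial>lborel) \<le> ennreal (2 * exp (- r\<^sup>2 / 4))"
  if "r \<ge> 0"
proof -
  have *: "std_normal2 y * indicator {y. norm y > r} y \<le>
     ennreal (exp (- r\<^sup>2 / 4)) * ennreal ((std_normal_density (y $ 1) * exp ((1/2) * (y $ 1)\<^sup>2 / 2))
         * (std_normal_density (y $ 2) * exp ((1/2) * (y $ 2)\<^sup>2 / 2)))" for y :: "real^2"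
  proof (cases "norm y > r")
    case True
    have ny: "(norm y)\<^sup>2 = (y $ 1)\<^sup>2 + (y $ 2)\<^sup>2"
      by (simp add: norm_vec_def L2_set_def sum_2)
    have "r\<^sup>2 \<le> (norm y)\<^sup>2" using True that by (intro power_mono) auto
    then have "0 \<le> (y $ 1)\<^sup>2 / 4 + (y $ 2)\<^sup>2 / 4 - r\<^sup>2 / 4" by (simp add: ny)
    then have "1 \<le> exp (- r\<^sup>2 / 4) * (exp ((1/2) * (y $ 1)\<^sup>2 / 2) * exp ((1/2) * (y $ 2)\<^sup>2 / 2))"
      unfolding exp_add[symmetric] by (simp add: algebra_simps)
    then have "(std_normal_density (y $ 1) * std_normal_density (y $ 2)) * 1 \<le>
      (std_normal_density (y $ 1) * std_normal_density (y $ 2)) *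
        (exp (- r\<^sup>2 / 4) * (exp ((1/2) * (y $ 1)\<^sup>2 / 2) * exp ((1/2) * (y $ 2)\<^sup>2 / 2)))"
      by (intro mult_left_mono) auto
    then show ?thesis using True
      by (simp add: std_normal2_def UNIV_2 ennreal_mult[symmetric] mult_ac)
  qed simp
  have g: "(\<integral>\<^sup>+x. ennreal (std_normal_density x * exp ((1/2) * x\<^sup>2 / 2)) \<partial>lborel) = ennreal (sqrt 2)"
    using nn_integral_std_normal_exp_quadratic[of "1/2" 0]
    by (simp add: real_sqrt_divide)
  have "(\<integral>\<^sup>+y. std_normal2 y * indicator {y. norm y > r} y \<partial>lborel) \<le>
    (\<integral>\<^sup>+y. ennreal (exp (- r\<^sup>2 / 4)) * ennreal ((std_normal_density (y $ 1) * exp ((1/2) * (y $ 1)\<^sup>2 / 2))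
         * (std_normal_density (y $ 2) * exp ((1/2) * (y $ 2)\<^sup>2 / 2))) \<partial>(lborel :: (real^2) measure))"
    by (intro nn_integral_mono *)
  also have "\<dots> = ennreal (exp (- r\<^sup>2 / 4)) * (ennreal (sqrt 2) * ennreal (sqrt 2))"
    using nn_integral_lborel_vec2[of "\<lambda>x. std_normal_density x * exp ((1/2) * x\<^sup>2 / 2)"
        "\<lambda>x. std_normal_density x * exp ((1/2) * x\<^sup>2 / 2)"]
    by (subst nn_integral_cmult) (simp_all only: g, auto)
  also have "\<dots> = ennreal (2 * exp (- r\<^sup>2 / 4))"
    by (simp add: ennreal_mult[symmetric] mult.commute del: ennreal_numeral)
  finally show ?thesis .
qed

text \<open>A lower Riemann sum. The density decreases on the positive axis, so on the pieces of
  length \<open>1/2\<close> ending at \<open>1\<close>, \<open>3/2\<close> and \<open>2\<close> it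
  is at least its value at the right end. Here \<open>63/25\<close> bounds
  \<open>sqrt (2 * pi)\<close>, and the three numerators bound \<open>exp (- 1/2)\<close>,
  \<open>exp (- 9/8)\<close> and \<open>exp (- 2)\<close>. The sum is \<open>105/504\<close>, just
  above \<open>1/5\<close>.\<close>

lemma std_normal_interval_ge:
  "ennreal (1 / 5) \<le> (\<integral>\<^sup>+x. ennreal (std_normal_density x * indicator {1/2..2} x) \<partial>lborel)"
proof -
  have "2 * pi \<le> (63 / 25)\<^sup>2" using pi_approx by (simp add: power2_eq_square)
  then have pi: "sqrt (2 * pi) \<le> 63 / 25" by (intro real_le_lsqrt) auto
  \<comment> \<open>The powers of \<open>1 - x / n\<close> are lower bounds of
    \<open>exp (- x)\<close>; \<open>n\<close> is taken large enough for the required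
    digits.\<close>
  have e1: "6/10 \<le> exp (- (1 / 2) :: real)"
    by (rule order_trans[OF _ exp_ge_one_minus_x_over_n_power_n[of _ 16]]) (simp_all add: power_divide)
  have e2: "32/100 \<le> exp (- (9 / 8) :: real)"
    by (rule order_trans[OF _ exp_ge_one_minus_x_over_n_power_n[of _ 64]]) (simp_all add: power_divide)
  have e3: "13/100 \<le> exp (- 2 :: real)"
    by (rule order_trans[OF _ exp_ge_one_minus_x_over_n_power_n[of _ 64]]) (simp_all add: power_divide)
  define h where "h = (\<lambda>x::real. ennreal (6/10 / (63/25)) * indicator {1/2<..1} x
      + ennreal (32/100 / (63/25)) * indicator {1<..3/2} x
      + ennreal (13/100 / (63/25)) * indicator {3/2<..2} x)"
  have "h x \<le> ennreal (std_normal_density x * indicator {1/2..2} x)" for x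
  proof -
    have *: "c / (63 / 25) \<le> std_normal_density x"
      if "c \<le> exp (- (b\<^sup>2 / 2))" "0 < x" "x \<le> b" "0 \<le> c" for b c
    proof -
      have "exp (- (b\<^sup>2 / 2)) \<le> exp (- (x\<^sup>2 / 2))" using that by simp
      then have "c \<le> exp (- (x\<^sup>2 / 2))" using that by linarith
      then have "c / (63 / 25) \<le> exp (- (x\<^sup>2 / 2)) / sqrt (2 * pi)"
        using pi that by (intro frac_le) auto
      then show ?thesis
        unfolding std_normal_density_def by simp
    qed
    consider "x \<le> 1/2" | "1/2 < x" "x \<le> 1" | "1 < x" "x \<le> 3/2" | "3/2 < x" "x \<le> 2" | "x > 2" by linarith
    then show ?thesis
    proof cases
      case 2 then show ?thesis using *[of "6/10" 1] e1 by (simp add: h_def ennreal_leI)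
    next
      case 3 then show ?thesis using *[of "32/100" "3/2"] e2 by (simp add: h_def power2_eq_square ennreal_leI)
    next
      case 4 then show ?thesis using *[of "13/100" 2] e3 by (simp add: h_def ennreal_leI)
    qed (simp_all add: h_def)
  qed
  then have "(\<integral>\<^sup>+x. h x \<partial>lborel) \<le>
      (\<integral>\<^sup>+x. ennreal (std_normal_density x * indicator {1/2..2} x) \<partial>lborel)"
    by (intro nn_integral_mono)
  moreover have "ennreal (1 / 5) \<le> (\<integral>\<^sup>+x. h x \<partial>lborel)"
  proof -
    have "(\<integral>\<^sup>+x. h x \<partial>lborel) = ennreal (6/10 / (63/25)) * ennreal (1/2)
        + ennreal (32/100 / (63/25)) * ennreal (1/2) + ennreal (13/100 / (63/25)) * ennreal (1/2)"
      unfolding h_def by (simp add: nn_integral_add nn_integral_cmult_indicator del: ennreal_half)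
    also have "\<dots> = ennreal (105 / 504)"
      by (subst (1 2 3) ennreal_mult[symmetric], simp_all) (simp add: ennreal_plus[symmetric] del: ennreal_plus)
    finally show ?thesis by (simp add: ennreal_leI)
  qed
  ultimately show ?thesis by (rule order_trans[rotated])
qed

lemma std_normal_even_interval:
  "(\<integral>\<^sup>+x. ennreal (std_normal_density x * indicator {- 2..- 1/2} x) \<partial>lborel) =
   (\<integral>\<^sup>+x. ennreal (std_normal_density x * indicator {1/2..2} x) \<partial>lborel)"
  by (subst nn_integral_real_affine[of _ "- 1" 0])
    (auto simp: std_normal_density_def indicator_def intro!: nn_integral_cong)

text \<open>The sign pattern of \<open>v\<close> selects a box of side \<open>3/2\<close> on which the linear form is large.\<close>

lemma std_normal_halfplane_ge:
  fixes v :: "real^2"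
  assumes r: "r\<^sup>2 \<ge> 8" "r \<ge> 0"
  shows "ennreal (1 / 25) \<le>
    (\<integral>\<^sup>+y. std_normal2 y * indicator {y. v \<bullet> y \<ge> norm v / 2 \<and> norm y \<le> r} y \<partial>lborel)"
proof -
  \<comment> \<open>The inner ends \<open>1/2\<close> make \<open>v \<bullet> y\<close> at least
    half the sum of the absolute entries of \<open>v\<close>, and the outer ends \<open>2\<close>
    keep the squared norm of \<open>y\<close> at most \<open>8\<close>, whence the assumption on
    \<open>r\<close>.\<close>
  define I where "I i = (if v $ i \<ge> 0 then {1/2..2::real} else {- 2..- 1/2})" for i :: 2
  have I: "ennreal (1 / 5) \<le> (\<integral>\<^sup>+x. ennreal (std_normal_density x * indicator (I i) x) \<partial>lborel)" for i
    using std_normal_interval_ge std_normal_even_interval unfolding I_def by (cases "v $ i \<ge> 0") auto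
  have [measurable]: "I i \<in> sets borel" for i by (simp add: I_def)
  have "ennreal (1 / 25) = ennreal (1 / 5) * ennreal (1 / 5)" by (simp add: ennreal_mult[symmetric])
  also have "\<dots> \<le> (\<integral>\<^sup>+x. ennreal (std_normal_density x * indicator (I 1) x) \<partial>lborel)
      * (\<integral>\<^sup>+x. ennreal (std_normal_density x * indicator (I 2) x) \<partial>lborel)"
    by (intro mult_mono I) auto
  also have "\<dots> = (\<integral>\<^sup>+y. ennreal ((std_normal_density (y $ 1) * indicator (I 1) (y $ 1))
      * (std_normal_density (y $ 2) * indicator (I 2) (y $ 2))) \<partial>(lborel :: (real^2) measure))"
    by (rule nn_integral_lborel_vec2[symmetric]) auto
  also have "\<dots> \<le> (\<integral>\<^sup>+y. std_normal2 y * indicator {y. v \<bullet> y \<ge> norm v / 2 \<and> norm y \<le> r} y \<partial>lborel)"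
  proof (intro nn_integral_mono)
    fix y :: "real^2"
    show "ennreal ((std_normal_density (y $ 1) * indicator (I 1) (y $ 1))
      * (std_normal_density (y $ 2) * indicator (I 2) (y $ 2)))
      \<le> std_normal2 y * indicator {y. v \<bullet> y \<ge> norm v / 2 \<and> norm y \<le> r} y"
    proof (cases "y $ 1 \<in> I 1 \<and> y $ 2 \<in> I 2")
      case True
      have a: "\<bar>v $ i\<bar> / 2 \<le> v $ i * y $ i" "(y $ i)\<^sup>2 \<le> 4" if "y $ i \<in> I i" for i
      proof -
        have "v $ i \<ge> 0 \<Longrightarrow> v $ i * (1/2) \<le> v $ i * y $ i"
          using that by (intro mult_left_mono) (auto simp: I_def)
        moreover have "v $ i < 0 \<Longrightarrow> v $ i * (- 1/2) \<le> v $ i * y $ i"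
          using that by (intro mult_left_mono_neg) (auto simp: I_def)
        ultimately show "\<bar>v $ i\<bar> / 2 \<le> v $ i * y $ i" by (cases "v $ i \<ge> 0") auto
        have "\<bar>y $ i\<bar> \<le> 2" using that by (auto simp: I_def split: if_splits)
        then have "(y $ i)\<^sup>2 \<le> 2\<^sup>2" by (subst abs_le_square_iff[symmetric]) simp
        then show "(y $ i)\<^sup>2 \<le> 4" by simp
      qed
      have "norm v \<le> \<bar>v $ 1\<bar> + \<bar>v $ 2\<bar>" using norm_le_l1_cart[of v] by (simp add: sum_2)
      then have "norm v / 2 \<le> v \<bullet> y"
        using a(1)[of 1] a(1)[of 2] True by (simp add: inner_vec_def sum_2)
      moreover have "(norm y)\<^sup>2 \<le> r\<^sup>2"
        using a(2)[of 1] a(2)[of 2] True r by (simp add: norm_vec_def L2_set_def sum_2)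
      then have "norm y \<le> r" using r by (simp add: power2_le_iff_abs_le)
      ultimately show ?thesis using True by (simp add: std_normal2_def UNIV_2)
    qed (auto simp: indicator_def)
  qed
  finally show ?thesis .
qed

subsection \<open>Independence and measurability\<close>

text \<open>By continuity the rational points suffice, and a countable supremum is measurable. The
  index interval must not depend on the point; this is why \<open>price_at\<close> later
  parametrizes a moving price interval by \<open>[0, 1]\<close>.\<close>

lemma borel_measurable_SUP_interval:
  fixes F :: "real \<Rightarrow> 'a \<Rightarrow> real"
  assumes F: "\<And>s. s \<in> {0..1} \<Longrightarrow> F s \<in> borel_measurable M"
    and cont: "\<And>x. x \<in> space M \<Longrightarrow> continuous_on {0..1} (\<lambda>s. F s x)"
  shows "(\<lambda>x. SUP s\<in>{0..1}. F s x) \<in> borel_measurable M"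
proof -
  let ?Q = "\<rat> \<inter> {0..1::real}"
  have Qc: "closure ?Q = {0..1}"
    using closure_convex_Int_superset[of "{0..1::real}" "\<rat>"]
    by (simp add: Rats_closure_real Int_commute)
  have bdd: "bdd_above ((\<lambda>s. F s x) ` {0..1})" if "x \<in> space M" for x
    using compact_continuous_image[OF cont[OF that]] by (auto intro: compact_imp_bounded bounded_imp_bdd_above)
  have ne: "?Q \<noteq> {}" by (auto intro: exI[of _ 0])
  have "(SUP s\<in>{0..1}. F s x) = (SUP s\<in>?Q. F s x)" if x: "x \<in> space M" for x
  proof (rule antisym)
    have bddQ: "bdd_above ((\<lambda>s. F s x) ` ?Q)" by (rule bdd_above_mono[OF bdd[OF x]]) auto
    show "(SUP s\<in>?Q. F s x) \<le> (SUP s\<in>{0..1}. F s x)"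
      using ne by (intro cSUP_subset_mono bdd x) auto
    show "(SUP s\<in>{0..1}. F s x) \<le> (SUP s\<in>?Q. F s x)"
    proof (rule cSUP_least)
      fix s :: real assume s: "s \<in> {0..1}"
      show "F s x \<le> (SUP s\<in>?Q. F s x)"
        using cont[OF x] s Qc bddQ
        by (intro continuous_le_on_closure[of ?Q "\<lambda>s. F s x" s]) (auto intro: cSUP_upper)
    qed auto
  qed
  moreover have "(\<lambda>x. SUP s\<in>?Q. F s x) \<in> borel_measurable M"
    using F bdd by (intro borel_measurable_cSUP countable_Int1 countable_rat)
      (auto intro!: bdd_above_mono[OF bdd])
  ultimately show ?thesis by (simp cong: measurable_cong)
qed

section \<open>Joining independent sigma-algebras and freezing variables\<close>

context prob_space
begin

lemma indep_set_commute: "indep_set A B \<Longrightarrow> indep_set B A"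
  unfolding indep_sets2_eq by (metis Int_commute mult.commute)

lemma indep_set_mono: "indep_set A B \<Longrightarrow> A' \<subseteq> A \<Longrightarrow> B' \<subseteq> B \<Longrightarrow> indep_set A' B'"
  by (auto simp: indep_sets2_eq subset_iff)

text \<open>The intersections \<open>b \<inter> c\<close> generate the joined
  \<open>\<sigma>\<close>-algebra and are stable under intersection; on them the product rule for
  three sets reduces to the two given ones. It serves to adjoin independent sources of randomness
  one at a time.\<close>

lemma indep_set_join:
  assumes A: "sigma_algebra (space M) A" and B: "sigma_algebra (space M) B"
    and C: "sigma_algebra (space M) C"
    and AB: "indep_set A B" and CAB: "indep_set C (sigma_sets (space M) (A \<union> B))"
  shows "indep_set A (sigma_sets (space M) (B \<union> C))"
proof -
  interpret A: sigma_algebra "space M" A by fact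
  interpret B: sigma_algebra "space M" B by fact
  interpret C: sigma_algebra "space M" C by fact
  let ?E = "{b \<inter> c | b c. b \<in> B \<and> c \<in> C}"
  have ev: "A \<subseteq> events" "B \<subseteq> events" "C \<subseteq> events"
    using AB CAB by (auto simp: indep_sets2_eq)
  have stable: "Int_stable ?E"
  proof (rule Int_stableI)
    fix x y assume "x \<in> ?E" "y \<in> ?E"
    then obtain b c b' c' where "x = b \<inter> c" "y = b' \<inter> c'" "b \<in> B" "c \<in> C" "b' \<in> B" "c' \<in> C" by blast
    then have "x \<inter> y = (b \<inter> b') \<inter> (c \<inter> c')" "b \<inter> b' \<in> B" "c \<inter> c' \<in> C"
      by (auto intro: B.Int C.Int)
    then show "x \<inter> y \<in> ?E" by blast
  qed
  have "indep_set A ?E"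
  proof (rule indep_setI)
    fix a e assume a: "a \<in> A" and "e \<in> ?E"
    then obtain b c where e: "e = b \<inter> c" "b \<in> B" "c \<in> C" by auto
    interpret S: sigma_algebra "space M" "sigma_sets (space M) (A \<union> B)"
      using A.space_closed B.space_closed by (intro sigma_algebra_sigma_sets) auto
    have ab: "a \<inter> b \<in> sigma_sets (space M) (A \<union> B)" using a e by (intro S.Int) auto
    have "prob (c \<inter> (a \<inter> b)) = prob c * prob (a \<inter> b)" by (rule indep_setD[OF CAB e(3) ab])
    also have "prob (a \<inter> b) = prob a * prob b" by (rule indep_setD[OF AB a e(2)])
    also have "c \<inter> (a \<inter> b) = a \<inter> e" by (auto simp: e)
    finally have 1: "prob (a \<inter> e) = prob c * (prob a * prob b)" .
    have "prob (c \<inter> b) = prob c * prob b" using e by (intro indep_setD[OF CAB]) auto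
    then have "prob e = prob c * prob b" by (simp add: e(1) Int_commute)
    then show "prob (a \<inter> e) = prob a * prob e" unfolding 1 by simp
  qed (use ev in auto)
  then have "indep_set (sigma_sets (space M) A) (sigma_sets (space M) ?E)"
    by (rule indep_set_sigma_sets[OF _ _ stable]) (auto intro!: Int_stableI A.Int)
  moreover have "B \<union> C \<subseteq> ?E"
  proof
    fix x assume "x \<in> B \<union> C"
    then have "x = x \<inter> space M \<and> x \<in> B \<or> x = space M \<inter> x \<and> x \<in> C"
      using B.space_closed C.space_closed by blast
    then show "x \<in> ?E" using B.top C.top by blast
  qed
  then have "sigma_sets (space M) (B \<union> C) \<subseteq> sigma_sets (space M) ?E"
    by (rule sigma_sets_mono')
  ultimately show ?thesis using indep_set_mono sigma_sets.Basic by blast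
qed

text \<open>The joint law of the \<open>K\<close>-part and of \<open>V\<close> is a product measure,
  so \<open>V\<close> can be averaged with everything else frozen. Later \<open>V\<close> is the
  noise or the covariate of the current round.\<close>

lemma indep_nn_integral:
  assumes K: "subalgebra M K" and V: "V \<in> measurable M N"
    and indep: "indep_set (sets K) {V -` A \<inter> space M | A. A \<in> sets N}"
    and h: "h \<in> borel_measurable (K \<Otimes>\<^sub>M N)"
  shows "(\<integral>\<^sup>+\<omega>. h (\<omega>, V \<omega>) \<partial>M) = (\<integral>\<^sup>+\<omega>. \<integral>\<^sup>+y. h (\<omega>, y) \<partial>distr M N V \<partial>M)"
proof -
  have spK: "space K = space M" and idM: "(\<lambda>\<omega>. \<omega>) \<in> measurable M K"
    using K by (auto simp: subalgebra_def measurable_def)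
  note [measurable] = V h idM
  interpret DV: prob_space "distr M N V" by (rule prob_space_distr[OF V])
  interpret DK: prob_space "distr M K (\<lambda>\<omega>. \<omega>)" by (rule prob_space_distr[OF idM])
  have eq: "distr M K (\<lambda>\<omega>. \<omega>) \<Otimes>\<^sub>M distr M N V = distr M (K \<Otimes>\<^sub>M N) (\<lambda>\<omega>. (\<omega>, V \<omega>))"
  proof (rule pair_measure_eqI)
    show "sigma_finite_measure (distr M K (\<lambda>\<omega>. \<omega>))" "sigma_finite_measure (distr M N V)"
      by unfold_locales
    fix A B assume A: "A \<in> sets (distr M K (\<lambda>\<omega>. \<omega>))" and B: "B \<in> sets (distr M N V)"
    have AM: "A \<in> sets M" using A K by (auto simp: subalgebra_def)
    have "(\<lambda>\<omega>. (\<omega>, V \<omega>)) -` (A \<times> B) \<inter> space M = A \<inter> (V -` B \<inter> space M)"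
      using sets.sets_into_space[OF AM] by auto
    moreover have "prob (A \<inter> (V -` B \<inter> space M)) = prob A * prob (V -` B \<inter> space M)"
      using A B by (intro indep_setD[OF indep]) auto
    moreover have "(\<lambda>\<omega>. \<omega>) -` A \<inter> space M = A" using sets.sets_into_space[OF AM] by auto
    ultimately show "emeasure (distr M K (\<lambda>\<omega>. \<omega>)) A * emeasure (distr M N V) B =
        emeasure (distr M (K \<Otimes>\<^sub>M N) (\<lambda>\<omega>. (\<omega>, V \<omega>))) (A \<times> B)"
      using A B by (simp add: emeasure_distr emeasure_eq_measure ennreal_mult)
  qed simp
  have "(\<integral>\<^sup>+\<omega>. h (\<omega>, V \<omega>) \<partial>M) = (\<integral>\<^sup>+u. h u \<partial>distr M (K \<Otimes>\<^sub>M N) (\<lambda>\<omega>. (\<omega>, V \<omega>)))"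
    by (subst nn_integral_distr) auto
  also have "\<dots> = (\<integral>\<^sup>+u. h u \<partial>(distr M K (\<lambda>\<omega>. \<omega>) \<Otimes>\<^sub>M distr M N V))" by (simp only: eq)
  also have "\<dots> = (\<integral>\<^sup>+\<omega>. \<integral>\<^sup>+y. h (\<omega>, y) \<partial>distr M N V \<partial>distr M K (\<lambda>\<omega>. \<omega>))"
    by (subst DV.nn_integral_fst[symmetric]) auto
  also have "\<dots> = (\<integral>\<^sup>+\<omega>. \<integral>\<^sup>+y. h (\<omega>, y) \<partial>distr M N V \<partial>M)"
    by (subst nn_integral_distr) auto
  finally show ?thesis .
qed

text \<open>Enlarging the conditioning \<open>\<sigma>\<close>-algebra by independent information does not change a
  conditional expectation.\<close>

lemma nn_integral_eq_join_indep:
  fixes \<phi> Y :: "'a \<Rightarrow> ennreal"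
  assumes K: "subalgebra M K" and F: "subalgebra M F" "sets F \<subseteq> sets K" and H: "subalgebra M H"
    and indep: "indep_set (sets K) (sets H)"
    and \<phi>: "\<phi> \<in> borel_measurable K" "(\<integral>\<^sup>+\<omega>. \<phi> \<omega> \<partial>M) < \<infinity>" and Y: "Y \<in> borel_measurable K"
    and eq: "\<And>A. A \<in> sets F \<Longrightarrow> (\<integral>\<^sup>+\<omega>. \<phi> \<omega> * indicator A \<omega> \<partial>M) = (\<integral>\<^sup>+\<omega>. Y \<omega> * indicator A \<omega> \<partial>M)"
    and Z: "Z \<in> borel_measurable (sigma (space M) (sets F \<union> sets H))"
  shows "(\<integral>\<^sup>+\<omega>. Z \<omega> * \<phi> \<omega> \<partial>M) = (\<integral>\<^sup>+\<omega>. Z \<omega> * Y \<omega> \<partial>M)"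
proof -
  let ?G = "sigma (space M) (sets F \<union> sets H)"
  let ?E = "{a \<inter> h | a h. a \<in> sets F \<and> h \<in> sets H}"
  have FH: "sets F \<union> sets H \<subseteq> Pow (space M)" and FHM: "sets F \<union> sets H \<subseteq> sets M"
    using F H sets.space_closed[of F] sets.space_closed[of H] by (auto simp: subalgebra_def)
  have G: "subalgebra M ?G"
    using FH sets.sigma_sets_subset[OF FHM] by (auto simp: subalgebra_def space_measure_of_conv sets_measure_of)
  have [measurable]: "\<phi> \<in> borel_measurable M" "Y \<in> borel_measurable M" "Z \<in> borel_measurable M"
    by (rule measurable_from_subalg[OF K \<phi>(1)] measurable_from_subalg[OF K Y] measurable_from_subalg[OF G Z])+
  have spF: "space F = space M" and spH: "space H = space M" using F H by (auto simp: subalgebra_def)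
  have E: "sets ?G = sigma_sets (space M) ?E"
  proof -
    have "?E \<subseteq> sigma_sets (space M) (sets F \<union> sets H)"
    proof safe
      interpret S: sigma_algebra "space M" "sigma_sets (space M) (sets F \<union> sets H)"
        using FH by (rule sigma_algebra_sigma_sets)
      fix a h assume "a \<in> sets F" "h \<in> sets H"
      then show "a \<inter> h \<in> sigma_sets (space M) (sets F \<union> sets H)" by (intro S.Int) auto
    qed
    moreover have "sets F \<union> sets H \<subseteq> sigma_sets (space M) ?E"
    proof
      fix x assume "x \<in> sets F \<union> sets H"
      then have "x \<in> ?E"
      proof
        assume x: "x \<in> sets F"
        then have "x = x \<inter> space H" using sets.sets_into_space[OF x] by (auto simp: spH spF)
        then show ?thesis using x by blast
      next
        assume x: "x \<in> sets H"
        then have "x = space F \<inter> x" using sets.sets_into_space[OF x] by (auto simp: spH spF)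
        then show ?thesis using x by blast
      qed
      then show "x \<in> sigma_sets (space M) ?E" by (rule sigma_sets.Basic)
    qed
    ultimately show ?thesis
      unfolding sets_measure_of[OF FH] by (intro subset_antisym sigma_sets_mono)
  qed
  \<comment> \<open>Independence splits off the probability of \<open>h\<close> and leaves an
    integral over \<open>a\<close>, to which \<open>eq\<close> applies.\<close>
  have rect: "(\<integral>\<^sup>+\<omega>. \<psi> \<omega> * indicator (a \<inter> h) \<omega> \<partial>M) = (\<integral>\<^sup>+\<omega>. \<psi> \<omega> * indicator a \<omega> \<partial>M) * emeasure M h"
    if \<psi>: "\<psi> \<in> borel_measurable K" and a: "a \<in> sets F" and h: "h \<in> sets H" for \<psi> :: "'a \<Rightarrow> ennreal" and a h
  proof -
    have hM: "h \<in> sets M" using h H by (auto simp: subalgebra_def)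
    have aK: "a \<in> sets K" using a F(2) by blast
    have idM: "(\<lambda>\<omega>. \<omega>) \<in> measurable M H"
      using H by (auto simp: subalgebra_def measurable_def)
    have [measurable]: "\<psi> \<in> borel_measurable M" by (rule measurable_from_subalg[OF K \<psi>])
    have aM: "a \<in> sets M" using aK K by (auto simp: subalgebra_def)
    have "A \<inter> space M = A" if "A \<in> sets H" for A
      using sets.sets_into_space[OF that] by (auto simp: spH)
    then have "{(\<lambda>\<omega>. \<omega>) -` A \<inter> space M |A. A \<in> sets H} \<subseteq> sets H" by auto
    then have ind: "indep_set (sets K) {(\<lambda>\<omega>. \<omega>) -` A \<inter> space M |A. A \<in> sets H}"
      using indep_set_mono[OF indep order_refl] by blast
    have "(\<integral>\<^sup>+\<omega>. \<psi> \<omega> * indicator (a \<inter> h) \<omega> \<partial>M) = (\<integral>\<^sup>+\<omega>. (\<lambda>(x, y). \<psi> x * indicator a x * indicator h y) (\<omega>, \<omega>) \<partial>M)"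
      by (auto intro!: nn_integral_cong simp: indicator_def)
    also have "\<dots> = (\<integral>\<^sup>+\<omega>. \<integral>\<^sup>+y. (\<lambda>(x, y). \<psi> x * indicator a x * indicator h y) (\<omega>, y) \<partial>distr M H (\<lambda>\<omega>. \<omega>) \<partial>M)"
      unfolding split_beta
      by (intro indep_nn_integral[OF K idM ind] borel_measurable_times_ennreal
          measurable_compose[OF measurable_fst \<psi>]
          measurable_compose[OF measurable_fst borel_measurable_indicator[OF aK]]
          measurable_compose[OF measurable_snd borel_measurable_indicator[OF h]])
    also have "\<dots> = (\<integral>\<^sup>+\<omega>. \<psi> \<omega> * indicator a \<omega> * emeasure M h \<partial>M)"
    proof (intro nn_integral_cong)
      fix \<omega>
      have "(\<integral>\<^sup>+y. \<psi> \<omega> * indicator a \<omega> * indicator h y \<partial>distr M H (\<lambda>\<omega>. \<omega>)) =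
          \<psi> \<omega> * indicator a \<omega> * emeasure (distr M H (\<lambda>\<omega>. \<omega>)) h"
        using h by (subst nn_integral_cmult_indicator) auto
      also have "emeasure (distr M H (\<lambda>\<omega>. \<omega>)) h = emeasure M h"
        using h idM sets.sets_into_space[OF hM] by (simp add: emeasure_distr Int_absorb2)
      finally show "(\<integral>\<^sup>+y. (\<lambda>(x, y). \<psi> x * indicator a x * indicator h y) (\<omega>, y) \<partial>distr M H (\<lambda>\<omega>. \<omega>)) =
          \<psi> \<omega> * indicator a \<omega> * emeasure M h" by simp
    qed
    also have "\<dots> = (\<integral>\<^sup>+\<omega>. \<psi> \<omega> * indicator a \<omega> \<partial>M) * emeasure M h"
      using aM by (subst nn_integral_multc) auto
    finally show ?thesis .
  qed
  \<comment> \<open>Equality for arbitrary \<open>Z\<close> is equality of the measures with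
    densities \<open>\<phi>\<close> and \<open>Y\<close> on the joined
    \<open>\<sigma>\<close>-algebra. Finiteness of the integral of \<open>\<phi>\<close> lets
    agreement on intersections extend to all of it.\<close>
  let ?R = "\<lambda>\<psi>. restr_to_subalg (density M \<psi>) ?G"
  have sub: "subalgebra (density M \<psi>) ?G" for \<psi> :: "'a \<Rightarrow> ennreal" using G by (simp add: subalgebra_def)
  have em: "emeasure (?R \<psi>) A = (\<integral>\<^sup>+\<omega>. \<psi> \<omega> * indicator A \<omega> \<partial>M)"
    if "A \<in> sets ?G" "\<psi> \<in> borel_measurable M" for A and \<psi> :: "'a \<Rightarrow> ennreal"
    using that G by (subst emeasure_restr_to_subalg[OF sub that(1)])
      (auto simp: emeasure_density subalgebra_def)
  have "?R \<phi> = ?R Y"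
  proof (rule measure_eqI_generator_eq[where \<Omega>="space M" and E="?E" and A="\<lambda>_. space M"])
    show "Int_stable ?E"
    proof (rule Int_stableI)
      fix x y assume "x \<in> ?E" "y \<in> ?E"
      then obtain b c b' c' where "x = b \<inter> c" "y = b' \<inter> c'" "b \<in> sets F" "c \<in> sets H"
        "b' \<in> sets F" "c' \<in> sets H" by blast
      then have "x \<inter> y = (b \<inter> b') \<inter> (c \<inter> c')" "b \<inter> b' \<in> sets F" "c \<inter> c' \<in> sets H" by auto
      then show "x \<inter> y \<in> ?E" by blast
    qed
    show "?E \<subseteq> Pow (space M)" using FH by auto
    show "emeasure (?R \<phi>) X = emeasure (?R Y) X" if "X \<in> ?E" for X
    proof -
      from that obtain a h where X: "X = a \<inter> h" "a \<in> sets F" "h \<in> sets H" by blast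
      have XG: "X \<in> sets ?G" using that unfolding E by (rule sigma_sets.Basic)
      have "emeasure (?R \<phi>) X = (\<integral>\<^sup>+\<omega>. \<phi> \<omega> * indicator (a \<inter> h) \<omega> \<partial>M)"
        unfolding X(1)[symmetric] by (rule em[OF XG]) measurable
      also have "\<dots> = (\<integral>\<^sup>+\<omega>. Y \<omega> * indicator (a \<inter> h) \<omega> \<partial>M)"
        by (simp only: rect[OF \<phi>(1) X(2,3)] rect[OF Y X(2,3)] eq[OF X(2)])
      also have "\<dots> = emeasure (?R Y) X"
        unfolding X(1)[symmetric] by (rule em[OF XG, symmetric]) measurable
      finally show ?thesis .
    qed
    show "sets (?R \<phi>) = sigma_sets (space M) ?E" "sets (?R Y) = sigma_sets (space M) ?E"
      by (simp_all add: sets_restr_to_subalg[OF sub] E)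
    show "range (\<lambda>_. space M) \<subseteq> ?E"
      using sets.top[of F] sets.top[of H] by (auto simp: spF spH)
    have sG: "space M \<in> sets ?G" using sets.top[of ?G] by (simp add: space_measure_of_conv)
    have "emeasure (?R \<phi>) (space M) = (\<integral>\<^sup>+\<omega>. \<phi> \<omega> * indicator (space M) \<omega> \<partial>M)"
      by (rule em[OF sG]) measurable
    also have "\<dots> = (\<integral>\<^sup>+\<omega>. \<phi> \<omega> \<partial>M)" by (auto intro!: nn_integral_cong)
    finally have "emeasure (?R \<phi>) (space M) = (\<integral>\<^sup>+\<omega>. \<phi> \<omega> \<partial>M)" .
    then show "emeasure (?R \<phi>) (space M) \<noteq> \<infinity>" using \<phi>(2) by auto
  qed auto
  then have "(\<integral>\<^sup>+\<omega>. Z \<omega> \<partial>?R \<phi>) = (\<integral>\<^sup>+\<omega>. Z \<omega> \<partial>?R Y)" by simp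
  then have "(\<integral>\<^sup>+\<omega>. Z \<omega> \<partial>density M \<phi>) = (\<integral>\<^sup>+\<omega>. Z \<omega> \<partial>density M Y)"
    by (simp only: nn_integral_subalgebra2[OF sub Z])
  then show ?thesis by (simp add: nn_integral_density mult.commute[of "Z _"])
qed

end

subsection \<open>Conditionally sub-Gaussian variables\<close>

text \<open>The conditional moment bound in integrated form. Testing against all nonnegative
  extended-real weights avoids integrability conditions on \<open>Z\<close>, which will contain
  exponentials of earlier shocks.\<close>

definition subgaussian_given :: "'a measure \<Rightarrow> 'a measure \<Rightarrow> real \<Rightarrow> ('a \<Rightarrow> real) \<Rightarrow> bool" where
  "subgaussian_given M F \<sigma> e \<longleftrightarrow>
    (\<forall>Z\<in>borel_measurable F. \<forall>r. (\<integral>\<^sup>+\<omega>. Z \<omega> * ennreal (exp (r * e \<omega>)) \<partial>M)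
      \<le> ennreal (exp (\<sigma>\<^sup>2 * r\<^sup>2 / 2)) * (\<integral>\<^sup>+\<omega>. Z \<omega> \<partial>M))"

lemma subgaussian_givenD:
  "subgaussian_given M F \<sigma> e \<Longrightarrow> Z \<in> borel_measurable F \<Longrightarrow>
    (\<integral>\<^sup>+\<omega>. Z \<omega> * ennreal (exp (r * e \<omega>)) \<partial>M) \<le> ennreal (exp (\<sigma>\<^sup>2 * r\<^sup>2 / 2)) * (\<integral>\<^sup>+\<omega>. Z \<omega> \<partial>M)"
  by (simp add: subgaussian_given_def)

text \<open>Staying below the absolute value of \<open>V\<close> is the point: it keeps
  \<open>exp (\<sigma>\<^sup>2 * U\<^sup>2 / 2)\<close> below its limit, so the passage to the limit
  in \<open>subgaussian_given_random_coeff\<close> needs no further domination.\<close>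

lemma simple_approx_toward_zero:
  fixes V :: "'a \<Rightarrow> real"
  assumes V: "V \<in> borel_measurable F"
  obtains U :: "nat \<Rightarrow> 'a \<Rightarrow> real" where
    "\<And>i. U i \<in> borel_measurable F" "\<And>i. finite (U i ` space F)"
    "\<And>i x. \<bar>U i x\<bar> \<le> \<bar>V x\<bar>" "\<And>x. (\<lambda>i. U i x) \<longlonglongrightarrow> V x"
proof -
  have "(\<lambda>x. \<bar>V x\<bar>) \<in> borel_measurable F" using V by measurable
  from borel_measurable_implies_simple_function_sequence_real[OF this]
  obtain S where S: "incseq S" "\<And>i. simple_function F (S i)" "\<And>x. bdd_above (range (\<lambda>i. S i x))"
    "\<And>i x. 0 \<le> S i x" and sup: "(\<lambda>x. \<bar>V x\<bar>) = (SUP i. S i)" by auto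
  have V_sup: "\<bar>V x\<bar> = (SUP i. S i x)" for x
    using fun_cong[OF sup, of x] by (simp add: Sup_fun_def image_comp)
  have le: "S i x \<le> \<bar>V x\<bar>" for i x
    unfolding V_sup by (intro cSUP_upper S) auto
  have lim: "(\<lambda>i. S i x) \<longlonglongrightarrow> \<bar>V x\<bar>" for x
    unfolding V_sup using S(1) by (intro LIMSEQ_incseq_SUP S) (auto simp: incseq_def le_fun_def)
  show ?thesis
  proof (rule that[of "\<lambda>i x. sgn (V x) * S i x"])
    fix i
    show "(\<lambda>x. sgn (V x) * S i x) \<in> borel_measurable F"
      using V borel_measurable_simple_function[OF S(2)] by measurable
    have "(\<lambda>x. sgn (V x) * S i x) ` space F \<subseteq> (\<lambda>(a, b). a * b) ` ({-1, 0, 1} \<times> S i ` space F)"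
      by (auto simp: sgn_real_def image_iff)
    then show "finite ((\<lambda>x. sgn (V x) * S i x) ` space F)"
      by (rule finite_subset) (use S(2)[of i] in \<open>auto simp: simple_function_def\<close>)
    show "\<bar>sgn (V x) * S i x\<bar> \<le> \<bar>V x\<bar>" for x
      using le[of i x] S(4)[of i x] by (auto simp: abs_mult sgn_real_def)
  next
    fix x
    have "(\<lambda>i. sgn (V x) * S i x) \<longlonglongrightarrow> sgn (V x) * \<bar>V x\<bar>" by (intro tendsto_intros lim)
    then show "(\<lambda>i. sgn (V x) * S i x) \<longlonglongrightarrow> V x" by (simp add: sgn_mult_abs)
  qed
qed

context prob_space
begin

context
  fixes F :: "'a measure" and \<sigma> :: real and e :: "'a \<Rightarrow> real"
  assumes F: "subalgebra M F" and e [measurable]: "e \<in> borel_measurable M"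
    and sg: "subgaussian_given M F \<sigma> e"
begin

text \<open>On each level set of a simple coefficient the bound for constants applies, with the
  indicator absorbed into the weight; Fatou's lemma then reaches a general \<open>V\<close>.\<close>

lemma subgaussian_given_random_coeff:
  assumes Z: "Z \<in> borel_measurable F" and V: "V \<in> borel_measurable F"
  shows "(\<integral>\<^sup>+\<omega>. Z \<omega> * ennreal (exp (V \<omega> * e \<omega>)) \<partial>M)
      \<le> (\<integral>\<^sup>+\<omega>. Z \<omega> * ennreal (exp (\<sigma>\<^sup>2 * (V \<omega>)\<^sup>2 / 2)) \<partial>M)"
proof -
  note MF = measurable_from_subalg[OF F]
  have spF: "space F = space M" using F by (simp add: subalgebra_def)
  have [measurable]: "Z \<in> borel_measurable M" "V \<in> borel_measurable M" using Z V MF by auto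
  obtain U where U: "\<And>i. U i \<in> borel_measurable F" "\<And>i. finite (U i ` space F)"
    "\<And>i x. \<bar>U i x\<bar> \<le> \<bar>V x\<bar>" "\<And>x. (\<lambda>i. U i x) \<longlonglongrightarrow> V x"
    using simple_approx_toward_zero[OF V] by blast
  have [measurable]: "U i \<in> borel_measurable M" for i using U(1) MF by auto
  have step: "(\<integral>\<^sup>+\<omega>. Z \<omega> * ennreal (exp (U i \<omega> * e \<omega>)) \<partial>M)
      \<le> (\<integral>\<^sup>+\<omega>. Z \<omega> * ennreal (exp (\<sigma>\<^sup>2 * (V \<omega>)\<^sup>2 / 2)) \<partial>M)" for i
  proof -
    let ?R = "U i ` space M"
    let ?I = "\<lambda>y. indicator (U i -` {y} \<inter> space M) :: 'a \<Rightarrow> ennreal"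
    have fin: "finite ?R" using U(2)[of i] by (simp add: spF)
    have split: "(\<Sum>y\<in>?R. h y * ?I y \<omega>) = h (U i \<omega>)" if "\<omega> \<in> space M" for h \<omega>
    proof -
      have "(\<Sum>y\<in>?R. h y * ?I y \<omega>) = (\<Sum>y\<in>?R. if y = U i \<omega> then h y else 0)"
        using that by (intro sum.cong) auto
      then show ?thesis using fin that by simp
    qed
    have IF: "?I y \<in> borel_measurable F" for y
    proof -
      have "U i -` {y} \<inter> space F \<in> sets F" using U(1)[of i] by (rule measurable_sets) simp
      then show ?thesis by (simp add: spF)
    qed
    have [measurable]: "?I y \<in> borel_measurable M" for y using MF[OF IF] .
    have "(\<integral>\<^sup>+\<omega>. Z \<omega> * ennreal (exp (U i \<omega> * e \<omega>)) \<partial>M)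
        = (\<integral>\<^sup>+\<omega>. (\<Sum>y\<in>?R. (Z \<omega> * ennreal (exp (y * e \<omega>))) * ?I y \<omega>) \<partial>M)"
      by (intro nn_integral_cong) (subst split, auto)
    also have "\<dots> = (\<Sum>y\<in>?R. (\<integral>\<^sup>+\<omega>. (Z \<omega> * ?I y \<omega>) * ennreal (exp (y * e \<omega>)) \<partial>M))"
      by (subst nn_integral_sum) (auto simp: mult_ac)
    also have "\<dots> \<le> (\<Sum>y\<in>?R. ennreal (exp (\<sigma>\<^sup>2 * y\<^sup>2 / 2)) * (\<integral>\<^sup>+\<omega>. Z \<omega> * ?I y \<omega> \<partial>M))"
      using sg Z IF unfolding subgaussian_given_def by (intro sum_mono) (auto intro!: borel_measurable_times)
    also have "\<dots> = (\<integral>\<^sup>+\<omega>. (\<Sum>y\<in>?R. (Z \<omega> * ennreal (exp (\<sigma>\<^sup>2 * y\<^sup>2 / 2))) * ?I y \<omega>) \<partial>M)"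
      by (subst nn_integral_sum) (auto simp: nn_integral_cmult[symmetric] mult_ac intro!: sum.cong nn_integral_cong)
    also have "\<dots> = (\<integral>\<^sup>+\<omega>. Z \<omega> * ennreal (exp (\<sigma>\<^sup>2 * (U i \<omega>)\<^sup>2 / 2)) \<partial>M)"
      by (intro nn_integral_cong) (subst split, auto)
    also have "\<dots> \<le> (\<integral>\<^sup>+\<omega>. Z \<omega> * ennreal (exp (\<sigma>\<^sup>2 * (V \<omega>)\<^sup>2 / 2)) \<partial>M)"
      using U(3) by (intro nn_integral_mono mult_left_mono ennreal_leI)
        (auto intro!: mult_left_mono abs_le_square_iff[THEN iffD1])
    finally show ?thesis .
  qed
  have "(\<integral>\<^sup>+\<omega>. Z \<omega> * ennreal (exp (V \<omega> * e \<omega>)) \<partial>M)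
      \<le> (\<integral>\<^sup>+\<omega>. liminf (\<lambda>i. Z \<omega> * ennreal (exp (U i \<omega> * e \<omega>))) \<partial>M)"
  proof (intro nn_integral_mono)
    fix \<omega>
    have "(\<lambda>i. Z \<omega> * ennreal (exp (U i \<omega> * e \<omega>))) \<longlonglongrightarrow> Z \<omega> * ennreal (exp (V \<omega> * e \<omega>))"
      by (intro tendsto_mult_ennreal tendsto_ennrealI tendsto_intros U) auto
    then show "Z \<omega> * ennreal (exp (V \<omega> * e \<omega>)) \<le> liminf (\<lambda>i. Z \<omega> * ennreal (exp (U i \<omega> * e \<omega>)))"
      by (simp add: lim_imp_Liminf)
  qed
  also have "\<dots> \<le> liminf (\<lambda>i. \<integral>\<^sup>+\<omega>. Z \<omega> * ennreal (exp (U i \<omega> * e \<omega>)) \<partial>M)"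
    by (intro nn_integral_liminf) measurable
  also have "\<dots> \<le> liminf (\<lambda>i::nat. \<integral>\<^sup>+\<omega>. Z \<omega> * ennreal (exp (\<sigma>\<^sup>2 * (V \<omega>)\<^sup>2 / 2)) \<partial>M)"
    by (intro Liminf_mono always_eventually allI step)
  also have "\<dots> = (\<integral>\<^sup>+\<omega>. Z \<omega> * ennreal (exp (\<sigma>\<^sup>2 * (V \<omega>)\<^sup>2 / 2)) \<partial>M)"
    by (intro Liminf_const) simp
  finally show ?thesis .
qed

text \<open>The square in the exponent is linearized by \<open>exp (k e\<^sup>2 / 2) = E exp (sqrt k \<xi> e)\<close> for a standard
  normal \<open>\<xi>\<close>.\<close>

lemma subgaussian_given_quadratic:
  assumes Z: "Z \<in> borel_measurable F" and V: "V \<in> borel_measurable F" and k: "k \<in> borel_measurable F"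
    and k0: "\<And>\<omega>. 0 \<le> k \<omega>" and k1: "\<And>\<omega>. \<sigma>\<^sup>2 * k \<omega> < 1"
  shows "(\<integral>\<^sup>+\<omega>. Z \<omega> * ennreal (exp (V \<omega> * e \<omega> + k \<omega> * (e \<omega>)\<^sup>2 / 2)) \<partial>M)
      \<le> (\<integral>\<^sup>+\<omega>. Z \<omega> * ennreal (exp (\<sigma>\<^sup>2 * (V \<omega>)\<^sup>2 / (2 * (1 - \<sigma>\<^sup>2 * k \<omega>))) / sqrt (1 - \<sigma>\<^sup>2 * k \<omega>)) \<partial>M)"
proof -
  note MF = measurable_from_subalg[OF F]
  have [measurable]: "Z \<in> borel_measurable M" "V \<in> borel_measurable M" "k \<in> borel_measurable M"
    using Z V k MF by auto
  let ?g = "\<lambda>x. ennreal (std_normal_density x)"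
  have 1: "ennreal (exp (V \<omega> * e \<omega> + k \<omega> * (e \<omega>)\<^sup>2 / 2)) =
     (\<integral>\<^sup>+x. ?g x * ennreal (exp ((V \<omega> + sqrt (k \<omega>) * x) * e \<omega>)) \<partial>lborel)" for \<omega>
  proof -
    have "(\<integral>\<^sup>+x. ?g x * ennreal (exp ((V \<omega> + sqrt (k \<omega>) * x) * e \<omega>)) \<partial>lborel) =
      (\<integral>\<^sup>+x. ennreal (exp (V \<omega> * e \<omega>)) * ennreal (std_normal_density x * exp ((sqrt (k \<omega>) * e \<omega>) * x + 0 * x\<^sup>2 / 2)) \<partial>lborel)"
      by (intro nn_integral_cong) (simp add: ennreal_mult[symmetric] exp_add[symmetric] algebra_simps mult_exp_exp)
    also have "\<dots> = ennreal (exp (V \<omega> * e \<omega>)) * ennreal (exp ((sqrt (k \<omega>) * e \<omega>)\<^sup>2 / 2))"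
      using nn_integral_std_normal_exp_quadratic[of 0 "sqrt (k \<omega>) * e \<omega>"]
      by (subst nn_integral_cmult) auto
    also have "\<dots> = ennreal (exp (V \<omega> * e \<omega> + k \<omega> * (e \<omega>)\<^sup>2 / 2))"
      using k0[of \<omega>] by (simp add: ennreal_mult[symmetric] exp_add[symmetric] power_mult_distrib mult_exp_exp)
    finally show ?thesis by simp
  qed
  have 2: "(\<integral>\<^sup>+x. ?g x * ennreal (exp (\<sigma>\<^sup>2 * (V \<omega> + sqrt (k \<omega>) * x)\<^sup>2 / 2)) \<partial>lborel) =
     ennreal (exp (\<sigma>\<^sup>2 * (V \<omega>)\<^sup>2 / (2 * (1 - \<sigma>\<^sup>2 * k \<omega>))) / sqrt (1 - \<sigma>\<^sup>2 * k \<omega>))" for \<omega>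
  proof -
    define b where "b = \<sigma>\<^sup>2 * V \<omega> * sqrt (k \<omega>)"
    have sk: "(sqrt (k \<omega>))\<^sup>2 = k \<omega>" using k0 by simp
    have ex: "\<sigma>\<^sup>2 * (V \<omega> + sqrt (k \<omega>) * x)\<^sup>2 / 2 = \<sigma>\<^sup>2 * (V \<omega>)\<^sup>2 / 2 + (b * x + (\<sigma>\<^sup>2 * k \<omega>) * x\<^sup>2 / 2)" for x
    proof -
      have "\<sigma>\<^sup>2 * (V \<omega> + sqrt (k \<omega>) * x)\<^sup>2 / 2 =
          \<sigma>\<^sup>2 * (V \<omega>)\<^sup>2 / 2 + (b * x + (\<sigma>\<^sup>2 * (sqrt (k \<omega>))\<^sup>2) * x\<^sup>2 / 2)"
        unfolding b_def by (simp add: power2_eq_square algebra_simps add_divide_distrib del: real_sqrt_mult_self)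
      then show ?thesis by (simp only: sk)
    qed
    have "(\<integral>\<^sup>+x. ?g x * ennreal (exp (\<sigma>\<^sup>2 * (V \<omega> + sqrt (k \<omega>) * x)\<^sup>2 / 2)) \<partial>lborel) =
      (\<integral>\<^sup>+x. ennreal (exp (\<sigma>\<^sup>2 * (V \<omega>)\<^sup>2 / 2)) * ennreal (std_normal_density x * exp (b * x + (\<sigma>\<^sup>2 * k \<omega>) * x\<^sup>2 / 2)) \<partial>lborel)"
      unfolding ex exp_add[of "\<sigma>\<^sup>2 * (V \<omega>)\<^sup>2 / 2"]
      by (intro nn_integral_cong) (simp add: ennreal_mult[symmetric] mult_ac)
    also have "\<dots> = ennreal (exp (\<sigma>\<^sup>2 * (V \<omega>)\<^sup>2 / 2)) *
        ennreal (exp (b\<^sup>2 / (2 * (1 - \<sigma>\<^sup>2 * k \<omega>))) / sqrt (1 - \<sigma>\<^sup>2 * k \<omega>))"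
      using nn_integral_std_normal_exp_quadratic[OF k1[of \<omega>], of b] by (subst nn_integral_cmult) auto
    also have "\<dots> = ennreal (exp (\<sigma>\<^sup>2 * (V \<omega>)\<^sup>2 / 2 + b\<^sup>2 / (2 * (1 - \<sigma>\<^sup>2 * k \<omega>))) / sqrt (1 - \<sigma>\<^sup>2 * k \<omega>))"
      using k1[of \<omega>] by (simp add: ennreal_mult[symmetric] exp_add)
    also have "\<sigma>\<^sup>2 * (V \<omega>)\<^sup>2 / 2 + b\<^sup>2 / (2 * (1 - \<sigma>\<^sup>2 * k \<omega>)) = \<sigma>\<^sup>2 * (V \<omega>)\<^sup>2 / (2 * (1 - \<sigma>\<^sup>2 * k \<omega>))"
    proof -
      have b2: "b\<^sup>2 = \<sigma>\<^sup>2 * (V \<omega>)\<^sup>2 * (\<sigma>\<^sup>2 * k \<omega>)"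
        unfolding b_def power_mult_distrib sk by (simp add: power2_eq_square)
      have "A / 2 + A * K / (2 * (1 - K)) = A / (2 * (1 - K))" if "K < 1" for A K :: real
        using that by (simp add: divide_simps) (simp add: algebra_simps)
      then show ?thesis unfolding b2 using k1 by blast
    qed
    finally show ?thesis .
  qed
  have "(\<integral>\<^sup>+\<omega>. Z \<omega> * ennreal (exp (V \<omega> * e \<omega> + k \<omega> * (e \<omega>)\<^sup>2 / 2)) \<partial>M) =
     (\<integral>\<^sup>+\<omega>. \<integral>\<^sup>+x. ?g x * (Z \<omega> * ennreal (exp ((V \<omega> + sqrt (k \<omega>) * x) * e \<omega>))) \<partial>lborel \<partial>M)"
    unfolding 1 by (subst nn_integral_cmult[symmetric]) (auto simp: mult_ac)
  also have "\<dots> = (\<integral>\<^sup>+x. \<integral>\<^sup>+\<omega>. ?g x * (Z \<omega> * ennreal (exp ((V \<omega> + sqrt (k \<omega>) * x) * e \<omega>))) \<partial>M \<partial>lborel)"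
  proof -
    interpret pair_sigma_finite lborel M by unfold_locales
    show ?thesis by (rule Fubini') measurable
  qed
  also have "\<dots> \<le> (\<integral>\<^sup>+x. \<integral>\<^sup>+\<omega>. ?g x * (Z \<omega> * ennreal (exp (\<sigma>\<^sup>2 * (V \<omega> + sqrt (k \<omega>) * x)\<^sup>2 / 2))) \<partial>M \<partial>lborel)"
  proof (rule nn_integral_mono)
    fix x :: real
    \<comment> \<open>For frozen \<open>x\<close> the exponent is linear in \<open>e\<close> with a
      random coefficient known to \<open>F\<close>.\<close>
    have "(\<lambda>\<omega>. V \<omega> + sqrt (k \<omega>) * x) \<in> borel_measurable F" using V k by measurable
    from mult_left_mono[OF subgaussian_given_random_coeff[OF Z this], of "?g x"]
    show "(\<integral>\<^sup>+\<omega>. ?g x * (Z \<omega> * ennreal (exp ((V \<omega> + sqrt (k \<omega>) * x) * e \<omega>))) \<partial>M)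
       \<le> (\<integral>\<^sup>+\<omega>. ?g x * (Z \<omega> * ennreal (exp (\<sigma>\<^sup>2 * (V \<omega> + sqrt (k \<omega>) * x)\<^sup>2 / 2))) \<partial>M)"
      by (simp add: nn_integral_cmult)
  qed
  also have "\<dots> = (\<integral>\<^sup>+\<omega>. \<integral>\<^sup>+x. ?g x * (Z \<omega> * ennreal (exp (\<sigma>\<^sup>2 * (V \<omega> + sqrt (k \<omega>) * x)\<^sup>2 / 2))) \<partial>lborel \<partial>M)"
  proof -
    interpret pair_sigma_finite lborel M by unfold_locales
    show ?thesis by (rule Fubini'[symmetric]) (measurable)
  qed
  also have "\<dots> = (\<integral>\<^sup>+\<omega>. Z \<omega> * ennreal (exp (\<sigma>\<^sup>2 * (V \<omega>)\<^sup>2 / (2 * (1 - \<sigma>\<^sup>2 * k \<omega>))) / sqrt (1 - \<sigma>\<^sup>2 * k \<omega>)) \<partial>M)"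
    unfolding 2[symmetric] by (subst nn_integral_cmult[symmetric]) (auto simp: mult_ac)
  finally show ?thesis .
qed

lemma subgaussian_given_integrable_exp: "integrable M (\<lambda>\<omega>. exp (r * e \<omega>))"
  and subgaussian_given_integrable: "integrable M e"
  and subgaussian_given_integrable_square: "integrable M (\<lambda>\<omega>. (e \<omega>)\<^sup>2)"
proof -
  show *: "integrable M (\<lambda>\<omega>. exp (r * e \<omega>))" for r
  proof (rule integrableI_nonneg)
    have "(\<integral>\<^sup>+\<omega>. 1 * ennreal (exp (r * e \<omega>)) \<partial>M) \<le> ennreal (exp (\<sigma>\<^sup>2 * r\<^sup>2 / 2)) * (\<integral>\<^sup>+\<omega>. 1 \<partial>M)"
      by (rule subgaussian_givenD[OF sg]) simp
    then show "(\<integral>\<^sup>+\<omega>. ennreal (exp (r * e \<omega>)) \<partial>M) < \<infinity>"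
      by (simp add: emeasure_space_1 order_le_less_trans[OF _ ennreal_less_top])
  qed auto
  \<comment> \<open>The quadratic Taylor bound for whichever exponential has a nonnegative argument;
    it dominates the first two moments by exponential ones.\<close>
  have bound: "1 + \<bar>x\<bar> + x\<^sup>2 / 2 \<le> exp x + exp (- x)" for x :: real
  proof (cases "x \<ge> 0")
    case True
    then show ?thesis using exp_lower_Taylor_quadratic[of x] exp_gt_zero[of "- x"] by (simp del: exp_gt_zero)
  next
    case False
    then show ?thesis using exp_lower_Taylor_quadratic[of "- x"] exp_gt_zero[of x] by (simp del: exp_gt_zero)
  qed
  have i: "integrable M (\<lambda>\<omega>. 2 * (exp (e \<omega>) + exp (- e \<omega>)))" using *[of 1] *[of "- 1"] by simp
  show "integrable M e"
  proof (rule Bochner_Integration.integrable_bound[OF i], simp, intro AE_I2)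
    fix \<omega> show "norm (e \<omega>) \<le> norm (2 * (exp (e \<omega>) + exp (- e \<omega>)))"
    proof -
      have "\<bar>e \<omega>\<bar> \<le> exp (e \<omega>) + exp (- e \<omega>)"
        using bound[of "e \<omega>"] zero_le_power2[of "e \<omega>"] by linarith
      also have "\<dots> \<le> 2 * (exp (e \<omega>) + exp (- e \<omega>))" by (simp add: add_nonneg_nonneg)
      finally show ?thesis by (simp add: add_nonneg_nonneg)
    qed
  qed
  show "integrable M (\<lambda>\<omega>. (e \<omega>)\<^sup>2)"
  proof (rule Bochner_Integration.integrable_bound[OF i], simp, intro AE_I2)
    fix \<omega> show "norm ((e \<omega>)\<^sup>2) \<le> norm (2 * (exp (e \<omega>) + exp (- e \<omega>)))"
      using bound[of "e \<omega>"] by (simp add: add_nonneg_nonneg)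
  qed
qed

lemma subgaussian_given_integrable_mult:
  assumes Z: "Z \<in> borel_measurable F" and B: "AE \<omega> in M. \<bar>Z \<omega>\<bar> \<le> B" and h: "integrable M h"
  shows "integrable M (\<lambda>\<omega>. Z \<omega> * h \<omega> :: real)"
proof (rule Bochner_Integration.integrable_bound)
  show "integrable M (\<lambda>\<omega>. B * h \<omega>)" using h by simp
  have "Z \<in> borel_measurable M" using measurable_from_subalg[OF F Z] .
  then show "(\<lambda>\<omega>. Z \<omega> * h \<omega>) \<in> borel_measurable M" using h by measurable
  show "AE \<omega> in M. norm (Z \<omega> * h \<omega>) \<le> norm (B * h \<omega>)"
    using B by eventually_elim (auto simp: abs_mult intro!: mult_right_mono)
qed

lemma subgaussian_given_integral_exp_le:
  assumes Z: "Z \<in> borel_measurable F" and B: "AE \<omega> in M. 0 \<le> Z \<omega> \<and> Z \<omega> \<le> B"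
  shows "(\<integral>\<omega>. Z \<omega> * exp (r * e \<omega>) \<partial>M) \<le> exp (\<sigma>\<^sup>2 * r\<^sup>2 / 2) * (\<integral>\<omega>. Z \<omega> \<partial>M)"
proof -
  have B': "AE \<omega> in M. \<bar>Z \<omega>\<bar> \<le> B" using B by eventually_elim auto
  have iZ: "integrable M Z"
    using subgaussian_given_integrable_mult[OF Z B', of "\<lambda>_. 1"] by simp
  have iZe: "integrable M (\<lambda>\<omega>. Z \<omega> * exp (r * e \<omega>))"
    by (rule subgaussian_given_integrable_mult[OF Z B' subgaussian_given_integrable_exp])
  have "(\<lambda>\<omega>. ennreal (Z \<omega>)) \<in> borel_measurable F" using Z by measurable
  then have "(\<integral>\<^sup>+\<omega>. ennreal (Z \<omega>) * ennreal (exp (r * e \<omega>)) \<partial>M)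
      \<le> ennreal (exp (\<sigma>\<^sup>2 * r\<^sup>2 / 2)) * (\<integral>\<^sup>+\<omega>. ennreal (Z \<omega>) \<partial>M)"
    by (rule subgaussian_givenD[OF sg])
  also have "(\<integral>\<^sup>+\<omega>. ennreal (Z \<omega>) \<partial>M) = ennreal (\<integral>\<omega>. Z \<omega> \<partial>M)"
    using B by (intro nn_integral_eq_integral iZ) auto
  also have "(\<integral>\<^sup>+\<omega>. ennreal (Z \<omega>) * ennreal (exp (r * e \<omega>)) \<partial>M) = (\<integral>\<^sup>+\<omega>. ennreal (Z \<omega> * exp (r * e \<omega>)) \<partial>M)"
    using B by (intro nn_integral_cong_AE, eventually_elim) (auto simp: ennreal_mult)
  also have "\<dots> = ennreal (\<integral>\<omega>. Z \<omega> * exp (r * e \<omega>) \<partial>M)"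
    using B by (intro nn_integral_eq_integral iZe, eventually_elim) auto
  finally have le: "ennreal (\<integral>\<omega>. Z \<omega> * exp (r * e \<omega>) \<partial>M)
      \<le> ennreal (exp (\<sigma>\<^sup>2 * r\<^sup>2 / 2)) * ennreal (\<integral>\<omega>. Z \<omega> \<partial>M)" .
  have "0 \<le> (\<integral>\<omega>. Z \<omega> \<partial>M)" using B by (intro integral_nonneg_AE) auto
  with le show ?thesis by (simp add: ennreal_mult[symmetric])
qed

text \<open>Since \<open>1 + r e \<le> exp (r e)\<close>, the moment bound gives
  \<open>r * I \<le> (exp (\<sigma>\<^sup>2 * r\<^sup>2 / 2) - 1) * A\<close> for a nonnegative
  weight. The right side is quadratic in \<open>r\<close> near \<open>0\<close>, so dividing by
  \<open>r\<close> and letting \<open>r\<close> tend to \<open>0\<close> from either side forces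
  \<open>I = 0\<close>.\<close>

lemma subgaussian_given_mean_zero:
  assumes Z: "Z \<in> borel_measurable F" and B: "AE \<omega> in M. \<bar>Z \<omega>\<bar> \<le> B"
  shows "(\<integral>\<omega>. Z \<omega> * e \<omega> \<partial>M) = 0"
proof -
  have nonneg: "(\<integral>\<omega>. Y \<omega> * e \<omega> \<partial>M) = 0"
    if Y: "Y \<in> borel_measurable F" and C: "AE \<omega> in M. 0 \<le> Y \<omega> \<and> Y \<omega> \<le> C" for Y C
  proof -
    have C': "AE \<omega> in M. \<bar>Y \<omega>\<bar> \<le> C" using C by eventually_elim auto
    define A where "A = (\<integral>\<omega>. Y \<omega> \<partial>M)"
    define I where "I = (\<integral>\<omega>. Y \<omega> * e \<omega> \<partial>M)"
    have iY: "integrable M Y" using subgaussian_given_integrable_mult[OF Y C', of "\<lambda>_. 1"] by simp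
    have A: "A \<ge> 0" unfolding A_def using C by (intro integral_nonneg_AE) auto
    have iYe: "integrable M (\<lambda>\<omega>. Y \<omega> * e \<omega>)"
      by (rule subgaussian_given_integrable_mult[OF Y C' subgaussian_given_integrable])
    have *: "r * I \<le> (exp (\<sigma>\<^sup>2 * r\<^sup>2 / 2) - 1) * A" for r
    proof -
      have "A + r * I = (\<integral>\<omega>. Y \<omega> + r * (Y \<omega> * e \<omega>) \<partial>M)"
        using iY iYe by (simp add: A_def I_def)
      also have "\<dots> \<le> (\<integral>\<omega>. Y \<omega> * exp (r * e \<omega>) \<partial>M)"
      proof (rule integral_mono_AE)
        show "AE \<omega> in M. Y \<omega> + r * (Y \<omega> * e \<omega>) \<le> Y \<omega> * exp (r * e \<omega>)"
          using C
        proof eventually_elim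
          fix \<omega> assume "0 \<le> Y \<omega> \<and> Y \<omega> \<le> C"
          then have "Y \<omega> * (1 + r * e \<omega>) \<le> Y \<omega> * exp (r * e \<omega>)" by (intro mult_left_mono) auto
          then show "Y \<omega> + r * (Y \<omega> * e \<omega>) \<le> Y \<omega> * exp (r * e \<omega>)" by (simp add: algebra_simps)
        qed
        show "integrable M (\<lambda>\<omega>. Y \<omega> * exp (r * e \<omega>))"
          by (rule subgaussian_given_integrable_mult[OF Y C' subgaussian_given_integrable_exp])
      qed (use iY iYe in auto)
      also have "\<dots> \<le> exp (\<sigma>\<^sup>2 * r\<^sup>2 / 2) * A"
        unfolding A_def by (rule subgaussian_given_integral_exp_le[OF Y C])
      finally show ?thesis by (simp add: algebra_simps)
    qed
    have lim: "((\<lambda>r. (exp (\<sigma>\<^sup>2 * r\<^sup>2 / 2) - 1) * A / r) \<longlongrightarrow> 0) (at 0)"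
    proof -
      have "((\<lambda>r. (exp (\<sigma>\<^sup>2 * r\<^sup>2 / 2) - 1) * A) has_real_derivative 0) (at 0)"
        by (auto intro!: derivative_eq_intros)
      then show ?thesis by (simp add: has_field_derivative_iff)
    qed
    have "I \<le> 0"
    proof (rule tendsto_lowerbound)
      show "((\<lambda>r. (exp (\<sigma>\<^sup>2 * r\<^sup>2 / 2) - 1) * A / r) \<longlongrightarrow> 0) (at_right 0)"
        by (rule filterlim_mono[OF lim order_refl]) (simp add: at_le)
      show "eventually (\<lambda>r. I \<le> (exp (\<sigma>\<^sup>2 * r\<^sup>2 / 2) - 1) * A / r) (at_right 0)"
        using * by (auto simp: eventually_at_right_field field_simps intro!: exI[of _ 1])
    qed auto
    moreover have "0 \<le> I"
    proof (rule tendsto_upperbound)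
      show "((\<lambda>r. (exp (\<sigma>\<^sup>2 * r\<^sup>2 / 2) - 1) * A / r) \<longlongrightarrow> 0) (at_left 0)"
        by (rule filterlim_mono[OF lim order_refl]) (simp add: at_le)
      show "eventually (\<lambda>r. (exp (\<sigma>\<^sup>2 * r\<^sup>2 / 2) - 1) * A / r \<le> I) (at_left 0)"
        using * by (auto simp: eventually_at_left_field field_simps intro!: exI[of _ "- 1"])
    qed auto
    ultimately show ?thesis by (simp add: I_def)
  qed
  \<comment> \<open>Adding the bound \<open>B\<close> writes a signed weight as a difference of two
    nonnegative ones.\<close>
  have m: "(\<lambda>\<omega>. Z \<omega> + B) \<in> borel_measurable F" using Z by measurable
  have "AE \<omega> in M. 0 \<le> Z \<omega> + B \<and> Z \<omega> + B \<le> 2 * B" using B by eventually_elim auto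
  from nonneg[OF m this] have "(\<integral>\<omega>. Z \<omega> * e \<omega> + B * e \<omega> \<partial>M) = 0" by (simp add: algebra_simps)
  moreover have "AE \<omega> in M. 0 \<le> B" using B by eventually_elim auto
  then have "(\<integral>\<omega>. B * e \<omega> \<partial>M) = 0" by (intro nonneg[of "\<lambda>_. B" B]) auto
  ultimately show ?thesis
    using subgaussian_given_integrable_mult[OF Z B subgaussian_given_integrable] subgaussian_given_integrable
    by auto
qed

text \<open>Because \<open>2 + x\<^sup>2 \<le> exp x + exp (- x)\<close>, the moment bounds at
  \<open>q\<close> and \<open>- q\<close> give
  \<open>2 + r * S \<le> 2 * exp (\<sigma>\<^sup>2 * r / 2)\<close> with
  \<open>r = q\<^sup>2\<close>; the claim compares slopes at \<open>r = 0\<close>.\<close>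

lemma subgaussian_given_second_moment: "(\<integral>\<omega>. (e \<omega>)\<^sup>2 \<partial>M) \<le> \<sigma>\<^sup>2"
proof -
  have cosh_ge: "2 + x\<^sup>2 \<le> exp x + exp (- x)" for x :: real
  proof -
    \<comment> \<open>The remainder of order four is nonnegative, and the odd terms cancel between
      \<open>x\<close> and \<open>- x\<close>.\<close>
    have "1 + x + x\<^sup>2 / 2 + x ^ 3 / 6 \<le> exp x" for x :: real
    proof -
      obtain t where "exp x = (\<Sum>m<4. x ^ m / fact m) + (exp t / fact 4) * x ^ 4"
        using Maclaurin_exp_le[of x 4] by blast
      moreover have "0 \<le> (exp t / fact 4) * x ^ 4" by simp
      ultimately show ?thesis by (simp add: eval_nat_numeral fact_numeral)
    qed
    from this[of x] this[of "- x"] show ?thesis by simp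
  qed
  define S where "S = (\<integral>\<omega>. (e \<omega>)\<^sup>2 \<partial>M)"
  have *: "S \<le> 2 * (exp (\<sigma>\<^sup>2 * r / 2) - 1) / r" if "r > 0" for r
  proof -
    define q where "q = sqrt r"
    have q2: "q\<^sup>2 = r" using that by (simp add: q_def)
    have "2 + r * S = (\<integral>\<omega>. 2 + (q * e \<omega>)\<^sup>2 \<partial>M)"
      using subgaussian_given_integrable_square by (simp add: S_def power_mult_distrib q2 prob_space)
    also have "\<dots> \<le> (\<integral>\<omega>. exp (q * e \<omega>) + exp (- (q * e \<omega>)) \<partial>M)"
      using subgaussian_given_integrable_square subgaussian_given_integrable_exp[of q]
        subgaussian_given_integrable_exp[of "- q"]
      by (intro integral_mono cosh_ge) (auto simp: power_mult_distrib)
    also have "\<dots> \<le> exp (\<sigma>\<^sup>2 * r / 2) + exp (\<sigma>\<^sup>2 * r / 2)"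
      using subgaussian_given_integral_exp_le[of "\<lambda>_. 1" 1 q]
        subgaussian_given_integral_exp_le[of "\<lambda>_. 1" 1 "- q"]
        subgaussian_given_integrable_exp[of q] subgaussian_given_integrable_exp[of "- q"]
      by (simp add: q2 prob_space)
    finally show ?thesis using that by (simp add: field_simps)
  qed
  have "((\<lambda>r. 2 * (exp (\<sigma>\<^sup>2 * r / 2) - 1)) has_real_derivative \<sigma>\<^sup>2) (at 0)"
    by (auto intro!: derivative_eq_intros)
  then have lim: "((\<lambda>r. 2 * (exp (\<sigma>\<^sup>2 * r / 2) - 1) / r) \<longlongrightarrow> \<sigma>\<^sup>2) (at 0)"
    by (simp add: has_field_derivative_iff)
  show ?thesis unfolding S_def[symmetric]
  proof (rule tendsto_lowerbound)
    show "((\<lambda>r. 2 * (exp (\<sigma>\<^sup>2 * r / 2) - 1) / r) \<longlongrightarrow> \<sigma>\<^sup>2) (at_right 0)"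
      by (rule filterlim_mono[OF lim order_refl]) (simp add: at_le)
    show "eventually (\<lambda>r. S \<le> 2 * (exp (\<sigma>\<^sup>2 * r / 2) - 1) / r) (at_right 0)"
      using * by (auto simp: eventually_at_right_field intro!: exI[of _ 1])
  qed auto
qed

end

end

subsection \<open>The design matrix and the confidence ellipsoid\<close>

definition feat :: "(nat \<Rightarrow> real^'n::finite) \<Rightarrow> (nat \<Rightarrow> real) \<Rightarrow> nat \<Rightarrow> real^('n + 'n)" where
  "feat x p s = stack (x s) (p s *\<^sub>R x s)"

lemma feat_inner: "feat x p s \<bullet> \<theta> = lin_index \<theta> (x s) (p s)"
  by (simp add: feat_def inner_stack)

definition inv_design :: "(nat \<Rightarrow> real^'n::finite) \<Rightarrow> (nat \<Rightarrow> real) \<Rightarrow> nat \<Rightarrow> real^('n + 'n)^('n + 'n)" where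
  "inv_design x p t = matrix_inv (design_matrix 1 x p t)"

text \<open>Uses the design of the preceding rounds, hence the index \<open>t - 1\<close>. Its
  square root is the confidence width in the direction played.\<close>

definition width2 :: "(nat \<Rightarrow> real^'n::finite) \<Rightarrow> (nat \<Rightarrow> real) \<Rightarrow> nat \<Rightarrow> real" where
  "width2 x p t = feat x p t \<bullet> (inv_design x p (t - 1) *v feat x p t)"

lemma design_0: "design_matrix 1 x p 0 = mat 1"
  by (simp add: design_matrix_def)

lemma design_Suc: "design_matrix 1 x p (Suc t) =
    design_matrix 1 x p t + (\<chi> i j. feat x p (Suc t) $ i * feat x p (Suc t) $ j)"
  by (simp add: design_matrix_def feat_def Let_def)

lemma dominates_id_design: "dominates_id (design_matrix 1 x p t)"
proof (induction t)
  case 0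
  then show ?case by (simp add: design_0 dominates_id_def power2_norm_eq_inner matrix_vector_mul_lid)
next
  case (Suc t)
  show ?case unfolding design_Suc by (rule dominates_id_rank_one_update[OF Suc])
qed

lemma design_mult_vec: "v \<bullet> (design_matrix 1 x p t *v v) = (norm v)\<^sup>2 + (\<Sum>s=1..t. (feat x p s \<bullet> v)\<^sup>2)"
proof (induction t)
  case 0
  then show ?case by (simp add: design_0 power2_norm_eq_inner matrix_vector_mul_lid)
next
  case (Suc t)
  then show ?case
    by (simp add: design_Suc matrix_vector_mult_add_rdistrib inner_add_right rank_one_mult_vec
        inner_commute[of v "feat _ _ _"] power2_eq_square)
qed

lemma width2_nonneg: "0 \<le> width2 x p t"
  unfolding width2_def inv_design_def by (rule matrix_inv_quad_nonneg[OF dominates_id_design])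

lemma width2_le: "width2 x p t \<le> (norm (feat x p t))\<^sup>2"
  unfolding width2_def inv_design_def by (rule matrix_inv_quad_le[OF dominates_id_design])

lemma det_design_Suc: "det (design_matrix 1 x p (Suc t)) = det (design_matrix 1 x p t) * (1 + width2 x p (Suc t))"
  unfolding design_Suc width2_def inv_design_def diff_Suc_1 by (rule det_rank_one_update[OF dominates_id_design])

lemma det_design_ge_1: "1 \<le> det (design_matrix 1 x p t)"
proof (induction t)
  case (Suc t)
  have "1 * 1 \<le> det (design_matrix 1 x p t) * (1 + width2 x p (Suc t))"
    using Suc width2_nonneg[of x p "Suc t"] by (intro mult_mono) auto
  then show ?case by (simp add: det_design_Suc)
qed (simp add: design_0)

lemma trace_design: "trace (design_matrix 1 (x :: nat \<Rightarrow> real^'n::finite) p t) =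
    2 * real CARD('n) + (\<Sum>s=1..t. (norm (feat x p s))\<^sup>2)"
proof (induction t)
  case (Suc t)
  have "trace (\<chi> i j. z $ i * z $ j) = (norm z)\<^sup>2" for z :: "real^('n + 'n)"
    by (simp add: trace_def power2_norm_eq_inner inner_vec_def)
  then show ?case using Suc by (simp add: design_Suc trace_add)
qed (simp add: design_0 trace_I)

text \<open>The trace starts at \<open>2 * d\<close> and grows by at most \<open>1\<close> per
  round; the determinant-trace inequality in dimension \<open>2 * d\<close> does the rest.\<close>

lemma ln_det_design_le:
  fixes x :: "nat \<Rightarrow> real^'n::finite"
  assumes "\<And>s. s \<in> {1..t} \<Longrightarrow> norm (feat x p s) \<le> 1" and "t \<le> T"
  shows "ln (det (design_matrix 1 x p t)) \<le>
    2 * real CARD('n) * ln ((2 * real CARD('n) + real T) / (2 * real CARD('n)))"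
proof -
  let ?M = "design_matrix 1 x p t" and ?n = "2 * real CARD('n)"
  have psd: "0 \<le> v \<bullet> (?M *v v)" for v
    by (rule order_trans[OF zero_le_power2 dominates_id_ge[OF dominates_id_design]])
  have "transpose ?M = ?M" using dominates_id_design[of x p t] by (simp add: dominates_id_def)
  moreover have "CARD('n + 'n) = 2 * CARD('n)" by simp
  ultimately have det: "det ?M \<le> (trace ?M / ?n) ^ (2 * CARD('n))"
    using det_le_trace_power[OF _ psd] by (simp only: of_nat_mult of_nat_numeral)
  have "(\<Sum>s=1..t. (norm (feat x p s))\<^sup>2) \<le> (\<Sum>s=1..t. 1)"
    using assms(1) by (intro sum_mono) (simp add: power_le_one)
  then have tr: "trace ?M \<le> ?n + real T" using \<open>t \<le> T\<close> by (simp add: trace_design)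
  have "0 \<le> trace ?M" by (simp add: trace_design sum_nonneg)
  then have "(trace ?M / ?n) ^ (2 * CARD('n)) \<le> ((?n + real T) / ?n) ^ (2 * CARD('n))"
    using tr by (intro power_mono divide_right_mono) auto
  then have "ln (det ?M) \<le> ln (((?n + real T) / ?n) ^ (2 * CARD('n)))"
    using det det_design_ge_1[of x p t] by (intro ln_mono) auto
  also have "\<dots> = ?n * ln ((?n + real T) / ?n)" by (simp add: ln_realpow add_pos_nonneg)
  finally show ?thesis .
qed

text \<open>The elliptical potential argument: round \<open>s\<close> multiplies the determinant by
  \<open>1 + w\<close>, and \<open>w \<le> 2 * ln (1 + w)\<close> for \<open>w\<close> between
  \<open>0\<close> and \<open>1\<close>, where features of norm at most \<open>1\<close> keep it.
  The logarithms telescope.\<close>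

lemma sum_width2_le:
  assumes "\<And>s. s \<in> {1..t} \<Longrightarrow> norm (feat x p s) \<le> 1"
  shows "(\<Sum>s=1..t. width2 x p s) \<le> 2 * ln (det (design_matrix 1 x p t))"
  using assms
proof (induction t)
  case (Suc t)
  define w where "w = width2 x p (Suc t)"
  have w0: "0 \<le> w" unfolding w_def by (rule width2_nonneg)
  have "w \<le> (norm (feat x p (Suc t)))\<^sup>2" unfolding w_def by (rule width2_le)
  also have "\<dots> \<le> 1" using Suc.prems by (simp add: power_le_one)
  finally have w1: "w \<le> 1" .
  have "w * (1 + w) \<le> 2 * w" using w0 w1 by (simp add: algebra_simps mult_left_le)
  then have "w / 2 \<le> w / (1 + w)" using w0 by (simp add: field_simps)
  also have "\<dots> = 1 - 1 / (1 + w)" using w0 by (simp add: field_simps)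
  also have "\<dots> \<le> ln (1 + w)"
    using ln_le_minus_one[of "1 / (1 + w)"] w0 by (simp add: ln_div)
  finally have "w \<le> 2 * ln (1 + w)" by simp
  moreover have "ln (det (design_matrix 1 x p (Suc t))) = ln (det (design_matrix 1 x p t)) + ln (1 + w)"
    unfolding det_design_Suc w_def[symmetric]
    using det_design_ge_1[of x p t] w0 by (intro ln_mult_pos) auto
  ultimately show ?case using Suc by (simp add: w_def)
qed (simp add: design_0)

section \<open>First-order condition of the estimator and the confidence ellipsoid\<close>

lemma log_lik_has_real_derivative_line:
  assumes "continuous_on UNIV g"
  shows "((\<lambda>s. log_lik g z y (\<theta> + s *\<^sub>R \<Delta>)) has_real_derivative (y - g (z \<bullet> \<theta>)) * (z \<bullet> \<Delta>)) (at 0)"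
proof -
  have "(log_lik g z y has_derivative (\<lambda>h. h \<bullet> ((y - g (z \<bullet> \<theta>)) *\<^sub>R z))) (at (\<theta> + 0 *\<^sub>R \<Delta>))"
    using log_lik_gradient[OF assms, of z y \<theta>] by (simp add: gderiv_def)
  moreover have "((\<lambda>s. \<theta> + s *\<^sub>R \<Delta>) has_derivative (\<lambda>s. s *\<^sub>R \<Delta>)) (at 0)"
    by (auto intro!: derivative_eq_intros)
  ultimately have "((\<lambda>s. log_lik g z y (\<theta> + s *\<^sub>R \<Delta>)) has_derivative
      (\<lambda>h. (h *\<^sub>R \<Delta>) \<bullet> ((y - g (z \<bullet> \<theta>)) *\<^sub>R z))) (at 0)"
    by (rule has_derivative_compose[rotated])
  then show ?thesis
    unfolding has_field_derivative_def
    by (rule has_derivative_eq_rhs) (simp add: fun_eq_iff inner_commute mult_ac)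
qed

text \<open>Along the segment from the maximizer to \<open>\<theta>\<close>, which stays in the
  ball, the objective cannot start with a positive derivative. This variational form covers a
  maximizer on the boundary of the ball, where the gradient need not vanish.\<close>

lemma mle_first_order:
  fixes \<theta>hat :: "real^('n::finite + 'n)"
  assumes g: "continuous_on UNIV g"
    and am: "is_arg_max (mle_objective g glow 1 x D p t) (\<lambda>\<theta>. norm \<theta> \<le> \<theta>bar) \<theta>hat"
    and \<theta>: "norm \<theta> \<le> \<theta>bar"
  shows "(\<Sum>s=1..t. (D s - g (feat x p s \<bullet> \<theta>hat)) * (feat x p s \<bullet> (\<theta> - \<theta>hat)))
    \<le> glow * (\<theta>hat \<bullet> (\<theta> - \<theta>hat))"
proof (rule ccontr)
  define \<Delta> where "\<Delta> = \<theta> - \<theta>hat"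
  define h where "h s = mle_objective g glow 1 x D p t (\<theta>hat + s *\<^sub>R \<Delta>)" for s
  define l where "l = - glow * (\<theta>hat \<bullet> \<Delta>) + (\<Sum>s=1..t. (D s - g (feat x p s \<bullet> \<theta>hat)) * (feat x p s \<bullet> \<Delta>))"
  assume "\<not> ?thesis"
  then have l: "l > 0" by (simp add: l_def \<Delta>_def)
  have norm2: "((\<lambda>s. (norm (\<theta>hat + s *\<^sub>R \<Delta>))\<^sup>2) has_real_derivative 2 * (\<theta>hat \<bullet> \<Delta>)) (at 0)"
    unfolding power2_norm_eq_inner has_field_derivative_def
    by (auto intro!: derivative_eq_intros simp: inner_commute fun_eq_iff algebra_simps)
  have "(h has_real_derivative - (1 * glow / 2) * (2 * (\<theta>hat \<bullet> \<Delta>)) +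
      (\<Sum>s=1..t. (D s - g (feat x p s \<bullet> \<theta>hat)) * (feat x p s \<bullet> \<Delta>))) (at 0)"
    unfolding h_def mle_objective_def feat_def[symmetric]
    by (intro DERIV_add DERIV_cmult norm2 DERIV_sum log_lik_has_real_derivative_line g)
  then have "(h has_real_derivative l) (at 0)" by (simp add: l_def)
  from DERIV_pos_inc_right[OF this l] obtain d where d: "d > 0" "\<And>s. s > 0 \<Longrightarrow> s < d \<Longrightarrow> h 0 < h (0 + s)" by blast
  define s where "s = min 1 (d / 2)"
  have s: "0 < s" "s < d" "s \<le> 1" using d by (auto simp: s_def)
  have nh: "norm \<theta>hat \<le> \<theta>bar" using am by (simp add: is_arg_max_def)
  have "\<theta>hat + s *\<^sub>R \<Delta> = (1 - s) *\<^sub>R \<theta>hat + s *\<^sub>R \<theta>" by (simp add: \<Delta>_def algebra_simps)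
  also have "norm \<dots> \<le> (1 - s) * norm \<theta>hat + s * norm \<theta>"
    using s by (intro norm_triangle_le) auto
  also have "\<dots> \<le> (1 - s) * \<theta>bar + s * \<theta>bar" using s nh \<theta> by (intro add_mono mult_left_mono) auto
  finally have "norm (\<theta>hat + s *\<^sub>R \<Delta>) \<le> \<theta>bar" by (simp add: algebra_simps)
  then have "\<not> h s > h 0" using am by (simp add: is_arg_max_def h_def)
  then show False using d(2)[OF s(1,2)] unfolding add_0 by blast
qed

text \<open>With \<open>\<Delta>\<close> the error and \<open>G\<close> its squared design norm, the
  first-order condition and the lower slope bound give \<open>glow * G \<le> glow * (\<theta>
  \<bullet> \<Delta>) - S \<bullet> \<Delta>\<close>. Both terms on the right are at most multiples
  of \<open>sqrt G\<close>: the first because \<open>norm \<Delta> \<le> sqrt G\<close>, the second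
  by duality of the norms. Dividing by \<open>sqrt G\<close> leaves the radius.\<close>

lemma confidence_ellipsoid:
  fixes \<theta>hat :: "real^('n::finite + 'n)" and x p t e
  defines "S \<equiv> (\<Sum>s=1..t. e s *\<^sub>R feat x p s)"
  assumes g: "continuous_on UNIV g" and glow: "glow > 0"
    and am: "is_arg_max (mle_objective g glow 1 x D p t) (\<lambda>\<theta>. norm \<theta> \<le> \<theta>bar) \<theta>hat"
    and \<theta>: "norm \<theta> \<le> \<theta>bar"
    and D: "\<And>s. s \<in> {1..t} \<Longrightarrow> D s = g (feat x p s \<bullet> \<theta>) + e s"
    and slope: "\<And>s u v. s \<in> {1..t} \<Longrightarrow> \<bar>u\<bar> \<le> norm (feat x p s) * \<theta>bar \<Longrightarrow> \<bar>v\<bar> \<le> norm (feat x p s) * \<theta>bar \<Longrightarrow>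
        glow * (u - v)\<^sup>2 \<le> (g u - g v) * (u - v)"
  shows "sqrt ((\<theta> - \<theta>hat) \<bullet> (design_matrix 1 x p t *v (\<theta> - \<theta>hat))) \<le>
     \<theta>bar + sqrt (S \<bullet> (inv_design x p t *v S)) / glow"
proof -
  define \<Delta> where "\<Delta> = \<theta> - \<theta>hat"
  define G where "G = \<Delta> \<bullet> (design_matrix 1 x p t *v \<Delta>)"
  have nh: "norm \<theta>hat \<le> \<theta>bar" using am by (simp add: is_arg_max_def)
  have zb: "\<bar>z \<bullet> \<theta>'\<bar> \<le> norm z * \<theta>bar" if "norm \<theta>' \<le> \<theta>bar" for z \<theta>' :: "real^('n + 'n)"
    by (rule order_trans[OF Cauchy_Schwarz_ineq2]) (use that in \<open>simp add: mult_left_mono\<close>)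
  have SD: "S \<bullet> \<Delta> = (\<Sum>s=1..t. e s * (feat x p s \<bullet> \<Delta>))" by (simp add: S_def inner_sum_left)
  have "(\<Sum>s=1..t. glow * (feat x p s \<bullet> \<Delta>)\<^sup>2 + e s * (feat x p s \<bullet> \<Delta>))
    \<le> (\<Sum>s=1..t. (D s - g (feat x p s \<bullet> \<theta>hat)) * (feat x p s \<bullet> \<Delta>))"
  proof (rule sum_mono)
    fix s assume s: "s \<in> {1..t}"
    have "glow * (feat x p s \<bullet> \<theta> - feat x p s \<bullet> \<theta>hat)\<^sup>2 \<le>
      (g (feat x p s \<bullet> \<theta>) - g (feat x p s \<bullet> \<theta>hat)) * (feat x p s \<bullet> \<theta> - feat x p s \<bullet> \<theta>hat)"
      by (rule slope[OF s zb[OF \<theta>] zb[OF nh]])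
    then show "glow * (feat x p s \<bullet> \<Delta>)\<^sup>2 + e s * (feat x p s \<bullet> \<Delta>) \<le>
      (D s - g (feat x p s \<bullet> \<theta>hat)) * (feat x p s \<bullet> \<Delta>)"
      by (simp add: D[OF s] \<Delta>_def inner_diff_right algebra_simps)
  qed
  also have "\<dots> \<le> glow * (\<theta>hat \<bullet> \<Delta>)" unfolding \<Delta>_def by (rule mle_first_order[OF g am \<theta>])
  \<comment> \<open>The regularizer supplies the term that matches the identity part of the design
    matrix.\<close>
  also have "\<dots> = glow * (\<theta> \<bullet> \<Delta>) - glow * (norm \<Delta>)\<^sup>2"
    by (simp add: \<Delta>_def power2_norm_eq_inner inner_diff_left inner_diff_right inner_commute algebra_simps)
  finally have "glow * G \<le> glow * (\<theta> \<bullet> \<Delta>) - S \<bullet> \<Delta>"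
    by (simp add: G_def design_mult_vec sum.distrib SD sum_distrib_left algebra_simps)
  moreover have G0: "(norm \<Delta>)\<^sup>2 \<le> G" unfolding G_def by (rule dominates_id_ge[OF dominates_id_design])
  have "\<theta> \<bullet> \<Delta> \<le> \<theta>bar * sqrt G"
  proof -
    have "\<theta> \<bullet> \<Delta> \<le> norm \<theta> * norm \<Delta>" by (rule norm_cauchy_schwarz)
    also have "norm \<Delta> \<le> sqrt G" using G0 by (rule real_le_rsqrt)
    then have "norm \<theta> * norm \<Delta> \<le> \<theta>bar * sqrt G" using \<theta> by (intro mult_mono) (simp_all add: order_trans[OF norm_ge_zero])
    finally show ?thesis .
  qed
  moreover have "- (S \<bullet> \<Delta>) \<le> sqrt (S \<bullet> (inv_design x p t *v S)) * sqrt G"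
  proof -
    have "(S \<bullet> \<Delta>)\<^sup>2 \<le> (S \<bullet> (inv_design x p t *v S)) * G"
      unfolding G_def inv_design_def by (rule inner_le_dual_quad[OF dominates_id_design])
    then have "sqrt ((S \<bullet> \<Delta>)\<^sup>2) \<le> sqrt ((S \<bullet> (inv_design x p t *v S)) * G)" by (rule real_sqrt_le_mono)
    then show ?thesis by (simp add: real_sqrt_mult)
  qed
  ultimately have "glow * G \<le> glow * (\<theta>bar * sqrt G) + sqrt (S \<bullet> (inv_design x p t *v S)) * sqrt G"
    using glow by (smt (verit) mult_left_mono)
  moreover have "0 \<le> G" using G0 by (rule order_trans[OF zero_le_power2])
  ultimately have "sqrt G * (glow * sqrt G) \<le> sqrt G * (glow * \<theta>bar + sqrt (S \<bullet> (inv_design x p t *v S)))"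
    by (simp add: algebra_simps)
  then have "glow * sqrt G \<le> glow * \<theta>bar + sqrt (S \<bullet> (inv_design x p t *v S)) \<or> sqrt G = 0"
    using \<open>0 \<le> G\<close> by (cases "sqrt G = 0") (auto simp: mult_le_cancel_left)
  moreover have "0 \<le> glow * \<theta>bar + sqrt (S \<bullet> (inv_design x p t *v S))"
    using glow order_trans[OF norm_ge_zero \<theta>] matrix_inv_quad_nonneg[OF dominates_id_design, of S]
    by (intro add_nonneg_nonneg mult_nonneg_nonneg) (simp_all add: inv_design_def)
  ultimately have "glow * sqrt G \<le> glow * \<theta>bar + sqrt (S \<bullet> (inv_design x p t *v S))" by auto
  then show ?thesis using glow by (simp add: G_def \<Delta>_def field_simps)
qed

subsection \<open>Inventory and dual variable along one path\<close>

definition active :: "real \<Rightarrow> (nat \<Rightarrow> real) \<Rightarrow> nat \<Rightarrow> real" where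
  "active C D t = (if stock C D t > 0 then 1 else 0)"

text \<open>The demand left unserved in the round that exhausts the stock; while the season is open
  it is the whole difference between demand and sale.\<close>

definition overshoot :: "real \<Rightarrow> (nat \<Rightarrow> real) \<Rightarrow> nat \<Rightarrow> real" where
  "overshoot C D t = active C D t * max 0 (D t - stock C D t)"

lemma active_01: "active C D t = 0 \<or> active C D t = 1"
  by (simp add: active_def)

lemma active_nonneg [simp]: "0 \<le> active C D t" and active_le_1 [simp]: "active C D t \<le> 1"
  by (simp_all add: active_def)

lemma stock_nonneg: "0 \<le> C \<Longrightarrow> 0 \<le> stock C D t"
  by (induction t) (auto simp: sale_def)

lemma stock_Suc_eq: "0 \<le> C \<Longrightarrow> t \<ge> 1 \<Longrightarrow>
    stock C D (Suc t) = stock C D t - active C D t * D t + overshoot C D t"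
  by (auto simp: sale_def active_def overshoot_def min_def max_def)

lemma active_Suc_le: "t \<ge> 1 \<Longrightarrow> active C D (Suc t) \<le> active C D t"
  by (auto simp: active_def sale_def)

lemma active_prefix:
  assumes "active C D t = 1" "1 \<le> s" "s \<le> t"
  shows "active C D s = 1"
  using assms(3,1)
proof (induction t rule: dec_induct)
  case (step n)
  then have "active C D (Suc n) \<le> active C D n" using assms(2) by (intro active_Suc_le) auto
  then have "active C D n = 1" using step active_01[of C D n] by auto
  then show ?case by (rule step.IH)
qed

lemma stock_eq_sum: "0 \<le> C \<Longrightarrow>
    stock C D (Suc T) = C - (\<Sum>t=1..T. active C D t * D t) + (\<Sum>t=1..T. overshoot C D t)"
  by (induction T) (simp_all add: stock_Suc_eq del: stock.simps(2), simp)

lemma overshoot_nonneg: "0 \<le> overshoot C D t"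
  by (simp add: overshoot_def)

text \<open>The season ends in the first period with an overshoot, so at most one of them is positive.\<close>

lemma sum_overshoot_le:
  assumes "0 \<le> C" "0 \<le> B" "\<And>t. t \<in> {1..T} \<Longrightarrow> active C D t = 1 \<Longrightarrow> D t \<le> B"
  shows "(\<Sum>t=1..T. overshoot C D t) \<le> B \<and> (stock C D (Suc T) > 0 \<longrightarrow> (\<Sum>t=1..T. overshoot C D t) = 0)"
  using assms(3)
proof (induction T)
  case (Suc T)
  have IH: "(\<Sum>t=1..T. overshoot C D t) \<le> B" "stock C D (Suc T) > 0 \<Longrightarrow> (\<Sum>t=1..T. overshoot C D t) = 0"
    using Suc by auto
  show ?case
  proof (cases "stock C D (Suc T) > 0")
    case True
    have "D (Suc T) \<le> B" using True by (intro Suc.prems) (auto simp: active_def)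
    then have "overshoot C D (Suc T) \<le> B" using assms(2) True by (simp add: overshoot_def active_def del: stock.simps)
    moreover have "overshoot C D (Suc T) = 0" if "stock C D (Suc (Suc T)) > 0"
      using that True stock.simps(2)[of C D "Suc T"]
      by (auto simp: overshoot_def sale_def active_def min_def max_def simp del: stock.simps split: if_splits)
    ultimately show ?thesis using IH(2)[OF True] by (simp del: stock.simps)
  next
    case False
    then have "overshoot C D (Suc T) = 0" by (simp add: overshoot_def active_def del: stock.simps)
    moreover have "\<not> stock C D (Suc (Suc T)) > 0"
      using False stock.simps(2)[of C D "Suc T"] by (auto simp: sale_def simp del: stock.simps)
    ultimately show ?thesis using IH(1) by (simp del: stock.simps)
  qed
qed (use assms in simp)

lemma revenue_le_sum_active:
  assumes "\<And>t. t \<in> {1..T} \<Longrightarrow> active C D t = 1 \<Longrightarrow> 0 \<le> q t"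
  shows "revenue C T q D \<le> (\<Sum>t=1..T. active C D t * (q t * D t))"
  unfolding revenue_def
  using assms by (intro sum_mono) (auto simp: active_def sale_def intro!: mult_left_mono)

lemma revenue_ge_sum_active:
  assumes q: "\<And>t. t \<in> {1..T} \<Longrightarrow> active C D t = 1 \<Longrightarrow> 0 \<le> q t \<and> q t \<le> pbar"
  shows "(\<Sum>t=1..T. active C D t * (q t * D t)) - pbar * (\<Sum>t=1..T. overshoot C D t) \<le> revenue C T q D"
proof -
  have "active C D t * (q t * D t) - pbar * overshoot C D t \<le> q t * sale (stock C D t) (D t)" if "t \<in> {1..T}" for t
  proof (cases "stock C D t > 0")
    case True
    then have a: "active C D t = 1" by (simp add: active_def)
    have "q t * max 0 (D t - stock C D t) \<le> pbar * max 0 (D t - stock C D t)"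
      using q[OF that a] by (intro mult_right_mono) auto
    then show ?thesis using True by (simp add: a overshoot_def sale_def min_def max_def algebra_simps split: if_splits)
  qed (simp add: active_def overshoot_def sale_def)
  then have "(\<Sum>t=1..T. active C D t * (q t * D t) - pbar * overshoot C D t) \<le> revenue C T q D"
    unfolding revenue_def by (rule sum_mono)
  then show ?thesis by (simp add: sum_subtractf sum_distrib_left)
qed

lemma dual_range: "0 \<le> pbar \<Longrightarrow> dual h c pbar D t \<in> {0..pbar}"
  by (cases t) (auto simp: closest_point_in_set[of "{0..pbar}"] simp del: atLeastAtMost_iff, auto)

text \<open>Projection onto the interval is nonexpansive and fixes \<open>u\<close>; what remains is
  the expansion of a square.\<close>

lemma dual_step:
  fixes D :: "nat \<Rightarrow> real" and c h :: real
  assumes "0 \<le> pbar" "u \<in> {0..pbar}" "t \<ge> 1"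
  defines "\<mu> \<equiv> dual h c pbar D"
  shows "2 * h * ((u - \<mu> t) * (D t - c)) \<le> (\<mu> t - u)\<^sup>2 - (\<mu> (Suc t) - u)\<^sup>2 + h\<^sup>2 * (D t - c)\<^sup>2"
proof -
  have "dist (closest_point {0..pbar} (\<mu> t + h * (D t - c))) (closest_point {0..pbar} u)
      \<le> dist (\<mu> t + h * (D t - c)) u"
    using assms by (intro closest_point_lipschitz) auto
  moreover have "closest_point {0..pbar} u = u" using assms by (intro closest_point_self)
  moreover have "\<mu> (Suc t) = closest_point {0..pbar} (\<mu> t + h * (D t - c))" using assms by (simp add: \<mu>_def)
  ultimately have "\<bar>\<mu> (Suc t) - u\<bar> \<le> \<bar>\<mu> t + h * (D t - c) - u\<bar>" by (simp add: dist_real_def)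
  then have "(\<mu> (Suc t) - u)\<^sup>2 \<le> (\<mu> t + h * (D t - c) - u)\<^sup>2" by (rule abs_le_square_iff[THEN iffD1])
  then show ?thesis by (simp add: power2_eq_square algebra_simps)
qed

text \<open>The weights \<open>active\<close> are nonincreasing, so each drop only subtracts a
  nonnegative term from the telescoping sum.\<close>

lemma sum_active_telescope:
  assumes "\<And>t. 0 \<le> a t"
  shows "(\<Sum>t=1..T. active C D t * (a t - a (Suc t))) \<le> a 1 - active C D (Suc T) * a (Suc T)"
proof (induction T)
  case (Suc T)
  have "active C D (Suc (Suc T)) * a (Suc (Suc T)) \<le> active C D (Suc T) * a (Suc (Suc T))"
    using assms by (intro mult_right_mono active_Suc_le) auto
  then show ?case using Suc by (simp add: algebra_simps)
qed (use assms in \<open>simp add: mult_left_le_one_le\<close>)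

text \<open>Online gradient descent against the comparator \<open>pbar\<close> if the inventory runs out and \<open>0\<close> otherwise.\<close>

lemma dual_regret:
  fixes D :: "nat \<Rightarrow> real" and T :: nat
  assumes p: "0 \<le> pbar" and c: "0 < c" and T: "T \<ge> 1" and Sq: "0 < Sq"
  defines "\<mu> \<equiv> dual (pbar / Sq) c pbar D" and "C \<equiv> c * real T"
  shows "pbar * c * (real T - (\<Sum>t=1..T. active C D t)) - pbar * Sq / 2
      - pbar / (2 * Sq) * (\<Sum>t=1..T. active C D t * (D t - c)\<^sup>2)
     \<le> (\<Sum>t=1..T. active C D t * (\<mu> t * (D t - c)))"
proof -
  have C: "C > 0" using c T by (simp add: C_def)
  define u where "u = (if stock C D (Suc T) > 0 then 0 else pbar)"
  have u: "u \<in> {0..pbar}" using p by (simp add: u_def)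
  let ?R = "active C D"
  have \<mu>r: "\<mu> t \<in> {0..pbar}" for t unfolding \<mu>_def by (rule dual_range[OF p])
  \<comment> \<open>If stock remains, every round was active and both sides vanish. Otherwise the
    active rounds demanded at least \<open>c * T\<close>, that is, \<open>c\<close> more than their
    share for every round lost.\<close>
  have comp: "pbar * c * (real T - (\<Sum>t=1..T. ?R t)) \<le> (\<Sum>t=1..T. ?R t * (u * (D t - c)))"
  proof (cases "stock C D (Suc T) > 0")
    case True
    then have "?R (Suc T) = 1" by (simp add: active_def del: stock.simps)
    from active_prefix[OF this] have "?R t = 1" if "t \<in> {1..T}" for t using that by auto
    then show ?thesis using True by (simp add: u_def del: stock.simps)
  next
    case False
    have "stock C D (Suc T) = 0" using stock_nonneg[of C D "Suc T"] C False by (simp del: stock.simps)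
    then have "C \<le> (\<Sum>t=1..T. ?R t * D t)"
      using stock_eq_sum[of C D T] C sum_nonneg[of "{1..T}" "overshoot C D"] overshoot_nonneg[of C D]
      by (simp del: stock.simps)
    then have "pbar * (c * real T) \<le> pbar * (\<Sum>t=1..T. ?R t * D t)" using p by (intro mult_left_mono) (auto simp: C_def)
    then show ?thesis using False
      by (simp add: u_def algebra_simps sum_subtractf sum_distrib_left del: stock.simps)
  qed
  have main: "(\<Sum>t=1..T. ?R t * ((u - \<mu> t) * (D t - c))) \<le>
     pbar * Sq / 2 + pbar / (2 * Sq) * (\<Sum>t=1..T. ?R t * (D t - c)\<^sup>2)"
  proof (cases "pbar = 0")
    \<comment> \<open>With \<open>pbar = 0\<close> the step size vanishes and cannot be divided by;
      all multipliers are then \<open>0\<close>.\<close>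
    case True
    then have "u = 0" "\<And>t. \<mu> t = 0" using u \<mu>r by auto
    then show ?thesis using True by simp
  next
    case False
    then have p0: "pbar > 0" using p by simp
    define h where "h = pbar / Sq"
    have h0: "h > 0" using p0 Sq by (simp add: h_def)
    have "2 * h * (\<Sum>t=1..T. ?R t * ((u - \<mu> t) * (D t - c)))
        = (\<Sum>t=1..T. ?R t * (2 * h * ((u - \<mu> t) * (D t - c))))"
      unfolding sum_distrib_left by (intro sum.cong refl) (simp add: algebra_simps)
    also have "\<dots> \<le> (\<Sum>t=1..T. ?R t * ((\<mu> t - u)\<^sup>2 - (\<mu> (Suc t) - u)\<^sup>2 + h\<^sup>2 * (D t - c)\<^sup>2))"
      unfolding \<mu>_def h_def using u p by (intro sum_mono mult_left_mono dual_step) auto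
    also have "\<dots> = (\<Sum>t=1..T. ?R t * ((\<mu> t - u)\<^sup>2 - (\<mu> (Suc t) - u)\<^sup>2))
        + h\<^sup>2 * (\<Sum>t=1..T. ?R t * (D t - c)\<^sup>2)"
      by (simp add: distrib_left sum.distrib sum_distrib_left mult_ac)
    also have "(\<Sum>t=1..T. ?R t * ((\<mu> t - u)\<^sup>2 - (\<mu> (Suc t) - u)\<^sup>2)) \<le> (\<mu> 1 - u)\<^sup>2 - ?R (Suc T) * (\<mu> (Suc T) - u)\<^sup>2"
      by (rule sum_active_telescope) simp
    also have "\<dots> \<le> (\<mu> 1 - u)\<^sup>2" by simp
    also have "\<dots> \<le> pbar\<^sup>2"
      using u \<mu>r[of 1] p by (intro abs_le_square_iff[THEN iffD1]) auto
    finally have "(\<Sum>t=1..T. ?R t * ((u - \<mu> t) * (D t - c))) \<le>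
        (pbar\<^sup>2 + h\<^sup>2 * (\<Sum>t=1..T. ?R t * (D t - c)\<^sup>2)) / (2 * h)"
      using h0 by (simp add: field_simps)
    also have "\<dots> = pbar * Sq / 2 + pbar / (2 * Sq) * (\<Sum>t=1..T. ?R t * (D t - c)\<^sup>2)"
    proof -
      have "(pbar\<^sup>2 + (pbar / Sq)\<^sup>2 * y) / (2 * (pbar / Sq)) = pbar * Sq / 2 + pbar / (2 * Sq) * y" for y
        using p0 Sq by (simp add: field_simps power2_eq_square)
      then show ?thesis unfolding h_def .
    qed
    finally show ?thesis .
  qed
  have "(\<Sum>t=1..T. ?R t * (u * (D t - c))) - (\<Sum>t=1..T. ?R t * (\<mu> t * (D t - c))) =
     (\<Sum>t=1..T. ?R t * ((u - \<mu> t) * (D t - c)))"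
    by (simp add: sum_subtractf[symmetric] algebra_simps)
  then show ?thesis using comp main by linarith
qed

subsection \<open>One round of Thompson sampling\<close>

text \<open>Parametrizes the prices admissible under the dual variable by the fixed interval
  \<open>[0, 1]\<close>, so that \<open>best\<close> is a supremum over an index set that does not
  vary with \<open>\<mu>\<close>.\<close>

definition price_at :: "real \<Rightarrow> real \<Rightarrow> real \<Rightarrow> real \<Rightarrow> real" where
  "price_at plo pbar \<mu> s = max \<mu> plo + s * (pbar - max \<mu> plo)"

definition best :: "real \<Rightarrow> real \<Rightarrow> real \<Rightarrow> (real \<Rightarrow> real) \<Rightarrow> real" where
  "best plo pbar \<mu> F = (SUP s\<in>{0..1}. F (price_at plo pbar \<mu> s))"

lemma price_at_image: "max \<mu> plo \<le> pbar \<Longrightarrow> price_at plo pbar \<mu> ` {0..1} = {max \<mu> plo..pbar}"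
proof
  assume a: "max \<mu> plo \<le> pbar"
  show "price_at plo pbar \<mu> ` {0..1} \<subseteq> {max \<mu> plo..pbar}"
  proof
    fix q assume "q \<in> price_at plo pbar \<mu> ` {0..1}"
    then obtain s where s: "0 \<le> s" "s \<le> 1" "q = price_at plo pbar \<mu> s" by auto
    have "0 \<le> s * (pbar - max \<mu> plo)" using s a by (intro mult_nonneg_nonneg) auto
    moreover have "s * (pbar - max \<mu> plo) \<le> 1 * (pbar - max \<mu> plo)"
      using s a by (intro mult_right_mono) auto
    ultimately show "q \<in> {max \<mu> plo..pbar}" by (simp add: s(3) price_at_def)
  qed
  show "{max \<mu> plo..pbar} \<subseteq> price_at plo pbar \<mu> ` {0..1}"
  proof
    fix q assume q: "q \<in> {max \<mu> plo..pbar}"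
    show "q \<in> price_at plo pbar \<mu> ` {0..1}"
    proof (cases "max \<mu> plo = pbar")
      case True
      then have "q = price_at plo pbar \<mu> 0" using q by (simp add: price_at_def)
      then show ?thesis by auto
    next
      case False
      define s where "s = (q - max \<mu> plo) / (pbar - max \<mu> plo)"
      have "s * (pbar - max \<mu> plo) = q - max \<mu> plo" using False by (simp add: s_def)
      then have "q = price_at plo pbar \<mu> s" by (simp add: price_at_def)
      moreover have "s \<in> {0..1}" using False a q by (auto simp: s_def divide_le_eq_1)
      ultimately show ?thesis by blast
    qed
  qed
qed

lemma best_attained:
  assumes "max \<mu> plo \<le> pbar" "continuous_on UNIV F"
  obtains q where "q \<in> {max \<mu> plo..pbar}" "best plo pbar \<mu> F = F q"
    "\<And>q'. q' \<in> {max \<mu> plo..pbar} \<Longrightarrow> F q' \<le> best plo pbar \<mu> F"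
proof -
  have "compact {max \<mu> plo..pbar}" "{max \<mu> plo..pbar} \<noteq> {}" using assms by auto
  then obtain q where q: "q \<in> {max \<mu> plo..pbar}" "\<And>q'. q' \<in> {max \<mu> plo..pbar} \<Longrightarrow> F q' \<le> F q"
    using continuous_attains_sup[of "{max \<mu> plo..pbar}" F] continuous_on_subset[OF assms(2)] by blast
  have "best plo pbar \<mu> F = Sup (F ` {max \<mu> plo..pbar})"
    unfolding best_def price_at_image[OF assms(1), symmetric] by (simp add: image_comp)
  also have "\<dots> = F q" using q by (intro cSup_eq_maximum) auto
  finally show ?thesis using q that by auto
qed

lemma continuous_on_price_at: "continuous_on S (\<lambda>s. price_at plo pbar \<mu> s)"
  unfolding price_at_def by (intro continuous_intros)

lemma borel_measurable_best:
  assumes F: "\<And>s. s \<in> {0..1} \<Longrightarrow> (\<lambda>\<omega>. F \<omega> (price_at plo pbar (\<mu> \<omega>) s)) \<in> borel_measurable M"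
    and cont: "\<And>\<omega>. \<omega> \<in> space M \<Longrightarrow> continuous_on UNIV (F \<omega>)"
  shows "(\<lambda>\<omega>. best plo pbar (\<mu> \<omega>) (F \<omega>)) \<in> borel_measurable M"
  unfolding best_def
  by (intro borel_measurable_SUP_interval F continuous_on_compose2[OF cont continuous_on_price_at]) auto

text \<open>One round with all random quantities frozen: \<open>centre\<close> and
  \<open>truth\<close> are indices as functions of the price, and \<open>w\<close> is a squared
  width. The truth lies within \<open>\<gamma> / 2\<close> widths of the centre, truncated samples
  within \<open>\<gamma> * \<rho>\<close> widths, and the slope of \<open>g\<close> is controlled
  only in this larger band.\<close>

locale ts_round =
  fixes g :: "real \<Rightarrow> real" and plo pbar \<mu> \<gamma> \<rho> gbar :: real and centre truth w :: "real \<Rightarrow> real"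
  assumes g: "strict_mono g" "continuous_on UNIV g"
    and \<mu>: "0 \<le> \<mu>" "\<mu> \<le> pbar" "plo \<le> pbar" and \<gamma>: "0 \<le> \<gamma>" and \<rho>: "1/2 \<le> \<rho>"
    and cont: "continuous_on UNIV centre" "continuous_on UNIV truth" "continuous_on UNIV w"
    and w0: "\<And>q. 0 \<le> w q"
    and lip: "\<And>q u v. q \<in> {max \<mu> plo..pbar} \<Longrightarrow> \<bar>u - centre q\<bar> \<le> \<gamma> * \<rho> * sqrt (w q) \<Longrightarrow>
       \<bar>v - centre q\<bar> \<le> \<gamma> * \<rho> * sqrt (w q) \<Longrightarrow> \<bar>g u - g v\<bar> \<le> gbar * \<bar>u - v\<bar>" and gbar: "0 \<le> gbar"
    and good: "\<And>q. q \<in> {max \<mu> plo..pbar} \<Longrightarrow> \<bar>truth q - centre q\<bar> \<le> \<gamma> / 2 * sqrt (w q)"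
begin

definition val :: "(real \<Rightarrow> real) \<Rightarrow> real \<Rightarrow> real" where "val c q = (q - \<mu>) * g (c q)"

text \<open>A lower bound for the index of every sample with noise of norm at most \<open>\<rho>\<close>, hence a reference
  value that does not depend on the sample.\<close>

definition low :: "real \<Rightarrow> real" where "low q = centre q - \<gamma> * \<rho> * sqrt (w q)"

lemma I: "max \<mu> plo \<le> pbar" using \<mu> by simp

lemma cont_val: "continuous_on UNIV c \<Longrightarrow> continuous_on UNIV (val c)"
  unfolding val_def by (intro continuous_intros continuous_on_compose2[OF g(2)]) auto

lemma cont_low: "continuous_on UNIV low"
  unfolding low_def using cont by (intro continuous_intros)

lemma val_mono: "q \<in> {max \<mu> plo..pbar} \<Longrightarrow> c q \<le> c' q \<Longrightarrow> val c q \<le> val c' q"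
  unfolding val_def using g(1) by (intro mult_left_mono) (auto simp: strict_mono_less_eq)

lemma val_diff:
  assumes "q \<in> {max \<mu> plo..pbar}" "\<bar>c q - centre q\<bar> \<le> \<gamma> * \<rho> * sqrt (w q)"
    "\<bar>c' q - centre q\<bar> \<le> \<gamma> * \<rho> * sqrt (w q)" "\<bar>c q - c' q\<bar> \<le> B"
  shows "val c q - val c' q \<le> pbar * gbar * B"
proof -
  have "val c q - val c' q = (q - \<mu>) * (g (c q) - g (c' q))" by (simp add: val_def algebra_simps)
  also have "\<dots> \<le> (q - \<mu>) * (gbar * \<bar>c q - c' q\<bar>)"
    using lip[OF assms(1-3)] assms(1) by (intro mult_left_mono) auto
  also have "\<dots> \<le> pbar * (gbar * B)"
    using assms(1,4) \<mu> gbar by (intro mult_mono) auto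
  finally show ?thesis by simp
qed

lemma good': "q \<in> {max \<mu> plo..pbar} \<Longrightarrow> \<bar>truth q - centre q\<bar> \<le> \<gamma> * \<rho> * sqrt (w q)"
  using good[of q] mult_right_mono[OF mult_left_mono[OF \<rho> \<gamma>], of "sqrt (w q)"] w0[of q] by simp

lemma low': "\<bar>low q - centre q\<bar> \<le> \<gamma> * \<rho> * sqrt (w q)"
  using \<gamma> \<rho> w0[of q] by (simp add: low_def)

lemma low_le_truth: "best plo pbar \<mu> (val low) \<le> best plo pbar \<mu> (val truth)"
proof -
  obtain q where q: "q \<in> {max \<mu> plo..pbar}" "best plo pbar \<mu> (val low) = val low q"
    using best_attained[OF I cont_val[OF cont_low]] by metis
  obtain q' where q': "\<And>q. q \<in> {max \<mu> plo..pbar} \<Longrightarrow> val truth q \<le> best plo pbar \<mu> (val truth)"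
    using best_attained[OF I cont_val[OF cont(2)]] by metis
  have "low q \<le> truth q" using good'[OF q(1)] by (simp add: low_def abs_le_iff)
  from val_mono[of q low truth, OF q(1) this] q' q show ?thesis by fastforce
qed

text \<open>Crude, since the widths are replaced by \<open>1\<close>; its purpose is the
  integrability of the gap.\<close>

lemma truth_minus_low_le:
  assumes "\<And>q. q \<in> {max \<mu> plo..pbar} \<Longrightarrow> w q \<le> 1"
  shows "best plo pbar \<mu> (val truth) - best plo pbar \<mu> (val low) \<le> pbar * gbar * (\<gamma> * (\<rho> + 1 / 2))"
proof -
  obtain q where q: "q \<in> {max \<mu> plo..pbar}" "best plo pbar \<mu> (val truth) = val truth q"
    using best_attained[OF I cont_val[OF cont(2)]] by metis
  have l: "val low q \<le> best plo pbar \<mu> (val low)"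
    using best_attained[OF I cont_val[OF cont_low]] q(1) by metis
  have "\<bar>truth q - low q\<bar> \<le> \<gamma> / 2 * sqrt (w q) + \<gamma> * \<rho> * sqrt (w q)"
    using good[OF q(1)] low'[of q] by linarith
  also have "\<dots> = \<gamma> * (\<rho> + 1/2) * sqrt (w q)" by (simp add: algebra_simps)
  also have "\<dots> \<le> \<gamma> * (\<rho> + 1/2) * 1" using \<gamma> \<rho> assms[OF q(1)] by (intro mult_left_mono) auto
  finally have "val truth q - val low q \<le> pbar * gbar * (\<gamma> * (\<rho> + 1/2))"
    using q(1) good' low' by (intro val_diff) auto
  then show ?thesis using l q by simp
qed

context
  fixes p :: real and sample :: "real \<Rightarrow> real"
  assumes sample: "continuous_on UNIV sample"
    "\<And>q. q \<in> {max \<mu> plo..pbar} \<Longrightarrow> \<bar>sample q - centre q\<bar> \<le> \<gamma> * \<rho> * sqrt (w q)"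
    and p: "p \<in> {max \<mu> plo..pbar}" "\<And>q. q \<in> {max \<mu> plo..pbar} \<Longrightarrow> val sample q \<le> val sample p"
begin

lemma best_sample: "best plo pbar \<mu> (val sample) = val sample p"
proof -
  obtain q where "q \<in> {max \<mu> plo..pbar}" "best plo pbar \<mu> (val sample) = val sample q"
    "\<And>q'. q' \<in> {max \<mu> plo..pbar} \<Longrightarrow> val sample q' \<le> best plo pbar \<mu> (val sample)"
    using best_attained[OF I cont_val[OF sample(1)]] by metis
  then show ?thesis using p by (metis order_antisym)
qed

text \<open>As \<open>low\<close> lies below the sample, its optimum is at most the sampled value of
  the posted price, which differs from the true value there by a multiple of the width at that
  price. What remains is the gap between \<open>truth\<close> and \<open>low\<close>, which does not
  involve the sample.\<close>

lemma round_regret: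
  "best plo pbar \<mu> (val truth) - val truth p \<le>
    (best plo pbar \<mu> (val truth) - best plo pbar \<mu> (val low)) + pbar * gbar * (\<gamma> * (\<rho> + 1/2) * sqrt (w p))"
proof -
  obtain q where q: "q \<in> {max \<mu> plo..pbar}" "best plo pbar \<mu> (val low) = val low q"
    using best_attained[OF I cont_val[OF cont_low]] by metis
  have "low q \<le> sample q" using sample(2)[OF q(1)] by (simp add: low_def abs_le_iff)
  then have "val low q \<le> val sample p" using val_mono[of q low sample] q(1) p(2)[OF q(1)] by fastforce
  moreover have "\<bar>sample p - truth p\<bar> \<le> \<gamma> * (\<rho> + 1/2) * sqrt (w p)"
  proof -
    have "\<bar>sample p - truth p\<bar> \<le> \<gamma> * \<rho> * sqrt (w p) + \<gamma> / 2 * sqrt (w p)"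
      using sample(2)[OF p(1)] good[OF p(1)] by linarith
    then show ?thesis by (simp add: algebra_simps)
  qed
  then have "val sample p - val truth p \<le> pbar * gbar * (\<gamma> * (\<rho> + 1/2) * sqrt (w p))"
    using p(1) sample(2) good' by (intro val_diff) auto
  ultimately show ?thesis using q(2) by linarith
qed

text \<open>An optimistic sample bounds the true optimum by its own value at the posted price, and
  the value of \<open>low\<close> there is at most the optimum of \<open>low\<close>. Hence the gap
  is controlled by the width at the price actually played, the only width that the potential
  argument sums.\<close>

lemma optimistic_gap:
  assumes "best plo pbar \<mu> (val truth) \<le> best plo pbar \<mu> (val sample)"
  shows "best plo pbar \<mu> (val truth) - best plo pbar \<mu> (val low) \<le> pbar * gbar * (2 * \<gamma> * \<rho> * sqrt (w p))"
proof -
  have l: "val low p \<le> best plo pbar \<mu> (val low)"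
    using best_attained[OF I cont_val[OF cont_low]] p(1) by metis
  have "\<bar>sample p - low p\<bar> \<le> 2 * \<gamma> * \<rho> * sqrt (w p)"
    using sample(2)[OF p(1)] low'[of p] by linarith
  then have "val sample p - val low p \<le> pbar * gbar * (2 * \<gamma> * \<rho> * sqrt (w p))"
    using p(1) sample(2) low' by (intro val_diff) auto
  then show ?thesis using assms l best_sample by linarith
qed

end

end

text \<open>As \<open>Y\<close> maps \<open>(1, q)\<close> to the feature at price \<open>q\<close>,
  the vector \<open>r q\<close> is the square root of \<open>Y^T W Y\<close> applied to
  \<open>(1, q)\<close>. The two-dimensional noise thus perturbs the index at every price with
  standard deviation \<open>\<gamma>\<close> times the width of the full feature there.\<close>

lemma sampled_index:
  fixes x :: "nat \<Rightarrow> real^'n::finite" and \<theta> :: "real^('n + 'n)" and p :: "nat \<Rightarrow> real" and t :: nat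
  defines "W \<equiv> inv_design x p (t - 1)"
  obtains r :: "real \<Rightarrow> real^2"
  where "\<And>q. (norm (r q))\<^sup>2 = stack (x t) (q *\<^sub>R x t) \<bullet> (W *v stack (x t) (q *\<^sub>R x t))"
    and "\<And>q \<xi>. sampled_coeffs 1 \<gamma> x p \<theta> \<xi> t $ 1 + sampled_coeffs 1 \<gamma> x p \<theta> \<xi> t $ 2 * q
      = lin_index \<theta> (x t) q + \<gamma> * (r q \<bullet> \<xi>)"
proof -
  define Y where "Y = Y_matrix (x t)"
  define A where "A = transpose Y ** W ** Y"
  define v :: "real \<Rightarrow> real^2" where "v q = vector [1, q]" for q
  have Yv: "Y *v u = stack (u $ 1 *\<^sub>R x t) (u $ 2 *\<^sub>R x t)" for u :: "real^2"
    by (simp add: Y_def Y_matrix_def matrix_vector_mult_def sum_2 stack_def vec_eq_iff split: sum.splits)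
  have A_quad: "u \<bullet> (A *v u') = (Y *v u) \<bullet> (W *v (Y *v u'))" for u u'
    unfolding A_def matrix_vector_mul_assoc[symmetric]
    using dot_lmul_matrix[of u "transpose Y" "W *v (Y *v u')"] by simp
  have Wsym: "(W *v a) \<bullet> b = a \<bullet> (W *v b)" for a b
    unfolding W_def inv_design_def by (rule matrix_inv_sym[OF dominates_id_design])
  have A_sym: "transpose A = A"
    using transpose_matrix_inv[OF dominates_id_design[of x p "t - 1"]]
    by (simp add: A_def matrix_transpose_mul W_def inv_design_def matrix_mul_assoc)
  have A_psd: "0 \<le> u \<bullet> (A *v u)" for u
    unfolding A_quad W_def inv_design_def by (rule matrix_inv_quad_nonneg[OF dominates_id_design])
  define Q where "Q = psd_sqrt A"
  have Qsym: "transpose Q = Q" and QQ: "Q ** Q = A"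
    unfolding Q_def by (rule psd_sqrt_2[OF A_sym A_psd])+
  show ?thesis
  proof (rule that[of "\<lambda>q. Q *v v q"])
    fix q
    have "(norm (Q *v v q))\<^sup>2 = v q \<bullet> (A *v v q)"
      unfolding power2_norm_eq_inner QQ[symmetric] matrix_vector_mul_assoc[symmetric]
      by (rule symmetric_matrix_inner[OF Qsym])
    then show "(norm (Q *v v q))\<^sup>2 = stack (x t) (q *\<^sub>R x t) \<bullet> (W *v stack (x t) (q *\<^sub>R x t))"
      unfolding A_quad Yv v_def by simp
    fix \<xi>
    have "sampled_coeffs 1 \<gamma> x p \<theta> \<xi> t = vector [x t \<bullet> alpha_part \<theta>, x t \<bullet> beta_part \<theta>] + \<gamma> *\<^sub>R (Q *v \<xi>)"
      by (simp add: sampled_coeffs_def Q_def A_def Y_def W_def inv_design_def)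
    moreover have "(Q *v v q) \<bullet> \<xi> = v q \<bullet> (Q *v \<xi>)" by (rule symmetric_matrix_inner[OF Qsym])
    ultimately show "sampled_coeffs 1 \<gamma> x p \<theta> \<xi> t $ 1 + sampled_coeffs 1 \<gamma> x p \<theta> \<xi> t $ 2 * q
      = lin_index \<theta> (x t) q + \<gamma> * ((Q *v v q) \<bullet> \<xi>)"
      by (simp add: lin_index_def v_def inner_vec_def sum_2 algebra_simps)
  qed
qed

subsection \<open>Information and independence\<close>

locale inventory_model = prob_space M for M :: "'a measure" +
  fixes T :: nat
    and XX :: "(real^'n::finite) set"
    and P :: "nat \<Rightarrow> (real^'n) measure"
    and X :: "nat \<Rightarrow> 'a \<Rightarrow> real^'n"
    and \<epsilon> :: "nat \<Rightarrow> 'a \<Rightarrow> real"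
    and \<eta> :: "nat \<Rightarrow> 'a \<Rightarrow> real^2"
    and \<theta>hat :: "nat \<Rightarrow> 'a \<Rightarrow> real^('n + 'n)"
    and p D :: "nat \<Rightarrow> 'a \<Rightarrow> real"
    and \<theta>star :: "real^('n + 'n)"
    and g :: "real \<Rightarrow> real"
    and plo pbar \<theta>bar Dbar \<sigma>bar glow gbar c C :: real
  assumes T: "T \<ge> 6"
    and prices: "0 \<le> plo" "plo \<le> pbar"
    and C: "C = c * real T"
    and X_meas: "\<And>t. t \<in> {1..T} \<Longrightarrow> X t \<in> borel_measurable M"
    and eps_meas: "\<And>t. t \<in> {1..T} \<Longrightarrow> \<epsilon> t \<in> borel_measurable M"
    and demand: "\<And>t \<omega>. D t \<omega> = g (lin_index \<theta>star (X t \<omega>) (p t \<omega>)) + \<epsilon> t \<omega>"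
    and X_law: "\<And>t. t \<in> {1..T} \<Longrightarrow> distr M borel (X t) = P t"
    and X_supp: "\<And>t. t \<in> {1..T} \<Longrightarrow> AE x in P t. x \<in> XX"
    and X_indep: "indep_vars (\<lambda>_. borel) X {1..T}"
    and X_eps_indep: "indep_set
           (sigma_sets (space M) (cyl M X {1..T})) (sigma_sets (space M) (cyl M \<epsilon> {1..T}))"
    and theta_bar: "\<theta>bar > 0"
    and theta_star: "norm \<theta>star \<le> \<theta>bar"
    and g_bounded: "\<And>x q. x \<in> XX \<Longrightarrow> q \<in> {plo..pbar} \<Longrightarrow>
           0 \<le> g (lin_index \<theta>star x q) \<and> g (lin_index \<theta>star x q) \<le> Dbar"
    and z_bounded: "\<And>x q. x \<in> XX \<Longrightarrow> q \<in> {plo..pbar} \<Longrightarrow> norm (stack x (q *\<^sub>R x)) \<le> 1"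
    and g_mono: "strict_mono g"
    and g_diff: "\<And>z. g differentiable (at z)"
    and glow: "glow > 0"
    and g_deriv: "\<And>x \<theta> q. x \<in> XX \<Longrightarrow> \<theta> \<in> Theta_enlarged \<theta>bar \<sigma>bar glow T \<Longrightarrow> q \<in> {plo..pbar} \<Longrightarrow>
           glow \<le> deriv g (lin_index \<theta> x q) \<and> deriv g (lin_index \<theta> x q) \<le> gbar"
    and sigma_bar: "\<sigma>bar \<ge> 0"
    and eps_exp_integrable: "\<And>t s. t \<in> {1..T} \<Longrightarrow> integrable M (\<lambda>\<omega>. exp (s * \<epsilon> t \<omega>))"
    and eps_subgaussian: "\<And>t s. t \<in> {1..T} \<Longrightarrow>
           AE \<omega> in M. ln (real_cond_exp M (shock_filtration M p \<epsilon> X (t - 1))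
                             (\<lambda>\<omega>. exp (s * \<epsilon> t \<omega>)) \<omega>) \<le> \<sigma>bar\<^sup>2 * s\<^sup>2 / 2"
    and c: "c \<in> {0..Dbar}"
    and feasible: "\<And>x. x \<in> XX \<Longrightarrow> g (lin_index \<theta>star x pbar) < c"
    and eta_normal: "\<And>t. t \<in> {1..T} \<Longrightarrow> distributed M lborel (\<eta> t) std_normal2"
    and eta_indep: "\<And>t. t \<in> {1..T} \<Longrightarrow> indep_set
           (sigma_sets (space M) (cyl M \<eta> {t}))
           (sigma_sets (space M) (cyl M X {1..T} \<union> cyl M \<epsilon> {1..T} \<union> cyl M \<eta> {1..<t}))"
    and theta_hat_meas: "\<And>t. t < T \<Longrightarrow> \<theta>hat t \<in> borel_measurable
           (sigma (space M) (cyl M X {1..t} \<union> cyl M p {1..t} \<union> cyl M D {1..t}))"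
    and p_meas: "\<And>t. t \<in> {1..T} \<Longrightarrow> p t \<in> borel_measurable
           (sigma (space M)
             (cyl M X {1..t} \<union> cyl M p {1..<t} \<union> cyl M D {1..<t} \<union> cyl M \<eta> {1..t}))"
    and algorithm: "AE \<omega> in M. inventory_TS g glow \<theta>bar \<sigma>bar Dbar plo pbar T C 1
           (\<lambda>t. X t \<omega>) (\<lambda>t. D t \<omega>) (\<lambda>t. \<eta> t \<omega>) (\<lambda>t. \<theta>hat t \<omega>) (\<lambda>t. p t \<omega>)"
begin

text \<open>Covariates up to \<open>i\<close>, shocks up to \<open>j\<close>, sampling noise up to \<open>k\<close>.  Prices and demands are functions of
  these, so no filtration that contains them is needed.\<close>

definition info :: "nat \<Rightarrow> nat \<Rightarrow> nat \<Rightarrow> 'a measure" where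
  "info i j k = sigma (space M) (cyl M X {1..i} \<union> cyl M \<epsilon> {1..j} \<union> cyl M \<eta> {1..k})"

definition noise_info :: "nat \<Rightarrow> 'a measure" where
  "noise_info k = sigma (space M) (cyl M \<eta> {1..k})"

lemma cyl_space: "cyl M Y I \<subseteq> Pow (space M)"
  by (auto simp: cyl_def)

lemma cyl_mono: "I \<subseteq> J \<Longrightarrow> cyl M Y I \<subseteq> cyl M Y J"
  by (auto simp: cyl_def)

lemma cyl_sets:
  assumes "space N = space M" "\<And>s. s \<in> I \<Longrightarrow> Y s \<in> borel_measurable N"
  shows "cyl M Y I \<subseteq> sets N"
proof
  fix A assume "A \<in> cyl M Y I"
  then obtain s B where sB: "s \<in> I" "B \<in> sets borel" "A = Y s -` B \<inter> space N"
    unfolding cyl_def assms(1) by blast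
  show "A \<in> sets N" unfolding sB(3) by (rule measurable_sets[OF assms(2)[OF sB(1)] sB(2)])
qed

lemma measurable_sigma_gen:
  assumes f: "f \<in> measurable (sigma (space M) E) N" and E: "E \<subseteq> sets F" and sp: "space F = space M"
  shows "f \<in> measurable F N"
proof -
  have "E \<subseteq> Pow (space M)" using E sets.space_closed[of F] sp by auto
  then have "sets (sigma (space M) E) \<subseteq> sets F"
    using sets.sigma_sets_subset[OF E] sp by (simp add: sets_measure_of)
  then show ?thesis
    using measurable_mono[OF order_refl refl, of "sigma (space M) E" F N] f sp
    by (auto simp: space_measure_of_conv)
qed

lemma info_gen: "cyl M X {1..i} \<union> cyl M \<epsilon> {1..j} \<union> cyl M \<eta> {1..k} \<subseteq> Pow (space M)"
  by (intro Un_least cyl_space)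

lemma space_info [simp]: "space (info i j k) = space M"
  by (simp add: info_def space_measure_of_conv)

lemma space_noise [simp]: "space (noise_info k) = space M"
  by (simp add: noise_info_def space_measure_of_conv)

lemma sets_info: "sets (info i j k) = sigma_sets (space M) (cyl M X {1..i} \<union> cyl M \<epsilon> {1..j} \<union> cyl M \<eta> {1..k})"
  unfolding info_def by (rule sets_measure_of[OF info_gen])

lemma sets_noise: "sets (noise_info k) = sigma_sets (space M) (cyl M \<eta> {1..k})"
  unfolding noise_info_def by (rule sets_measure_of[OF cyl_space])

lemma sets_info_mono: "i \<le> i' \<Longrightarrow> j \<le> j' \<Longrightarrow> k \<le> k' \<Longrightarrow> sets (info i j k) \<subseteq> sets (info i' j' k')"
  unfolding sets_info by (intro sigma_sets_mono' Un_mono cyl_mono) auto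

lemma measurable_info_mono:
  assumes "f \<in> measurable (info i j k) N" "i \<le> i'" "j \<le> j'" "k \<le> k'"
  shows "f \<in> measurable (info i' j' k') N"
  using measurable_mono[OF order_refl refl sets_info_mono[OF assms(2-4)], of N] assms(1) by auto

lemma in_cyl: "s \<in> I \<Longrightarrow> B \<in> sets borel \<Longrightarrow> Y s -` B \<inter> space M \<in> cyl M Y I"
  by (auto simp: cyl_def)

lemma measurable_of_cyl:
  fixes Y :: "nat \<Rightarrow> 'a \<Rightarrow> 'x::topological_space"
  assumes "cyl M Y I \<subseteq> sets N" "space N = space M" "s \<in> I"
  shows "Y s \<in> borel_measurable N"
proof (rule measurableI)
  fix B :: "'x set" assume "B \<in> sets borel"
  then show "Y s -` B \<inter> space N \<in> sets N" using in_cyl[OF assms(3)] assms(1,2) by auto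
qed simp

lemma X_info: "s \<in> {1..i} \<Longrightarrow> X s \<in> borel_measurable (info i j k)"
  by (rule measurable_of_cyl[of X "{1..i}"]) (auto simp: sets_info)

lemma eps_info: "s \<in> {1..j} \<Longrightarrow> \<epsilon> s \<in> borel_measurable (info i j k)"
  by (rule measurable_of_cyl[of \<epsilon> "{1..j}"]) (auto simp: sets_info)

lemma eta_info: "s \<in> {1..k} \<Longrightarrow> \<eta> s \<in> borel_measurable (info i j k)"
  by (rule measurable_of_cyl[of \<eta> "{1..k}"]) (auto simp: sets_info)

lemma eta_meas: "t \<in> {1..T} \<Longrightarrow> \<eta> t \<in> borel_measurable M"
  using distributed_measurable[OF eta_normal] by simp

lemma subalgebra_info: "i \<le> T \<Longrightarrow> j \<le> T \<Longrightarrow> k \<le> T \<Longrightarrow> subalgebra M (info i j k)"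
  unfolding subalgebra_def sets_info
  by (intro conjI sets.sigma_sets_subset Un_least cyl_sets) (auto intro: X_meas eps_meas eta_meas)

lemma subalgebra_noise: "k \<le> T \<Longrightarrow> subalgebra M (noise_info k)"
  unfolding subalgebra_def sets_noise
  by (intro conjI sets.sigma_sets_subset cyl_sets) (auto intro: eta_meas)

lemma g_cont: "continuous_on S g"
  by (intro continuous_at_imp_continuous_on ballI differentiable_imp_continuous_within g_diff)

lemma g_borel [measurable]: "g \<in> borel_measurable borel"
  by (rule borel_measurable_continuous_onI[OF g_cont])

lemma lin_index_measurable:
  fixes \<theta> x :: "'b \<Rightarrow> _"
  assumes [measurable]: "\<theta> \<in> borel_measurable N" "x \<in> borel_measurable N" "q \<in> borel_measurable N"
  shows "(\<lambda>\<omega>. lin_index (\<theta> \<omega> :: real^('n + 'n)) (x \<omega>) (q \<omega>)) \<in> borel_measurable N"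
proof -
  have "continuous_on UNIV (\<lambda>v :: real^('n + 'n). alpha_part v)" "continuous_on UNIV (\<lambda>v :: real^('n + 'n). beta_part v)"
    unfolding alpha_part_def beta_part_def by (intro continuous_intros)+
  then have [measurable]: "(alpha_part :: real^('n + 'n) \<Rightarrow> _) \<in> borel_measurable borel"
     "(beta_part :: real^('n + 'n) \<Rightarrow> _) \<in> borel_measurable borel"
    by (auto intro: borel_measurable_continuous_onI)
  show ?thesis unfolding lin_index_def by measurable
qed

text \<open>A price uses the noise of its round but not its shock, a demand uses both, hence the
  index patterns \<open>(t, t - 1, t)\<close> and \<open>(t, t, t)\<close>. The induction is strong
  because the measurability assumption on a price refers to all earlier prices and demands.\<close>

lemma p_info_D_info: "t \<in> {1..T} \<Longrightarrow> p t \<in> borel_measurable (info t (t - 1) t) \<and> D t \<in> borel_measurable (info t t t)"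
proof (induction t rule: less_induct)
  case (less t)
  have IH: "Suc 0 \<le> s \<Longrightarrow> s < t \<Longrightarrow> p s \<in> borel_measurable (info t (t - Suc 0) t)"
    "Suc 0 \<le> s \<Longrightarrow> s < t \<Longrightarrow> D s \<in> borel_measurable (info t (t - Suc 0) t)" for s
    using less.IH[of s] less.prems by (auto elim!: measurable_info_mono)
  have p: "p t \<in> borel_measurable (info t (t - 1) t)"
    by (rule measurable_sigma_gen[OF p_meas[OF less.prems]])
      ((intro Un_least cyl_sets; auto intro: X_info eta_info IH)+, simp)
  have [measurable]: "p t \<in> borel_measurable (info t t t)" using p by (rule measurable_info_mono) auto
  have [measurable]: "X t \<in> borel_measurable (info t t t)" "\<epsilon> t \<in> borel_measurable (info t t t)"
    using less.prems by (auto intro: X_info eps_info)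
  have "(\<lambda>\<omega>. g (lin_index \<theta>star (X t \<omega>) (p t \<omega>)) + \<epsilon> t \<omega>) \<in> borel_measurable (info t t t)"
    by (intro borel_measurable_add measurable_compose[OF lin_index_measurable g_borel]) auto
  with p show ?case by (simp add: demand[abs_def])
qed

lemma p_info: "s \<in> {1..T} \<Longrightarrow> s \<le> i \<Longrightarrow> s \<le> Suc j \<Longrightarrow> s \<le> k \<Longrightarrow> p s \<in> borel_measurable (info i j k)"
  using p_info_D_info[of s] by (auto elim!: measurable_info_mono)

lemma D_info: "s \<in> {1..T} \<Longrightarrow> s \<le> i \<Longrightarrow> s \<le> j \<Longrightarrow> s \<le> k \<Longrightarrow> D s \<in> borel_measurable (info i j k)"
  using p_info_D_info[of s] by (auto elim!: measurable_info_mono)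

lemma theta_hat_info:
  assumes "s < T" "s \<le> i" "s \<le> j" "s \<le> k"
  shows "\<theta>hat s \<in> borel_measurable (info i j k)"
  by (rule measurable_sigma_gen[OF theta_hat_meas[OF assms(1)]])
    ((intro Un_least cyl_sets; use assms in \<open>auto intro: X_info p_info D_info\<close>)+, simp)

lemma p_measurable_M: "t \<in> {1..T} \<Longrightarrow> p t \<in> borel_measurable M"
  using measurable_from_subalg[OF subalgebra_info[of T T T]] p_info[of t T T T] by auto

lemma sigma_algebra_of: "space N = space M \<Longrightarrow> sigma_algebra (space M) (sets N)"
  using sets.sigma_algebra_axioms[of N] by simp

lemma sigma_sets_Un_sets:
  "sets (info T T k) = sigma_sets (space M) (sets (info T T 0) \<union> sets (noise_info k))"
proof
  show "sets (info T T k) \<subseteq> sigma_sets (space M) (sets (info T T 0) \<union> sets (noise_info k))"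
    unfolding sets_info[of T T k]
    by (rule sigma_sets_mono) (auto simp: sets_info sets_noise intro!: sigma_sets.Basic)
  have "sets (info T T 0) \<subseteq> sets (info T T k)" by (rule sets_info_mono) auto
  moreover have "sets (noise_info k) \<subseteq> sets (info T T k)"
    unfolding sets_info sets_noise by (rule sigma_sets_mono') auto
  ultimately show "sigma_sets (space M) (sets (info T T 0) \<union> sets (noise_info k)) \<subseteq> sets (info T T k)"
    using sets.sigma_sets_subset[of "sets (info T T 0) \<union> sets (noise_info k)" "info T T k"] by simp
qed

lemma eta_indep_info:
  assumes "t \<in> {1..T}"
  shows "indep_set (sigma_sets (space M) (cyl M \<eta> {t})) (sets (info T T (t - 1)))"
proof -
  have "{1..<t} = {1..t - 1}" using assms by auto
  then show ?thesis using eta_indep[OF assms] by (simp add: sets_info)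
qed

text \<open>Each noise is given as independent of covariates, shocks and earlier noise;
  \<open>indep_set_join\<close> adjoins them one at a time.\<close>

lemma indep_noise: "k \<le> T \<Longrightarrow> indep_set (sets (info T T 0)) (sets (noise_info k))"
proof (induction k)
  case 0
  have s: "sets (noise_info 0) = {{}, space M}"
    unfolding sets_noise by (simp add: cyl_def sigma_sets_empty_eq)
  show ?case
  proof (rule indep_setI)
    show "sets (info T T 0) \<subseteq> events" "sets (noise_info 0) \<subseteq> events"
      using subalgebra_info[of T T 0] subalgebra_noise[of 0] by (auto simp: subalgebra_def)
    then show "prob (a \<inter> b) = prob a * prob b" if "a \<in> sets (info T T 0)" "b \<in> sets (noise_info 0)" for a b
      using that sets.sets_into_space[of a M] by (auto simp: s prob_space Int_absorb2)
  qed
next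
  case (Suc k)
  let ?N = "sigma_sets (space M) (cyl M \<eta> {Suc k})"
  have "indep_set (sets (info T T 0)) (sigma_sets (space M) (sets (noise_info k) \<union> ?N))"
  proof (rule indep_set_join)
    show "sigma_algebra (space M) (sets (info T T 0))" "sigma_algebra (space M) (sets (noise_info k))"
      by (auto intro: sigma_algebra_of)
    show "sigma_algebra (space M) ?N" by (rule sigma_algebra_sigma_sets[OF cyl_space])
    show "indep_set (sets (info T T 0)) (sets (noise_info k))" using Suc by simp
    show "indep_set ?N (sigma_sets (space M) (sets (info T T 0) \<union> sets (noise_info k)))"
      unfolding sigma_sets_Un_sets[symmetric] using eta_indep_info[of "Suc k"] Suc.prems by simp
  qed
  moreover have "sets (noise_info (Suc k)) \<subseteq> sigma_sets (space M) (sets (noise_info k) \<union> ?N)"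
    unfolding sets_noise[of "Suc k"]
  proof (rule sigma_sets_mono, rule subsetI)
    fix A assume "A \<in> cyl M \<eta> {1..Suc k}"
    then have "A \<in> cyl M \<eta> {1..k} \<union> cyl M \<eta> {Suc k}" by (auto simp: cyl_def le_Suc_eq)
    then show "A \<in> sigma_sets (space M) (sets (noise_info k) \<union> ?N)"
      by (auto simp: sets_noise intro: sigma_sets.Basic)
  qed
  ultimately show ?case by (rule indep_set_mono[OF _ order_refl])
qed

text \<open>The conditioning \<open>\<sigma>\<close>-algebra contains all shocks, future ones
  included. Independence among the covariates is joined first with the shocks and then with the
  noise; each added part is independent of everything already present.\<close>

lemma X_indep_past:
  assumes t: "t \<in> {1..T}"
  shows "indep_set (sets (info (t - 1) T (t - 1))) {X t -` A \<inter> space M | A. A \<in> sets borel}"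
proof -
  let ?E = "\<lambda>i. {X i -` A \<inter> space M | A. A \<in> sets borel}"
  let ?I = "case_bool {t} {1..t - 1}"
  let ?XT = "sigma_sets (space M) (cyl M X {t})" and ?XP = "sigma_sets (space M) (cyl M X {1..t - 1})"
    and ?EP = "sigma_sets (space M) (cyl M \<epsilon> {1..T})"
  have E: "(\<Union>i\<in>I. ?E i) = cyl M X I" for I by (auto simp: cyl_def)
  have "indep_sets (\<lambda>j. sigma_sets (space M) (\<Union>i\<in>?I j. ?E i)) UNIV"
  proof (rule indep_sets_collect_sigma)
    have "indep_sets ?E {1..T}" using X_indep by (simp add: indep_vars_def2)
    then show "indep_sets ?E (\<Union>j. ?I j)"
      by (rule indep_sets_mono_index[rotated]) (use t in \<open>auto split: bool.splits\<close>)
    show "disjoint_family_on ?I UNIV"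
      using t by (auto simp: disjoint_family_on_def split: bool.splits)
    show "Int_stable (?E i)" for i
    proof (rule Int_stableI)
      fix a b assume "a \<in> ?E i" "b \<in> ?E i"
      then obtain A B where "a = X i -` A \<inter> space M" "b = X i -` B \<inter> space M" "A \<in> sets borel" "B \<in> sets borel" by auto
      then have "a \<inter> b = X i -` (A \<inter> B) \<inter> space M" "A \<inter> B \<in> sets borel" by auto
      then show "a \<inter> b \<in> ?E i" by blast
    qed
  qed
  then have XX: "indep_set ?XT ?XP"
    unfolding indep_set_def E by (rule indep_sets_mono_sets) (auto split: bool.split)
  have 1: "indep_set ?XT (sigma_sets (space M) (?XP \<union> ?EP))"
  proof (rule indep_set_join)
    have sub: "?XT \<union> ?XP \<subseteq> sigma_sets (space M) (cyl M X {1..T})"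
      using t by (intro Un_least sigma_sets_mono' cyl_mono) auto
    have "sigma_sets (space M) (?XT \<union> ?XP) \<subseteq> sigma_sets (space M) (cyl M X {1..T})"
      using sub by (rule sigma_sets_mono)
    then show "indep_set ?EP (sigma_sets (space M) (?XT \<union> ?XP))"
      using indep_set_mono[OF indep_set_commute[OF X_eps_indep] order_refl] by blast
  qed (rule sigma_algebra_sigma_sets[OF cyl_space] XX)+
  have 2: "indep_set ?XT (sigma_sets (space M) (sigma_sets (space M) (?XP \<union> ?EP) \<union> sets (noise_info (t - 1))))"
  proof (rule indep_set_join)
    have sub: "cyl M X {t} \<subseteq> sets (info T T 0)" "cyl M X {1..t - 1} \<subseteq> sets (info T T 0)"
        "cyl M \<epsilon> {1..T} \<subseteq> sets (info T T 0)"
      using t by (intro cyl_sets; auto intro: X_info eps_info)+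
    note s = sets.sigma_sets_subset[where M="info T T 0", simplified]
    have "sigma_sets (space M) (?XT \<union> sigma_sets (space M) (?XP \<union> ?EP)) \<subseteq> sets (info T T 0)"
      by (intro s Un_least sub)
    moreover have "indep_set (sets (noise_info (t - 1))) (sets (info T T 0))"
      using t by (intro indep_set_commute[OF indep_noise]) auto
    ultimately show "indep_set (sets (noise_info (t - 1))) (sigma_sets (space M) (?XT \<union> sigma_sets (space M) (?XP \<union> ?EP)))"
      by (rule indep_set_mono[OF _ order_refl, rotated])
    have "?XP \<subseteq> Pow (space M)" "?EP \<subseteq> Pow (space M)"
      using sigma_sets_into_sp[OF cyl_space] by blast+
    then show "sigma_algebra (space M) (sigma_sets (space M) (?XP \<union> ?EP))"
      by (intro sigma_algebra_sigma_sets Un_least)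
  qed (rule sigma_algebra_sigma_sets[OF cyl_space] sigma_algebra_of[OF space_noise] 1)+
  have "?E t \<subseteq> ?XT" by (auto simp: cyl_def intro!: sigma_sets.Basic)
  moreover have "sets (info (t - 1) T (t - 1)) \<subseteq>
      sigma_sets (space M) (sigma_sets (space M) (?XP \<union> ?EP) \<union> sets (noise_info (t - 1)))"
    unfolding sets_info sets_noise by (intro sigma_sets_mono) (auto intro!: sigma_sets.Basic)
  ultimately show ?thesis using indep_set_mono[OF indep_set_commute[OF 2]] by blast
qed

lemma eta_indep_past:
  assumes t: "t \<in> {1..T}"
  shows "indep_set (sets (info t (t - 1) (t - 1))) {\<eta> t -` A \<inter> space M | A. A \<in> sets borel}"
proof -
  have "{\<eta> t -` A \<inter> space M | A. A \<in> sets borel} \<subseteq> sigma_sets (space M) (cyl M \<eta> {t})"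
    by (auto simp: cyl_def intro!: sigma_sets.Basic)
  moreover have "sets (info t (t - 1) (t - 1)) \<subseteq> sets (info T T (t - 1))"
    using t by (intro sets_info_mono) auto
  ultimately show ?thesis
    using indep_set_mono[OF indep_set_commute[OF eta_indep_info[OF t]]] by blast
qed

lemma sigma_finite_subalgebra_of:
  assumes "subalgebra M F"
  shows "sigma_finite_subalgebra M F"
proof -
  interpret finite_measure_subalgebra M F by unfold_locales fact
  show ?thesis by unfold_locales
qed

text \<open>The detour goes through \<open>?F\<close>, which knows covariates and shocks but no
  prices. It is contained in the assumed filtration, so the tower property transfers the bound; and
  the noise is independent of all covariates and shocks, so it can be adjoined. The result
  determines the price of round \<open>t\<close>.\<close>

lemma subgaussian_shock:
  assumes t: "t \<in> {1..T}"
  shows "subgaussian_given M (info t (t - 1) t) \<sigma>bar (\<epsilon> t)"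
  unfolding subgaussian_given_def
proof (intro ballI allI)
  fix Z :: "'a \<Rightarrow> ennreal" and r :: real
  assume Z: "Z \<in> borel_measurable (info t (t - 1) t)"
  let ?F = "info t (t - 1) 0" and ?H = "shock_filtration M p \<epsilon> X (t - 1)"
  define \<phi> where "\<phi> \<omega> = exp (r * \<epsilon> t \<omega>)" for \<omega>
  define b where "b = exp (\<sigma>bar\<^sup>2 * r\<^sup>2 / 2)"
  have gen: "cyl M p {1..t - 1} \<union> cyl M \<epsilon> {1..t - 1} \<union> cyl M X {1..Suc (t - 1)} \<subseteq> sets M"
    using t by (intro Un_least cyl_sets) (auto intro: p_measurable_M eps_meas X_meas)
  then have setsH: "sets ?H = sigma_sets (space M) (cyl M p {1..t - 1} \<union> cyl M \<epsilon> {1..t - 1} \<union> cyl M X {1..Suc (t - 1)})"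
    unfolding shock_filtration_def using sets.space_closed[of M] by (intro sets_measure_of) auto
  have H: "subalgebra M ?H"
    unfolding subalgebra_def setsH using sets.sigma_sets_subset[OF gen]
    by (simp add: shock_filtration_def space_measure_of_conv)
  have FM: "subalgebra M ?F" using t by (intro subalgebra_info) auto
  have FH: "subalgebra ?H ?F"
  proof -
    have "cyl M \<eta> {1..0} = {}" by (simp add: cyl_def)
    moreover have "Suc (t - 1) = t" using t by simp
    ultimately have "sets ?F \<subseteq> sets ?H"
      unfolding setsH sets_info by (intro sigma_sets_mono') auto
    then show ?thesis by (simp add: subalgebra_def shock_filtration_def space_measure_of_conv)
  qed
  interpret FM: sigma_finite_subalgebra M ?F by (rule sigma_finite_subalgebra_of[OF FM])
  interpret H: sigma_finite_subalgebra M ?H by (rule sigma_finite_subalgebra_of[OF H])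
  have i\<phi>: "integrable M \<phi>" unfolding \<phi>_def by (rule eps_exp_integrable[OF t])
  define Y where "Y = real_cond_exp M ?F \<phi>"
  have Yb: "AE \<omega> in M. Y \<omega> \<le> b"
  proof -
    have "AE \<omega> in M. real_cond_exp M ?H \<phi> \<omega> \<le> b"
      using eps_subgaussian[OF t, of r]
    proof eventually_elim
      fix \<omega> assume a: "ln (real_cond_exp M ?H (\<lambda>\<omega>. exp (r * \<epsilon> t \<omega>)) \<omega>) \<le> \<sigma>bar\<^sup>2 * r\<^sup>2 / 2"
      show "real_cond_exp M ?H \<phi> \<omega> \<le> b"
      proof (cases "real_cond_exp M ?H \<phi> \<omega> > 0")
        case True
        have "exp (ln (real_cond_exp M ?H \<phi> \<omega>)) \<le> b"
          using a unfolding b_def \<phi>_def by simp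
        then show ?thesis using True by simp
      next
        \<comment> \<open>The logarithm is informative only at a positive argument; here the bound
          holds because \<open>b\<close> is positive.\<close>
        case False
        then have "real_cond_exp M ?H \<phi> \<omega> \<le> 0" by simp
        also have "0 \<le> b" by (simp add: b_def)
        finally show ?thesis .
      qed
    qed
    from FM.real_cond_exp_le_c[OF H.real_cond_exp_int(1)[OF i\<phi>] this]
      FM.real_cond_exp_nested_subalg[OF H FH i\<phi>]
    show ?thesis unfolding Y_def by eventually_elim simp
  qed
  have Y0: "AE \<omega> in M. 0 \<le> Y \<omega>"
    unfolding Y_def using i\<phi> by (intro FM.real_cond_exp_pos) (auto simp: \<phi>_def)
  have iY: "integrable M Y" unfolding Y_def by (rule FM.real_cond_exp_int(1)[OF i\<phi>])
  have YF: "Y \<in> borel_measurable ?F" unfolding Y_def by simp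
  have FK: "sets ?F \<subseteq> sets (info T T 0)" using t by (intro sets_info_mono) auto
  have "(\<integral>\<^sup>+\<omega>. Z \<omega> * ennreal (\<phi> \<omega>) \<partial>M) = (\<integral>\<^sup>+\<omega>. Z \<omega> * ennreal (Y \<omega>) \<partial>M)"
  proof (rule nn_integral_eq_join_indep[OF _ FM FK])
    show "subalgebra M (info T T 0)" by (intro subalgebra_info) auto
    show "subalgebra M (noise_info t)" "indep_set (sets (info T T 0)) (sets (noise_info t))"
      using t by (auto intro!: subalgebra_noise indep_noise)
    have "\<epsilon> t \<in> borel_measurable (info T T 0)" using t by (intro eps_info) auto
    then show "(\<lambda>\<omega>. ennreal (\<phi> \<omega>)) \<in> borel_measurable (info T T 0)" unfolding \<phi>_def by measurable
    show "(\<integral>\<^sup>+\<omega>. ennreal (\<phi> \<omega>) \<partial>M) < \<infinity>"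
      using nn_integral_eq_integral[OF i\<phi>] by (simp add: \<phi>_def)
    have "Y \<in> borel_measurable (info T T 0)"
      using YF by (rule measurable_info_mono) (use t in auto)
    then show "(\<lambda>\<omega>. ennreal (Y \<omega>)) \<in> borel_measurable (info T T 0)" by measurable
    show "(\<integral>\<^sup>+\<omega>. ennreal (\<phi> \<omega>) * indicator A \<omega> \<partial>M) = (\<integral>\<^sup>+\<omega>. ennreal (Y \<omega>) * indicator A \<omega> \<partial>M)"
      if A: "A \<in> sets ?F" for A
    proof -
      have AM: "A \<in> sets M" using A FM by (auto simp: subalgebra_def)
      have nn: "(\<integral>\<^sup>+\<omega>. ennreal (h \<omega>) * indicator A \<omega> \<partial>M) = ennreal (\<integral>\<omega>\<in>A. h \<omega> \<partial>M)"
        if "integrable M h" "AE \<omega> in M. 0 \<le> h \<omega>" for h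
      proof -
        have "(\<integral>\<^sup>+\<omega>. ennreal (h \<omega>) * indicator A \<omega> \<partial>M) = (\<integral>\<^sup>+\<omega>. ennreal (indicator A \<omega> *\<^sub>R h \<omega>) \<partial>M)"
          by (intro nn_integral_cong) (auto simp: indicator_def)
        also have "\<dots> = ennreal (\<integral>\<omega>. indicator A \<omega> *\<^sub>R h \<omega> \<partial>M)"
          using that AM by (intro nn_integral_eq_integral integrable_mult_indicator) (auto simp: indicator_def)
        finally show ?thesis by (simp add: set_lebesgue_integral_def)
      qed
      show ?thesis
        using FM.real_cond_exp_intA[OF i\<phi> A] nn[OF i\<phi>] nn[OF iY Y0] by (simp add: Y_def \<phi>_def)
    qed
    show "Z \<in> borel_measurable (sigma (space M) (sets ?F \<union> sets (noise_info t)))"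
    proof (rule measurable_sigma_gen[OF Z[unfolded info_def]])
      have Pw: "sets ?F \<union> sets (noise_info t) \<subseteq> Pow (space M)"
        using sets.space_closed[of ?F] sets.space_closed[of "noise_info t"] by auto
      show "cyl M X {1..t} \<union> cyl M \<epsilon> {1..t - 1} \<union> cyl M \<eta> {1..t} \<subseteq>
          sets (sigma (space M) (sets ?F \<union> sets (noise_info t)))"
        unfolding sets_measure_of[OF Pw] by (auto simp: sets_info sets_noise intro!: sigma_sets.Basic)
    qed (simp add: space_measure_of_conv)
  qed
  also have "\<dots> \<le> (\<integral>\<^sup>+\<omega>. ennreal b * Z \<omega> \<partial>M)"
  proof (rule nn_integral_mono_AE)
    show "AE \<omega> in M. Z \<omega> * ennreal (Y \<omega>) \<le> ennreal b * Z \<omega>"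
      using Yb by eventually_elim (auto simp: mult.commute[of "ennreal b"] intro!: mult_left_mono ennreal_leI)
  qed
  also have "\<dots> = ennreal b * (\<integral>\<^sup>+\<omega>. Z \<omega> \<partial>M)"
    using measurable_from_subalg[OF subalgebra_info Z] t by (intro nn_integral_cmult) auto
  finally show "(\<integral>\<^sup>+\<omega>. Z \<omega> * ennreal (exp (r * \<epsilon> t \<omega>)) \<partial>M)
      \<le> ennreal (exp (\<sigma>bar\<^sup>2 * r\<^sup>2 / 2)) * (\<integral>\<^sup>+\<omega>. Z \<omega> \<partial>M)"
    by (simp add: \<phi>_def b_def)
qed

end

subsection \<open>The self-normalized score\<close>

lemma vec_nth_measurable:
  fixes f :: "'b \<Rightarrow> real^'m"
  assumes "f \<in> borel_measurable N"
  shows "(\<lambda>\<omega>. f \<omega> $ i) \<in> borel_measurable N"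
  by (rule measurable_compose[OF assms]) (intro borel_measurable_continuous_onI continuous_intros)

lemma feat_nth_measurable:
  assumes "x s \<in> borel_measurable N" "p s \<in> borel_measurable N"
  shows "(\<lambda>\<omega>. feat (\<lambda>s. x s \<omega>) (\<lambda>s. p s \<omega>) s $ k) \<in> borel_measurable N"
  using assms(2) vec_nth_measurable[OF assms(1)]
  by (cases k) (auto simp: feat_def stack_def)

lemma quad_measurable:
  fixes u v :: "'b \<Rightarrow> real^'m" and W :: "'b \<Rightarrow> real^'m^'m"
  assumes "\<And>i. (\<lambda>\<omega>. u \<omega> $ i) \<in> borel_measurable N" "\<And>i. (\<lambda>\<omega>. v \<omega> $ i) \<in> borel_measurable N"
    "\<And>i j. (\<lambda>\<omega>. W \<omega> $ i $ j) \<in> borel_measurable N"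
  shows "(\<lambda>\<omega>. u \<omega> \<bullet> (W \<omega> *v v \<omega>)) \<in> borel_measurable N"
  using assms by (simp add: inner_vec_def matrix_vector_mult_def)

text \<open>The recursion expresses the entries of the inverse design matrix rationally in the
  features, so that measurability goes by induction on the rounds.\<close>

lemma inv_design_Suc_nth:
  fixes x p and t :: nat
  defines "W \<equiv> inv_design x p t" and "z \<equiv> feat x p (Suc t)"
  shows "inv_design x p (Suc t) $ i $ j =
    W $ i $ j - (\<Sum>k\<in>UNIV. W $ i $ k * z $ k) * (\<Sum>k\<in>UNIV. W $ j $ k * z $ k) / (1 + z \<bullet> (W *v z))"
proof -
  have basis: "(B *v axis j 1) $ i = B $ i $ j" for B :: "real^'b^'b" and i j
    by (simp add: matrix_vector_mult_basis column_def)
  have nth: "(W *v z) $ i = (\<Sum>k\<in>UNIV. W $ i $ k * z $ k)" for i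
    by (simp add: matrix_vector_mult_def)
  have "z \<bullet> (W *v axis j 1) = (W *v z) \<bullet> axis j 1"
    unfolding W_def inv_design_def by (rule matrix_inv_sym[OF dominates_id_design, symmetric])
  then have zW: "z \<bullet> (W *v axis j 1) = (W *v z) $ j" by (simp add: inner_axis)
  have "inv_design x p (Suc t) *v axis j 1 =
      W *v axis j 1 - ((z \<bullet> (W *v axis j 1)) / (1 + z \<bullet> (W *v z))) *\<^sub>R (W *v z)"
    unfolding inv_design_def[of x p "Suc t"] design_Suc W_def z_def inv_design_def
    by (rule sherman_morrison[OF dominates_id_design])
  from arg_cong[OF this, of "\<lambda>v. v $ i"] show ?thesis
    by (simp add: basis zW nth)
qed

lemma inv_design_0: "inv_design x p 0 = mat 1"
  using matrix_inv_mult[OF dominates_id_design, of x p 0] by (simp add: inv_design_def design_0)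

lemma inv_design_measurable:
  assumes "\<And>s. s \<in> {1..t} \<Longrightarrow> x s \<in> borel_measurable N" "\<And>s. s \<in> {1..t} \<Longrightarrow> p s \<in> borel_measurable N"
  shows "(\<lambda>\<omega>. inv_design (\<lambda>s. x s \<omega>) (\<lambda>s. p s \<omega>) t $ i $ j) \<in> borel_measurable N"
  using assms
proof (induction t arbitrary: i j)
  case 0
  then show ?case by (simp add: inv_design_0)
next
  case (Suc t)
  have IH: "(\<lambda>\<omega>. inv_design (\<lambda>s. x s \<omega>) (\<lambda>s. p s \<omega>) t $ i $ j) \<in> borel_measurable N" for i j
    using Suc.prems by (intro Suc.IH) auto
  have z: "(\<lambda>\<omega>. feat (\<lambda>s. x s \<omega>) (\<lambda>s. p s \<omega>) (Suc t) $ k) \<in> borel_measurable N" for k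
    using Suc.prems by (intro feat_nth_measurable) auto
  show ?case unfolding inv_design_Suc_nth
    by (intro borel_measurable_diff borel_measurable_divide borel_measurable_add borel_measurable_times
        borel_measurable_sum quad_measurable IH z borel_measurable_const)
qed

lemma width2_measurable:
  assumes "\<And>s. s \<in> {1..t} \<Longrightarrow> x s \<in> borel_measurable N" "\<And>s. s \<in> {1..t} \<Longrightarrow> p s \<in> borel_measurable N" "t \<ge> 1"
  shows "(\<lambda>\<omega>. width2 (\<lambda>s. x s \<omega>) (\<lambda>s. p s \<omega>) t) \<in> borel_measurable N"
  unfolding width2_def
  using assms by (intro quad_measurable feat_nth_measurable inv_design_measurable) auto

lemma det_design_measurable:
  assumes "\<And>s. s \<in> {1..t} \<Longrightarrow> x s \<in> borel_measurable N" "\<And>s. s \<in> {1..t} \<Longrightarrow> p s \<in> borel_measurable N"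
  shows "(\<lambda>\<omega>. det (design_matrix 1 (\<lambda>s. x s \<omega>) (\<lambda>s. p s \<omega>) t)) \<in> borel_measurable N"
  using assms
proof (induction t)
  case (Suc t)
  then have "(\<lambda>\<omega>. width2 (\<lambda>s. x s \<omega>) (\<lambda>s. p s \<omega>) (Suc t)) \<in> borel_measurable N"
    by (intro width2_measurable) auto
  moreover have "(\<lambda>\<omega>. det (design_matrix 1 (\<lambda>s. x s \<omega>) (\<lambda>s. p s \<omega>) t)) \<in> borel_measurable N"
    using Suc by auto
  ultimately show ?case unfolding det_design_Suc by measurable
qed (simp add: design_0)

context inventory_model
begin

abbreviation "xs \<omega> \<equiv> \<lambda>s. X s \<omega>"
abbreviation "ps \<omega> \<equiv> \<lambda>s. p s \<omega>"
abbreviation "Ds \<omega> \<equiv> \<lambda>s. D s \<omega>"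

definition score :: "nat \<Rightarrow> 'a \<Rightarrow> real^('n + 'n)" where
  "score t \<omega> = (\<Sum>s=1..t. \<epsilon> s \<omega> *\<^sub>R feat (xs \<omega>) (ps \<omega>) s)"

definition score_norm2 :: "nat \<Rightarrow> 'a \<Rightarrow> real" where
  "score_norm2 t \<omega> = score t \<omega> \<bullet> (inv_design (xs \<omega>) (ps \<omega>) t *v score t \<omega>)"

abbreviation "ddet t \<omega> \<equiv> det (design_matrix 1 (xs \<omega>) (ps \<omega>) t)"

lemma score_nth_measurable:
  assumes "t \<le> T" "t \<le> i" "t \<le> j" "t \<le> k"
  shows "(\<lambda>\<omega>. score t \<omega> $ m) \<in> borel_measurable (info i j k)"
  unfolding score_def sum_component vector_scaleR_component
  using assms by (intro borel_measurable_sum borel_measurable_scaleR feat_nth_measurable eps_info X_info p_info) auto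

lemma score_norm2_measurable:
  assumes "t \<le> T" "t \<le> i" "t \<le> j" "t \<le> k"
  shows "score_norm2 t \<in> borel_measurable (info i j k)"
  unfolding score_norm2_def[abs_def]
  using assms by (intro quad_measurable score_nth_measurable inv_design_measurable X_info p_info) auto

text \<open>The last shock is integrated out given the data that determine its feature. The exponent
  has the form \<open>V e + k e\<^sup>2 / 2\<close>, and
  \<open>\<kappa> * \<sigma>bar\<^sup>2 \<le> 1\<close> gives
  \<open>1 - \<sigma>bar\<^sup>2 * k \<ge> 1 / (1 + w)\<close>. Consequently the square subtracted
  from the score norm pays for the linear term, and the growth of the determinant pays for the
  Gaussian normalization.\<close>

lemma exp_score_integral_le:
  assumes \<kappa>: "0 \<le> \<kappa>" "\<kappa> * \<sigma>bar\<^sup>2 \<le> 1" and "t \<le> T"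
  shows "(\<integral>\<^sup>+\<omega>. ennreal (exp (\<kappa> / 2 * score_norm2 t \<omega>) / sqrt (ddet t \<omega>)) \<partial>M) \<le> 1"
  using \<open>t \<le> T\<close>
proof (induction t)
  case 0
  then show ?case by (simp add: score_norm2_def score_def design_0 emeasure_space_1)
next
  case (Suc t)
  define u where "u = Suc t"
  have u: "u \<in> {1..T}" using Suc by (simp add: u_def)
  let ?F = "info u (u - 1) u"
  have F: "subalgebra M ?F" using u by (intro subalgebra_info) auto
  define w where "w \<omega> = width2 (xs \<omega>) (ps \<omega>) u" for \<omega>
  define a where "a \<omega> = feat (xs \<omega>) (ps \<omega>) u \<bullet> (inv_design (xs \<omega>) (ps \<omega>) t *v score t \<omega>)" for \<omega>
  have XF: "s \<in> {1..u} \<Longrightarrow> X s \<in> borel_measurable ?F" and pF: "s \<in> {1..u} \<Longrightarrow> p s \<in> borel_measurable ?F" for s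
    using u by (auto intro!: X_info p_info)
  have w0: "0 \<le> w \<omega>" for \<omega> unfolding w_def by (rule width2_nonneg)
  have wF [measurable]: "w \<in> borel_measurable ?F"
    unfolding w_def[abs_def] using u by (intro width2_measurable XF pF) auto
  have sF: "(\<lambda>\<omega>. score t \<omega> $ m) \<in> borel_measurable ?F" for m
    using u by (intro score_nth_measurable) (auto simp: u_def)
  have aF [measurable]: "a \<in> borel_measurable ?F"
    unfolding a_def[abs_def] using u
    by (intro quad_measurable sF feat_nth_measurable inv_design_measurable XF pF) (auto simp: u_def)
  have dF [measurable]: "(\<lambda>\<omega>. ddet u \<omega>) \<in> borel_measurable ?F"
    by (intro det_design_measurable XF pF) auto
  have nF [measurable]: "score_norm2 t \<in> borel_measurable ?F"
    using u by (intro score_norm2_measurable) (auto simp: u_def)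
  \<comment> \<open>The part of the integrand that is known before the shock of round
    \<open>u\<close>.\<close>
  define Z where "Z \<omega> = ennreal (exp (\<kappa> / 2 * (score_norm2 t \<omega> - (a \<omega>)\<^sup>2 / (1 + w \<omega>))) / sqrt (ddet u \<omega>))" for \<omega>
  define V where "V \<omega> = \<kappa> * a \<omega> / (1 + w \<omega>)" for \<omega>
  define k where "k \<omega> = \<kappa> * w \<omega> / (1 + w \<omega>)" for \<omega>
  have ZF: "Z \<in> borel_measurable ?F" and VF: "V \<in> borel_measurable ?F" and kF: "k \<in> borel_measurable ?F"
    unfolding Z_def[abs_def] V_def[abs_def] k_def[abs_def] by measurable
  have k0: "0 \<le> k \<omega>" for \<omega> using w0[of \<omega>] \<kappa> by (simp add: k_def)
  have sk: "\<sigma>bar\<^sup>2 * k \<omega> \<le> w \<omega> / (1 + w \<omega>)" for \<omega>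
  proof -
    have "\<sigma>bar\<^sup>2 * k \<omega> = (\<kappa> * \<sigma>bar\<^sup>2) * (w \<omega> / (1 + w \<omega>))" by (simp add: k_def)
    also have "\<dots> \<le> 1 * (w \<omega> / (1 + w \<omega>))" using w0[of \<omega>] \<kappa> by (intro mult_right_mono) auto
    finally show ?thesis by simp
  qed
  have lt1: "w \<omega> / (1 + w \<omega>) < 1" for \<omega> using w0[of \<omega>] by simp
  then have k1: "\<sigma>bar\<^sup>2 * k \<omega> < 1" for \<omega> using sk[of \<omega>] by (rule le_less_trans[rotated])
  have eq: "ennreal (exp (\<kappa> / 2 * score_norm2 u \<omega>) / sqrt (ddet u \<omega>)) =
      Z \<omega> * ennreal (exp (V \<omega> * \<epsilon> u \<omega> + k \<omega> * (\<epsilon> u \<omega>)\<^sup>2 / 2))" for \<omega>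
  proof -
    have su: "score u \<omega> = score t \<omega> + \<epsilon> u \<omega> *\<^sub>R feat (xs \<omega>) (ps \<omega>) u"
      by (simp add: score_def u_def)
    have "score_norm2 u \<omega> = score_norm2 t \<omega> - (a \<omega>)\<^sup>2 / (1 + w \<omega>) + 2 * \<epsilon> u \<omega> * a \<omega> / (1 + w \<omega>)
        + (\<epsilon> u \<omega>)\<^sup>2 * w \<omega> / (1 + w \<omega>)"
      unfolding score_norm2_def su a_def w_def width2_def
      unfolding u_def inv_design_def diff_Suc_1 design_Suc
      by (rule quad_rank_one_update[OF dominates_id_design])
    moreover have "\<kappa> / 2 * (N - A + 2 * e * b / q + e\<^sup>2 * r / q) = \<kappa> / 2 * (N - A) + (\<kappa> * b / q * e + \<kappa> * r / q * e\<^sup>2 / 2)"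
      for N A e b q r :: real by (simp add: algebra_simps add_divide_distrib diff_divide_distrib)
    ultimately have "\<kappa> / 2 * score_norm2 u \<omega> = \<kappa> / 2 * (score_norm2 t \<omega> - (a \<omega>)\<^sup>2 / (1 + w \<omega>))
        + (V \<omega> * \<epsilon> u \<omega> + k \<omega> * (\<epsilon> u \<omega>)\<^sup>2 / 2)"
      unfolding V_def k_def by (simp only:)
    then have "exp (\<kappa> / 2 * score_norm2 u \<omega>) = exp (\<kappa> / 2 * (score_norm2 t \<omega> - (a \<omega>)\<^sup>2 / (1 + w \<omega>)))
        * exp (V \<omega> * \<epsilon> u \<omega> + k \<omega> * (\<epsilon> u \<omega>)\<^sup>2 / 2)"
      by (simp only: exp_add)
    moreover have "0 \<le> ddet u \<omega>" by (rule order_trans[OF zero_le_one det_design_ge_1])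
    ultimately show ?thesis unfolding Z_def by (simp add: ennreal_mult[symmetric])
  qed
  have pt: "Z \<omega> * ennreal (exp (\<sigma>bar\<^sup>2 * (V \<omega>)\<^sup>2 / (2 * (1 - \<sigma>bar\<^sup>2 * k \<omega>))) / sqrt (1 - \<sigma>bar\<^sup>2 * k \<omega>))
      \<le> ennreal (exp (\<kappa> / 2 * score_norm2 t \<omega>) / sqrt (ddet t \<omega>))" for \<omega>
  proof -
    define q where "q = 1 + w \<omega>"
    have q: "q \<ge> 1" using w0[of \<omega>] by (simp add: q_def)
    define h where "h = 1 - \<sigma>bar\<^sup>2 * k \<omega>"
    have h: "1 / q \<le> h" using sk[of \<omega>] q by (simp add: h_def q_def field_simps)
    have h0: "h > 0" using k1[of \<omega>] by (simp add: h_def)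
    have d1: "ddet t \<omega> \<ge> 1" by (rule det_design_ge_1)
    have du: "ddet u \<omega> = ddet t \<omega> * q" unfolding u_def q_def w_def by (rule det_design_Suc)
    \<comment> \<open>The exponent produced by the shock is at most the one that \<open>Z\<close>
      subtracts.\<close>
    have e1: "\<sigma>bar\<^sup>2 * (V \<omega>)\<^sup>2 / (2 * h) \<le> \<kappa> / 2 * ((a \<omega>)\<^sup>2 / q)"
    proof -
      have "\<sigma>bar\<^sup>2 * (V \<omega>)\<^sup>2 / (2 * h) = (\<kappa> * \<sigma>bar\<^sup>2) * (\<kappa> * (a \<omega>)\<^sup>2 / (2 * q)) * ((1 / q) / h)"
        unfolding V_def q_def[symmetric] using h0 q by (simp add: field_simps power2_eq_square)
      also have "1 \<le> q * h" using h q by (simp add: field_simps)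
      then have "(\<kappa> * \<sigma>bar\<^sup>2) * (\<kappa> * (a \<omega>)\<^sup>2 / (2 * q)) * ((1 / q) / h) \<le> 1 * (\<kappa> * (a \<omega>)\<^sup>2 / (2 * q)) * 1"
        using h0 q \<kappa> by (intro mult_mono mult_nonneg_nonneg) auto
      finally show ?thesis by simp
    qed
    \<comment> \<open>The normalization is at most the factor by which the root of the determinant
      grows.\<close>
    have e2: "1 / sqrt h \<le> sqrt q"
    proof -
      have "1 / h \<le> q" using h h0 q by (simp add: field_simps)
      then have "sqrt (1 / h) \<le> sqrt q" by (rule real_sqrt_le_mono)
      then show ?thesis by (simp add: real_sqrt_divide)
    qed
    have "exp (\<kappa> / 2 * (score_norm2 t \<omega> - (a \<omega>)\<^sup>2 / q)) / sqrt (ddet u \<omega>) *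
        (exp (\<sigma>bar\<^sup>2 * (V \<omega>)\<^sup>2 / (2 * h)) / sqrt h)
      = exp (\<kappa> / 2 * (score_norm2 t \<omega> - (a \<omega>)\<^sup>2 / q) + \<sigma>bar\<^sup>2 * (V \<omega>)\<^sup>2 / (2 * h)) / sqrt (ddet u \<omega>) * (1 / sqrt h)"
      by (simp add: exp_add)
    also have "\<dots> \<le> exp (\<kappa> / 2 * score_norm2 t \<omega>) / sqrt (ddet u \<omega>) * sqrt q"
      using e1 e2 h0 d1 q du
      by (intro mult_mono divide_right_mono) (auto simp: right_diff_distrib)
    also have "\<dots> = exp (\<kappa> / 2 * score_norm2 t \<omega>) / sqrt (ddet t \<omega>)"
      using q by (simp add: du real_sqrt_mult)
    finally show ?thesis
      unfolding Z_def q_def[symmetric] h_def[symmetric] using d1 q h0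
      by (simp add: ennreal_mult[symmetric] ennreal_leI du)
  qed
  have "(\<integral>\<^sup>+\<omega>. ennreal (exp (\<kappa> / 2 * score_norm2 u \<omega>) / sqrt (ddet u \<omega>)) \<partial>M)
      \<le> (\<integral>\<^sup>+\<omega>. Z \<omega> * ennreal (exp (\<sigma>bar\<^sup>2 * (V \<omega>)\<^sup>2 / (2 * (1 - \<sigma>bar\<^sup>2 * k \<omega>))) / sqrt (1 - \<sigma>bar\<^sup>2 * k \<omega>)) \<partial>M)"
    unfolding eq
    by (rule subgaussian_given_quadratic[OF F eps_meas[OF u] subgaussian_shock[OF u] ZF VF kF k0 k1])
  also have "\<dots> \<le> (\<integral>\<^sup>+\<omega>. ennreal (exp (\<kappa> / 2 * score_norm2 t \<omega>) / sqrt (ddet t \<omega>)) \<partial>M)"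
    by (intro nn_integral_mono pt)
  also have "\<dots> \<le> 1" using Suc by simp
  finally show ?case by (simp add: u_def)
qed

lemma eps_integrable_M: "t \<in> {1..T} \<Longrightarrow> integrable M (\<epsilon> t)"
  and eps_square_integrable_M: "t \<in> {1..T} \<Longrightarrow> integrable M (\<lambda>\<omega>. (\<epsilon> t \<omega>)\<^sup>2)"
  and eps_second_moment: "t \<in> {1..T} \<Longrightarrow> (\<integral>\<omega>. (\<epsilon> t \<omega>)\<^sup>2 \<partial>M) \<le> \<sigma>bar\<^sup>2"
proof -
  assume t: "t \<in> {1..T}"
  have F: "subalgebra M (info t (t - 1) t)" using t by (intro subalgebra_info) auto
  note f = F eps_meas[OF t] subgaussian_shock[OF t]
  show "integrable M (\<epsilon> t)" by (rule subgaussian_given_integrable[OF f])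
  show "integrable M (\<lambda>\<omega>. (\<epsilon> t \<omega>)\<^sup>2)" by (rule subgaussian_given_integrable_square[OF f])
  show "(\<integral>\<omega>. (\<epsilon> t \<omega>)\<^sup>2 \<partial>M) \<le> \<sigma>bar\<^sup>2" by (rule subgaussian_given_second_moment[OF f])
qed

lemma score_norm2_measurable_M: "t \<le> T \<Longrightarrow> score_norm2 t \<in> borel_measurable M"
  by (rule measurable_from_subalg[OF subalgebra_info[of T T T] score_norm2_measurable]) auto

lemma ddet_measurable_M: "t \<le> T \<Longrightarrow> (\<lambda>\<omega>. ddet t \<omega>) \<in> borel_measurable M"
  by (intro det_design_measurable X_meas p_measurable_M) auto

text \<open>Markov's inequality for \<open>exp_score_integral_le\<close> at the largest admissible
  \<open>\<kappa> = 1 / \<sigma>bar\<^sup>2\<close>: on the event the integrand is at least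
  \<open>T\<close>. With \<open>\<sigma>bar = 0\<close> this \<open>\<kappa>\<close> does not exist,
  but then the shocks vanish almost surely.\<close>

lemma score_tail:
  assumes t: "t \<le> T"
  shows "prob {\<omega>\<in>space M. \<sigma>bar\<^sup>2 * (2 * ln (real T) + ln (ddet t \<omega>)) < score_norm2 t \<omega>} \<le> 1 / real T"
    (is "prob ?B \<le> _")
proof (cases "\<sigma>bar = 0")
  case True
  have "AE \<omega> in M. \<forall>s\<in>{1..t}. \<epsilon> s \<omega> = 0"
  proof (intro AE_finite_allI)
    fix s assume "s \<in> {1..t}"
    then have s: "s \<in> {1..T}" using t by auto
    have "0 \<le> (\<integral>\<omega>. (\<epsilon> s \<omega>)\<^sup>2 \<partial>M)" by (rule Bochner_Integration.integral_nonneg) simp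
    moreover have "(\<integral>\<omega>. (\<epsilon> s \<omega>)\<^sup>2 \<partial>M) \<le> 0" using eps_second_moment[OF s] True by simp
    ultimately have "(\<integral>\<omega>. (\<epsilon> s \<omega>)\<^sup>2 \<partial>M) = 0" by (rule antisym[rotated])
    then have "AE \<omega> in M. (\<epsilon> s \<omega>)\<^sup>2 = 0"
      using eps_square_integrable_M[OF s] by (subst (asm) integral_nonneg_eq_0_iff_AE) auto
    then show "AE \<omega> in M. \<epsilon> s \<omega> = 0" by auto
  qed simp
  then have "AE \<omega> in M. \<not> (\<sigma>bar\<^sup>2 * (2 * ln (real T) + ln (ddet t \<omega>)) < score_norm2 t \<omega>)"
    by eventually_elim (simp add: True score_norm2_def score_def)
  then have "prob ?B = 0"
    by (intro prob_eq_0_AE) auto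
  then show ?thesis by simp
next
  case False
  then have s0: "\<sigma>bar\<^sup>2 > 0" by simp
  define \<kappa> where "\<kappa> = 1 / \<sigma>bar\<^sup>2"
  have \<kappa>: "0 \<le> \<kappa>" "\<kappa> * \<sigma>bar\<^sup>2 \<le> 1" using s0 by (simp_all add: \<kappa>_def)
  have T0: "real T > 0" using T by simp
  note [measurable] = score_norm2_measurable_M[OF t] ddet_measurable_M[OF t]
  have B [measurable]: "?B \<in> sets M" by measurable
  have "ennreal (real T) * emeasure M ?B = (\<integral>\<^sup>+\<omega>. ennreal (real T) * indicator ?B \<omega> \<partial>M)"
    by (simp add: nn_integral_cmult_indicator)
  also have "\<dots> \<le> (\<integral>\<^sup>+\<omega>. ennreal (exp (\<kappa> / 2 * score_norm2 t \<omega>) / sqrt (ddet t \<omega>)) \<partial>M)"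
  proof (rule nn_integral_mono)
    fix \<omega>
    show "ennreal (real T) * indicator ?B \<omega> \<le> ennreal (exp (\<kappa> / 2 * score_norm2 t \<omega>) / sqrt (ddet t \<omega>))"
    proof (cases "\<omega> \<in> ?B")
      case True
      have d: "ddet t \<omega> \<ge> 1" by (rule det_design_ge_1)
      have "2 * ln (real T) + ln (ddet t \<omega>) \<le> \<kappa> * score_norm2 t \<omega>"
        using True s0 by (simp add: \<kappa>_def field_simps)
      then have "exp (ln (real T) + ln (ddet t \<omega>) / 2) \<le> exp (\<kappa> / 2 * score_norm2 t \<omega>)" by simp
      also have "exp (ln (real T) + ln (ddet t \<omega>) / 2) = real T * sqrt (ddet t \<omega>)"
        using T0 d by (simp add: exp_add ln_sqrt[symmetric])
      finally have "real T \<le> exp (\<kappa> / 2 * score_norm2 t \<omega>) / sqrt (ddet t \<omega>)"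
        using d by (simp add: field_simps)
      then show ?thesis using True by (simp add: ennreal_leI)
    qed simp
  qed
  also have "\<dots> \<le> 1" by (rule exp_score_integral_le[OF \<kappa> t])
  finally have "ennreal (real T * prob ?B) \<le> ennreal 1"
    by (simp add: emeasure_eq_measure ennreal_mult)
  then have "real T * prob ?B \<le> 1" by (subst (asm) ennreal_le_iff) auto
  then show ?thesis using T0 by (simp add: field_simps)
qed

end

subsection \<open>Confidence along a run\<close>

lemma stock_measurable:
  assumes "\<And>s. s \<in> {1..<t} \<Longrightarrow> D s \<in> borel_measurable N"
  shows "(\<lambda>\<omega>. stock C (\<lambda>s. D s \<omega>) t) \<in> borel_measurable N"
  using assms
proof (induction t)
  case (Suc t)
  show ?case
  proof (cases "t = 0")
    case False
    then have [measurable]: "D t \<in> borel_measurable N" "(\<lambda>\<omega>. stock C (\<lambda>s. D s \<omega>) t) \<in> borel_measurable N"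
      using Suc by auto
    show ?thesis using False by (simp add: sale_def)
  qed simp
qed simp

lemma dual_measurable:
  assumes "\<And>s. s \<in> {1..<t} \<Longrightarrow> D s \<in> borel_measurable N" "0 \<le> pbar"
  shows "(\<lambda>\<omega>. dual h c pbar (\<lambda>s. D s \<omega>) t) \<in> borel_measurable N"
  using assms(1)
proof (induction t)
  case (Suc t)
  show ?case
  proof (cases "t = 0")
    case False
    then have [measurable]: "D t \<in> borel_measurable N" "(\<lambda>\<omega>. dual h c pbar (\<lambda>s. D s \<omega>) t) \<in> borel_measurable N"
      using Suc by auto
    have [measurable]: "closest_point {0..pbar} \<in> borel_measurable borel"
      using assms(2) by (intro borel_measurable_continuous_onI continuous_on_closest_point) auto
    show ?thesis using False by simp
  qed simp
qed simp

lemma active_cutoff: "\<exists>N\<le>T. \<forall>t\<in>{1..T}. active C D t = (if t \<le> N then 1 else 0)"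
proof (induction T)
  case (Suc T)
  then obtain N where N: "N \<le> T" "\<And>t. t \<in> {1..T} \<Longrightarrow> active C D t = (if t \<le> N then 1 else 0)" by auto
  show ?case
  proof (cases "active C D (Suc T) = 1")
    case True
    then show ?thesis
      by (intro exI[of _ "Suc T"]) (auto intro: active_prefix)
  next
    case False
    then have "active C D (Suc T) = 0" using active_01 by blast
    then show ?thesis using N by (intro exI[of _ N]) (auto simp: le_Suc_eq)
  qed
qed simp

lemma Y_matrix_nth: "Y_matrix x $ k $ j =
    (case k of Inl i \<Rightarrow> (if j = 1 then x $ i else 0) | Inr i \<Rightarrow> (if j = 1 then 0 else x $ i))"
  by (auto simp: Y_matrix_def stack_def split: sum.split)

text \<open>Every ingredient is an explicit expression in measurable entries, the matrix root by the
  closed form of \<open>psd_sqrt_2\<close>.\<close>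

lemma sampled_coeffs_measurable:
  fixes x :: "nat \<Rightarrow> 'b \<Rightarrow> real^'n::finite" and \<theta> :: "'b \<Rightarrow> real^('n + 'n)" and y :: "'b \<Rightarrow> real^2"
  assumes x: "\<And>s. s \<in> {1..t} \<Longrightarrow> x s \<in> borel_measurable N" and p: "\<And>s. s \<in> {1..<t} \<Longrightarrow> p s \<in> borel_measurable N"
    and \<theta>: "\<theta> \<in> borel_measurable N" and y: "y \<in> borel_measurable N" and t: "t \<ge> 1"
  shows "(\<lambda>\<omega>. sampled_coeffs 1 \<gamma> (\<lambda>s. x s \<omega>) (\<lambda>s. p s \<omega>) (\<theta> \<omega>) (y \<omega>) t $ i) \<in> borel_measurable N"
proof -
  define W where "W \<omega> = inv_design (\<lambda>s. x s \<omega>) (\<lambda>s. p s \<omega>) (t - 1)" for \<omega>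
  define A where "A \<omega> = transpose (Y_matrix (x t \<omega>)) ** W \<omega> ** Y_matrix (x t \<omega>)" for \<omega>
  have W: "(\<lambda>\<omega>. W \<omega> $ i $ j) \<in> borel_measurable N" for i j
    unfolding W_def using x p by (intro inv_design_measurable) auto
  have xt: "x t \<in> borel_measurable N" using x t by auto
  have Y: "(\<lambda>\<omega>. Y_matrix (x t \<omega>) $ k $ j) \<in> borel_measurable N" for k j
    using vec_nth_measurable[OF xt] by (cases k) (auto simp: Y_matrix_nth)
  have A: "(\<lambda>\<omega>. A \<omega> $ i $ j) \<in> borel_measurable N" for i j
    unfolding A_def matrix_matrix_mult_def transpose_def vec_lambda_beta
    by (intro borel_measurable_sum borel_measurable_times W Y)
  have sq: "psd_sqrt (A \<omega>) = (let \<delta> = sqrt (A \<omega> $ 1 $ 1 * A \<omega> $ 2 $ 2 - A \<omega> $ 1 $ 2 * A \<omega> $ 1 $ 2);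
      \<tau> = sqrt (A \<omega> $ 1 $ 1 + A \<omega> $ 2 $ 2 + 2 * \<delta>) in
      (\<chi> i j. (A \<omega> $ i $ j + (if i = j then \<delta> else 0)) / \<tau>))" for \<omega>
  proof -
    have "transpose (A \<omega>) = A \<omega>"
      using transpose_matrix_inv[OF dominates_id_design[of "\<lambda>s. x s \<omega>" "\<lambda>s. p s \<omega>" "t - 1"]]
      by (simp add: A_def matrix_transpose_mul W_def inv_design_def matrix_mul_assoc)
    moreover have "0 \<le> u \<bullet> (A \<omega> *v u)" for u
    proof -
      have "u \<bullet> (A \<omega> *v u) = (Y_matrix (x t \<omega>) *v u) \<bullet> (W \<omega> *v (Y_matrix (x t \<omega>) *v u))"
        unfolding A_def matrix_vector_mul_assoc[symmetric]
        using dot_lmul_matrix[of u "transpose (Y_matrix (x t \<omega>))" "W \<omega> *v (Y_matrix (x t \<omega>) *v u)"] by simp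
      then show ?thesis
        unfolding W_def inv_design_def by (simp add: matrix_inv_quad_nonneg[OF dominates_id_design])
    qed
    ultimately show ?thesis unfolding Let_def by (rule psd_sqrt_2(1))
  qed
  have Q: "(\<lambda>\<omega>. psd_sqrt (A \<omega>) $ i $ j) \<in> borel_measurable N" for i j
    unfolding sq Let_def vec_lambda_beta using A by measurable
  have ab: "(\<lambda>\<omega>. x t \<omega> \<bullet> alpha_part (\<theta> \<omega>)) \<in> borel_measurable N" "(\<lambda>\<omega>. x t \<omega> \<bullet> beta_part (\<theta> \<omega>)) \<in> borel_measurable N"
    unfolding inner_vec_def alpha_part_def beta_part_def vec_lambda_beta inner_real_def
    by (intro borel_measurable_sum borel_measurable_times vec_nth_measurable xt \<theta>)+
  have eq: "sampled_coeffs 1 \<gamma> (\<lambda>s. x s \<omega>) (\<lambda>s. p s \<omega>) (\<theta> \<omega>) (y \<omega>) t $ i =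
     (if i = 1 then x t \<omega> \<bullet> alpha_part (\<theta> \<omega>) else x t \<omega> \<bullet> beta_part (\<theta> \<omega>))
      + \<gamma> * (\<Sum>j\<in>UNIV. psd_sqrt (A \<omega>) $ i $ j * y \<omega> $ j)" for \<omega>
    using exhaust_2[of i]
    by (auto simp: sampled_coeffs_def A_def W_def inv_design_def matrix_vector_mult_def)
  show ?thesis unfolding eq
    by (intro borel_measurable_add borel_measurable_times borel_measurable_sum Q vec_nth_measurable y
        borel_measurable_const) (use ab in auto)
qed

section \<open>Scales, dual path and typical sample paths\<close>

context inventory_model
begin

definition expl :: real where "expl = explore_scale 1 \<theta>bar \<sigma>bar glow CARD('n) T"

definition logdim :: real where "logdim = 2 * real CARD('n) * ln ((2 * real CARD('n) + real T) / (2 * real CARD('n)))"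

definition rho0 :: real where "rho0 = sqrt (ln (4 * real T ^ 2))"

text \<open>The noise \<open>\<eta>\<^sub>t\<close> exceeds \<open>rho\<close> in norm with probability at most \<open>1 / T\<close>.\<close>

definition rho :: real where "rho = sqrt 2 * rho0"

text \<open>\<open>Theta_enlarged\<close> contains the ball of this radius.\<close>

definition radius :: real where "radius = \<theta>bar + 2 * expl * rho0"

definition run :: "nat \<Rightarrow> 'a \<Rightarrow> real" where "run t \<omega> = active C (Ds \<omega>) t"

definition mu :: "nat \<Rightarrow> 'a \<Rightarrow> real" where
  "mu t \<omega> = dual (pbar / sqrt ((Dbar\<^sup>2 + \<sigma>bar\<^sup>2) * real T)) c pbar (Ds \<omega>) t"

text \<open>The function \<open>f_m\<close> of the overview. Prices below \<open>m\<close> are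
  excluded; their margin would be negative.\<close>

definition fval :: "real \<Rightarrow> real^'n \<Rightarrow> real" where
  "fval m x = best plo pbar m (\<lambda>q. (q - m) * g (lin_index \<theta>star x q))"

definition gt :: "nat \<Rightarrow> 'a \<Rightarrow> real" where "gt t \<omega> = g (lin_index \<theta>star (X t \<omega>) (p t \<omega>))"

definition typical :: "'a \<Rightarrow> bool" where
  "typical \<omega> \<longleftrightarrow> (\<forall>t\<in>{1..T}. X t \<omega> \<in> XX) \<and> inventory_TS g glow \<theta>bar \<sigma>bar Dbar plo pbar T C 1
           (xs \<omega>) (Ds \<omega>) (\<lambda>t. \<eta> t \<omega>) (\<lambda>t. \<theta>hat t \<omega>) (ps \<omega>)"

lemma AE_X:
  assumes t: "t \<in> {1..T}"
  shows "AE \<omega> in M. X t \<omega> \<in> XX"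
  by (rule AE_distrD[OF X_meas[OF t]]) (unfold X_law[OF t], rule X_supp[OF t])

lemma AE_typical: "AE \<omega> in M. typical \<omega>"
proof -
  have "AE \<omega> in M. \<forall>t\<in>{1..T}. X t \<omega> \<in> XX" by (intro AE_finite_allI AE_X) auto
  then show ?thesis using algorithm by eventually_elim (simp add: typical_def)
qed

lemma XX_nonempty: "XX \<noteq> {}"
proof
  assume "XX = {}"
  then have "AE \<omega> in M. False" using AE_X[of 1] T by auto
  then show False by simp
qed

lemma pbar_nonneg: "0 \<le> pbar" using prices by simp

lemma c_pos: "0 < c" and Dbar_pos: "0 < Dbar"
proof -
  obtain x where x: "x \<in> XX" using XX_nonempty by blast
  have "0 \<le> g (lin_index \<theta>star x pbar)" using g_bounded[OF x, of pbar] prices by auto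
  then show "0 < c" using feasible[OF x] by simp
  then show "0 < Dbar" using c by simp
qed

lemma T_pos: "0 < real T" using T by simp

lemma C_div_T: "C / real T = c" using C T_pos by simp

lemma C_pos: "0 < C" using C c_pos T_pos by simp

text \<open>From \<open>T \<ge> 6\<close>, as \<open>exp 4 \<le> 81 \<le> 144\<close>. It yields
  \<open>rho0 \<ge> 2\<close> and \<open>rho\<^sup>2 \<ge> 8\<close>, the radius that the boxes of
  \<open>std_normal_halfplane_ge\<close> need.\<close>

lemma ln_4T2: "4 \<le> ln (4 * real T ^ 2)"
proof -
  have "exp 4 = exp (1::real) ^ 4" by (simp add: exp_of_nat_mult[symmetric])
  also have "\<dots> \<le> 3 ^ 4" by (intro power_mono exp_le) auto
  also have "\<dots> \<le> 4 * 6 ^ 2" by simp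
  also have "\<dots> \<le> 4 * real T ^ 2" using T by (intro mult_left_mono power_mono) auto
  finally show ?thesis using T_pos by (subst ln_ge_iff) auto
qed

lemma rho0_ge: "2 \<le> rho0"
  unfolding rho0_def using ln_4T2 by (intro real_le_rsqrt) auto

lemma rho_sq: "rho\<^sup>2 = 2 * ln (4 * real T ^ 2)"
  using ln_4T2 by (simp add: rho_def rho0_def power_mult_distrib)

lemma rho_le: "rho \<le> 2 * rho0 - 1/2" and rho_ge: "2 \<le> rho" and rho_sq_ge: "8 \<le> rho\<^sup>2"
proof -
  have s: "1 \<le> sqrt 2" "sqrt 2 \<le> 3 / 2"
    using real_le_lsqrt[of "3 / 2" 2] by (auto simp: power2_eq_square)
  have "sqrt 2 * rho0 \<le> 3 / 2 * rho0" using s rho0_ge by (intro mult_right_mono) auto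
  then show "rho \<le> 2 * rho0 - 1/2" using rho0_ge unfolding rho_def by linarith
  have "1 * rho0 \<le> sqrt 2 * rho0" using s rho0_ge by (intro mult_right_mono) auto
  then show "2 \<le> rho" using rho0_ge unfolding rho_def by linarith
  show "8 \<le> rho\<^sup>2" using ln_4T2 by (simp add: rho_sq)
qed

lemma logdim_nonneg: "0 \<le> logdim"
  unfolding logdim_def by (intro mult_nonneg_nonneg ln_ge_zero) auto

lemma expl_eq: "expl = 2 * \<theta>bar + 2 * \<sigma>bar / glow * sqrt (2 * ln (real T) + logdim)"
  by (simp add: expl_def explore_scale_def logdim_def)

lemma lnT_nonneg: "0 \<le> ln (real T)" using T by simp

lemma expl_ge: "2 * \<theta>bar \<le> expl" and expl_pos: "0 < expl"
proof -
  show "2 * \<theta>bar \<le> expl" unfolding expl_eq using sigma_bar glow lnT_nonneg logdim_nonneg by simp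
  then show "0 < expl" using theta_bar by linarith
qed

text \<open>The slope bounds are given at indices of enlarged parameters but needed on an interval
  of real numbers. A number \<open>u\<close> of this size is the index of the parameter
  \<open>u z / |z|^2\<close>, whose norm is at most \<open>radius\<close>; pulling that parameter
  back radially to norm \<open>\<theta>bar\<close> costs at most the allowed distance
  \<open>2 * expl * rho0\<close>.\<close>

lemma deriv_bounds:
  assumes x: "x \<in> XX" and q: "q \<in> {plo..pbar}" and u: "\<bar>u\<bar> \<le> norm (stack x (q *\<^sub>R x)) * radius"
  shows "glow \<le> deriv g u \<and> deriv g u \<le> gbar"
proof -
  define z where "z = stack x (q *\<^sub>R x)"
  define \<theta> where "\<theta> = (u / (norm z)\<^sup>2) *\<^sub>R z"
  have r0: "0 \<le> radius" using theta_bar expl_pos rho0_ge by (simp add: radius_def)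
  have zu: "lin_index \<theta> x q = u"
  proof (cases "z = 0")
    \<comment> \<open>For \<open>z = 0\<close> the assumed bound forces \<open>u = 0\<close>, and
      every index is \<open>0\<close>.\<close>
    case True
    then show ?thesis using u unfolding inner_stack[symmetric] by (simp add: z_def[symmetric])
  next
    case False
    then show ?thesis unfolding inner_stack[symmetric] z_def[symmetric] \<theta>_def
      by (simp add: power2_norm_eq_inner)
  qed
  have n\<theta>: "norm \<theta> \<le> radius"
  proof (cases "z = 0")
    case True
    then show ?thesis using r0 by (simp add: \<theta>_def)
  next
    case False
    have "norm \<theta> = \<bar>u\<bar> / norm z" using False by (simp add: \<theta>_def power2_eq_square)
    also have "\<dots> \<le> radius" using u False by (simp add: z_def[symmetric] divide_le_eq mult.commute)
    finally show ?thesis .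
  qed
  define \<theta>' where "\<theta>' = (if norm \<theta> \<le> \<theta>bar then \<theta> else (\<theta>bar / norm \<theta>) *\<^sub>R \<theta>)"
  have "norm \<theta>' \<le> \<theta>bar" using theta_bar by (auto simp: \<theta>'_def)
  moreover have "norm (\<theta> - \<theta>') \<le> 2 * expl * rho0"
  proof (cases "norm \<theta> \<le> \<theta>bar")
    case True
    then show ?thesis using expl_pos rho0_ge by (simp add: \<theta>'_def)
  next
    case False
    then have "norm \<theta> > 0" using theta_bar by linarith
    have "\<theta> - \<theta>' = (1 - \<theta>bar / norm \<theta>) *\<^sub>R \<theta>" using False by (simp add: \<theta>'_def algebra_simps)
    then have "norm (\<theta> - \<theta>') = \<bar>1 - \<theta>bar / norm \<theta>\<bar> * norm \<theta>" by simp
    also have "\<dots> = norm \<theta> - \<theta>bar" using False \<open>norm \<theta> > 0\<close> by (simp add: abs_if field_simps)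
    finally show ?thesis using n\<theta> by (simp add: radius_def)
  qed
  moreover have "2 * expl * rho0 = 4 * \<theta>bar * sqrt (ln (4 * real T ^ 2)) + 4 * \<sigma>bar / glow *
       sqrt ((2 * ln (real T) + 2 * real CARD('n) * ln ((2 * real CARD('n) + real T) / (2 * real CARD('n))))
                  * ln (4 * real T ^ 2))"
    unfolding expl_eq rho0_def logdim_def real_sqrt_mult by (simp add: algebra_simps)
  ultimately have "\<theta> \<in> Theta_enlarged \<theta>bar \<sigma>bar glow T"
    unfolding Theta_enlarged_def Let_def by auto
  from g_deriv[OF x this q] show ?thesis by (simp add: zu)
qed

lemma gbar_ge: "glow \<le> gbar"
proof -
  obtain x where x: "x \<in> XX" using XX_nonempty by blast
  have "0 \<le> radius" using theta_bar expl_pos rho0_ge by (simp add: radius_def)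
  then show ?thesis using deriv_bounds[OF x, of pbar 0] prices by auto
qed

lemma gbar_pos: "0 < gbar" using gbar_ge glow by linarith

text \<open>The mean value theorem; the symmetric interval of radius \<open>b\<close> contains every
  point between two of its members.\<close>

lemma g_slope:
  assumes der: "\<And>z. \<bar>z\<bar> \<le> b \<Longrightarrow> glow \<le> deriv g z \<and> deriv g z \<le> gbar" and uv: "\<bar>u\<bar> \<le> b" "\<bar>v\<bar> \<le> b"
  shows "\<bar>g u - g v\<bar> \<le> gbar * \<bar>u - v\<bar>" and "glow * (u - v)\<^sup>2 \<le> (g u - g v) * (u - v)"
proof -
  have D: "(g has_real_derivative deriv g z) (at z)" for z
    using g_diff[of z] by (simp add: DERIV_deriv_iff_real_differentiable)
  have "\<exists>z. \<bar>z\<bar> \<le> b \<and> g u - g v = (u - v) * deriv g z"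
  proof (cases u v rule: linorder_cases)
    case less
    from MVT2[OF less, of g "deriv g"] D obtain z where z: "u < z" "z < v" "g v - g u = (v - u) * deriv g z" by blast
    then show ?thesis using uv by (intro exI[of _ z]) (auto simp: algebra_simps)
  next
    case equal
    then show ?thesis using uv by auto
  next
    case greater
    from MVT2[OF greater, of g "deriv g"] D obtain z where z: "v < z" "z < u" "g u - g v = (u - v) * deriv g z" by blast
    then show ?thesis using uv by (intro exI[of _ z]) auto
  qed
  then obtain z where z: "\<bar>z\<bar> \<le> b" "g u - g v = (u - v) * deriv g z" by blast
  have dz: "glow \<le> deriv g z" "deriv g z \<le> gbar" using der[OF z(1)] by auto
  show "\<bar>g u - g v\<bar> \<le> gbar * \<bar>u - v\<bar>"
    unfolding z(2) abs_mult using dz glow by (simp add: mult.commute[of gbar] mult_left_mono)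
  have "glow * (u - v)\<^sup>2 \<le> deriv g z * (u - v)\<^sup>2" using dz by (intro mult_right_mono) auto
  then show "glow * (u - v)\<^sup>2 \<le> (g u - g v) * (u - v)"
    unfolding z(2) by (simp add: power2_eq_square mult_ac)
qed

lemma run_01: "run t \<omega> = 0 \<or> run t \<omega> = 1"
  by (simp add: run_def active_01)

lemma run_nonneg [simp]: "0 \<le> run t \<omega>" and run_le_1 [simp]: "run t \<omega> \<le> 1"
  by (simp_all add: run_def)

lemma mu_range: "mu t \<omega> \<in> {0..pbar}"
  unfolding mu_def by (rule dual_range[OF pbar_nonneg])

lemma typical_run:
  assumes ty: "typical \<omega>" and t: "t \<in> {1..T}" and r: "run t \<omega> = 1"
  shows typical_X: "X t \<omega> \<in> XX"
    and typical_argmax: "is_arg_max (mle_objective g glow 1 (xs \<omega>) (Ds \<omega>) (ps \<omega>) (t - 1)) (\<lambda>\<theta>. norm \<theta> \<le> \<theta>bar) (\<theta>hat (t - 1) \<omega>)"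
    and typical_price: "is_arg_max (\<lambda>q. (q - mu t \<omega>) *
         g (sampled_coeffs 1 expl (xs \<omega>) (ps \<omega>) (\<theta>hat (t - 1) \<omega>) (\<eta> t \<omega>) t $ 1
            + sampled_coeffs 1 expl (xs \<omega>) (ps \<omega>) (\<theta>hat (t - 1) \<omega>) (\<eta> t \<omega>) t $ 2 * q))
        (\<lambda>q. q \<in> {max (mu t \<omega>) plo..pbar}) (p t \<omega>)"
    and typical_range: "p t \<omega> \<in> {plo..pbar}" "mu t \<omega> \<le> p t \<omega>"
    and typical_feat: "norm (feat (xs \<omega>) (ps \<omega>) t) \<le> 1"
proof -
  show X: "X t \<omega> \<in> XX" using ty t by (simp add: typical_def)
  have st: "stock C (Ds \<omega>) t > 0" using r by (simp add: run_def active_def split: if_splits)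
  note ts = ty[unfolded typical_def inventory_TS_def Let_def, THEN conjunct2, rule_format, OF t st]
  show "is_arg_max (mle_objective g glow 1 (xs \<omega>) (Ds \<omega>) (ps \<omega>) (t - 1)) (\<lambda>\<theta>. norm \<theta> \<le> \<theta>bar) (\<theta>hat (t - 1) \<omega>)"
    using ts by simp
  have I: "q \<in> {mu t \<omega>..pbar} \<inter> {plo..pbar} \<longleftrightarrow> q \<in> {max (mu t \<omega>) plo..pbar}" for q by auto
  show am: "is_arg_max (\<lambda>q. (q - mu t \<omega>) *
         g (sampled_coeffs 1 expl (xs \<omega>) (ps \<omega>) (\<theta>hat (t - 1) \<omega>) (\<eta> t \<omega>) t $ 1
            + sampled_coeffs 1 expl (xs \<omega>) (ps \<omega>) (\<theta>hat (t - 1) \<omega>) (\<eta> t \<omega>) t $ 2 * q))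
        (\<lambda>q. q \<in> {max (mu t \<omega>) plo..pbar}) (p t \<omega>)"
    using conjunct2[OF ts] unfolding mu_def[symmetric] C_div_T expl_def[symmetric] I by simp
  then show pr: "p t \<omega> \<in> {plo..pbar}" "mu t \<omega> \<le> p t \<omega>" by (auto simp: is_arg_max_def)
  show "norm (feat (xs \<omega>) (ps \<omega>) t) \<le> 1" unfolding feat_def by (rule z_bounded[OF X pr(1)])
qed

lemma run_before:
  assumes "run t \<omega> = 1" "1 \<le> s" "s \<le> t"
  shows "run s \<omega> = 1"
  using active_prefix[of C "Ds \<omega>" t s] assms by (simp add: run_def)

lemma confidence:
  assumes ty: "typical \<omega>" and t: "t \<in> {1..T}" and r: "run t \<omega> = 1"
    and good: "score_norm2 (t - 1) \<omega> \<le> \<sigma>bar\<^sup>2 * (2 * ln (real T) + ln (ddet (t - 1) \<omega>))"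
  shows "sqrt ((\<theta>star - \<theta>hat (t - 1) \<omega>) \<bullet> (design_matrix 1 (xs \<omega>) (ps \<omega>) (t - 1) *v (\<theta>star - \<theta>hat (t - 1) \<omega>))) \<le> expl / 2"
proof -
  \<comment> \<open>Since the season is open in round \<open>t\<close>, all earlier rounds obeyed
    the pricing rule, so their features are bounded and the slope bounds apply.\<close>
  have s: "s \<in> {1..T}" "run s \<omega> = 1" if "s \<in> {1..t - 1}" for s
    using that t run_before[OF r, of s] by auto
  have "sqrt ((\<theta>star - \<theta>hat (t - 1) \<omega>) \<bullet> (design_matrix 1 (xs \<omega>) (ps \<omega>) (t - 1) *v (\<theta>star - \<theta>hat (t - 1) \<omega>))) \<le>
      \<theta>bar + sqrt ((\<Sum>s=1..t - 1. \<epsilon> s \<omega> *\<^sub>R feat (xs \<omega>) (ps \<omega>) s) \<bullet>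
        (inv_design (xs \<omega>) (ps \<omega>) (t - 1) *v (\<Sum>s=1..t - 1. \<epsilon> s \<omega> *\<^sub>R feat (xs \<omega>) (ps \<omega>) s))) / glow"
  proof (rule confidence_ellipsoid[OF g_cont glow typical_argmax[OF ty t r] theta_star])
    show "D s \<omega> = g (feat (xs \<omega>) (ps \<omega>) s \<bullet> \<theta>star) + \<epsilon> s \<omega>" for s by (simp add: demand feat_inner)
    show "glow * (u - v)\<^sup>2 \<le> (g u - g v) * (u - v)"
      if sI: "s \<in> {1..t - 1}" and u: "\<bar>u\<bar> \<le> norm (feat (xs \<omega>) (ps \<omega>) s) * \<theta>bar"
        and v: "\<bar>v\<bar> \<le> norm (feat (xs \<omega>) (ps \<omega>) s) * \<theta>bar" for s u v
    proof (rule g_slope(2)[OF _ u v])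
      fix z :: real assume "\<bar>z\<bar> \<le> norm (feat (xs \<omega>) (ps \<omega>) s) * \<theta>bar"
      also have "\<dots> \<le> norm (feat (xs \<omega>) (ps \<omega>) s) * radius"
        using expl_pos rho0_ge by (intro mult_left_mono) (auto simp: radius_def)
      finally show "glow \<le> deriv g z \<and> deriv g z \<le> gbar"
        unfolding feat_def by (rule deriv_bounds[OF typical_X[OF ty s[OF sI]] typical_range(1)[OF ty s[OF sI]]])
    qed
  qed
  also have "\<dots> = \<theta>bar + sqrt (score_norm2 (t - 1) \<omega>) / glow" by (simp add: score_norm2_def score_def)
  also have "\<dots> \<le> \<theta>bar + (\<sigma>bar * sqrt (2 * ln (real T) + logdim)) / glow"
  proof -
    have "ln (ddet (t - 1) \<omega>) \<le> logdim"
      unfolding logdim_def using t typical_feat[OF ty s] by (intro ln_det_design_le) auto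
    then have "score_norm2 (t - 1) \<omega> \<le> \<sigma>bar\<^sup>2 * (2 * ln (real T) + logdim)"
      by (intro order_trans[OF good] mult_left_mono) auto
    then have "sqrt (score_norm2 (t - 1) \<omega>) \<le> sqrt (\<sigma>bar\<^sup>2 * (2 * ln (real T) + logdim))" by (rule real_sqrt_le_mono)
    also have "\<dots> = \<sigma>bar * sqrt (2 * ln (real T) + logdim)" using sigma_bar by (simp add: real_sqrt_mult)
    finally show ?thesis using glow by (intro add_left_mono divide_right_mono) auto
  qed
  \<comment> \<open>The exploration scale is defined as twice this radius; the other half is the
    room left for optimism.\<close>
  also have "\<dots> = expl / 2" by (simp add: expl_eq)
  finally show ?thesis .
qed

lemma sum_run_width2_le:
  assumes ty: "typical \<omega>"
  shows "(\<Sum>t=1..T. run t \<omega> * width2 (xs \<omega>) (ps \<omega>) t) \<le> 2 * logdim"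
proof -
  \<comment> \<open>The active rounds form an initial segment, so the weighted sum is an unweighted
    one to which the potential argument applies.\<close>
  obtain N where N: "N \<le> T" "\<And>t. t \<in> {1..T} \<Longrightarrow> run t \<omega> = (if t \<le> N then 1 else 0)"
    using active_cutoff[of T C "Ds \<omega>"] unfolding run_def by blast
  have "(\<Sum>t=1..T. run t \<omega> * width2 (xs \<omega>) (ps \<omega>) t) = (\<Sum>t=1..N. width2 (xs \<omega>) (ps \<omega>) t)"
    using N by (intro sum.mono_neutral_cong_right) auto
  also have feat1: "norm (feat (xs \<omega>) (ps \<omega>) s) \<le> 1" if "s \<in> {1..N}" for s
    using that N by (intro typical_feat[OF ty]) auto
  then have "(\<Sum>t=1..N. width2 (xs \<omega>) (ps \<omega>) t) \<le> 2 * ln (ddet N \<omega>)" by (rule sum_width2_le)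
  also have "\<dots> \<le> 2 * logdim"
    unfolding logdim_def using ln_det_design_le[OF feat1 N(1)] by simp
  finally show ?thesis .
qed

lemma sum_run_width_le:
  assumes ty: "typical \<omega>"
  shows "(\<Sum>t=1..T. run t \<omega> * sqrt (width2 (xs \<omega>) (ps \<omega>) t)) \<le> sqrt (2 * real T * logdim)"
proof (rule real_le_rsqrt)
  have "(\<Sum>t=1..T. run t \<omega> * sqrt (width2 (xs \<omega>) (ps \<omega>) t))\<^sup>2 =
      (\<Sum>t=1..T. 1 * (run t \<omega> * sqrt (width2 (xs \<omega>) (ps \<omega>) t)))\<^sup>2" by simp
  also have "\<dots> \<le> (\<Sum>t=1..T. 1\<^sup>2) * (\<Sum>t=1..T. (run t \<omega> * sqrt (width2 (xs \<omega>) (ps \<omega>) t))\<^sup>2)"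
    by (rule Cauchy_Schwarz_ineq_sum)
  also have "(\<Sum>t=1..T. (run t \<omega> * sqrt (width2 (xs \<omega>) (ps \<omega>) t))\<^sup>2) = (\<Sum>t=1..T. run t \<omega> * width2 (xs \<omega>) (ps \<omega>) t)"
  proof (rule sum.cong[OF refl])
    fix t
    have "(run t \<omega>)\<^sup>2 = run t \<omega>" using run_01[of t \<omega>] by auto
    then show "(run t \<omega> * sqrt (width2 (xs \<omega>) (ps \<omega>) t))\<^sup>2 = run t \<omega> * width2 (xs \<omega>) (ps \<omega>) t"
      by (simp add: power_mult_distrib width2_nonneg)
  qed
  also have "(\<Sum>t=1..T. 1\<^sup>2) * (\<Sum>t=1..T. run t \<omega> * width2 (xs \<omega>) (ps \<omega>) t) \<le> real T * (2 * logdim)"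
    using sum_run_width2_le[OF ty] by (simp add: mult_left_mono)
  finally show "(\<Sum>t=1..T. run t \<omega> * sqrt (width2 (xs \<omega>) (ps \<omega>) t))\<^sup>2 \<le> 2 * real T * logdim" by (simp add: mult_ac)
qed

end

subsection \<open>The price of an optimistic sample\<close>

lemma stack_split: "stack x (q *\<^sub>R x) = stack x 0 + q *\<^sub>R stack 0 x"
  by (simp add: stack_def vec_eq_iff split: sum.split)

lemma continuous_on_quad_stack:
  fixes W :: "real^('n::finite + 'n)^('n + 'n)"
  shows "continuous_on S (\<lambda>q. stack x (q *\<^sub>R x) \<bullet> (W *v stack x (q *\<^sub>R x)))"
  unfolding stack_split matrix_vector_right_distrib matrix_vector_mult_scaleR
  by (intro continuous_intros)

lemma continuous_on_lin_index: "continuous_on S (\<lambda>q. lin_index \<theta> x q)"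
  unfolding lin_index_def by (intro continuous_intros)

context inventory_model
begin

definition cen :: "nat \<Rightarrow> 'a \<Rightarrow> real \<Rightarrow> real" where "cen t \<omega> q = lin_index (\<theta>hat (t - 1) \<omega>) (X t \<omega>) q"

definition tru :: "nat \<Rightarrow> 'a \<Rightarrow> real \<Rightarrow> real" where "tru t \<omega> q = lin_index \<theta>star (X t \<omega>) q"

definition wid :: "nat \<Rightarrow> 'a \<Rightarrow> real \<Rightarrow> real" where
  "wid t \<omega> q = stack (X t \<omega>) (q *\<^sub>R X t \<omega>) \<bullet> (inv_design (xs \<omega>) (ps \<omega>) (t - 1) *v stack (X t \<omega>) (q *\<^sub>R X t \<omega>))"

text \<open>The noise is an argument, so that it can be averaged while the past is frozen.\<close>

definition smp :: "nat \<Rightarrow> 'a \<Rightarrow> real^2 \<Rightarrow> real \<Rightarrow> real" where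
  "smp t \<omega> y q = sampled_coeffs 1 expl (xs \<omega>) (ps \<omega>) (\<theta>hat (t - 1) \<omega>) y t $ 1
      + sampled_coeffs 1 expl (xs \<omega>) (ps \<omega>) (\<theta>hat (t - 1) \<omega>) y t $ 2 * q"

definition lowv :: "nat \<Rightarrow> 'a \<Rightarrow> real" where
  "lowv t \<omega> = best plo pbar (mu t \<omega>) (\<lambda>q. (q - mu t \<omega>) * g (cen t \<omega> q - expl * rho * sqrt (wid t \<omega> q)))"

definition smpv :: "nat \<Rightarrow> 'a \<Rightarrow> real^2 \<Rightarrow> real" where
  "smpv t \<omega> y = best plo pbar (mu t \<omega>) (\<lambda>q. (q - mu t \<omega>) * g (smp t \<omega> y q))"

definition err2 :: "nat \<Rightarrow> 'a \<Rightarrow> real" where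
  "err2 t \<omega> = (\<theta>star - \<theta>hat (t - 1) \<omega>) \<bullet> (design_matrix 1 (xs \<omega>) (ps \<omega>) (t - 1) *v (\<theta>star - \<theta>hat (t - 1) \<omega>))"

lemma wid_nonneg: "0 \<le> wid t \<omega> q"
  unfolding wid_def inv_design_def by (rule matrix_inv_quad_nonneg[OF dominates_id_design])

lemma wid_le: "wid t \<omega> q \<le> (norm (stack (X t \<omega>) (q *\<^sub>R X t \<omega>)))\<^sup>2"
  unfolding wid_def inv_design_def by (rule matrix_inv_quad_le[OF dominates_id_design])

lemma wid_price: "wid t \<omega> (p t \<omega>) = width2 (xs \<omega>) (ps \<omega>) t"
  by (simp add: wid_def width2_def feat_def)

lemma price_interval: "q \<in> {max (mu t \<omega>) plo..pbar} \<Longrightarrow> q \<in> {plo..pbar} \<and> mu t \<omega> \<le> q"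
  by auto

context
  fixes t :: nat and \<omega> :: 'a
  assumes ty: "typical \<omega>" and t: "t \<in> {1..T}" and r: "run t \<omega> = 1"
begin

lemma wid_le_1: "q \<in> {max (mu t \<omega>) plo..pbar} \<Longrightarrow> wid t \<omega> q \<le> 1"
  using wid_le[of t \<omega> q] z_bounded[OF typical_X[OF ty t r], of q] price_interval[of q t \<omega>]
  by (meson norm_ge_zero order_trans power_le_one)

lemma round_locale:
  assumes good: "err2 t \<omega> \<le> (expl / 2)\<^sup>2"
  shows "ts_round g plo pbar (mu t \<omega>) expl rho gbar (cen t \<omega>) (tru t \<omega>) (wid t \<omega>)"
proof
  show "strict_mono g" "continuous_on UNIV g" by (rule g_mono, rule g_cont)
  show "0 \<le> mu t \<omega>" "mu t \<omega> \<le> pbar" using mu_range[of t \<omega>] by auto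
  show "plo \<le> pbar" by (rule prices(2))
  show "0 \<le> expl" using expl_pos by simp
  show "1 / 2 \<le> rho" using rho_ge by simp
  show "continuous_on UNIV (cen t \<omega>)" "continuous_on UNIV (tru t \<omega>)" "continuous_on UNIV (wid t \<omega>)"
    unfolding cen_def[abs_def] tru_def[abs_def] wid_def[abs_def]
    by (intro continuous_on_lin_index continuous_on_quad_stack)+
  show "0 \<le> wid t \<omega> q" for q by (rule wid_nonneg)
  show "0 \<le> gbar" using gbar_pos by simp
  have X: "X t \<omega> \<in> XX" by (rule typical_X[OF ty t r])
  show "\<bar>g u - g v\<bar> \<le> gbar * \<bar>u - v\<bar>"
    if q: "q \<in> {max (mu t \<omega>) plo..pbar}" and u: "\<bar>u - cen t \<omega> q\<bar> \<le> expl * rho * sqrt (wid t \<omega> q)"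
      and v: "\<bar>v - cen t \<omega> q\<bar> \<le> expl * rho * sqrt (wid t \<omega> q)" for q u v
  proof -
    define z where "z = stack (X t \<omega>) (q *\<^sub>R X t \<omega>)"
    have nh: "norm (\<theta>hat (t - 1) \<omega>) \<le> \<theta>bar" using typical_argmax[OF ty t r] by (simp add: is_arg_max_def)
    have c: "\<bar>cen t \<omega> q\<bar> \<le> norm z * \<theta>bar"
      unfolding cen_def inner_stack[symmetric] z_def[symmetric]
      by (rule order_trans[OF Cauchy_Schwarz_ineq2]) (use nh in \<open>simp add: mult_left_mono\<close>)
    have "sqrt (wid t \<omega> q) \<le> norm z"
      using wid_le[of t \<omega> q] by (intro real_le_lsqrt) (auto simp: z_def)
    then have "expl * rho * sqrt (wid t \<omega> q) \<le> expl * rho * norm z"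
      using expl_pos rho_ge by (intro mult_left_mono) auto
    also have "\<dots> \<le> expl * (2 * rho0) * norm z"
      using expl_pos rho_le by (intro mult_right_mono mult_left_mono) auto
    finally have w: "expl * rho * sqrt (wid t \<omega> q) \<le> expl * (2 * rho0) * norm z" .
    \<comment> \<open>The centre contributes at most \<open>norm z * \<theta>bar\<close> and the
      band at most \<open>2 * expl * rho0 * norm z\<close>; the sum is the range of
      \<open>deriv_bounds\<close>.\<close>
    have b: "\<bar>y\<bar> \<le> norm z * radius" if "\<bar>y - cen t \<omega> q\<bar> \<le> expl * rho * sqrt (wid t \<omega> q)" for y
      using that c w by (simp add: radius_def algebra_simps)
    have der: "glow \<le> deriv g y \<and> deriv g y \<le> gbar" if "\<bar>y\<bar> \<le> norm z * radius" for y
      using deriv_bounds[OF X, of q y] q that by (auto simp: z_def)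
    show ?thesis by (rule g_slope(1)[OF der b[OF u] b[OF v]])
  qed
  show "\<bar>tru t \<omega> q - cen t \<omega> q\<bar> \<le> expl / 2 * sqrt (wid t \<omega> q)" for q
  proof -
    define z where "z = stack (X t \<omega>) (q *\<^sub>R X t \<omega>)"
    define \<Delta> where "\<Delta> = \<theta>star - \<theta>hat (t - 1) \<omega>"
    have "tru t \<omega> q - cen t \<omega> q = z \<bullet> \<Delta>"
      by (simp add: tru_def cen_def inner_stack[symmetric] z_def \<Delta>_def inner_diff_right)
    moreover have "(z \<bullet> \<Delta>)\<^sup>2 \<le> wid t \<omega> q * err2 t \<omega>"
      unfolding wid_def err2_def z_def \<Delta>_def inv_design_def by (rule inner_le_dual_quad[OF dominates_id_design])
    then have "(z \<bullet> \<Delta>)\<^sup>2 \<le> wid t \<omega> q * (expl / 2)\<^sup>2"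
      by (rule order_trans) (intro mult_left_mono good wid_nonneg)
    then have "sqrt ((z \<bullet> \<Delta>)\<^sup>2) \<le> sqrt (wid t \<omega> q * (expl / 2)\<^sup>2)" by (rule real_sqrt_le_mono)
    then have "\<bar>z \<bullet> \<Delta>\<bar> \<le> expl / 2 * sqrt (wid t \<omega> q)" using expl_pos by (simp add: real_sqrt_mult mult.commute)
    ultimately show ?thesis by simp
  qed
qed

lemma smp_width:
  assumes "norm y \<le> rho"
  shows "\<bar>smp t \<omega> y q - cen t \<omega> q\<bar> \<le> expl * rho * sqrt (wid t \<omega> q)"
proof -
  obtain r :: "real \<Rightarrow> real^2" where r: "\<And>q. (norm (r q))\<^sup>2 = wid t \<omega> q"
    "\<And>q y. smp t \<omega> y q = cen t \<omega> q + expl * (r q \<bullet> y)"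
    using sampled_index[of "xs \<omega>" t "ps \<omega>" expl "\<theta>hat (t - 1) \<omega>"] unfolding wid_def smp_def cen_def by blast
  have "norm (r q) = sqrt (wid t \<omega> q)" using r(1)[of q] by (metis norm_ge_zero real_sqrt_unique)
  then have "\<bar>r q \<bullet> y\<bar> \<le> sqrt (wid t \<omega> q) * rho"
    using Cauchy_Schwarz_ineq2[of "r q" y] mult_left_mono[OF assms norm_ge_zero[of "r q"]] by simp
  then have "expl * \<bar>r q \<bullet> y\<bar> \<le> expl * (sqrt (wid t \<omega> q) * rho)" using expl_pos by (intro mult_left_mono) auto
  then show ?thesis using expl_pos by (simp add: r(2) abs_mult mult_ac)
qed

lemma continuous_smp: "continuous_on S (smp t \<omega> y)"
  unfolding smp_def[abs_def] by (intro continuous_intros)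

lemma price_best: "q \<in> {max (mu t \<omega>) plo..pbar} \<Longrightarrow>
    (q - mu t \<omega>) * g (smp t \<omega> (\<eta> t \<omega>) q) \<le> (p t \<omega> - mu t \<omega>) * g (smp t \<omega> (\<eta> t \<omega>) (p t \<omega>))"
  and price_mem: "p t \<omega> \<in> {max (mu t \<omega>) plo..pbar}"
  using typical_price[OF ty t r] unfolding smp_def[symmetric] is_arg_max_def by (auto simp: not_less)

context
  assumes good: "err2 t \<omega> \<le> (expl / 2)\<^sup>2"
begin

interpretation R: ts_round g plo pbar "mu t \<omega>" expl rho gbar "cen t \<omega>" "tru t \<omega>" "wid t \<omega>"
  by (rule round_locale[OF good])

lemma val_eqs:
  "best plo pbar (mu t \<omega>) (R.val (tru t \<omega>)) = fval (mu t \<omega>) (X t \<omega>)"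
  "best plo pbar (mu t \<omega>) (R.val R.low) = lowv t \<omega>"
  "best plo pbar (mu t \<omega>) (R.val (smp t \<omega> y)) = smpv t \<omega> y"
  by (simp_all add: fval_def lowv_def smpv_def R.val_def[abs_def] R.low_def tru_def)

lemma gap_nonneg: "lowv t \<omega> \<le> fval (mu t \<omega>) (X t \<omega>)"
  using R.low_le_truth by (simp add: val_eqs)

lemma gap_bounded: "fval (mu t \<omega>) (X t \<omega>) - lowv t \<omega> \<le> pbar * gbar * (expl * (rho + 1 / 2))"
  using R.truth_minus_low_le[OF wid_le_1] by (simp add: val_eqs)

lemma round_regret_le:
  assumes "norm (\<eta> t \<omega>) \<le> rho"
  shows "fval (mu t \<omega>) (X t \<omega>) - (p t \<omega> - mu t \<omega>) * gt t \<omega> \<le>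
     (fval (mu t \<omega>) (X t \<omega>) - lowv t \<omega>) + pbar * gbar * (expl * (rho + 1/2) * sqrt (width2 (xs \<omega>) (ps \<omega>) t))"
proof -
  have "R.val (smp t \<omega> (\<eta> t \<omega>)) q \<le> R.val (smp t \<omega> (\<eta> t \<omega>)) (p t \<omega>)" if "q \<in> {max (mu t \<omega>) plo..pbar}" for q
    using price_best[OF that] by (simp add: R.val_def)
  from R.round_regret[OF continuous_smp smp_width[OF assms] price_mem this]
  show ?thesis by (simp add: val_eqs wid_price) (simp add: R.val_def tru_def gt_def)
qed

lemma optimistic_gap_le:
  assumes "norm (\<eta> t \<omega>) \<le> rho" "fval (mu t \<omega>) (X t \<omega>) \<le> smpv t \<omega> (\<eta> t \<omega>)"
  shows "fval (mu t \<omega>) (X t \<omega>) - lowv t \<omega> \<le> pbar * gbar * (2 * expl * rho * sqrt (width2 (xs \<omega>) (ps \<omega>) t))"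
proof -
  have "R.val (smp t \<omega> (\<eta> t \<omega>)) q \<le> R.val (smp t \<omega> (\<eta> t \<omega>)) (p t \<omega>)" if "q \<in> {max (mu t \<omega>) plo..pbar}" for q
    using price_best[OF that] by (simp add: R.val_def)
  from R.optimistic_gap[OF continuous_smp smp_width[OF assms(1)] price_mem this] assms(2)
  show ?thesis by (simp add: val_eqs wid_price)
qed

text \<open>It suffices to be optimistic at the truly optimal price \<open>q\<close>. There the true
  index exceeds the centre by at most \<open>expl / 2\<close> times the norm of \<open>r q\<close>,
  while the noise shifts the sampled index by \<open>expl * (r q \<bullet> y)\<close>. So a
  half-plane truncated at norm \<open>rho\<close> consists of optimistic noise.\<close>

lemma optimism_probability:
  assumes meas: "{y. fval (mu t \<omega>) (X t \<omega>) \<le> smpv t \<omega> y \<and> norm y \<le> rho} \<in> sets borel"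
  shows "ennreal (1 / 25) \<le> emeasure (density lborel std_normal2)
    {y. fval (mu t \<omega>) (X t \<omega>) \<le> smpv t \<omega> y \<and> norm y \<le> rho}"
proof -
  obtain r :: "real \<Rightarrow> real^2" where r: "\<And>q. (norm (r q))\<^sup>2 = wid t \<omega> q"
    "\<And>q y. smp t \<omega> y q = cen t \<omega> q + expl * (r q \<bullet> y)"
    using sampled_index[of "xs \<omega>" t "ps \<omega>" expl "\<theta>hat (t - 1) \<omega>"] unfolding wid_def smp_def cen_def by blast
  obtain q where q: "q \<in> {max (mu t \<omega>) plo..pbar}" "fval (mu t \<omega>) (X t \<omega>) = R.val (tru t \<omega>) q"
    using best_attained[OF R.I R.cont_val[OF R.cont(2)]] unfolding val_eqs by metis
  have nr: "norm (r q) = sqrt (wid t \<omega> q)" using r(1)[of q] by (metis norm_ge_zero real_sqrt_unique)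
  let ?H = "{y. r q \<bullet> y \<ge> norm (r q) / 2 \<and> norm y \<le> rho}"
  have sub: "?H \<subseteq> {y. fval (mu t \<omega>) (X t \<omega>) \<le> smpv t \<omega> y \<and> norm y \<le> rho}"
  proof safe
    fix y assume y: "norm (r q) / 2 \<le> r q \<bullet> y"
    have "tru t \<omega> q \<le> cen t \<omega> q + expl * (norm (r q) / 2)"
      using abs_ge_self[of "tru t \<omega> q - cen t \<omega> q"] R.good[OF q(1)] unfolding nr by (simp add: mult.commute)
    also have "\<dots> \<le> smp t \<omega> y q" unfolding r(2) using y expl_pos by simp
    finally have "R.val (tru t \<omega>) q \<le> R.val (smp t \<omega> y) q" by (rule R.val_mono[OF q(1)])
    also have "\<dots> \<le> smpv t \<omega> y"
      using best_attained[OF R.I R.cont_val[OF continuous_smp]] q(1) unfolding val_eqs by metis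
    finally show "fval (mu t \<omega>) (X t \<omega>) \<le> smpv t \<omega> y" by (simp add: q(2))
  qed
  have std [measurable]: "std_normal2 \<in> borel_measurable borel"
    using distributed_borel_measurable[OF eta_normal[OF t]] by simp
  have "ennreal (1 / 25) \<le> (\<integral>\<^sup>+y. std_normal2 y * indicator ?H y \<partial>lborel)"
    using rho_sq_ge rho_ge by (intro std_normal_halfplane_ge) auto
  also have "\<dots> \<le> (\<integral>\<^sup>+y. std_normal2 y * indicator {y. fval (mu t \<omega>) (X t \<omega>) \<le> smpv t \<omega> y \<and> norm y \<le> rho} y \<partial>lborel)"
    using sub by (intro nn_integral_mono mult_left_mono) (auto simp: indicator_def)
  also have "\<dots> = emeasure (density lborel std_normal2) {y. fval (mu t \<omega>) (X t \<omega>) \<le> smpv t \<omega> y \<and> norm y \<le> rho}"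
    using meas by (subst emeasure_density) auto
  finally show ?thesis .
qed

end

end

lemma fval_bounds:
  assumes x: "x \<in> XX" and m: "m \<in> {0..pbar}"
  shows "0 \<le> fval m x" "fval m x \<le> pbar * Dbar"
proof -
  have I: "max m plo \<le> pbar" using m prices by simp
  have cont: "continuous_on UNIV (\<lambda>q. (q - m) * g (lin_index \<theta>star x q))"
    by (intro continuous_intros continuous_on_compose2[OF g_cont continuous_on_lin_index]) auto
  obtain q where q: "q \<in> {max m plo..pbar}" "fval m x = (q - m) * g (lin_index \<theta>star x q)"
    using best_attained[OF I cont] unfolding fval_def by metis
  have "q \<in> {plo..pbar}" using q by auto
  from g_bounded[OF x this] have g: "0 \<le> g (lin_index \<theta>star x q)" "g (lin_index \<theta>star x q) \<le> Dbar" by auto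
  show "0 \<le> fval m x" unfolding q(2) using g q(1) by (intro mult_nonneg_nonneg) auto
  show "fval m x \<le> pbar * Dbar" unfolding q(2) using g q(1) m pbar_nonneg by (intro mult_mono) auto
qed

lemma gt_bounds:
  assumes "typical \<omega>" "t \<in> {1..T}" "run t \<omega> = 1"
  shows "0 \<le> gt t \<omega>" "gt t \<omega> \<le> Dbar"
  using g_bounded[OF typical_X[OF assms] typical_range(1)[OF assms]] by (auto simp: gt_def)

subsection \<open>Expected regret of a round\<close>

lemma run_info: "t \<in> {1..T} \<Longrightarrow> t - 1 \<le> i \<Longrightarrow> t - 1 \<le> j \<Longrightarrow> t - 1 \<le> k \<Longrightarrow> run t \<in> borel_measurable (info i j k)"
proof -
  assume a: "t \<in> {1..T}" "t - 1 \<le> i" "t - 1 \<le> j" "t - 1 \<le> k"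
  have [measurable]: "(\<lambda>\<omega>. stock C (Ds \<omega>) t) \<in> borel_measurable (info i j k)"
    using a by (intro stock_measurable D_info) auto
  show "run t \<in> borel_measurable (info i j k)"
    unfolding run_def[abs_def] active_def by measurable
qed

lemma mu_info: "t \<in> {1..T} \<Longrightarrow> t - 1 \<le> i \<Longrightarrow> t - 1 \<le> j \<Longrightarrow> t - 1 \<le> k \<Longrightarrow> mu t \<in> borel_measurable (info i j k)"
  unfolding mu_def[abs_def] by (intro dual_measurable D_info pbar_nonneg) auto

lemma run_M: "t \<in> {1..T} \<Longrightarrow> run t \<in> borel_measurable M" and mu_M: "t \<in> {1..T} \<Longrightarrow> mu t \<in> borel_measurable M"
  by (rule measurable_from_subalg[OF subalgebra_info[of T T T]], auto intro: run_info mu_info)+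

lemma price_at_measurable: "m \<in> borel_measurable N \<Longrightarrow> (\<lambda>u. price_at plo pbar (m u) s) \<in> borel_measurable N"
  unfolding price_at_def
  by (intro borel_measurable_add borel_measurable_times borel_measurable_diff borel_measurable_max borel_measurable_const)

lemma stack_nth_measurable:
  fixes x :: "'b \<Rightarrow> real^'n"
  assumes x: "x \<in> borel_measurable N" and [measurable]: "q \<in> borel_measurable N"
  shows "(\<lambda>u. stack (x u) (q u *\<^sub>R x u) $ k) \<in> borel_measurable N"
  using vec_nth_measurable[OF x] by (cases k) (auto simp: stack_def)

lemma best_val_measurable:
  assumes m: "m \<in> borel_measurable N"
    and h: "\<And>q. q \<in> borel_measurable N \<Longrightarrow> (\<lambda>u. h u (q u)) \<in> borel_measurable N"
    and cont: "\<And>u. continuous_on UNIV (h u)"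
  shows "(\<lambda>u. best plo pbar (m u) (\<lambda>q. (q - m u) * g (h u q))) \<in> borel_measurable N"
proof (rule borel_measurable_best)
  fix s :: real
  have q [measurable]: "(\<lambda>u. price_at plo pbar (m u) s) \<in> borel_measurable N" by (rule price_at_measurable[OF m])
  have "(\<lambda>u. g (h u (price_at plo pbar (m u) s))) \<in> borel_measurable N"
    by (rule measurable_compose[OF h[OF q] g_borel])
  then show "(\<lambda>u. (price_at plo pbar (m u) s - m u) * g (h u (price_at plo pbar (m u) s))) \<in> borel_measurable N"
    using m by measurable
  show "continuous_on UNIV (\<lambda>q. (q - m u) * g (h u q))" for u
    by (intro continuous_intros continuous_on_compose2[OF g_cont cont]) auto
qed

lemma fval_measurable:
  assumes m: "m \<in> borel_measurable N" and x: "x \<in> borel_measurable N"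
  shows "(\<lambda>u. fval (m u) (x u)) \<in> borel_measurable N"
  unfolding fval_def
  by (rule best_val_measurable[OF m lin_index_measurable[OF _ x] continuous_on_lin_index]) auto

lemma smpv_measurable:
  assumes t: "t \<in> {1..T}"
  shows "(\<lambda>u. smpv t (fst u) (snd u)) \<in> borel_measurable (info t (t - 1) (t - 1) \<Otimes>\<^sub>M borel)"
proof -
  let ?N = "info t (t - 1) (t - 1) \<Otimes>\<^sub>M (borel :: (real^2) measure)"
  have lift: "(\<lambda>u. f (fst u)) \<in> borel_measurable ?N" if "f \<in> borel_measurable (info t (t - 1) (t - 1))"
    for f :: "'a \<Rightarrow> 'x::topological_space"
    by (rule measurable_compose[OF measurable_fst that])
  have sc: "(\<lambda>u. sampled_coeffs 1 expl (xs (fst u)) (ps (fst u)) (\<theta>hat (t - 1) (fst u)) (snd u) t $ i) \<in> borel_measurable ?N" for i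
    using t by (intro sampled_coeffs_measurable[where x="\<lambda>s u. X s (fst u)" and p="\<lambda>s u. p s (fst u)"]
        lift X_info p_info theta_hat_info measurable_snd) auto
  show ?thesis unfolding smpv_def smp_def
  proof (rule best_val_measurable)
    show "(\<lambda>u. mu t (fst u)) \<in> borel_measurable ?N" using t by (intro lift mu_info) auto
    show "(\<lambda>u. sampled_coeffs 1 expl (xs (fst u)) (ps (fst u)) (\<theta>hat (t - 1) (fst u)) (snd u) t $ 1 +
        sampled_coeffs 1 expl (xs (fst u)) (ps (fst u)) (\<theta>hat (t - 1) (fst u)) (snd u) t $ 2 * q u) \<in> borel_measurable ?N"
      if "q \<in> borel_measurable ?N" for q using that sc by measurable
  qed (intro continuous_intros)
qed

lemma lowv_info:
  assumes t: "t \<in> {1..T}"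
  shows "lowv t \<in> borel_measurable (info t (t - 1) (t - 1))"
proof -
  let ?N = "info t (t - 1) (t - 1)"
  have "(\<lambda>\<omega>. best plo pbar (mu t \<omega>) (\<lambda>q. (q - mu t \<omega>) * g (cen t \<omega> q - expl * rho * sqrt (wid t \<omega> q)))) \<in> borel_measurable ?N"
  proof (rule best_val_measurable)
    show "mu t \<in> borel_measurable ?N" using t by (intro mu_info) auto
    show "(\<lambda>\<omega>. cen t \<omega> (q \<omega>) - expl * rho * sqrt (wid t \<omega> (q \<omega>))) \<in> borel_measurable ?N"
      if q: "q \<in> borel_measurable ?N" for q
    proof -
      have "(\<lambda>\<omega>. cen t \<omega> (q \<omega>)) \<in> borel_measurable ?N"
        unfolding cen_def using t by (intro lin_index_measurable theta_hat_info X_info q) auto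
      moreover have "(\<lambda>\<omega>. wid t \<omega> (q \<omega>)) \<in> borel_measurable ?N"
        unfolding wid_def using t
        by (intro quad_measurable stack_nth_measurable inv_design_measurable X_info p_info q) auto
      ultimately show ?thesis by measurable
    qed
    show "continuous_on UNIV (\<lambda>q. cen t \<omega> q - expl * rho * sqrt (wid t \<omega> q))" for \<omega>
      unfolding cen_def wid_def by (intro continuous_intros continuous_on_lin_index continuous_on_quad_stack)
  qed
  then show ?thesis by (simp add: lowv_def[abs_def])
qed

lemma err2_info:
  assumes t: "t \<in> {1..T}"
  shows "err2 t \<in> borel_measurable (info t (t - 1) (t - 1))"
proof -
  let ?N = "info t (t - 1) (t - 1)"
  have th: "\<theta>hat (t - 1) \<in> borel_measurable ?N" using t by (intro theta_hat_info) auto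
  have v: "(\<lambda>\<omega>. \<theta>star - \<theta>hat (t - 1) \<omega>) \<in> borel_measurable ?N"
    using th by (intro borel_measurable_diff) auto
  have f: "(\<lambda>\<omega>. feat (xs \<omega>) (ps \<omega>) s $ k) \<in> borel_measurable ?N" if "s \<in> {1..t - 1}" for s k
    using t that by (intro feat_nth_measurable X_info p_info) auto
  have "(\<lambda>\<omega>. feat (xs \<omega>) (ps \<omega>) s \<bullet> (\<theta>star - \<theta>hat (t - 1) \<omega>)) \<in> borel_measurable ?N" if "s \<in> {1..t - 1}" for s
    unfolding inner_vec_def inner_real_def
    by (intro borel_measurable_sum borel_measurable_times f[OF that] vec_nth_measurable v)
  then show ?thesis
    unfolding err2_def[abs_def] design_mult_vec using v by measurable
qed

text \<open>Known before the noise of round \<open>t\<close> is drawn, which permits averaging over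
  the noise against it. It is set to \<open>0\<close> after the season and off the confidence event,
  where the sign of the difference is not controlled.\<close>

definition gap :: "nat \<Rightarrow> 'a \<Rightarrow> real" where
  "gap t \<omega> = (if run t \<omega> = 1 \<and> err2 t \<omega> \<le> (expl / 2)\<^sup>2 then fval (mu t \<omega>) (X t \<omega>) - lowv t \<omega> else 0)"

lemma gap_info:
  assumes t: "t \<in> {1..T}"
  shows "gap t \<in> borel_measurable (info t (t - 1) (t - 1))"
proof -
  let ?N = "info t (t - 1) (t - 1)"
  have [measurable]: "run t \<in> borel_measurable ?N" "err2 t \<in> borel_measurable ?N" "lowv t \<in> borel_measurable ?N"
    "(\<lambda>\<omega>. fval (mu t \<omega>) (X t \<omega>)) \<in> borel_measurable ?N"
    using t by (auto intro!: run_info err2_info[OF t, simplified] lowv_info[OF t, simplified] fval_measurable mu_info X_info)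
  show ?thesis unfolding gap_def[abs_def] by measurable
qed

lemma gap_M: "t \<in> {1..T} \<Longrightarrow> gap t \<in> borel_measurable M"
  by (rule measurable_from_subalg[OF subalgebra_info gap_info]) auto

lemma width_M: "t \<in> {1..T} \<Longrightarrow> (\<lambda>\<omega>. run t \<omega> * sqrt (width2 (xs \<omega>) (ps \<omega>) t)) \<in> borel_measurable M"
proof -
  assume t: "t \<in> {1..T}"
  have [measurable]: "(\<lambda>\<omega>. width2 (xs \<omega>) (ps \<omega>) t) \<in> borel_measurable M"
    using t by (intro width2_measurable X_meas p_measurable_M) auto
  note [measurable] = run_M[OF t]
  show "(\<lambda>\<omega>. run t \<omega> * sqrt (width2 (xs \<omega>) (ps \<omega>) t)) \<in> borel_measurable M" by measurable
qed

lemma run_width_le_1: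
  assumes "typical \<omega>" "t \<in> {1..T}"
  shows "0 \<le> run t \<omega> * sqrt (width2 (xs \<omega>) (ps \<omega>) t)" "run t \<omega> * sqrt (width2 (xs \<omega>) (ps \<omega>) t) \<le> 1"
proof -
  show "0 \<le> run t \<omega> * sqrt (width2 (xs \<omega>) (ps \<omega>) t)" by (simp add: width2_nonneg)
  show "run t \<omega> * sqrt (width2 (xs \<omega>) (ps \<omega>) t) \<le> 1"
    using run_01[of t \<omega>] wid_le_1[OF assms _ price_mem[OF assms]] by (auto simp: wid_price)
qed

lemma width_integrable: "t \<in> {1..T} \<Longrightarrow> integrable M (\<lambda>\<omega>. run t \<omega> * sqrt (width2 (xs \<omega>) (ps \<omega>) t))"
  by (rule integrable_const_bound[of _ 1]) (use AE_typical run_width_le_1 in \<open>auto intro!: width_M elim!: AE_mp\<close>)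

lemma gap_range:
  assumes "typical \<omega>" "t \<in> {1..T}"
  shows "0 \<le> gap t \<omega>" "gap t \<omega> \<le> pbar * gbar * (expl * (rho + 1 / 2))"
  using gap_nonneg[OF assms] gap_bounded[OF assms] pbar_nonneg gbar_pos expl_pos rho_ge
  by (auto simp: gap_def)

lemma gap_integrable: "t \<in> {1..T} \<Longrightarrow> integrable M (gap t)"
  by (rule integrable_const_bound[of _ "pbar * gbar * (expl * (rho + 1 / 2))"])
    (use AE_typical gap_range in \<open>auto intro!: gap_M elim!: AE_mp\<close>)

lemma eta_distr:
  assumes t: "t \<in> {1..T}"
  shows "distr M borel (\<eta> t) = density lborel std_normal2"
proof -
  have "distr M borel (\<eta> t) = distr M lborel (\<eta> t)" by (rule distr_cong) auto
  then show ?thesis using distributed_distr_eq_density[OF eta_normal[OF t]] by simp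
qed

text \<open>Since the gap is fixed before the noise, its expectation is at most \<open>25\<close>
  times its expectation over the optimistic event. On that event the gap is at most a multiple of
  the width at the posted price, and dropping the event again leaves the expected width of the price
  played, optimistic or not.\<close>

lemma expected_gap_le:
  assumes t: "t \<in> {1..T}"
  shows "(\<integral>\<omega>. gap t \<omega> \<partial>M) \<le> pbar * gbar * (50 * expl * rho) * (\<integral>\<omega>. run t \<omega> * sqrt (width2 (xs \<omega>) (ps \<omega>) t) \<partial>M)"
proof -
  let ?N = "info t (t - 1) (t - 1)"
  let ?O = "{u \<in> space (?N \<Otimes>\<^sub>M (borel :: (real^2) measure)).
      fval (mu t (fst u)) (X t (fst u)) \<le> smpv t (fst u) (snd u) \<and> norm (snd u) \<le> rho}"
  let ?w = "\<lambda>\<omega>. run t \<omega> * sqrt (width2 (xs \<omega>) (ps \<omega>) t)"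
  let ?K = "pbar * gbar * (2 * expl * rho)"
  have N: "subalgebra M ?N" using t by (intro subalgebra_info) auto
  have fN: "(\<lambda>\<omega>. fval (mu t \<omega>) (X t \<omega>)) \<in> borel_measurable ?N"
    using t by (intro fval_measurable mu_info X_info) auto
  note [measurable] = measurable_compose[OF measurable_fst fN] smpv_measurable[OF t]
    measurable_compose[OF measurable_fst gap_info[OF t]]
  have O: "?O \<in> sets (?N \<Otimes>\<^sub>M borel)" by measurable
  have K0: "0 \<le> ?K" using pbar_nonneg gbar_pos expl_pos rho_ge by simp
  define h where "h u = ennreal (gap t (fst u)) * indicator ?O u" for u
  have h: "h \<in> borel_measurable (?N \<Otimes>\<^sub>M borel)" unfolding h_def[abs_def] using O by measurable
  have slice: "{y. fval (mu t \<omega>) (X t \<omega>) \<le> smpv t \<omega> y \<and> norm y \<le> rho} = Pair \<omega> -` ?O" if "\<omega> \<in> space M" for \<omega>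
    using that by (auto simp: space_pair_measure)
  have slice_sets: "Pair \<omega> -` ?O \<in> sets borel" for \<omega> using sets_Pair1[OF O] by simp
  have "ennreal (1 / 25) * (\<integral>\<^sup>+\<omega>. ennreal (gap t \<omega>) \<partial>M) = (\<integral>\<^sup>+\<omega>. ennreal (gap t \<omega>) * ennreal (1 / 25) \<partial>M)"
    using gap_M[OF t] by (subst nn_integral_multc) (auto simp: mult.commute)
  also have "\<dots> \<le> (\<integral>\<^sup>+\<omega>. \<integral>\<^sup>+y. h (\<omega>, y) \<partial>distr M borel (\<eta> t) \<partial>M)"
  proof (rule nn_integral_mono_AE)
    show "AE \<omega> in M. ennreal (gap t \<omega>) * ennreal (1 / 25) \<le> (\<integral>\<^sup>+y. h (\<omega>, y) \<partial>distr M borel (\<eta> t))"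
      using AE_typical AE_space
    proof eventually_elim
      fix \<omega> assume ty: "typical \<omega>" and sp: "\<omega> \<in> space M"
      have "(\<integral>\<^sup>+y. h (\<omega>, y) \<partial>distr M borel (\<eta> t)) = (\<integral>\<^sup>+y. ennreal (gap t \<omega>) * indicator (Pair \<omega> -` ?O) y \<partial>distr M borel (\<eta> t))"
        by (intro nn_integral_cong) (simp add: h_def indicator_def)
      also have "\<dots> = ennreal (gap t \<omega>) * emeasure (density lborel std_normal2) (Pair \<omega> -` ?O)"
        unfolding eta_distr[OF t] using slice_sets[of \<omega>] by (subst nn_integral_cmult_indicator) auto
      finally have e: "(\<integral>\<^sup>+y. h (\<omega>, y) \<partial>distr M borel (\<eta> t)) = ennreal (gap t \<omega>) * emeasure (density lborel std_normal2) (Pair \<omega> -` ?O)" .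
      show "ennreal (gap t \<omega>) * ennreal (1 / 25) \<le> (\<integral>\<^sup>+y. h (\<omega>, y) \<partial>distr M borel (\<eta> t))"
      proof (cases "run t \<omega> = 1 \<and> err2 t \<omega> \<le> (expl / 2)\<^sup>2")
        case True
        then show ?thesis
          unfolding e using optimism_probability[OF ty t] slice_sets[of \<omega>] unfolding slice[OF sp]
          by (intro mult_left_mono) auto
      qed (auto simp: gap_def)
    qed
  qed
  also have "\<dots> = (\<integral>\<^sup>+\<omega>. h (\<omega>, \<eta> t \<omega>) \<partial>M)"
    by (rule indep_nn_integral[OF N eta_meas[OF t] eta_indep_past[OF t] h, symmetric])
  also have "\<dots> \<le> (\<integral>\<^sup>+\<omega>. ennreal (?K * ?w \<omega>) \<partial>M)"
  proof (rule nn_integral_mono_AE)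
    show "AE \<omega> in M. h (\<omega>, \<eta> t \<omega>) \<le> ennreal (?K * ?w \<omega>)"
      using AE_typical
    proof eventually_elim
      fix \<omega> assume ty: "typical \<omega>"
      show "h (\<omega>, \<eta> t \<omega>) \<le> ennreal (?K * ?w \<omega>)"
      proof (cases "run t \<omega> = 1 \<and> err2 t \<omega> \<le> (expl / 2)\<^sup>2 \<and> (\<omega>, \<eta> t \<omega>) \<in> ?O")
        case True
        then have "gap t \<omega> \<le> ?K * ?w \<omega>"
          using optimistic_gap_le[OF ty t] by (simp add: gap_def mult_ac)
        then show ?thesis using True by (simp add: h_def ennreal_leI)
      next
        case False
        then have "h (\<omega>, \<eta> t \<omega>) = 0" by (auto simp: h_def gap_def indicator_def)
        then show ?thesis by simp
      qed
    qed
  qed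
  also have "\<dots> = ennreal (\<integral>\<omega>. ?K * ?w \<omega> \<partial>M)"
    using K0 by (intro nn_integral_eq_integral integrable_mult_right width_integrable t)
      (auto simp: width2_nonneg)
  also have "(\<integral>\<^sup>+\<omega>. ennreal (gap t \<omega>) \<partial>M) = ennreal (\<integral>\<omega>. gap t \<omega> \<partial>M)"
    using AE_typical gap_range(1)[OF _ t] by (intro nn_integral_eq_integral gap_integrable t) (auto elim!: AE_mp)
  finally have "ennreal (1 / 25 * (\<integral>\<omega>. gap t \<omega> \<partial>M)) \<le> ennreal (\<integral>\<omega>. ?K * ?w \<omega> \<partial>M)"
    by (subst ennreal_mult') (assumption | simp)+
  moreover have "0 \<le> (\<integral>\<omega>. ?K * ?w \<omega> \<partial>M)"
    using K0 by (intro integral_nonneg_AE AE_I2) (simp add: width2_nonneg)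
  ultimately have "1 / 25 * (\<integral>\<omega>. gap t \<omega> \<partial>M) \<le> ?K * (\<integral>\<omega>. ?w \<omega> \<partial>M)"
    by (subst (asm) ennreal_le_iff) simp_all
  then show ?thesis by (simp add: algebra_simps)
qed

definition bad :: "nat \<Rightarrow> 'a set" where
  "bad t = {\<omega>\<in>space M. \<sigma>bar\<^sup>2 * (2 * ln (real T) + ln (ddet (t - 1) \<omega>)) < score_norm2 (t - 1) \<omega>}"

definition far :: "nat \<Rightarrow> 'a set" where "far t = {\<omega>\<in>space M. rho < norm (\<eta> t \<omega>)}"

lemma bad_sets: "t \<in> {1..T} \<Longrightarrow> bad t \<in> sets M" and far_sets: "t \<in> {1..T} \<Longrightarrow> far t \<in> sets M"
proof -
  assume t: "t \<in> {1..T}"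
  then have le: "t - 1 \<le> T" by auto
  note [measurable] = score_norm2_measurable_M[OF le] ddet_measurable_M[OF le] eta_meas[OF t]
  show "bad t \<in> sets M" "far t \<in> sets M" unfolding bad_def far_def by measurable
qed

text \<open>The origin of \<open>4 * T^2\<close> in the logarithm:
  \<open>rho\<^sup>2 / 4 = ln (2 * T)\<close>, so the tail bound
  \<open>2 * exp (- rho\<^sup>2 / 4)\<close> is exactly \<open>1 / T\<close>.\<close>

lemma prob_far:
  assumes t: "t \<in> {1..T}"
  shows "prob (far t) \<le> 1 / real T"
proof -
  have std [measurable]: "std_normal2 \<in> borel_measurable borel"
    using distributed_borel_measurable[OF eta_normal[OF t]] by simp
  have "emeasure M (far t) = emeasure (distr M borel (\<eta> t)) {y. rho < norm y}"
    using eta_meas[OF t] by (subst emeasure_distr) (auto simp: far_def intro!: arg_cong2[where f=emeasure])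
  also have "\<dots> = (\<integral>\<^sup>+y. std_normal2 y * indicator {y. norm y > rho} y \<partial>lborel)"
    unfolding eta_distr[OF t] by (subst emeasure_density) auto
  also have "\<dots> \<le> ennreal (2 * exp (- rho\<^sup>2 / 4))" using rho_ge by (intro std_normal_tail) auto
  also have "2 * exp (- rho\<^sup>2 / 4) = 1 / real T"
  proof -
    have "4 * real T ^ 2 = (2 * real T) ^ 2" by (simp add: power_mult_distrib)
    then have "ln (4 * real T ^ 2) = 2 * ln (2 * real T)"
      using ln_realpow[of "2 * real T" 2] T_pos by (simp only: of_nat_numeral)
    then have "- rho\<^sup>2 / 4 = - ln (2 * real T)" by (simp add: rho_sq)
    then have "exp (- rho\<^sup>2 / 4) = exp (- ln (2 * real T))" by (simp only:)
    also have "\<dots> = 1 / (2 * real T)" using T_pos by (simp add: exp_minus inverse_eq_divide)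
    finally show ?thesis by simp
  qed
  finally show ?thesis by (simp add: emeasure_eq_measure)
qed

text \<open>Measured with the mean demand and at the current dual price, which separates the loss
  due to estimation from the shocks and from the inventory.\<close>

definition round_loss :: "nat \<Rightarrow> 'a \<Rightarrow> real" where
  "round_loss t \<omega> = run t \<omega> * (fval (mu t \<omega>) (X t \<omega>) - (p t \<omega> - mu t \<omega>) * gt t \<omega>)"

lemma gt_M: "t \<in> {1..T} \<Longrightarrow> gt t \<in> borel_measurable M"
  unfolding gt_def[abs_def]
  by (intro measurable_compose[OF lin_index_measurable g_borel] X_meas p_measurable_M) auto

lemma round_loss_M: "t \<in> {1..T} \<Longrightarrow> round_loss t \<in> borel_measurable M"
proof -
  assume t: "t \<in> {1..T}"
  note [measurable] = run_M[OF t] mu_M[OF t] p_measurable_M[OF t] gt_M[OF t] fval_measurable[OF mu_M[OF t] X_meas[OF t]]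
  show "round_loss t \<in> borel_measurable M" unfolding round_loss_def[abs_def] by measurable
qed

lemma round_loss_le:
  assumes ty: "typical \<omega>" and t: "t \<in> {1..T}"
  shows "round_loss t \<omega> \<le> pbar * Dbar" "- (pbar * Dbar) \<le> round_loss t \<omega>"
proof -
  have "round_loss t \<omega> \<le> pbar * Dbar \<and> - (pbar * Dbar) \<le> round_loss t \<omega>"
  proof (cases "run t \<omega> = 1")
    case True
    note g = gt_bounds[OF ty t True] and f = fval_bounds[OF typical_X[OF ty t True] mu_range[of t \<omega>]]
      and r = typical_range[OF ty t True]
    have "0 \<le> (p t \<omega> - mu t \<omega>) * gt t \<omega>" using g r by simp
    moreover have "(p t \<omega> - mu t \<omega>) * gt t \<omega> \<le> pbar * Dbar"
      using g r mu_range[of t \<omega>] pbar_nonneg by (intro mult_mono) auto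
    ultimately show ?thesis using f True by (simp add: round_loss_def)
  next
    case False
    then have "run t \<omega> = 0" using run_01 by blast
    then show ?thesis using pbar_nonneg Dbar_pos by (simp add: round_loss_def)
  qed
  then show "round_loss t \<omega> \<le> pbar * Dbar" "- (pbar * Dbar) \<le> round_loss t \<omega>" by auto
qed

lemma round_loss_integrable: "t \<in> {1..T} \<Longrightarrow> integrable M (round_loss t)"
  by (rule integrable_const_bound[of _ "pbar * Dbar"])
    (use AE_typical round_loss_le in \<open>force intro!: round_loss_M elim!: AE_mp simp: abs_le_iff\<close>)+

text \<open>Each of the two exceptional events has probability at most \<open>1 / T\<close> and
  costs at most \<open>pbar * Dbar\<close>. On the remaining paths the gap contributes
  \<open>50 * rho\<close> and the deviation at the posted price \<open>rho + 1/2\<close>.\<close>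

lemma expected_round_loss_le:
  assumes t: "t \<in> {1..T}"
  shows "(\<integral>\<omega>. round_loss t \<omega> \<partial>M) \<le> 2 * (pbar * Dbar) / real T
    + pbar * gbar * (expl * (51 * rho + 1/2)) * (\<integral>\<omega>. run t \<omega> * sqrt (width2 (xs \<omega>) (ps \<omega>) t) \<partial>M)"
proof -
  let ?w = "\<lambda>\<omega>. run t \<omega> * sqrt (width2 (xs \<omega>) (ps \<omega>) t)"
  let ?K = "pbar * gbar * (expl * (rho + 1/2))"
  have K0: "0 \<le> ?K" using pbar_nonneg gbar_pos expl_pos rho_ge by simp
  have PD: "0 \<le> pbar * Dbar" using pbar_nonneg Dbar_pos by simp
  have le: "t - 1 \<le> T" using t by auto
  have pb: "prob (bad t) \<le> 1 / real T" unfolding bad_def by (rule score_tail[OF le])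
  have ib: "integrable M (\<lambda>\<omega>. pbar * Dbar * indicator (bad t) \<omega>)" "integrable M (\<lambda>\<omega>. pbar * Dbar * indicator (far t) \<omega>)"
    using bad_sets[OF t] far_sets[OF t]
    by (auto simp: integrable_indicator_iff emeasure_eq_measure)
  have "AE \<omega> in M. round_loss t \<omega> \<le> gap t \<omega> + ?K * ?w \<omega>
      + (pbar * Dbar * indicator (bad t) \<omega> + pbar * Dbar * indicator (far t) \<omega>)"
    using AE_typical AE_space
  proof eventually_elim
    fix \<omega> assume ty: "typical \<omega>" and sp: "\<omega> \<in> space M"
    have pos: "0 \<le> gap t \<omega>" "0 \<le> ?K * ?w \<omega>" "0 \<le> pbar * Dbar * indicator (bad t) \<omega>" "0 \<le> pbar * Dbar * indicator (far t) \<omega>"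
      using gap_range(1)[OF ty t] run_width_le_1(1)[OF ty t] K0 PD by auto
    consider "run t \<omega> = 0" | "\<omega> \<in> bad t" | "\<omega> \<in> far t" | "run t \<omega> = 1" "\<omega> \<notin> bad t" "\<omega> \<notin> far t"
      using run_01 by blast
    then show "round_loss t \<omega> \<le> gap t \<omega> + ?K * ?w \<omega>
      + (pbar * Dbar * indicator (bad t) \<omega> + pbar * Dbar * indicator (far t) \<omega>)"
    proof cases
      case 1
      then have "round_loss t \<omega> = 0" by (simp add: round_loss_def)
      then show ?thesis using pos by linarith
    next
      case 2
      then have "pbar * Dbar * indicator (bad t) \<omega> = pbar * Dbar" by simp
      then show ?thesis using round_loss_le(1)[OF ty t] pos by linarith
    next
      case 3
      then have "pbar * Dbar * indicator (far t) \<omega> = pbar * Dbar" by simp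
      then show ?thesis using round_loss_le(1)[OF ty t] pos by linarith
    next
      case 4
      have "score_norm2 (t - 1) \<omega> \<le> \<sigma>bar\<^sup>2 * (2 * ln (real T) + ln (ddet (t - 1) \<omega>))"
        using 4(2) sp by (simp add: bad_def)
      then have "sqrt (err2 t \<omega>) \<le> expl / 2" unfolding err2_def by (rule confidence[OF ty t 4(1)])
      then have e: "err2 t \<omega> \<le> (expl / 2)\<^sup>2" using expl_pos by (intro sqrt_le_D) auto
      have n: "norm (\<eta> t \<omega>) \<le> rho" using 4(3) sp by (simp add: far_def)
      have "round_loss t \<omega> \<le> gap t \<omega> + ?K * ?w \<omega>"
        using round_regret_le[OF ty t 4(1) e n] 4(1) e by (simp add: round_loss_def gap_def mult_ac)
      then show ?thesis using pos by linarith
    qed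
  qed
  then have "(\<integral>\<omega>. round_loss t \<omega> \<partial>M) \<le> (\<integral>\<omega>. gap t \<omega> + ?K * ?w \<omega>
      + (pbar * Dbar * indicator (bad t) \<omega> + pbar * Dbar * indicator (far t) \<omega>) \<partial>M)"
    using ib by (intro integral_mono_AE round_loss_integrable[OF t] Bochner_Integration.integrable_add
        gap_integrable[OF t] integrable_mult_right width_integrable[OF t]) auto
  also have "\<dots> = (\<integral>\<omega>. gap t \<omega> \<partial>M) + ?K * (\<integral>\<omega>. ?w \<omega> \<partial>M) + (pbar * Dbar * prob (bad t) + pbar * Dbar * prob (far t))"
    using ib gap_integrable[OF t] width_integrable[OF t] bad_sets[OF t] far_sets[OF t] by simp
  also have "(\<integral>\<omega>. gap t \<omega> \<partial>M) + ?K * (\<integral>\<omega>. ?w \<omega> \<partial>M) + (pbar * Dbar * prob (bad t) + pbar * Dbar * prob (far t))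
      \<le> pbar * gbar * (50 * expl * rho) * (\<integral>\<omega>. ?w \<omega> \<partial>M) + ?K * (\<integral>\<omega>. ?w \<omega> \<partial>M)
      + (pbar * Dbar * (1 / real T) + pbar * Dbar * (1 / real T))"
    by (intro add_mono mult_left_mono expected_gap_le[OF t] prob_far[OF t] pb PD order_refl)
  also have "\<dots> = 2 * (pbar * Dbar) / real T
    + pbar * gbar * (expl * (51 * rho + 1/2)) * (\<integral>\<omega>. ?w \<omega> \<partial>M)" by (simp add: algebra_simps)
  finally show ?thesis .
qed

lemma expected_total_loss_le:
  "(\<Sum>t=1..T. \<integral>\<omega>. round_loss t \<omega> \<partial>M) \<le> 2 * (pbar * Dbar)
    + pbar * gbar * (expl * (51 * rho + 1/2)) * sqrt (2 * real T * logdim)"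
proof -
  let ?w = "\<lambda>t \<omega>. run t \<omega> * sqrt (width2 (xs \<omega>) (ps \<omega>) t)"
  let ?K = "pbar * gbar * (expl * (51 * rho + 1/2))"
  have K0: "0 \<le> ?K" using pbar_nonneg gbar_pos expl_pos rho_ge by simp
  have "(\<Sum>t=1..T. \<integral>\<omega>. round_loss t \<omega> \<partial>M) \<le> (\<Sum>t=1..T. 2 * (pbar * Dbar) / real T + ?K * (\<integral>\<omega>. ?w t \<omega> \<partial>M))"
    by (intro sum_mono expected_round_loss_le)
  also have "\<dots> = 2 * (pbar * Dbar) + ?K * (\<Sum>t=1..T. \<integral>\<omega>. ?w t \<omega> \<partial>M)"
    using T_pos by (simp add: sum.distrib sum_distrib_left)
  also have "(\<Sum>t=1..T. \<integral>\<omega>. ?w t \<omega> \<partial>M) = (\<integral>\<omega>. (\<Sum>t=1..T. ?w t \<omega>) \<partial>M)"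
    by (rule Bochner_Integration.integral_sum[symmetric]) (rule width_integrable)
  also have "\<dots> \<le> (\<integral>\<omega>. sqrt (2 * real T * logdim) \<partial>M)"
    by (intro integral_mono_AE Bochner_Integration.integrable_sum width_integrable)
      (use AE_typical sum_run_width_le in \<open>auto elim!: AE_mp\<close>)
  also have "\<dots> = sqrt (2 * real T * logdim)" by (simp add: prob_space)
  finally show ?thesis using K0 by (simp add: mult_left_mono)
qed

end

subsection \<open>The benchmark\<close>

text \<open>Without integrability the integral has the default value \<open>0\<close>, which a
  nonnegative bound also covers; so the values of hindsight policies need no separate integrability
  argument.\<close>

lemma integral_le_const_of_nonneg:
  fixes f :: "'a \<Rightarrow> real"
  assumes "prob_space N" "AE x in N. f x \<le> B" "0 \<le> B"
  shows "(\<integral>x. f x \<partial>N) \<le> B"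
proof (cases "integrable N f")
  case True
  interpret prob_space N by fact
  have "(\<integral>x. f x \<partial>N) \<le> (\<integral>x. B \<partial>N)" using True assms(2) by (intro integral_mono_AE) auto
  then show ?thesis by (simp add: prob_space)
next
  case False
  then show ?thesis using assms(3) by (simp add: not_integrable_integral_eq)
qed

definition hind_price :: "(nat \<Rightarrow> real \<Rightarrow> real) \<Rightarrow> hind_policy \<Rightarrow> (nat \<Rightarrow> real) \<Rightarrow> real \<Rightarrow> nat \<Rightarrow> real" where
  "hind_price m \<pi> e u t = \<pi> t (fst (hind_path m \<pi> e u (t - 1)), snd (hind_path m \<pi> e u (t - 1)), u)"

lemma hind_path_Suc: "hind_path m \<pi> e u (Suc t) =
    ((fst (hind_path m \<pi> e u t))(Suc t := m (Suc t) (hind_price m \<pi> e u (Suc t)) + e (Suc t)),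
     (snd (hind_path m \<pi> e u t))(Suc t := hind_price m \<pi> e u (Suc t)))"
  by (simp add: hind_price_def Let_def case_prod_unfold)

lemma hind_path_nth: "s \<in> {1..t} \<Longrightarrow>
    fst (hind_path m \<pi> e u t) s = m s (hind_price m \<pi> e u s) + e s
    \<and> snd (hind_path m \<pi> e u t) s = hind_price m \<pi> e u s"
  by (induction t) (auto simp: hind_path_Suc le_Suc_eq simp del: hind_path.simps(2))

lemma stock_cong:
  assumes "\<And>s. s \<in> {1..<t} \<Longrightarrow> D s = D' s"
  shows "stock C D t = stock C D' t"
  using assms
proof (induction t)
  case (Suc t)
  have "stock C D t = stock C D' t" by (rule Suc.IH) (use Suc.prems in auto)
  moreover have "D t = D' t" if "t \<noteq> 0" using Suc.prems[of t] that by simp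
  ultimately show ?case by simp
qed simp

lemma revenue_cong:
  assumes "\<And>s. s \<in> {1..T} \<Longrightarrow> D s = D' s" "\<And>s. s \<in> {1..T} \<Longrightarrow> q s = q' s"
  shows "revenue C T q D = revenue C T q' D'"
  unfolding revenue_def
proof (rule sum.cong[OF refl])
  fix t assume t: "t \<in> {1..T}"
  have "stock C D t = stock C D' t" using assms(1) t by (intro stock_cong) auto
  then show "q t * sale (stock C D t) (D t) = q' t * sale (stock C D' t) (D' t)" using assms t by auto
qed

context inventory_model
begin

text \<open>Bounds all shocks at once, since the round of an overshoot is random; its mean is at
  most \<open>\<sigma>bar * sqrt T\<close> by second moments alone.\<close>

definition shock_norm :: "'a \<Rightarrow> real" where "shock_norm \<omega> = sqrt (\<Sum>t=1..T. (\<epsilon> t \<omega>)\<^sup>2)"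

lemma shock_norm_ge:
  assumes "t \<in> {1..T}"
  shows "\<bar>\<epsilon> t \<omega>\<bar> \<le> shock_norm \<omega>"
proof -
  have "(\<epsilon> t \<omega>)\<^sup>2 \<le> (\<Sum>t=1..T. (\<epsilon> t \<omega>)\<^sup>2)" using assms by (intro member_le_sum) auto
  then show ?thesis unfolding shock_norm_def by (intro real_le_rsqrt) simp
qed

lemma shock_norm_nonneg: "0 \<le> shock_norm \<omega>"
  by (simp add: shock_norm_def sum_nonneg)

lemma shock_norm_integrable: "integrable M shock_norm"
  and expected_shock_norm: "(\<integral>\<omega>. shock_norm \<omega> \<partial>M) \<le> \<sigma>bar * sqrt (real T)"
proof -
  have sq: "(shock_norm \<omega>)\<^sup>2 = (\<Sum>t=1..T. (\<epsilon> t \<omega>)\<^sup>2)" for \<omega> by (simp add: shock_norm_def sum_nonneg)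
  have i2: "integrable M (\<lambda>\<omega>. (shock_norm \<omega>)\<^sup>2)"
    unfolding sq by (intro Bochner_Integration.integrable_sum eps_square_integrable_M)
  have m: "shock_norm \<in> borel_measurable M"
    unfolding shock_norm_def[abs_def] using eps_meas by measurable
  show i1: "integrable M shock_norm" by (rule square_integrable_imp_integrable[OF m i2])
  \<comment> \<open>Nonnegativity of the variance is Jensen's inequality for the square.\<close>
  have "0 \<le> variance shock_norm" by (rule variance_positive)
  then have "(expectation shock_norm)\<^sup>2 \<le> expectation (\<lambda>\<omega>. (shock_norm \<omega>)\<^sup>2)"
    using variance_eq[OF i1 i2] by simp
  also have "\<dots> = (\<Sum>t=1..T. expectation (\<lambda>\<omega>. (\<epsilon> t \<omega>)\<^sup>2))"
    unfolding sq by (intro Bochner_Integration.integral_sum eps_square_integrable_M)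
  also have "\<dots> \<le> (\<Sum>t=1..T. \<sigma>bar\<^sup>2)" by (intro sum_mono eps_second_moment)
  also have "\<dots> = (\<sigma>bar * sqrt (real T))\<^sup>2" by (simp add: power_mult_distrib)
  finally show "(\<integral>\<omega>. shock_norm \<omega> \<partial>M) \<le> \<sigma>bar * sqrt (real T)"
    using sigma_bar by (auto intro: power2_le_imp_le)
qed

abbreviation "mean x \<equiv> \<lambda>t q. g (lin_index \<theta>star (x t) q)"
abbreviation "shocks \<omega> \<equiv> \<lambda>t\<in>{1..T}. \<epsilon> t \<omega>"

definition hind_q :: "(nat \<Rightarrow> real^'n) \<Rightarrow> hind_policy \<Rightarrow> real \<Rightarrow> nat \<Rightarrow> 'a \<Rightarrow> real" where
  "hind_q x \<pi> u t \<omega> = hind_price (mean x) \<pi> (shocks \<omega>) u t"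

definition hind_D :: "(nat \<Rightarrow> real^'n) \<Rightarrow> hind_policy \<Rightarrow> real \<Rightarrow> nat \<Rightarrow> 'a \<Rightarrow> real" where
  "hind_D x \<pi> u t \<omega> = mean x t (hind_q x \<pi> u t \<omega>) + \<epsilon> t \<omega>"

context
  fixes x :: "nat \<Rightarrow> real^'n" and \<pi> :: hind_policy and u :: real
  assumes x: "\<And>t. t \<in> {1..T} \<Longrightarrow> x t \<in> XX" and \<pi>: "\<pi> \<in> hind_policies plo pbar T"
begin

abbreviation "hq \<equiv> hind_q x \<pi> u"
abbreviation "hD \<equiv> hind_D x \<pi> u"

lemma mean_measurable [measurable]: "mean x t \<in> borel_measurable borel"
  by (intro borel_measurable_continuous_onI continuous_on_compose2[OF g_cont continuous_on_lin_index]) auto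

lemma hq_range: "t \<in> {1..T} \<Longrightarrow> hq t \<omega> \<in> {plo..pbar}"
  using \<pi> by (simp add: hind_q_def hind_price_def hind_policies_def)

lemma hind_price_measurable:
  assumes t: "t \<in> {1..T}"
    and path: "(\<lambda>\<omega>. hind_path (mean x) \<pi> (shocks \<omega>) u (t - 1)) \<in>
      measurable N (PiM {1..t - 1} (\<lambda>_. borel) \<Otimes>\<^sub>M PiM {1..t - 1} (\<lambda>_. borel))"
  shows "hq t \<in> borel_measurable N"
proof -
  have I: "{1..<t} = {1..t - 1}" using t by auto
  have pm: "\<pi> t \<in> borel_measurable (PiM {1..t - 1} (\<lambda>_. borel) \<Otimes>\<^sub>M PiM {1..t - 1} (\<lambda>_. borel) \<Otimes>\<^sub>M borel)"
    using \<pi> t unfolding hind_policies_def I[symmetric] by blast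
  note path' = measurable_compose[OF path measurable_fst] measurable_compose[OF path measurable_snd]
  show ?thesis
    unfolding hind_q_def[abs_def] hind_price_def
    by (rule measurable_compose[OF _ pm]) (intro measurable_Pair path' measurable_const, auto)
qed

lemma hind_path_measurable: "t \<le> T \<Longrightarrow> (\<lambda>\<omega>. hind_path (mean x) \<pi> (shocks \<omega>) u t) \<in>
      measurable (info 0 t 0) (PiM {1..t} (\<lambda>_. borel) \<Otimes>\<^sub>M PiM {1..t} (\<lambda>_. borel))"
proof (induction t)
  case 0
  have "(\<lambda>_. undefined) \<in> space (PiM {1..0::nat} (\<lambda>_. borel :: real measure))" by (simp add: space_PiM)
  then show ?case by (simp add: space_pair_measure)
next
  case (Suc t)
  have IH: "(\<lambda>\<omega>. hind_path (mean x) \<pi> (shocks \<omega>) u t) \<in>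
      measurable (info 0 (Suc t) 0) (PiM {1..t} (\<lambda>_. borel) \<Otimes>\<^sub>M PiM {1..t} (\<lambda>_. borel))"
    by (rule measurable_info_mono[OF Suc.IH]) (use Suc.prems in auto)
  have q: "hq (Suc t) \<in> borel_measurable (info 0 (Suc t) 0)"
    by (rule hind_price_measurable) (use IH Suc.prems in auto)
  have e: "\<epsilon> (Suc t) \<in> borel_measurable (info 0 (Suc t) 0)" by (intro eps_info) auto
  have I: "{1..Suc t} = insert (Suc t) {1..t}" by auto
  have eq: "hind_path (mean x) \<pi> (shocks \<omega>) u (Suc t) =
    ((fst (hind_path (mean x) \<pi> (shocks \<omega>) u t))(Suc t := mean x (Suc t) (hq (Suc t) \<omega>) + \<epsilon> (Suc t) \<omega>),
     (snd (hind_path (mean x) \<pi> (shocks \<omega>) u t))(Suc t := hq (Suc t) \<omega>))" for \<omega>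
    unfolding hind_path_Suc hind_q_def[symmetric] using Suc.prems by simp
  have mq: "(\<lambda>\<omega>. mean x (Suc t) (hq (Suc t) \<omega>) + \<epsilon> (Suc t) \<omega>) \<in> borel_measurable (info 0 (Suc t) 0)"
    by (intro borel_measurable_add measurable_compose[OF q mean_measurable] e)
  show ?case
    unfolding eq I
    by (intro measurable_Pair measurable_fun_upd[of _ "{1..t}"] measurable_compose[OF IH measurable_fst]
        measurable_compose[OF IH measurable_snd] mq q) auto
qed

text \<open>With covariates and seed fixed, a hindsight price is a function of past shocks only, so
  the shock of its round still averages to zero against it.\<close>

lemma hq_info: "t \<in> {1..T} \<Longrightarrow> hq t \<in> borel_measurable (info 0 (t - 1) 0)"
  by (rule hind_price_measurable[OF _ hind_path_measurable]) auto

lemma hD_info: "t \<in> {1..T} \<Longrightarrow> t \<le> j \<Longrightarrow> hD t \<in> borel_measurable (info i j k)"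
proof -
  assume t: "t \<in> {1..T}" "t \<le> j"
  have "hq t \<in> borel_measurable (info i j k)" by (rule measurable_info_mono[OF hq_info]) (use t in auto)
  moreover have "\<epsilon> t \<in> borel_measurable (info i j k)" using t by (intro eps_info) auto
  ultimately show ?thesis
    unfolding hind_D_def[abs_def] by (intro borel_measurable_add measurable_compose[OF _ mean_measurable])
qed

lemma hind_revenue_le:
  assumes m: "m \<in> {0..pbar}"
  shows "revenue C T (\<lambda>t. hq t \<omega>) (\<lambda>t. hD t \<omega>) \<le>
    (\<Sum>t=1..T. fval m (x t)) + (\<Sum>t=1..T. (active C (\<lambda>t. hD t \<omega>) t * (hq t \<omega> - m)) * \<epsilon> t \<omega>)
      + m * C + pbar * (Dbar + shock_norm \<omega>)"
proof -
  let ?D = "\<lambda>t. hD t \<omega>" and ?q = "\<lambda>t. hq t \<omega>"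
  let ?R = "active C ?D"
  have C0: "0 \<le> C" using C_pos by simp
  have q: "?q t \<in> {plo..pbar}" if "t \<in> {1..T}" for t by (rule hq_range[OF that])
  have mean: "0 \<le> mean x t (?q t)" "mean x t (?q t) \<le> Dbar" if "t \<in> {1..T}" for t
    using g_bounded[OF x[OF that] q[OF that]] by auto
  have B: "?D t \<le> Dbar + shock_norm \<omega>" if "t \<in> {1..T}" for t
    using mean[OF that] shock_norm_ge[OF that, of \<omega>] by (simp add: hind_D_def abs_le_iff)
  have "revenue C T ?q ?D \<le> (\<Sum>t=1..T. ?R t * (?q t * ?D t))"
    by (rule revenue_le_sum_active) (use q prices in fastforce)
  also have "\<dots> = (\<Sum>t=1..T. ?R t * ((?q t - m) * mean x t (?q t))) + (\<Sum>t=1..T. (?R t * (?q t - m)) * \<epsilon> t \<omega>)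
      + m * (\<Sum>t=1..T. ?R t * ?D t)"
    unfolding sum_distrib_left sum.distrib[symmetric] by (intro sum.cong refl) (simp add: hind_D_def algebra_simps)
  also have "(\<Sum>t=1..T. ?R t * ((?q t - m) * mean x t (?q t))) \<le> (\<Sum>t=1..T. fval m (x t))"
  proof (rule sum_mono)
    fix t assume t: "t \<in> {1..T}"
    have f0: "0 \<le> fval m (x t)" by (rule fval_bounds(1)[OF x[OF t] m])
    \<comment> \<open>\<open>fval\<close> maximizes over prices at least \<open>m\<close>; a lower
      price has a negative margin and cannot beat \<open>0\<close>.\<close>
    have "(?q t - m) * mean x t (?q t) \<le> fval m (x t)"
    proof (cases "m \<le> ?q t")
      case True
      have I: "max m plo \<le> pbar" using m prices by simp
      have "continuous_on UNIV (\<lambda>q. (q - m) * mean x t q)"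
        by (intro continuous_intros continuous_on_compose2[OF g_cont continuous_on_lin_index]) auto
      from best_attained[OF I this]
      have "q' \<in> {max m plo..pbar} \<Longrightarrow> (q' - m) * mean x t q' \<le> fval m (x t)" for q'
        unfolding fval_def by blast
      moreover have "?q t \<in> {max m plo..pbar}" using q[OF t] True by auto
      ultimately show ?thesis by blast
    next
      case False
      then have "(?q t - m) * mean x t (?q t) \<le> 0" using mean[OF t] by (intro mult_nonpos_nonneg) auto
      then show ?thesis using f0 by simp
    qed
    then show "?R t * ((?q t - m) * mean x t (?q t)) \<le> fval m (x t)"
      using f0 active_01[of C ?D t] by auto
  qed
  \<comment> \<open>Demand in the active rounds exceeds the inventory by at most one
    overshoot.\<close>
  also have "m * (\<Sum>t=1..T. ?R t * ?D t) \<le> m * (C + (Dbar + shock_norm \<omega>))"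
  proof (rule mult_left_mono)
    have "(\<Sum>t=1..T. overshoot C ?D t) \<le> Dbar + shock_norm \<omega>"
      using sum_overshoot_le[OF C0, of "Dbar + shock_norm \<omega>" T ?D] B shock_norm_nonneg[of \<omega>] Dbar_pos by auto
    then show "(\<Sum>t=1..T. ?R t * ?D t) \<le> C + (Dbar + shock_norm \<omega>)"
      using stock_eq_sum[OF C0, of ?D T] stock_nonneg[OF C0, of ?D "Suc T"] by linarith
  qed (use m in auto)
  also have "m * (C + (Dbar + shock_norm \<omega>)) \<le> m * C + pbar * (Dbar + shock_norm \<omega>)"
    using mult_right_mono[of m pbar "Dbar + shock_norm \<omega>"] m Dbar_pos shock_norm_nonneg[of \<omega>]
    by (simp add: distrib_left)
  finally show ?thesis by simp
qed

lemma expected_hind_revenue_le: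
  assumes m: "m \<in> {0..pbar}" and i: "integrable M (\<lambda>\<omega>. revenue C T (\<lambda>t. hq t \<omega>) (\<lambda>t. hD t \<omega>))"
  shows "(\<integral>\<omega>. revenue C T (\<lambda>t. hq t \<omega>) (\<lambda>t. hD t \<omega>) \<partial>M) \<le>
    (\<Sum>t=1..T. fval m (x t)) + m * C + pbar * (Dbar + \<sigma>bar * sqrt (real T))"
proof -
  let ?R = "\<lambda>t \<omega>. active C (\<lambda>t. hD t \<omega>) t"
  let ?Z = "\<lambda>t \<omega>. ?R t \<omega> * (hq t \<omega> - m)"
  have noise: "integrable M (\<lambda>\<omega>. ?Z t \<omega> * \<epsilon> t \<omega>) \<and> (\<integral>\<omega>. ?Z t \<omega> * \<epsilon> t \<omega> \<partial>M) = 0" if t: "t \<in> {1..T}" for t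
  proof -
    let ?F = "info t (t - 1) t"
    have F: "subalgebra M ?F" using t by (intro subalgebra_info) auto
    have [measurable]: "hq t \<in> borel_measurable ?F" by (rule measurable_info_mono[OF hq_info[OF t]]) auto
    have [measurable]: "(\<lambda>\<omega>. stock C (\<lambda>t. hD t \<omega>) t) \<in> borel_measurable ?F"
      using t by (intro stock_measurable hD_info) auto
    have Z: "?Z t \<in> borel_measurable ?F" unfolding active_def by measurable
    have "\<bar>?Z t \<omega>\<bar> \<le> pbar" for \<omega>
    proof -
      have "\<bar>hq t \<omega> - m\<bar> \<le> pbar" using hq_range[OF t, of \<omega>] m prices by auto
      then show ?thesis using active_01[of C "\<lambda>t. hD t \<omega>" t] pbar_nonneg by auto
    qed
    then have B: "AE \<omega> in M. \<bar>?Z t \<omega>\<bar> \<le> pbar" by simp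
    note sgf = F eps_meas[OF t] subgaussian_shock[OF t] Z B
    show ?thesis
      using subgaussian_given_integrable_mult[OF sgf eps_integrable_M[OF t]] subgaussian_given_mean_zero[OF sgf] by blast
  qed
  have "(\<integral>\<omega>. revenue C T (\<lambda>t. hq t \<omega>) (\<lambda>t. hD t \<omega>) \<partial>M) \<le>
    (\<integral>\<omega>. (\<Sum>t=1..T. fval m (x t)) + (\<Sum>t=1..T. ?Z t \<omega> * \<epsilon> t \<omega>) + m * C + pbar * (Dbar + shock_norm \<omega>) \<partial>M)"
    using noise shock_norm_integrable
    by (intro integral_mono i hind_revenue_le m Bochner_Integration.integrable_add
        Bochner_Integration.integrable_sum integrable_mult_right) auto
  also have "\<dots> = (\<Sum>t=1..T. fval m (x t)) + (\<Sum>t=1..T. \<integral>\<omega>. ?Z t \<omega> * \<epsilon> t \<omega> \<partial>M) + m * C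
      + pbar * (Dbar + (\<integral>\<omega>. shock_norm \<omega> \<partial>M))"
  proof -
    have "integrable M (\<lambda>\<omega>. \<Sum>t=1..T. ?Z t \<omega> * \<epsilon> t \<omega>)"
      using noise by (intro Bochner_Integration.integrable_sum) auto
    moreover have "(\<integral>\<omega>. (\<Sum>t=1..T. ?Z t \<omega> * \<epsilon> t \<omega>) \<partial>M) = (\<Sum>t=1..T. \<integral>\<omega>. ?Z t \<omega> * \<epsilon> t \<omega> \<partial>M)"
      using noise by (intro Bochner_Integration.integral_sum) auto
    ultimately show ?thesis using shock_norm_integrable by (simp add: prob_space)
  qed
  also have "(\<Sum>t=1..T. \<integral>\<omega>. ?Z t \<omega> * \<epsilon> t \<omega> \<partial>M) = 0" using noise by (intro sum.neutral) auto
  also have "pbar * (Dbar + (\<integral>\<omega>. shock_norm \<omega> \<partial>M)) \<le> pbar * (Dbar + \<sigma>bar * sqrt (real T))"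
    using expected_shock_norm pbar_nonneg by (intro mult_left_mono) auto
  finally show ?thesis by simp
qed

end

lemma OPT_le:
  fixes x :: "nat \<Rightarrow> real^'n"
  assumes x: "\<And>t. t \<in> {1..T} \<Longrightarrow> x t \<in> XX" and m: "m \<in> {0..pbar}"
  shows "OPT (distr M (PiM {1..T} (\<lambda>_. borel)) (\<lambda>\<omega>. \<lambda>t\<in>{1..T}. \<epsilon> t \<omega>)) g \<theta>star plo pbar T x C
    \<le> (\<Sum>t=1..T. fval m (x t)) + m * C + pbar * (Dbar + \<sigma>bar * sqrt (real T))"
  unfolding OPT_def
proof (rule cSUP_least)
  have "(\<lambda>_ _. plo) \<in> hind_policies plo pbar T" using prices by (simp add: hind_policies_def)
  then show "hind_policies plo pbar T \<noteq> {}" by blast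
  fix \<pi> assume \<pi>: "\<pi> \<in> hind_policies plo pbar T"
  let ?N = "distr M (PiM {1..T} (\<lambda>_. borel)) (\<lambda>\<omega>. \<lambda>t\<in>{1..T}. \<epsilon> t \<omega>)"
  let ?U = "uniform_measure lborel {0..1::real}"
  let ?m = "\<lambda>t q. g (lin_index \<theta>star (x t) q)"
  let ?B = "(\<Sum>t=1..T. fval m (x t)) + m * C + pbar * (Dbar + \<sigma>bar * sqrt (real T))"
  define h where "h e u = (let (D, P) = hind_path ?m \<pi> e u T in revenue C T P D)" for e u
  have B0: "0 \<le> ?B"
    using m C_pos pbar_nonneg Dbar_pos sigma_bar fval_bounds(1)[OF x m] by (intro add_nonneg_nonneg sum_nonneg) auto
  have em: "(\<lambda>\<omega>. \<lambda>t\<in>{1..T}. \<epsilon> t \<omega>) \<in> measurable M (PiM {1..T} (\<lambda>_. borel))"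
    by (intro measurable_restrict eps_meas)
  have pN: "prob_space ?N" by (rule prob_space_distr[OF em])
  have pU: "prob_space ?U" by (intro prob_space_uniform_measure) auto
  \<comment> \<open>For a fixed seed the policy is deterministic, and transporting the shocks back
    to \<open>M\<close> makes \<open>expected_hind_revenue_le\<close> applicable.\<close>
  have inner: "(\<integral>e. h e u \<partial>?N) \<le> ?B" for u
  proof (cases "integrable ?N (\<lambda>e. h e u)")
    case True
    have eq: "h (\<lambda>t\<in>{1..T}. \<epsilon> t \<omega>) u = revenue C T (\<lambda>t. hind_q x \<pi> u t \<omega>) (\<lambda>t. hind_D x \<pi> u t \<omega>)" for \<omega>
      unfolding h_def Let_def case_prod_unfold
      by (rule revenue_cong) (auto simp: hind_path_nth hind_D_def hind_q_def)
    have "integrable M (\<lambda>\<omega>. h (\<lambda>t\<in>{1..T}. \<epsilon> t \<omega>) u)" by (rule integrable_distr[OF em True])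
    moreover have "(\<integral>e. h e u \<partial>?N) = (\<integral>\<omega>. h (\<lambda>t\<in>{1..T}. \<epsilon> t \<omega>) u \<partial>M)"
      by (rule integral_distr[OF em borel_measurable_integrable[OF True, simplified measurable_distr_eq1]])
    ultimately show ?thesis
      unfolding eq using expected_hind_revenue_le[OF x \<pi> m] by simp
  next
    case False
    then show ?thesis using B0 by (simp add: not_integrable_integral_eq)
  qed
  interpret NU: pair_sigma_finite ?N ?U
    by (intro pair_sigma_finite.intro prob_space_imp_sigma_finite pN pU)
  show "hind_value ?N ?m C T \<pi> \<le> ?B"
  proof (cases "integrable (?N \<Otimes>\<^sub>M ?U) (\<lambda>(e, u). h e u)")
    case True
    have "hind_value ?N ?m C T \<pi> = (\<integral>u. (\<integral>e. h e u \<partial>?N) \<partial>?U)"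
      using NU.integral_snd[OF True] by (simp add: hind_value_def h_def)
    also have "\<dots> \<le> ?B" by (rule integral_le_const_of_nonneg[OF pU AE_I2[OF inner] B0])
    finally show ?thesis .
  next
    case False
    then have "hind_value ?N ?m C T \<pi> = 0" by (simp add: hind_value_def h_def not_integrable_integral_eq)
    then show ?thesis using B0 by simp
  qed
qed

end

subsection \<open>Wasserstein distance\<close>

lemma coupling_AE:
  assumes \<gamma>: "\<gamma> \<in> couplings P Q" and P: "AE x in P. x \<in> S" and Q: "AE x in Q. x \<in> S"
  shows "AE z in \<gamma>. fst z \<in> S \<and> snd z \<in> S"
proof -
  have [measurable_cong]: "sets \<gamma> = sets (borel \<Otimes>\<^sub>M borel)" and d: "distr \<gamma> borel fst = P" "distr \<gamma> borel snd = Q"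
    using \<gamma> by (auto simp: couplings_def)
  have "AE z in \<gamma>. fst z \<in> S" by (rule AE_distrD[of fst _ borel]) (simp, unfold d, rule P)
  moreover have "AE z in \<gamma>. snd z \<in> S" by (rule AE_distrD[of snd _ borel]) (simp, unfold d, rule Q)
  ultimately show ?thesis by eventually_elim simp
qed

lemma pair_measure_coupling:
  assumes P: "prob_space P" "sets P = sets borel" and Q: "prob_space Q" "sets Q = sets borel"
  shows "P \<Otimes>\<^sub>M Q \<in> couplings P Q"
proof -
  interpret P: prob_space P by fact
  interpret Q: prob_space Q by fact
  have s: "sets (P \<Otimes>\<^sub>M Q) = sets (borel \<Otimes>\<^sub>M borel)" using assms by (intro sets_pair_measure_cong) auto
  note [measurable_cong] = s
  have sp: "space P = UNIV" "space Q = UNIV" using sets_eq_imp_space_eq[OF P(2)] sets_eq_imp_space_eq[OF Q(2)] by auto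
  have "distr (P \<Otimes>\<^sub>M Q) borel fst = P"
  proof (rule measure_eqI)
    fix A assume "A \<in> sets (distr (P \<Otimes>\<^sub>M Q) borel fst)"
    then have A: "A \<in> sets borel" by simp
    then have "emeasure (distr (P \<Otimes>\<^sub>M Q) borel fst) A = emeasure (P \<Otimes>\<^sub>M Q) (fst -` A \<inter> space (P \<Otimes>\<^sub>M Q))"
      by (intro emeasure_distr) auto
    also have "fst -` A \<inter> space (P \<Otimes>\<^sub>M Q) = A \<times> UNIV" by (auto simp: space_pair_measure sp)
    also have "emeasure (P \<Otimes>\<^sub>M Q) (A \<times> UNIV) = emeasure P A * emeasure Q UNIV"
      by (rule Q.emeasure_pair_measure_Times) (use A assms in auto)
    also have "\<dots> = emeasure P A" using Q.emeasure_space_1 by (simp add: sp)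
    finally show "emeasure (distr (P \<Otimes>\<^sub>M Q) borel fst) A = emeasure P A" .
  qed (simp add: P)
  moreover have "distr (P \<Otimes>\<^sub>M Q) borel snd = Q"
  proof (rule measure_eqI)
    fix A assume "A \<in> sets (distr (P \<Otimes>\<^sub>M Q) borel snd)"
    then have A: "A \<in> sets borel" by simp
    then have "emeasure (distr (P \<Otimes>\<^sub>M Q) borel snd) A = emeasure (P \<Otimes>\<^sub>M Q) (snd -` A \<inter> space (P \<Otimes>\<^sub>M Q))"
      by (intro emeasure_distr) auto
    also have "snd -` A \<inter> space (P \<Otimes>\<^sub>M Q) = UNIV \<times> A" by (auto simp: space_pair_measure sp)
    also have "emeasure (P \<Otimes>\<^sub>M Q) (UNIV \<times> A) = emeasure P UNIV * emeasure Q A"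
      by (rule Q.emeasure_pair_measure_Times) (use A assms in auto)
    also have "\<dots> = emeasure Q A" using P.emeasure_space_1 by (simp add: sp)
    finally show "emeasure (distr (P \<Otimes>\<^sub>M Q) borel snd) A = emeasure Q A" .
  qed (simp add: Q)
  ultimately show ?thesis using s by (simp add: couplings_def)
qed

text \<open>The product measure is a coupling, and its cost is finite because the laws live on a
  bounded set.\<close>

lemma wasserstein_finite:
  fixes P Q :: "'a::{metric_space, second_countable_topology} measure"
  assumes P: "prob_space P" "sets P = sets borel" "AE x in P. x \<in> S"
    and Q: "prob_space Q" "sets Q = sets borel" "AE x in Q. x \<in> S"
    and S: "\<And>x y. x \<in> S \<Longrightarrow> y \<in> S \<Longrightarrow> dist x y \<le> r"
  shows "wasserstein P Q < \<infinity>"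
proof -
  have c: "P \<Otimes>\<^sub>M Q \<in> couplings P Q" by (rule pair_measure_coupling) fact+
  interpret P: prob_space P by fact
  interpret Q: prob_space Q by fact
  have sp: "space P = UNIV" "space Q = UNIV" using sets_eq_imp_space_eq[OF P(2)] sets_eq_imp_space_eq[OF Q(2)] by auto
  have one: "emeasure (P \<Otimes>\<^sub>M Q) (space (P \<Otimes>\<^sub>M Q)) = 1"
    unfolding space_pair_measure using P.emeasure_space_1 Q.emeasure_space_1
    by (subst Q.emeasure_pair_measure_Times) auto
  have "wasserstein P Q \<le> (\<integral>\<^sup>+z. ennreal (dist (fst z) (snd z)) \<partial>(P \<Otimes>\<^sub>M Q))"
    unfolding wasserstein_def using c by (intro INF_lower)
  also have "\<dots> \<le> (\<integral>\<^sup>+z. ennreal r \<partial>(P \<Otimes>\<^sub>M Q))"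
  proof (rule nn_integral_mono_AE)
    show "AE z in P \<Otimes>\<^sub>M Q. ennreal (dist (fst z) (snd z)) \<le> ennreal r"
      using coupling_AE[OF c P(3) Q(3)] by eventually_elim (intro ennreal_leI S, auto)
  qed
  also have "\<dots> < \<infinity>" by (simp add: one)
  finally show ?thesis .
qed

text \<open>The easy half of Kantorovich duality, one coupling at a time. As the infimum is not
  shown to be attained, a coupling within \<open>d\<close> of it is used.\<close>

lemma wasserstein_lipschitz:
  fixes P Q :: "'a::{metric_space, second_countable_topology} measure" and F :: "'a \<Rightarrow> real"
  assumes P: "AE x in P. x \<in> S" and Q: "AE x in Q. x \<in> S"
    and F: "F \<in> borel_measurable borel" "\<And>x. x \<in> S \<Longrightarrow> 0 \<le> F x"
    and L: "0 \<le> L" "\<And>x y. x \<in> S \<Longrightarrow> y \<in> S \<Longrightarrow> F x \<le> F y + L * dist x y"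
    and w: "wasserstein P Q < \<infinity>"
  shows "(\<integral>\<^sup>+x. ennreal (F x) \<partial>Q) \<le> (\<integral>\<^sup>+x. ennreal (F x) \<partial>P) + ennreal L * wasserstein P Q"
proof -
  have le: "(\<integral>\<^sup>+x. ennreal (F x) \<partial>Q) \<le> (\<integral>\<^sup>+x. ennreal (F x) \<partial>P)
      + ennreal L * (\<integral>\<^sup>+z. ennreal (dist (fst z) (snd z)) \<partial>\<gamma>)" if \<gamma>: "\<gamma> \<in> couplings P Q" for \<gamma>
  proof -
    have [measurable_cong]: "sets \<gamma> = sets (borel \<Otimes>\<^sub>M borel)" and d: "P = distr \<gamma> borel fst" "Q = distr \<gamma> borel snd"
      using \<gamma> by (auto simp: couplings_def)
    note [measurable] = F(1)
    have "(\<integral>\<^sup>+x. ennreal (F x) \<partial>Q) = (\<integral>\<^sup>+z. ennreal (F (snd z)) \<partial>\<gamma>)" unfolding d by (intro nn_integral_distr) auto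
    also have "\<dots> \<le> (\<integral>\<^sup>+z. ennreal (F (fst z)) + ennreal L * ennreal (dist (fst z) (snd z)) \<partial>\<gamma>)"
    proof (rule nn_integral_mono_AE)
      show "AE z in \<gamma>. ennreal (F (snd z)) \<le> ennreal (F (fst z)) + ennreal L * ennreal (dist (fst z) (snd z))"
        using coupling_AE[OF \<gamma> P Q]
      proof eventually_elim
        fix z :: "'a \<times> 'a" assume "fst z \<in> S \<and> snd z \<in> S"
        then have "F (snd z) \<le> F (fst z) + L * dist (fst z) (snd z)" "0 \<le> F (fst z)"
          using L(2)[of "snd z" "fst z"] F(2) by (auto simp: dist_commute)
        then show "ennreal (F (snd z)) \<le> ennreal (F (fst z)) + ennreal L * ennreal (dist (fst z) (snd z))"
          using L(1) by (simp add: ennreal_mult[symmetric] ennreal_plus[symmetric] ennreal_leI del: ennreal_plus)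
      qed
    qed
    also have "\<dots> = (\<integral>\<^sup>+z. ennreal (F (fst z)) \<partial>\<gamma>) + ennreal L * (\<integral>\<^sup>+z. ennreal (dist (fst z) (snd z)) \<partial>\<gamma>)"
      by (subst nn_integral_add) (auto intro!: nn_integral_cmult)
    also have "(\<integral>\<^sup>+z. ennreal (F (fst z)) \<partial>\<gamma>) = (\<integral>\<^sup>+x. ennreal (F x) \<partial>P)" unfolding d by (intro nn_integral_distr[symmetric]) auto
    finally show ?thesis .
  qed
  show ?thesis
  proof (rule ennreal_le_epsilon)
    fix e :: real assume e: "0 < e"
    \<comment> \<open>The \<open>+ 1\<close> covers \<open>L = 0\<close>.\<close>
    define d where "d = e / (L + 1)"
    have d: "0 < d" "L * d \<le> e" using e L(1) by (auto simp: d_def field_simps)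
    have "wasserstein P Q < wasserstein P Q + ennreal d" using w d(1) by (simp add: ennreal_add_left_cancel_less[of _ 0, simplified])
    then obtain \<gamma> where \<gamma>: "\<gamma> \<in> couplings P Q"
      and cost: "(\<integral>\<^sup>+z. ennreal (dist (fst z) (snd z)) \<partial>\<gamma>) < wasserstein P Q + ennreal d"
      by (subst (asm) (2) wasserstein_def) (auto simp: INF_less_iff)
    have "ennreal L * (\<integral>\<^sup>+z. ennreal (dist (fst z) (snd z)) \<partial>\<gamma>) \<le> ennreal L * (wasserstein P Q + ennreal d)"
      using cost by (intro mult_left_mono) auto
    also have "\<dots> = ennreal L * wasserstein P Q + ennreal (L * d)"
      using L(1) d(1) by (simp add: distrib_left ennreal_mult)
    also have "\<dots> \<le> ennreal L * wasserstein P Q + ennreal e"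
      using d(2) by (intro add_left_mono ennreal_leI)
    finally show "(\<integral>\<^sup>+x. ennreal (F x) \<partial>Q) \<le> (\<integral>\<^sup>+x. ennreal (F x) \<partial>P) + ennreal L * wasserstein P Q + ennreal e"
      using order_trans[OF le[OF \<gamma>] add_left_mono] by (simp add: add.assoc)
  qed
qed

text \<open>\<open>measure_of\<close> returns the given set function only if it is countably
  additive. This is obtained by identifying the average with a two-stage experiment, a uniform index
  followed by a draw from \<open>P t\<close>, which also gives the integral formula.\<close>

lemma avg_measure_bind:
  fixes P :: "nat \<Rightarrow> 'a::topological_space measure"
  assumes T: "T \<ge> 1" and P: "\<And>t. t \<in> {1..T} \<Longrightarrow> prob_space (P t)" "\<And>t. t \<in> {1..T} \<Longrightarrow> sets (P t) = sets borel"
  shows "sets (avg_measure T P) = sets borel"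
    and "f \<in> borel_measurable borel \<Longrightarrow>
      (\<integral>\<^sup>+x. f x \<partial>avg_measure T P) = (\<Sum>t=1..T. ennreal (1 / real T) * (\<integral>\<^sup>+x. f x \<partial>P t))"
proof -
  let ?N = "point_measure {1..T} (\<lambda>_. ennreal (1 / real T))"
  have m: "P \<in> measurable ?N (subprob_algebra borel)"
    using P by (auto simp: measurable_def space_subprob_algebra space_point_measure sets_point_measure prob_space_imp_subprob_space)
  have ne: "space ?N \<noteq> {}" using T by (simp add: space_point_measure)
  let ?B = "?N \<bind> P"
  have sB: "sets ?B = sets borel" using P ne by (intro sets_bind) (auto simp: space_point_measure)
  then have spB: "space ?B = UNIV" by (metis sets_eq_imp_space_eq space_borel)
  have "avg_measure T P = measure_of (space ?B) (sets ?B) (emeasure ?B)"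
    unfolding avg_measure_def sB spB
  proof (rule measure_of_eq)
    fix A :: "'a set" assume "A \<in> sigma_sets UNIV (sets borel)"
    then have "A \<in> sets borel" by (metis sets.sigma_sets_eq space_borel)
    then have "emeasure ?B A = (\<integral>\<^sup>+t. emeasure (P t) A \<partial>?N)" by (rule emeasure_bind[OF ne m])
    also have "\<dots> = (\<Sum>t=1..T. ennreal (1 / real T) * emeasure (P t) A)" by (rule nn_integral_point_measure_finite) simp
    also have "\<dots> = (\<Sum>t=1..T. emeasure (P t) A) / of_nat T"
      unfolding sum_distrib_left[symmetric] divide_ennreal_def using T
      by (simp add: ennreal_of_nat_eq_real_of_nat inverse_ennreal inverse_eq_divide mult.commute)
    finally show "(\<Sum>t=1..T. emeasure (P t) A) / of_nat T = emeasure ?B A" by simp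
  qed auto
  then have eq: "avg_measure T P = ?B" by (simp add: measure_of_of_measure)
  show "sets (avg_measure T P) = sets borel" unfolding eq by (rule sB)
  show "(\<integral>\<^sup>+x. f x \<partial>avg_measure T P) = (\<Sum>t=1..T. ennreal (1 / real T) * (\<integral>\<^sup>+x. f x \<partial>P t))"
    if "f \<in> borel_measurable borel"
    unfolding eq nn_integral_bind[OF that m] by (rule nn_integral_point_measure_finite) simp
qed

lemma avg_measure_prob:
  fixes P :: "nat \<Rightarrow> 'a::topological_space measure"
  assumes T: "T \<ge> 1" and P: "\<And>t. t \<in> {1..T} \<Longrightarrow> prob_space (P t)" "\<And>t. t \<in> {1..T} \<Longrightarrow> sets (P t) = sets borel"
  shows "prob_space (avg_measure T P)"
proof
  have e1: "emeasure (P t) (space (avg_measure T P)) = 1" if "t \<in> {1..T}" for t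
    using prob_space.emeasure_space_1[OF P(1)[OF that]] sets_eq_imp_space_eq[OF P(2)[OF that]]
      sets_eq_imp_space_eq[OF avg_measure_bind(1)[OF T P]] by simp
  have "emeasure (avg_measure T P) (space (avg_measure T P)) = (\<integral>\<^sup>+x. 1 \<partial>avg_measure T P)" by simp
  also have "\<dots> = (\<Sum>t=1..T. ennreal (1 / real T) * (\<integral>\<^sup>+x. 1 \<partial>P t))"
    by (rule avg_measure_bind(2)[OF T P]) auto
  also have "\<dots> = (\<Sum>t=1..T. ennreal (1 / real T))"
    using prob_space.emeasure_space_1[OF P(1)] by (intro sum.cong refl) simp
  also have "\<dots> = ennreal (\<Sum>t=1..T. 1 / real T)" by (intro sum_ennreal) simp
  also have "\<dots> = 1" using T by simp
  finally show "emeasure (avg_measure T P) (space (avg_measure T P)) = 1" .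
qed

text \<open>\<open>S\<close> is an arbitrary set, so its complement is covered by null sets
  \<open>A t\<close> of the individual laws; their intersection still covers it and is null for
  every \<open>P t\<close> at once.\<close>

lemma avg_measure_AE:
  fixes P :: "nat \<Rightarrow> 'a::topological_space measure"
  assumes T: "T \<ge> 1" and P: "\<And>t. t \<in> {1..T} \<Longrightarrow> prob_space (P t)" "\<And>t. t \<in> {1..T} \<Longrightarrow> sets (P t) = sets borel"
    and S: "\<And>t. t \<in> {1..T} \<Longrightarrow> AE x in P t. x \<in> S"
  shows "AE x in avg_measure T P. x \<in> S"
proof -
  have "\<exists>A. A \<in> null_sets (P t) \<and> - S \<subseteq> A" if t: "t \<in> {1..T}" for t
  proof -
    have "space (P t) = UNIV" using sets_eq_imp_space_eq[OF P(2)[OF t]] by simp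
    then show ?thesis using AE_E3[OF S[OF t]] by (metis (no_types, lifting) Compl_iff Diff_iff UNIV_I subsetI)
  qed
  then obtain A where A: "\<And>t. t \<in> {1..T} \<Longrightarrow> A t \<in> null_sets (P t)" "\<And>t. t \<in> {1..T} \<Longrightarrow> - S \<subseteq> A t" by metis
  define A' where "A' = (\<Inter>t\<in>{1..T}. A t)"
  have mA: "A t \<in> sets borel" if "t \<in> {1..T}" for t using A(1)[OF that] P(2)[OF that] by auto
  have A': "A' \<in> sets borel" unfolding A'_def using T by (intro sets.finite_INT mA) auto
  have z: "emeasure (P t) A' = 0" if t: "t \<in> {1..T}" for t
  proof -
    have "emeasure (P t) A' \<le> emeasure (P t) (A t)" using t mA[OF t] P(2)[OF t] by (intro emeasure_mono) (auto simp: A'_def)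
    then show ?thesis using A(1)[OF t] by auto
  qed
  have "emeasure (avg_measure T P) A' = (\<integral>\<^sup>+x. indicator A' x \<partial>avg_measure T P)"
    using A' avg_measure_bind(1)[OF T P] by simp
  also have "\<dots> = (\<Sum>t=1..T. ennreal (1 / real T) * (\<integral>\<^sup>+x. indicator A' x \<partial>P t))"
    by (rule avg_measure_bind(2)[OF T P]) (use A' in auto)
  also have "\<dots> = 0" using z A' P(2) by (intro sum.neutral) auto
  finally have "A' \<in> null_sets (avg_measure T P)" using A' avg_measure_bind(1)[OF T P] by (simp add: null_sets_def)
  then show ?thesis by (rule AE_I') (use A(2) in \<open>unfold A'_def, blast\<close>)
qed

subsection \<open>The regret\<close>

lemma norm_param_parts: "norm (alpha_part \<theta>) \<le> norm (\<theta> :: real^('n::finite + 'n))" "norm (beta_part \<theta>) \<le> norm \<theta>"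
proof -
  have "\<theta> \<bullet> \<theta> = (\<Sum>k\<in>(UNIV :: 'n set) <+> (UNIV :: 'n set). \<theta> $ k * \<theta> $ k)" by (simp add: inner_vec_def)
  also have "\<dots> = alpha_part \<theta> \<bullet> alpha_part \<theta> + beta_part \<theta> \<bullet> beta_part \<theta>"
    by (subst sum.Plus) (simp_all add: alpha_part_def beta_part_def inner_vec_def)
  finally show "norm (alpha_part \<theta>) \<le> norm \<theta>" "norm (beta_part \<theta>) \<le> norm \<theta>" by (auto simp: norm_eq_sqrt_inner)
qed

context inventory_model
begin

definition lip :: real where "lip = (pbar + pbar\<^sup>2) * gbar * \<theta>bar"

definition Favg :: "real \<Rightarrow> real" where "Favg m = enn2real (\<integral>\<^sup>+x. ennreal (fval m x) \<partial>avg_measure T P)"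

definition wd :: "nat \<Rightarrow> real" where "wd t = enn2real (wasserstein (P t) (avg_measure T P))"

definition Vopt :: real where "Vopt = (INF m\<in>{0..pbar}. Favg m + m * c)"

lemma lip_nonneg: "0 \<le> lip"
  using pbar_nonneg gbar_pos theta_bar by (simp add: lip_def)

lemma wd_nonneg: "0 \<le> wd t" by (simp add: wd_def)

lemma fval_borel [measurable]: "fval m \<in> borel_measurable borel"
  by (rule fval_measurable) auto

text \<open>The optimal price for \<open>x\<close> is kept at \<open>x'\<close>. The index then
  moves by at most \<open>(1 + pbar) * \<theta>bar\<close> times the distance, the demand by at most
  \<open>gbar\<close> times that, and the margin is at most \<open>pbar\<close>; the product is
  \<open>lip\<close>.\<close>

lemma fval_lipschitz:
  assumes x: "x \<in> XX" "x' \<in> XX" and m: "m \<in> {0..pbar}"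
  shows "fval m x \<le> fval m x' + lip * dist x x'"
proof -
  have I: "max m plo \<le> pbar" using m prices by simp
  have cont: "continuous_on UNIV (\<lambda>q. (q - m) * g (lin_index \<theta>star y q))" for y
    by (intro continuous_intros continuous_on_compose2[OF g_cont continuous_on_lin_index]) auto
  obtain q where q: "q \<in> {max m plo..pbar}" "fval m x = (q - m) * g (lin_index \<theta>star x q)"
    using best_attained[OF I cont] unfolding fval_def by metis
  have "(q - m) * g (lin_index \<theta>star x' q) \<le> fval m x'"
    using best_attained[OF I cont] q(1) unfolding fval_def by metis
  moreover have "(q - m) * g (lin_index \<theta>star x q) \<le> (q - m) * g (lin_index \<theta>star x' q) + lip * dist x x'"
  proof -
    let ?n = "\<lambda>y. norm (stack y (q *\<^sub>R y))"
    \<comment> \<open>Taking the larger of the two feature norms puts both indices, and all points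
      between them, into one interval covered by the slope bounds of \<open>x\<close> or of
      \<open>x'\<close>.\<close>
    define b where "b = max (?n x) (?n x') * radius"
    have r: "\<theta>bar \<le> radius" using expl_pos rho0_ge by (simp add: radius_def)
    have qr: "q \<in> {plo..pbar}" "0 \<le> q" using q(1) prices by auto
    have bd: "\<bar>lin_index \<theta>star y q\<bar> \<le> b" if "y = x \<or> y = x'" for y
    proof -
      have "\<bar>lin_index \<theta>star y q\<bar> \<le> ?n y * norm \<theta>star"
        unfolding inner_stack[symmetric] by (rule Cauchy_Schwarz_ineq2)
      also have "\<dots> \<le> b" unfolding b_def using that r theta_star theta_bar
        by (intro mult_mono) (auto simp: le_max_iff_disj)
      finally show ?thesis .
    qed
    have der: "glow \<le> deriv g z \<and> deriv g z \<le> gbar" if "\<bar>z\<bar> \<le> b" for z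
      using that deriv_bounds[OF x(1) qr(1), of z] deriv_bounds[OF x(2) qr(1), of z]
      unfolding b_def by (cases "?n x \<le> ?n x'") (auto simp: max_def)
    have "\<bar>lin_index \<theta>star x q - lin_index \<theta>star x' q\<bar> =
        \<bar>(x - x') \<bullet> alpha_part \<theta>star + (x - x') \<bullet> beta_part \<theta>star * q\<bar>"
      by (simp add: lin_index_def inner_diff_left algebra_simps)
    also have "\<dots> \<le> \<bar>(x - x') \<bullet> alpha_part \<theta>star\<bar> + \<bar>(x - x') \<bullet> beta_part \<theta>star\<bar> * q"
      using qr by (intro order_trans[OF abs_triangle_ineq]) (simp add: abs_mult)
    also have "\<dots> \<le> norm (x - x') * \<theta>bar + norm (x - x') * \<theta>bar * pbar"
      using qr theta_bar order_trans[OF norm_param_parts(1) theta_star] order_trans[OF norm_param_parts(2) theta_star]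
      by (intro add_mono mult_mono order_trans[OF Cauchy_Schwarz_ineq2] mult_left_mono) auto
    finally have u: "\<bar>lin_index \<theta>star x q - lin_index \<theta>star x' q\<bar> \<le> (1 + pbar) * \<theta>bar * dist x x'"
      by (simp add: dist_norm algebra_simps)
    have "(q - m) * (g (lin_index \<theta>star x q) - g (lin_index \<theta>star x' q)) \<le>
        pbar * (gbar * ((1 + pbar) * \<theta>bar * dist x x'))"
    proof (rule order_trans[OF mult_left_mono mult_right_mono])
      have "g (lin_index \<theta>star x q) - g (lin_index \<theta>star x' q) \<le> gbar * \<bar>lin_index \<theta>star x q - lin_index \<theta>star x' q\<bar>"
        using g_slope(1)[OF der bd[of x] bd[of x']] by auto
      also have "\<dots> \<le> gbar * ((1 + pbar) * \<theta>bar * dist x x')" using u gbar_pos by (intro mult_left_mono) auto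
      finally show "g (lin_index \<theta>star x q) - g (lin_index \<theta>star x' q) \<le> gbar * ((1 + pbar) * \<theta>bar * dist x x')" .
    qed (use q m gbar_pos pbar_nonneg theta_bar in auto)
    also have "\<dots> = lip * dist x x'" by (simp add: lip_def power2_eq_square algebra_simps)
    finally show ?thesis by (simp add: algebra_simps)
  qed
  ultimately show ?thesis using q(2) by linarith
qed

lemma T1: "T \<ge> 1" using T by simp

lemma P_prob: "t \<in> {1..T} \<Longrightarrow> prob_space (P t)" and P_sets: "t \<in> {1..T} \<Longrightarrow> sets (P t) = sets borel"
proof -
  assume t: "t \<in> {1..T}"
  show "prob_space (P t)" "sets (P t) = sets borel"
    unfolding X_law[OF t, symmetric] by (simp_all add: prob_space_distr[OF X_meas[OF t]])
qed

lemma dist_XX: "x \<in> XX \<Longrightarrow> y \<in> XX \<Longrightarrow> dist x y \<le> 2"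
proof -
  have "norm x \<le> 1" if "x \<in> XX" for x
  proof -
    have "norm x \<le> norm (stack x (pbar *\<^sub>R x))"
      using norm_param_parts(1)[of "stack x (pbar *\<^sub>R x)"] by (simp add: alpha_part_def stack_def)
    then show ?thesis using z_bounded[OF that, of pbar] prices by simp
  qed
  then have "x \<in> XX \<Longrightarrow> y \<in> XX \<Longrightarrow> norm x + norm y \<le> 1 + 1" by (intro add_mono)
  then show "x \<in> XX \<Longrightarrow> y \<in> XX \<Longrightarrow> dist x y \<le> 2"
    unfolding dist_norm by (intro order_trans[OF norm_triangle_ineq4]) simp
qed

lemma avg_prob: "prob_space (avg_measure T P)" and avg_sets: "sets (avg_measure T P) = sets borel"
  and avg_AE: "AE x in avg_measure T P. x \<in> XX"
  using avg_measure_prob[OF T1 P_prob P_sets] avg_measure_bind(1)[OF T1 P_prob P_sets]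
    avg_measure_AE[OF T1 P_prob P_sets X_supp] by auto

lemma wasserstein_P: "t \<in> {1..T} \<Longrightarrow> wasserstein (P t) (avg_measure T P) = ennreal (wd t)"
  using wasserstein_finite[OF P_prob P_sets X_supp avg_prob avg_sets avg_AE dist_XX] by (simp add: wd_def)

lemma fval_AE_bounds:
  assumes N: "prob_space N" "sets N = sets borel" "AE x in N. x \<in> XX" and m: "m \<in> {0..pbar}"
  shows "(\<integral>\<^sup>+x. ennreal (fval m x) \<partial>N) = ennreal (enn2real (\<integral>\<^sup>+x. ennreal (fval m x) \<partial>N))"
proof -
  interpret N: prob_space N by fact
  have "(\<integral>\<^sup>+x. ennreal (fval m x) \<partial>N) \<le> (\<integral>\<^sup>+x. ennreal (pbar * Dbar) \<partial>N)"
    using N(3) by (intro nn_integral_mono_AE) (auto elim!: eventually_mono intro!: ennreal_leI fval_bounds(2) m)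
  then have "(\<integral>\<^sup>+x. ennreal (fval m x) \<partial>N) < \<top>" by (simp add: N.emeasure_space_1 le_less_trans)
  then show ?thesis by simp
qed

lemma Favg_eq: "m \<in> {0..pbar} \<Longrightarrow> (\<integral>\<^sup>+x. ennreal (fval m x) \<partial>avg_measure T P) = ennreal (Favg m)"
  unfolding Favg_def by (rule fval_AE_bounds[OF avg_prob avg_sets avg_AE])

lemma Favg_nonneg: "0 \<le> Favg m" by (simp add: Favg_def)

lemma Favg_le:
  assumes t: "t \<in> {1..T}" and m: "m \<in> {0..pbar}"
  shows "ennreal (Favg m) \<le> (\<integral>\<^sup>+x. ennreal (fval m x) \<partial>P t) + ennreal (lip * wd t)"
  unfolding Favg_eq[OF m, symmetric] ennreal_mult[OF lip_nonneg wd_nonneg] wasserstein_P[OF t, symmetric]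
proof (rule wasserstein_lipschitz[OF X_supp[OF t] avg_AE fval_borel _ lip_nonneg])
  show "wasserstein (P t) (avg_measure T P) < \<infinity>" by (simp add: wasserstein_P[OF t])
qed (use fval_bounds(1) fval_lipschitz m in auto)

lemma fval_X_integrable:
  assumes t: "t \<in> {1..T}" and m: "m \<in> {0..pbar}"
  shows "integrable M (\<lambda>\<omega>. fval m (X t \<omega>))"
proof (rule integrable_const_bound[of _ "pbar * Dbar"])
  show "AE \<omega> in M. norm (fval m (X t \<omega>)) \<le> pbar * Dbar"
    using AE_X[OF t] by eventually_elim (use fval_bounds m in auto)
qed (intro measurable_compose[OF X_meas[OF t] fval_borel])

lemma expected_sum_fval:
  assumes m: "m \<in> {0..pbar}"
  shows "(\<integral>\<omega>. (\<Sum>t=1..T. fval m (X t \<omega>)) \<partial>M) = real T * Favg m"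
proof -
  have e: "ennreal (\<integral>\<omega>. fval m (X t \<omega>) \<partial>M) = (\<integral>\<^sup>+x. ennreal (fval m x) \<partial>P t)"
    and nn: "0 \<le> (\<integral>\<omega>. fval m (X t \<omega>) \<partial>M)" if t: "t \<in> {1..T}" for t
  proof -
    have nn: "AE \<omega> in M. 0 \<le> fval m (X t \<omega>)" using AE_X[OF t] by eventually_elim (rule fval_bounds(1)[OF _ m])
    have "(\<integral>\<^sup>+x. ennreal (fval m x) \<partial>P t) = (\<integral>\<^sup>+\<omega>. ennreal (fval m (X t \<omega>)) \<partial>M)"
      unfolding X_law[OF t, symmetric] by (intro nn_integral_distr X_meas[OF t]) auto
    then show "ennreal (\<integral>\<omega>. fval m (X t \<omega>) \<partial>M) = (\<integral>\<^sup>+x. ennreal (fval m x) \<partial>P t)"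
      using nn_integral_eq_integral[OF fval_X_integrable[OF t m] nn] by simp
    show "0 \<le> (\<integral>\<omega>. fval m (X t \<omega>) \<partial>M)" by (rule integral_nonneg_AE[OF nn])
  qed
  have "ennreal (Favg m) = (\<Sum>t=1..T. ennreal (1 / real T) * ennreal (\<integral>\<omega>. fval m (X t \<omega>) \<partial>M))"
    unfolding Favg_eq[OF m, symmetric]
    by (subst avg_measure_bind(2)[OF T1 P_prob P_sets]) (auto simp: e intro!: sum.cong)
  also have "\<dots> = (\<Sum>t=1..T. ennreal ((\<integral>\<omega>. fval m (X t \<omega>) \<partial>M) / real T))"
    using nn by (intro sum.cong refl) (simp add: ennreal_mult'[symmetric])
  also have "\<dots> = ennreal (\<Sum>t=1..T. (\<integral>\<omega>. fval m (X t \<omega>) \<partial>M) / real T)"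
    using nn by (intro sum_ennreal) auto
  finally have "Favg m = (\<Sum>t=1..T. (\<integral>\<omega>. fval m (X t \<omega>) \<partial>M)) / real T"
    unfolding sum_divide_distrib
    by (rule ennreal_inj[THEN iffD1, rotated 2]) (use nn in \<open>auto intro!: sum_nonneg Favg_nonneg\<close>)
  then have "real T * Favg m = (\<Sum>t=1..T. (\<integral>\<omega>. fval m (X t \<omega>) \<partial>M))" using T_pos by simp
  also have "\<dots> = (\<integral>\<omega>. (\<Sum>t=1..T. fval m (X t \<omega>)) \<partial>M)"
    by (rule Bochner_Integration.integral_sum[symmetric]) (rule fval_X_integrable[OF _ m])
  finally show ?thesis by simp
qed

lemma Vopt_le: "m \<in> {0..pbar} \<Longrightarrow> Vopt \<le> Favg m + m * c"
  unfolding Vopt_def using Favg_nonneg c_pos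
  by (intro cINF_lower bdd_belowI2[of _ 0]) (auto intro!: add_nonneg_nonneg)

text \<open>At \<open>m = pbar\<close> the only admissible price has margin \<open>0\<close>. The
  bound lets the dual credit \<open>pbar * c\<close> pay for the rounds after the inventory is
  exhausted.\<close>

lemma Vopt_le_pbar: "Vopt \<le> pbar * c"
proof -
  have "fval pbar x = 0" for x
  proof -
    have "continuous_on UNIV (\<lambda>q. (q - pbar) * g (lin_index \<theta>star x q))"
      by (intro continuous_intros continuous_on_compose2[OF g_cont continuous_on_lin_index]) auto
    from best_attained[OF _ this, of pbar plo pbar] obtain q where "q \<in> {max pbar plo..pbar}"
      "fval pbar x = (q - pbar) * g (lin_index \<theta>star x q)"
      using prices unfolding fval_def by (metis max.absorb1 order_refl)
    then show ?thesis by auto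
  qed
  then have "Favg pbar = 0" by (simp add: Favg_def)
  then show ?thesis using Vopt_le[of pbar] pbar_nonneg by simp
qed

lemma run_fval_integrable:
  assumes t: "t \<in> {1..T}"
  shows "integrable M (\<lambda>\<omega>. run t \<omega> * fval (mu t \<omega>) (X t \<omega>))"
proof (rule integrable_const_bound[of _ "pbar * Dbar"])
  show "AE \<omega> in M. norm (run t \<omega> * fval (mu t \<omega>) (X t \<omega>)) \<le> pbar * Dbar"
    using AE_X[OF t]
  proof eventually_elim
    fix \<omega> assume "X t \<omega> \<in> XX"
    from fval_bounds[OF this mu_range[of t \<omega>]]
    show "norm (run t \<omega> * fval (mu t \<omega>) (X t \<omega>)) \<le> pbar * Dbar"
      using run_01[of t \<omega>] pbar_nonneg Dbar_pos by auto
  qed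
qed (intro borel_measurable_times run_M fval_measurable mu_M X_meas t)

lemma run_mu_integrable: "t \<in> {1..T} \<Longrightarrow> integrable M (\<lambda>\<omega>. run t \<omega> * mu t \<omega>)"
  and run_integrable: "t \<in> {1..T} \<Longrightarrow> integrable M (run t)"
proof -
  assume t: "t \<in> {1..T}"
  show "integrable M (\<lambda>\<omega>. run t \<omega> * mu t \<omega>)"
  proof (rule integrable_const_bound[of _ pbar])
    have "norm (run t \<omega> * mu t \<omega>) \<le> pbar" for \<omega> using run_01[of t \<omega>] mu_range[of t \<omega>] pbar_nonneg by auto
    then show "AE \<omega> in M. norm (run t \<omega> * mu t \<omega>) \<le> pbar" by simp
  qed (intro borel_measurable_times run_M mu_M t)
  show "integrable M (run t)"
    by (rule integrable_const_bound[of _ 1]) (auto intro: run_M[OF t])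
qed

text \<open>\<open>run\<close> and \<open>mu\<close> of round \<open>t\<close> are known before its
  covariate, which may thus be integrated out under \<open>P t\<close>. Passing to the averaged law
  costs \<open>lip * wd t\<close>, and \<open>Favg m \<ge> Vopt - c * m\<close> holds at whatever
  value \<open>mu\<close> takes.\<close>

lemma expected_run_fval_ge:
  assumes t: "t \<in> {1..T}"
  shows "Vopt * (\<integral>\<omega>. run t \<omega> \<partial>M) - c * (\<integral>\<omega>. run t \<omega> * mu t \<omega> \<partial>M) - lip * wd t
    \<le> (\<integral>\<omega>. run t \<omega> * fval (mu t \<omega>) (X t \<omega>) \<partial>M)"
proof -
  let ?K = "info (t - 1) T (t - 1)"
  let ?r = "\<lambda>\<omega>. run t \<omega> * Vopt - c * (run t \<omega> * mu t \<omega>) - lip * wd t"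
  let ?J = "\<integral>\<omega>. run t \<omega> * fval (mu t \<omega>) (X t \<omega>) \<partial>M"
  have K: "subalgebra M ?K" using t by (intro subalgebra_info) auto
  have [measurable]: "run t \<in> borel_measurable ?K" "mu t \<in> borel_measurable ?K"
    using t by (auto intro!: run_info mu_info)
  have h: "(\<lambda>z. ennreal (run t (fst z) * fval (mu t (fst z)) (snd z))) \<in> borel_measurable (?K \<Otimes>\<^sub>M borel)"
    by (intro measurable_compose[OF _ measurable_ennreal] borel_measurable_times fval_measurable) measurable
  have nn: "AE \<omega> in M. 0 \<le> run t \<omega> * fval (mu t \<omega>) (X t \<omega>)"
    using AE_X[OF t] by eventually_elim (use fval_bounds(1) mu_range in simp)
  have J: "ennreal ?J = (\<integral>\<^sup>+\<omega>. ennreal (run t \<omega> * fval (mu t \<omega>) (X t \<omega>)) \<partial>M)"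
    by (rule nn_integral_eq_integral[OF run_fval_integrable[OF t] nn, symmetric])
  also have "\<dots> = (\<integral>\<^sup>+\<omega>. \<integral>\<^sup>+y. ennreal (run t \<omega> * fval (mu t \<omega>) y) \<partial>P t \<partial>M)"
    using indep_nn_integral[OF K X_meas[OF t] X_indep_past[OF t] h] unfolding X_law[OF t] by simp
  also have "\<dots> \<ge> (\<integral>\<^sup>+\<omega>. ennreal (?r \<omega>) \<partial>M)"
  proof (rule nn_integral_mono)
    fix \<omega>
    have "Vopt - c * mu t \<omega> \<le> Favg (mu t \<omega>)" using Vopt_le[OF mu_range[of t \<omega>]] by (simp add: mult.commute)
    then have "ennreal (Vopt - c * mu t \<omega>) \<le> (\<integral>\<^sup>+x. ennreal (fval (mu t \<omega>) x) \<partial>P t) + ennreal (lip * wd t)"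
      by (intro order_trans[OF ennreal_leI Favg_le[OF t mu_range]])
    then have "ennreal (Vopt - c * mu t \<omega>) - ennreal (lip * wd t) \<le> (\<integral>\<^sup>+x. ennreal (fval (mu t \<omega>) x) \<partial>P t)"
      by (subst (asm) add.commute) (simp add: ennreal_minus_le_iff)
    then have "ennreal (Vopt - c * mu t \<omega> - lip * wd t) \<le> (\<integral>\<^sup>+x. ennreal (fval (mu t \<omega>) x) \<partial>P t)"
      using lip_nonneg wd_nonneg[of t] by (simp add: ennreal_minus)
    moreover have "ennreal (- (lip * wd t)) = 0" using lip_nonneg wd_nonneg[of t] by (simp add: ennreal_neg)
    ultimately show "ennreal (?r \<omega>) \<le> (\<integral>\<^sup>+y. ennreal (run t \<omega> * fval (mu t \<omega>) y) \<partial>P t)"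
      using run_01[of t \<omega>] by auto
  qed
  finally have le: "(\<integral>\<^sup>+\<omega>. ennreal (?r \<omega>) \<partial>M) \<le> ennreal ?J" .
  note i = run_integrable[OF t] run_mu_integrable[OF t]
  have ir: "integrable M ?r" using i by simp
  \<comment> \<open>\<open>ennreal\<close> cuts \<open>?r\<close> off at \<open>0\<close>, so the
    nonnegative integral only bounds the signed one from above, which is the direction
    needed.\<close>
  have "(\<integral>\<omega>. ?r \<omega> \<partial>M) \<le> enn2real (\<integral>\<^sup>+\<omega>. ennreal (?r \<omega>) \<partial>M)"
    unfolding real_lebesgue_integral_def[OF ir] by simp
  also have "\<dots> \<le> ?J"
    using enn2real_mono[OF le] integral_nonneg_AE[OF nn] by simp
  also have "(\<integral>\<omega>. ?r \<omega> \<partial>M) = Vopt * (\<integral>\<omega>. run t \<omega> \<partial>M) - c * (\<integral>\<omega>. run t \<omega> * mu t \<omega> \<partial>M) - lip * wd t"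
    using i by (simp add: prob_space)
  finally show ?thesis .
qed

section \<open>Decomposition of the revenue of a run\<close>

definition Sq :: real where "Sq = sqrt ((Dbar\<^sup>2 + \<sigma>bar\<^sup>2) * real T)"

definition noise_gain :: "nat \<Rightarrow> 'a \<Rightarrow> real" where "noise_gain t \<omega> = (run t \<omega> * (p t \<omega> - mu t \<omega>)) * \<epsilon> t \<omega>"

definition drift :: "nat \<Rightarrow> 'a \<Rightarrow> real" where "drift t \<omega> = run t \<omega> * (D t \<omega> - c)\<^sup>2"

text \<open>An integrable minorant of the revenue, which is enough because the regret is an upper
  expectation. Its terms are the dual optima, the estimation loss, the shocks, the dual value of the
  budget, the guarantee of gradient descent, and the overshoot.\<close>

definition revenue_low :: "'a \<Rightarrow> real" where
  "revenue_low \<omega> = (\<Sum>t=1..T. run t \<omega> * fval (mu t \<omega>) (X t \<omega>)) - (\<Sum>t=1..T. round_loss t \<omega>)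
    + (\<Sum>t=1..T. noise_gain t \<omega>) + c * (\<Sum>t=1..T. run t \<omega> * mu t \<omega>)
    + (pbar * c * (real T - (\<Sum>t=1..T. run t \<omega>)) - pbar * Sq / 2 - pbar / (2 * Sq) * (\<Sum>t=1..T. drift t \<omega>))
    - pbar * (Dbar + shock_norm \<omega>)"

lemma Sq_pos: "0 < Sq"
proof -
  have "0 < Dbar\<^sup>2 + \<sigma>bar\<^sup>2" using Dbar_pos by (intro add_pos_nonneg) auto
  then show ?thesis using T_pos by (simp add: Sq_def)
qed

lemma Sq_sq: "Sq\<^sup>2 = (Dbar\<^sup>2 + \<sigma>bar\<^sup>2) * real T"
  unfolding Sq_def by (intro real_sqrt_pow2) simp

lemma revenue_low_le:
  assumes ty: "typical \<omega>"
  shows "revenue_low \<omega> \<le> revenue C T (ps \<omega>) (Ds \<omega>)"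
proof -
  let ?R = "\<lambda>t. run t \<omega>"
  have C0: "0 \<le> C" using C_pos by simp
  have "(\<Sum>t=1..T. overshoot C (Ds \<omega>) t) \<le> Dbar + shock_norm \<omega>"
  proof -
    have "D t \<omega> \<le> Dbar + shock_norm \<omega>" if t: "t \<in> {1..T}" and a: "active C (Ds \<omega>) t = 1" for t
      using gt_bounds(2)[OF ty t] a shock_norm_ge[OF t, of \<omega>] by (simp add: run_def demand gt_def abs_le_iff)
    then show ?thesis
      using sum_overshoot_le[OF C0, of "Dbar + shock_norm \<omega>" T "Ds \<omega>"] shock_norm_nonneg[of \<omega>] Dbar_pos by auto
  qed
  then have over: "pbar * (\<Sum>t=1..T. overshoot C (Ds \<omega>) t) \<le> pbar * (Dbar + shock_norm \<omega>)"
    using pbar_nonneg by (rule mult_left_mono)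
  have "(\<Sum>t=1..T. active C (Ds \<omega>) t * (ps \<omega> t * Ds \<omega> t)) - pbar * (\<Sum>t=1..T. overshoot C (Ds \<omega>) t)
      \<le> revenue C T (ps \<omega>) (Ds \<omega>)"
  proof (rule revenue_ge_sum_active)
    fix t assume t: "t \<in> {1..T}" and a: "active C (Ds \<omega>) t = 1"
    then show "0 \<le> ps \<omega> t \<and> ps \<omega> t \<le> pbar"
      using typical_range(1)[OF ty t] prices by (simp add: run_def)
  qed
  \<comment> \<open>Term by term this is \<open>q D = (q - mu) D + c mu + mu (D - c)\<close>, with
    the first \<open>D\<close> split into mean and shock.\<close>
  moreover have "(\<Sum>t=1..T. active C (Ds \<omega>) t * (ps \<omega> t * Ds \<omega> t)) =
      (\<Sum>t=1..T. ?R t * fval (mu t \<omega>) (X t \<omega>)) - (\<Sum>t=1..T. round_loss t \<omega>) + (\<Sum>t=1..T. noise_gain t \<omega>)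
      + c * (\<Sum>t=1..T. ?R t * mu t \<omega>) + (\<Sum>t=1..T. ?R t * (mu t \<omega> * (D t \<omega> - c)))"
    unfolding sum_distrib_left sum_subtractf[symmetric] sum.distrib[symmetric]
  proof (rule sum.cong[OF refl])
    fix t
    have d: "Ds \<omega> t = gt t \<omega> + \<epsilon> t \<omega>" by (simp add: demand gt_def)
    show "active C (Ds \<omega>) t * (ps \<omega> t * Ds \<omega> t) = run t \<omega> * fval (mu t \<omega>) (X t \<omega>) - round_loss t \<omega> + noise_gain t \<omega>
        + c * (run t \<omega> * mu t \<omega>) + run t \<omega> * (mu t \<omega> * (D t \<omega> - c))"
      unfolding run_def[symmetric] round_loss_def noise_gain_def d by (simp add: algebra_simps)
  qed
  moreover have "pbar * c * (real T - (\<Sum>t=1..T. ?R t)) - pbar * Sq / 2 - pbar / (2 * Sq) * (\<Sum>t=1..T. drift t \<omega>)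
      \<le> (\<Sum>t=1..T. ?R t * (mu t \<omega> * (D t \<omega> - c)))"
    using dual_regret[OF pbar_nonneg c_pos T1 Sq_pos, of "Ds \<omega>"]
    unfolding run_def mu_def drift_def Sq_def C[symmetric] .
  ultimately show ?thesis unfolding revenue_low_def using over by linarith
qed

lemma noise_gain_integrable: "t \<in> {1..T} \<Longrightarrow> integrable M (noise_gain t)"
  and expected_noise_gain: "t \<in> {1..T} \<Longrightarrow> (\<integral>\<omega>. noise_gain t \<omega> \<partial>M) = 0"
proof -
  assume t: "t \<in> {1..T}"
  let ?F = "info t (t - 1) t" and ?Z = "\<lambda>\<omega>. run t \<omega> * (p t \<omega> - mu t \<omega>)"
  have F: "subalgebra M ?F" using t by (intro subalgebra_info) auto
  have Z: "?Z \<in> borel_measurable ?F"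
    using t by (intro borel_measurable_times borel_measurable_diff run_info p_info mu_info) auto
  have B: "AE \<omega> in M. \<bar>?Z \<omega>\<bar> \<le> pbar"
    using AE_typical
  proof eventually_elim
    fix \<omega> assume ty: "typical \<omega>"
    show "\<bar>?Z \<omega>\<bar> \<le> pbar"
    proof (cases "run t \<omega> = 1")
      case True
      then show ?thesis using typical_range[OF ty t True] mu_range[of t \<omega>] by auto
    next
      case False
      then have "run t \<omega> = 0" using run_01 by blast
      then show ?thesis using pbar_nonneg by simp
    qed
  qed
  note sgf = F eps_meas[OF t] subgaussian_shock[OF t] Z B
  show "integrable M (noise_gain t)" "(\<integral>\<omega>. noise_gain t \<omega> \<partial>M) = 0"
    unfolding noise_gain_def[abs_def]
    by (rule subgaussian_given_integrable_mult[OF sgf eps_integrable_M[OF t]])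
       (rule subgaussian_given_mean_zero[OF sgf])
qed

lemma drift_integrable: "t \<in> {1..T} \<Longrightarrow> integrable M (drift t)"
  and expected_drift_le: "t \<in> {1..T} \<Longrightarrow> (\<integral>\<omega>. drift t \<omega> \<partial>M) \<le> Dbar\<^sup>2 + \<sigma>bar\<^sup>2"
proof -
  assume t: "t \<in> {1..T}"
  let ?F = "info t (t - 1) t" and ?Z = "\<lambda>\<omega>. run t \<omega> * (gt t \<omega> - c)"
  have F: "subalgebra M ?F" using t by (intro subalgebra_info) auto
  have gi: "gt t \<in> borel_measurable ?F"
    unfolding gt_def[abs_def]
    by (intro measurable_compose[OF lin_index_measurable g_borel] X_info p_info) (use t in auto)
  have Z: "?Z \<in> borel_measurable ?F"
    using t by (intro borel_measurable_times borel_measurable_diff run_info gi) auto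
  have B: "AE \<omega> in M. \<bar>?Z \<omega>\<bar> \<le> Dbar"
    using AE_typical
  proof eventually_elim
    fix \<omega> assume ty: "typical \<omega>"
    show "\<bar>?Z \<omega>\<bar> \<le> Dbar"
    proof (cases "run t \<omega> = 1")
      case True
      then show ?thesis using gt_bounds[OF ty t True] c c_pos by auto
    next
      case False
      then have "run t \<omega> = 0" using run_01 by blast
      then show ?thesis using Dbar_pos by simp
    qed
  qed
  note sgf = F eps_meas[OF t] subgaussian_shock[OF t] Z B
  have iZ: "integrable M (\<lambda>\<omega>. ?Z \<omega> * \<epsilon> t \<omega>)" and eZ: "(\<integral>\<omega>. ?Z \<omega> * \<epsilon> t \<omega> \<partial>M) = 0"
    by (rule subgaussian_given_integrable_mult[OF sgf eps_integrable_M[OF t]])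
       (rule subgaussian_given_mean_zero[OF sgf])
  have ZM: "?Z \<in> borel_measurable M" by (rule measurable_from_subalg[OF F Z])
  have Z2: "AE \<omega> in M. (?Z \<omega>)\<^sup>2 \<le> Dbar\<^sup>2" using B by eventually_elim (simp add: abs_le_square_iff[symmetric])
  have iZ2: "integrable M (\<lambda>\<omega>. (?Z \<omega>)\<^sup>2)"
    by (rule integrable_const_bound[of _ "Dbar\<^sup>2"]) (use Z2 ZM in auto)
  have iE: "integrable M (\<lambda>\<omega>. run t \<omega> * (\<epsilon> t \<omega>)\<^sup>2)"
    by (rule Bochner_Integration.integrable_bound[OF eps_square_integrable_M[OF t]])
      (use run_M[OF t] eps_meas[OF t] in \<open>auto simp: abs_mult mult_left_le_one_le\<close>)
  \<comment> \<open>The cross term has mean zero; mean demand and \<open>c\<close> both lie between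
    \<open>0\<close> and \<open>Dbar\<close>, which gives
    \<open>Dbar\<^sup>2 + \<sigma>bar\<^sup>2\<close>.\<close>
  have eq: "drift t = (\<lambda>\<omega>. (?Z \<omega>)\<^sup>2 + 2 * (?Z \<omega> * \<epsilon> t \<omega>) + run t \<omega> * (\<epsilon> t \<omega>)\<^sup>2)"
  proof
    fix \<omega>
    show "drift t \<omega> = (?Z \<omega>)\<^sup>2 + 2 * (?Z \<omega> * \<epsilon> t \<omega>) + run t \<omega> * (\<epsilon> t \<omega>)\<^sup>2"
      using run_01[of t \<omega>] by (auto simp: drift_def demand gt_def power2_eq_square algebra_simps)
  qed
  show "integrable M (drift t)" unfolding eq using iZ iZ2 iE by simp
  have "(\<integral>\<omega>. drift t \<omega> \<partial>M) = (\<integral>\<omega>. (?Z \<omega>)\<^sup>2 \<partial>M) + (\<integral>\<omega>. run t \<omega> * (\<epsilon> t \<omega>)\<^sup>2 \<partial>M)"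
    unfolding eq using iZ iZ2 iE eZ by simp
  also have "(\<integral>\<omega>. (?Z \<omega>)\<^sup>2 \<partial>M) \<le> (\<integral>\<omega>. Dbar\<^sup>2 \<partial>M)" by (intro integral_mono_AE iZ2 Z2) simp
  also have "(\<integral>\<omega>. Dbar\<^sup>2 \<partial>M) = Dbar\<^sup>2" by (simp add: prob_space)
  also have "(\<integral>\<omega>. run t \<omega> * (\<epsilon> t \<omega>)\<^sup>2 \<partial>M) \<le> (\<integral>\<omega>. (\<epsilon> t \<omega>)\<^sup>2 \<partial>M)"
    by (intro integral_mono iE eps_square_integrable_M[OF t]) (simp add: mult_left_le_one_le)
  also have "\<dots> \<le> \<sigma>bar\<^sup>2" by (rule eps_second_moment[OF t])
  finally show "(\<integral>\<omega>. drift t \<omega> \<partial>M) \<le> Dbar\<^sup>2 + \<sigma>bar\<^sup>2" by simp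
qed

definition loss_bound :: real where
  "loss_bound = 2 * (pbar * Dbar) + pbar * gbar * (expl * (51 * rho + 1/2)) * sqrt (2 * real T * logdim)"

lemma revenue_low_integrable: "integrable M revenue_low"
  and expected_revenue_low_ge: "real T * Vopt - lip * variation T P - loss_bound - pbar * Sq
    - pbar * (Dbar + \<sigma>bar * sqrt (real T)) \<le> (\<integral>\<omega>. revenue_low \<omega> \<partial>M)"
proof -
  note i = run_fval_integrable round_loss_integrable noise_gain_integrable run_mu_integrable run_integrable drift_integrable
  have isum: "integrable M (\<lambda>\<omega>. \<Sum>t=1..T. run t \<omega> * fval (mu t \<omega>) (X t \<omega>))"
    "integrable M (\<lambda>\<omega>. \<Sum>t=1..T. round_loss t \<omega>)" "integrable M (\<lambda>\<omega>. \<Sum>t=1..T. noise_gain t \<omega>)"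
    "integrable M (\<lambda>\<omega>. \<Sum>t=1..T. run t \<omega> * mu t \<omega>)" "integrable M (\<lambda>\<omega>. \<Sum>t=1..T. run t \<omega>)"
    "integrable M (\<lambda>\<omega>. \<Sum>t=1..T. drift t \<omega>)"
    by (intro Bochner_Integration.integrable_sum i; assumption)+
  have es: "(\<integral>\<omega>. (\<Sum>t=1..T. run t \<omega> * fval (mu t \<omega>) (X t \<omega>)) \<partial>M) = (\<Sum>t=1..T. \<integral>\<omega>. run t \<omega> * fval (mu t \<omega>) (X t \<omega>) \<partial>M)"
    "(\<integral>\<omega>. (\<Sum>t=1..T. round_loss t \<omega>) \<partial>M) = (\<Sum>t=1..T. \<integral>\<omega>. round_loss t \<omega> \<partial>M)"
    "(\<integral>\<omega>. (\<Sum>t=1..T. noise_gain t \<omega>) \<partial>M) = (\<Sum>t=1..T. \<integral>\<omega>. noise_gain t \<omega> \<partial>M)"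
    "(\<integral>\<omega>. (\<Sum>t=1..T. run t \<omega> * mu t \<omega>) \<partial>M) = (\<Sum>t=1..T. \<integral>\<omega>. run t \<omega> * mu t \<omega> \<partial>M)"
    "(\<integral>\<omega>. (\<Sum>t=1..T. run t \<omega>) \<partial>M) = (\<Sum>t=1..T. \<integral>\<omega>. run t \<omega> \<partial>M)"
    "(\<integral>\<omega>. (\<Sum>t=1..T. drift t \<omega>) \<partial>M) = (\<Sum>t=1..T. \<integral>\<omega>. drift t \<omega> \<partial>M)"
    by (intro Bochner_Integration.integral_sum i; assumption)+
  show "integrable M revenue_low"
    unfolding revenue_low_def[abs_def] using isum shock_norm_integrable by simp
  have eq: "(\<integral>\<omega>. revenue_low \<omega> \<partial>M) =
      (\<Sum>t=1..T. \<integral>\<omega>. run t \<omega> * fval (mu t \<omega>) (X t \<omega>) \<partial>M) - (\<Sum>t=1..T. \<integral>\<omega>. round_loss t \<omega> \<partial>M)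
      + (\<Sum>t=1..T. \<integral>\<omega>. noise_gain t \<omega> \<partial>M) + c * (\<Sum>t=1..T. \<integral>\<omega>. run t \<omega> * mu t \<omega> \<partial>M)
      + (pbar * c * (real T - (\<Sum>t=1..T. \<integral>\<omega>. run t \<omega> \<partial>M)) - pbar * Sq / 2
          - pbar / (2 * Sq) * (\<Sum>t=1..T. \<integral>\<omega>. drift t \<omega> \<partial>M))
      - pbar * (Dbar + (\<integral>\<omega>. shock_norm \<omega> \<partial>M))"
    unfolding revenue_low_def es[symmetric] using isum shock_norm_integrable by (simp add: prob_space)
  define A where "A = (\<Sum>t=1..T. \<integral>\<omega>. run t \<omega> \<partial>M)"
  define B where "B = (\<Sum>t=1..T. \<integral>\<omega>. run t \<omega> * mu t \<omega> \<partial>M)"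
  have "(\<Sum>t=1..T. Vopt * (\<integral>\<omega>. run t \<omega> \<partial>M) - c * (\<integral>\<omega>. run t \<omega> * mu t \<omega> \<partial>M) - lip * wd t)
      \<le> (\<Sum>t=1..T. \<integral>\<omega>. run t \<omega> * fval (mu t \<omega>) (X t \<omega>) \<partial>M)"
    by (intro sum_mono expected_run_fval_ge)
  then have 1: "Vopt * A - c * B - lip * variation T P \<le> (\<Sum>t=1..T. \<integral>\<omega>. run t \<omega> * fval (mu t \<omega>) (X t \<omega>) \<partial>M)"
    by (simp add: sum_subtractf sum_distrib_left[symmetric] A_def B_def wd_def[abs_def] variation_def)
  have 2: "(\<Sum>t=1..T. \<integral>\<omega>. round_loss t \<omega> \<partial>M) \<le> loss_bound"
    unfolding loss_bound_def by (rule expected_total_loss_le)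
  have 3: "(\<Sum>t=1..T. \<integral>\<omega>. noise_gain t \<omega> \<partial>M) = 0" by (intro sum.neutral ballI expected_noise_gain)
  \<comment> \<open>\<open>Sq\<^sup>2\<close> bounds the total drift, so the step size
    \<open>pbar / Sq\<close> bounds each of the two error terms of gradient descent by
    \<open>pbar * Sq / 2\<close>.\<close>
  have "(\<Sum>t=1..T. \<integral>\<omega>. drift t \<omega> \<partial>M) \<le> (\<Sum>t=1..T. Dbar\<^sup>2 + \<sigma>bar\<^sup>2)" by (intro sum_mono expected_drift_le)
  also have "\<dots> = Sq\<^sup>2" by (simp add: Sq_sq mult.commute)
  finally have "pbar / (2 * Sq) * (\<Sum>t=1..T. \<integral>\<omega>. drift t \<omega> \<partial>M) \<le> pbar / (2 * Sq) * Sq\<^sup>2"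
    using pbar_nonneg Sq_pos by (intro mult_left_mono) auto
  also have "\<dots> = pbar * Sq / 2" using Sq_pos by (simp add: power2_eq_square)
  finally have 4: "pbar / (2 * Sq) * (\<Sum>t=1..T. \<integral>\<omega>. drift t \<omega> \<partial>M) \<le> pbar * Sq / 2" .
  have 5: "pbar * (Dbar + (\<integral>\<omega>. shock_norm \<omega> \<partial>M)) \<le> pbar * (Dbar + \<sigma>bar * sqrt (real T))"
    using expected_shock_norm pbar_nonneg by (intro mult_left_mono) auto
  have "A \<le> (\<Sum>t=1..T. 1)" unfolding A_def
  proof (rule sum_mono)
    fix t assume t: "t \<in> {1..T}"
    have "(\<integral>\<omega>. run t \<omega> \<partial>M) \<le> (\<integral>\<omega>. 1 \<partial>M)" by (intro integral_mono run_integrable[OF t]) auto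
    then show "(\<integral>\<omega>. run t \<omega> \<partial>M) \<le> 1" by (simp add: prob_space)
  qed
  \<comment> \<open>A lost round is worth at most \<open>pbar * c\<close> to the benchmark, exactly
    the credit granted by the dual comparator.\<close>
  then have "Vopt * (real T - A) \<le> pbar * c * (real T - A)"
    using Vopt_le_pbar by (intro mult_right_mono) auto
  then have 6: "real T * Vopt \<le> Vopt * A + pbar * c * (real T - A)" by (simp add: algebra_simps)
  show "real T * Vopt - lip * variation T P - loss_bound - pbar * Sq
    - pbar * (Dbar + \<sigma>bar * sqrt (real T)) \<le> (\<integral>\<omega>. revenue_low \<omega> \<partial>M)"
    unfolding eq 3 A_def[symmetric] B_def[symmetric] using 1 2 4 5 6 by linarith
qed

lemma regret_le:
  "regret M g \<theta>star plo pbar T C X \<epsilon> p D \<le>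
    ereal (lip * variation T P + loss_bound + pbar * Sq + 2 * pbar * (Dbar + \<sigma>bar * sqrt (real T)))"
proof (rule ereal_le_epsilon2)
  fix e :: real assume e: "0 < e"
  \<comment> \<open>A multiplier within \<open>e / T\<close> of the infimum. It is fixed before the
    covariates are drawn, so the mean of the benchmark bound is \<open>T * Favg m\<close> plus
    constants.\<close>
  have "Vopt < Vopt + e / real T" using e T_pos by simp
  then obtain m where m: "m \<in> {0..pbar}" "Favg m + m * c < Vopt + e / real T"
    unfolding Vopt_def using pbar_nonneg
    by (subst (asm) cINF_less_iff) (auto intro!: bdd_belowI2[of _ 0] add_nonneg_nonneg Favg_nonneg simp: c_pos less_imp_le)
  let ?k = "m * C + pbar * (Dbar + \<sigma>bar * sqrt (real T))"
  let ?h = "\<lambda>\<omega>. (\<Sum>t=1..T. fval m (X t \<omega>)) + ?k - revenue_low \<omega>"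
  have i: "integrable M (\<lambda>\<omega>. \<Sum>t=1..T. fval m (X t \<omega>))"
    by (intro Bochner_Integration.integrable_sum fval_X_integrable m)
  have ih: "integrable M ?h" using i revenue_low_integrable by simp
  have "regret M g \<theta>star plo pbar T C X \<epsilon> p D \<le> ereal (\<integral>\<omega>. ?h \<omega> \<partial>M)"
    unfolding regret_def upper_expectation_def
  proof (intro INF_lower CollectI conjI ih)
    show "AE \<omega> in M. OPT (distr M (PiM {1..T} (\<lambda>_. borel)) (\<lambda>\<omega>. \<lambda>t\<in>{1..T}. \<epsilon> t \<omega>))
          g \<theta>star plo pbar T (\<lambda>t. X t \<omega>) C - revenue C T (\<lambda>t. p t \<omega>) (\<lambda>t. D t \<omega>) \<le> ?h \<omega>"
      using AE_typical
    proof eventually_elim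
      fix \<omega> assume ty: "typical \<omega>"
      have X: "\<And>t. t \<in> {1..T} \<Longrightarrow> X t \<omega> \<in> XX" using ty by (simp add: typical_def)
      have "OPT (distr M (PiM {1..T} (\<lambda>_. borel)) (\<lambda>\<omega>. \<lambda>t\<in>{1..T}. \<epsilon> t \<omega>)) g \<theta>star plo pbar T (\<lambda>t. X t \<omega>) C
          \<le> (\<Sum>t=1..T. fval m (X t \<omega>)) + m * C + pbar * (Dbar + \<sigma>bar * sqrt (real T))"
        by (rule OPT_le[OF X m(1)])
      with revenue_low_le[OF ty]
      show "OPT (distr M (PiM {1..T} (\<lambda>_. borel)) (\<lambda>\<omega>. \<lambda>t\<in>{1..T}. \<epsilon> t \<omega>))
          g \<theta>star plo pbar T (\<lambda>t. X t \<omega>) C - revenue C T (\<lambda>t. p t \<omega>) (\<lambda>t. D t \<omega>) \<le> ?h \<omega>" by simp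
    qed
  qed
  also have "(\<integral>\<omega>. ?h \<omega> \<partial>M) = real T * Favg m + ?k - (\<integral>\<omega>. revenue_low \<omega> \<partial>M)"
    using i revenue_low_integrable expected_sum_fval[OF m(1)] by (simp add: prob_space)
  also have "\<dots> \<le> lip * variation T P + loss_bound + pbar * Sq + 2 * pbar * (Dbar + \<sigma>bar * sqrt (real T)) + e"
  proof -
    have "real T * (Favg m + m * c) \<le> real T * (Vopt + e / real T)" using m(2) T_pos by (intro mult_left_mono) auto
    also have "\<dots> = real T * Vopt + e" using T_pos by (simp add: distrib_left)
    finally have "real T * Favg m + m * C \<le> real T * Vopt + e" by (simp add: C algebra_simps)
    then show ?thesis using expected_revenue_low_ge by (simp add: algebra_simps)
  qed
  finally show "regret M g \<theta>star plo pbar T C X \<epsilon> p D \<le>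
    ereal (lip * variation T P + loss_bound + pbar * Sq + 2 * pbar * (Dbar + \<sigma>bar * sqrt (real T))) + ereal e" by simp
qed

end

section \<open>Growth rate and numerical constants of the bound\<close>

lemma add_le_two_mult:
  fixes d y :: real
  assumes "1 \<le> d" "2 \<le> y"
  shows "2 * d + y \<le> 2 * (d * y)"
proof -
  have "0 \<le> d * (y - 2)" "0 \<le> (d - 1) * y" using assms by (auto intro!: mult_nonneg_nonneg)
  then show ?thesis by (simp add: algebra_simps)
qed

text \<open>In the main term both \<open>\<gamma>\<close> and the root contribute
  \<open>sqrt d\<close> and at most one power of \<open>ln T\<close>, whence \<open>d\<close> and
  \<open>k = 2\<close>; as \<open>ln T \<ge> 1\<close> for \<open>T \<ge> 6\<close>, the other terms
  fit under the same power. \<open>K\<close> is formed from the model constants alone, uniformly in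
  \<open>d\<close>, \<open>T\<close> and \<open>W\<close>.\<close>

lemma regret_bound_growth:
  assumes nn: "0 \<le> gbar" "0 < glow" "0 \<le> pbar" "0 \<le> \<theta>bar" "0 \<le> \<sigma>bar" "0 \<le> Dbar"
  shows "\<exists>K k. \<forall>d T W. d \<ge> 1 \<longrightarrow> T \<ge> 6 \<longrightarrow> W \<ge> 0 \<longrightarrow>
             regret_bound gbar glow pbar \<theta>bar \<sigma>bar Dbar d T W
               \<le> K * ln (real T) ^ k * (real d * sqrt (real T) + W)"
proof (intro exI allI impI)
  fix d T :: nat and W :: real
  assume d: "d \<ge> 1" and T: "T \<ge> 6" and W: "W \<ge> 0"
  let ?K1 = "40 * gbar * pbar * (2 * \<theta>bar + 4 * \<sigma>bar / glow) * sqrt (8 * exp 1 * pi)"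
  let ?K2 = "pbar * sqrt (Dbar\<^sup>2 + \<sigma>bar\<^sup>2)" and ?K3 = "7 * Dbar * pbar"
    and ?K4 = "sqrt 2 * (pbar + pbar\<^sup>2) * gbar * \<theta>bar"
  let ?d = "real d" and ?T = "real T"
  define l where "l = ln ?T"
  define L where "L = ln ((2 * ?d + ?T) / (2 * ?d))"
  define \<gamma> where "\<gamma> = 2 * \<theta>bar + 2 * \<sigma>bar / glow * sqrt (2 * ln ?T + 2 * ?d * L)"
  have T0: "6 \<le> ?T" and d1: "1 \<le> ?d" using T d by auto
  have l1: "1 \<le> l"
    unfolding l_def using T0 exp_le by (subst ln_ge_iff) auto
  have frac: "(2 * ?d + ?T) / (2 * ?d) \<le> ?T"
  proof -
    have "2 * ?d + ?T \<le> 2 * (?d * ?T)" using T0 by (intro add_le_two_mult d1) simp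
    then show ?thesis using d1 by (simp add: field_simps)
  qed
  have L: "0 \<le> L" "L \<le> l"
    unfolding L_def l_def using frac d1 T0 by (auto intro!: ln_ge_zero ln_mono)
  have ln4: "ln (4 * ?T ^ 2) \<le> 4 * l" "0 \<le> ln (4 * ?T ^ 2)"
  proof -
    have "4 * ?T ^ 2 \<le> ?T ^ 2 * ?T ^ 2" using power_mono[OF T0, of 2] by (intro mult_right_mono) auto
    also have "\<dots> = ?T ^ 4" by (simp add: power_add[symmetric])
    finally have "ln (4 * ?T ^ 2) \<le> ln (?T ^ 4)" using T0 by (intro ln_mono) auto
    also have "\<dots> = 4 * l" using T0 by (simp add: l_def ln_realpow)
    finally show "ln (4 * ?T ^ 2) \<le> 4 * l" .
    have "1 \<le> ?T ^ 2" using T0 by (intro one_le_power) simp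
    then show "0 \<le> ln (4 * ?T ^ 2)" by (intro ln_ge_zero) simp
  qed
  have sd: "1 \<le> sqrt ?d" "1 \<le> sqrt ?T" using d1 T0 by auto
  have sl: "sqrt l \<le> l" using l1 by (intro real_le_lsqrt) (auto simp: power2_eq_square)
  have dl: "1 \<le> sqrt ?d * l" using mult_mono[OF sd(1) l1] l1 by simp
  have "2 * ln ?T + 2 * ?d * L \<le> 4 * (?d * l)"
  proof -
    have "l \<le> ?d * l" using mult_right_mono[OF d1, of l] l1 by simp
    moreover have "?d * L \<le> ?d * l" using L(2) by (intro mult_left_mono) auto
    ultimately show ?thesis unfolding l_def[symmetric] mult.assoc by linarith
  qed
  then have "sqrt (2 * ln ?T + 2 * ?d * L) \<le> sqrt (4 * (?d * l))" by (rule real_sqrt_le_mono)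
  also have "\<dots> = 2 * (sqrt ?d * sqrt l)" by (simp add: real_sqrt_mult)
  also have "\<dots> \<le> 2 * (sqrt ?d * l)" using sl by (intro mult_left_mono) auto
  finally have "2 * \<sigma>bar / glow * sqrt (2 * ln ?T + 2 * ?d * L) \<le> 2 * \<sigma>bar / glow * (2 * (sqrt ?d * l))"
    using nn by (intro mult_left_mono) auto
  moreover have "2 * \<theta>bar * 1 \<le> 2 * \<theta>bar * (sqrt ?d * l)" using dl nn by (intro mult_left_mono) auto
  ultimately have \<gamma>: "\<gamma> \<le> (2 * \<theta>bar + 4 * \<sigma>bar / glow) * (sqrt ?d * l)"
    unfolding \<gamma>_def by (simp add: algebra_simps)
  have \<gamma>0: "0 \<le> \<gamma>"
    unfolding \<gamma>_def using nn L d1 l1 by (intro add_nonneg_nonneg mult_nonneg_nonneg) (auto simp: l_def)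
  have "2 * exp 1 * pi * ?d * ?T * L * ln (4 * ?T ^ 2) \<le> 2 * exp 1 * pi * ?d * ?T * l * (4 * l)"
    using L ln4 l1 by (intro mult_mono) auto
  then have "sqrt (2 * exp 1 * pi * ?d * ?T * L * ln (4 * ?T ^ 2)) \<le> sqrt (8 * exp 1 * pi * ?d * ?T * l\<^sup>2)"
    by (simp add: power2_eq_square algebra_simps)
  also have "\<dots> = sqrt (8 * exp 1 * pi) * (sqrt ?d * sqrt ?T * l)" using l1 by (simp add: real_sqrt_mult)
  finally have s: "sqrt (2 * exp 1 * pi * ?d * ?T * L * ln (4 * ?T ^ 2)) \<le> sqrt (8 * exp 1 * pi) * (sqrt ?d * sqrt ?T * l)" .
  have "40 * gbar * pbar * \<gamma> * sqrt (2 * exp 1 * pi * ?d * ?T * L * ln (4 * ?T ^ 2)) \<le>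
      40 * gbar * pbar * ((2 * \<theta>bar + 4 * \<sigma>bar / glow) * (sqrt ?d * l)) * (sqrt (8 * exp 1 * pi) * (sqrt ?d * sqrt ?T * l))"
    using s \<gamma> \<gamma>0 nn l1 L ln4 by (intro mult_mono mult_left_mono) (auto intro!: mult_nonneg_nonneg)
  also have "\<dots> = ?K1 * (l\<^sup>2 * ((sqrt ?d * sqrt ?d) * sqrt ?T))"
    by (simp only: power2_eq_square mult_ac)
  finally have t1: "40 * gbar * pbar * \<gamma> * sqrt (2 * exp 1 * pi * ?d * ?T * L * ln (4 * ?T ^ 2)) \<le> ?K1 * (l\<^sup>2 * (?d * sqrt ?T))"
    by simp
  have l2: "1 \<le> l\<^sup>2" using l1 by (intro one_le_power)
  have dT: "sqrt ?T \<le> l\<^sup>2 * (?d * sqrt ?T)"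
    using mult_mono[OF l2 mult_right_mono[OF d1, of "sqrt ?T"]] by simp
  have "pbar * sqrt ((Dbar\<^sup>2 + \<sigma>bar\<^sup>2) * ?T) = ?K2 * sqrt ?T" by (simp add: real_sqrt_mult)
  also have "\<dots> \<le> ?K2 * (l\<^sup>2 * (?d * sqrt ?T))" using dT nn by (intro mult_left_mono) auto
  finally have t2: "pbar * sqrt ((Dbar\<^sup>2 + \<sigma>bar\<^sup>2) * ?T) \<le> ?K2 * (l\<^sup>2 * (?d * sqrt ?T))" .
  have "?K3 * 1 \<le> ?K3 * (l\<^sup>2 * (?d * sqrt ?T))"
    using order_trans[OF sd(2) dT] nn by (intro mult_left_mono) auto
  then have t3: "?K3 \<le> ?K3 * (l\<^sup>2 * (?d * sqrt ?T))" by simp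
  have t4: "?K4 * W \<le> ?K4 * (l\<^sup>2 * W)"
    using mult_right_mono[OF l2 W] nn by (intro mult_left_mono) auto
  let ?K = "?K1 + ?K2 + ?K3 + ?K4"
  have K0: "0 \<le> ?K1" "0 \<le> ?K2" "0 \<le> ?K3" "0 \<le> ?K4" using nn by auto
  have x0: "0 \<le> l\<^sup>2 * (?d * sqrt ?T)" "0 \<le> l\<^sup>2 * W" using W by auto
  have "regret_bound gbar glow pbar \<theta>bar \<sigma>bar Dbar d T W \<le> ?K1 * (l\<^sup>2 * (?d * sqrt ?T)) + ?K2 * (l\<^sup>2 * (?d * sqrt ?T))
      + ?K3 * (l\<^sup>2 * (?d * sqrt ?T)) + ?K4 * (l\<^sup>2 * W)"
    unfolding regret_bound_def Let_def L_def[symmetric] \<gamma>_def[symmetric] using t1 t2 t3 t4 by linarith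
  also have "\<dots> \<le> ?K * (l\<^sup>2 * (?d * sqrt ?T)) + ?K * (l\<^sup>2 * W)"
  proof -
    have "(?K1 + ?K2 + ?K3) * (l\<^sup>2 * (?d * sqrt ?T)) \<le> ?K * (l\<^sup>2 * (?d * sqrt ?T))"
      by (rule mult_right_mono[OF _ x0(1)]) (use K0(4) in linarith)
    moreover have "?K4 * (l\<^sup>2 * W) \<le> ?K * (l\<^sup>2 * W)"
      by (rule mult_right_mono[OF _ x0(2)]) (use K0 in linarith)
    ultimately show ?thesis by (simp only: distrib_right)
  qed
  also have "\<dots> = ?K * ln ?T ^ 2 * (?d * sqrt ?T + W)" by (simp only: l_def distrib_left mult.assoc)
  finally show "regret_bound gbar glow pbar \<theta>bar \<sigma>bar Dbar d T W \<le> ?K * ln ?T ^ 2 * (?d * sqrt ?T + W)" .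
qed

context inventory_model
begin

lemma variation_nonneg: "0 \<le> variation T P"
  by (simp add: variation_def sum_nonneg)

text \<open>The derived bound still contains \<open>2 * pbar * \<sigma>bar * sqrt T\<close> from the
  two overshoots. The first term absorbs it, because
  \<open>2 * \<sigma>bar \<le> glow * expl \<le> gbar * expl\<close> and
  \<open>sqrt T \<le> A * rho0\<close> with \<open>A = sqrt (d * T * L)\<close>.\<close>

lemma regret_le_regret_bound:
  "regret M g \<theta>star plo pbar T C X \<epsilon> p D
     \<le> ereal (regret_bound gbar glow pbar \<theta>bar \<sigma>bar Dbar CARD('n) T (variation T P))"
proof (rule order_trans[OF regret_le], rule ereal_less_eq(3)[THEN iffD2])
  let ?d = "real CARD('n)" and ?T = "real T" and ?W = "variation T P"
  define L where "L = ln ((2 * ?d + ?T) / (2 * ?d))"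
  define A where "A = sqrt (?d * ?T * L)"
  have T6: "6 \<le> ?T" and d1: "1 \<le> ?d" using T by (auto simp: Suc_le_eq)
  have "1 - 1 / ((2 * ?d + ?T) / (2 * ?d)) \<le> L"
    unfolding L_def using ln_ge_iff d1 T6 ln_le_minus_one[of "1 / ((2 * ?d + ?T) / (2 * ?d))"]
    by (simp add: ln_div)
  then have "?T / (2 * ?d + ?T) \<le> L" using d1 T6 by (simp add: field_simps)
  then have "?d * (?T / (2 * ?d + ?T)) \<le> ?d * L" using d1 by (intro mult_left_mono) auto
  \<comment> \<open>Together with \<open>L \<ge> T / (2 * d + T)\<close>, from
    \<open>ln y \<ge> 1 - 1 / y\<close>, this keeps \<open>d * L\<close> away from \<open>0\<close>
    uniformly in \<open>d\<close>.\<close>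
  moreover have "1 / 2 \<le> ?d * (?T / (2 * ?d + ?T))"
    using add_le_two_mult[OF d1, of ?T] d1 T6 by (simp add: field_simps)
  ultimately have dL: "1 / 2 \<le> ?d * L" by linarith
  have A: "sqrt ?T \<le> 2 * A"
  proof -
    have "?T / 4 \<le> ?d * L * ?T" using mult_right_mono[OF dL, of ?T] T6 by linarith
    then have "sqrt (?T / 4) \<le> A" unfolding A_def by (intro real_sqrt_le_mono) (simp add: mult_ac)
    then show ?thesis by (simp add: real_sqrt_divide)
  qed
  have A0: "0 \<le> A" using A T6 by (smt (verit) real_sqrt_ge_zero)
  have "1 \<le> sqrt (2 * ln ?T + logdim)"
    using dL lnT_nonneg by (simp add: logdim_def L_def)
  then have "2 * \<sigma>bar / glow * 1 \<le> 2 * \<sigma>bar / glow * sqrt (2 * ln ?T + logdim)"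
    using sigma_bar glow by (intro mult_left_mono) auto
  then have "2 * \<sigma>bar / glow \<le> expl" using theta_bar by (simp add: expl_eq)
  then have "2 * \<sigma>bar \<le> glow * expl" using glow by (simp add: field_simps)
  also have "\<dots> \<le> gbar * expl" using gbar_ge expl_pos by (intro mult_right_mono) auto
  finally have sig: "2 * \<sigma>bar \<le> gbar * expl" .
  have "sqrt ?T \<le> A * rho0" using A mult_left_mono[OF rho0_ge A0] by simp
  then have s\<sigma>: "2 * \<sigma>bar * sqrt ?T \<le> gbar * expl * (A * rho0)"
    by (rule mult_mono[OF sig]) (use gbar_pos expl_pos in auto)
  \<comment> \<open>The sides are about \<open>145.8\<close> and \<open>165.3\<close>; the bounds
    \<open>sqrt 2 \<le> 1.42\<close>, \<open>exp 1 \<ge> 5/2\<close> and \<open>pi > 3\<close> are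
    sharp enough.\<close>
  have c1: "102 * sqrt 2 + 3 / 2 \<le> 40 * sqrt (2 * exp 1 * pi)"
  proof -
    have "sqrt 2 \<le> 142 / 100" by (intro real_le_lsqrt) (auto simp: power2_eq_square)
    moreover have "380 / 100 \<le> sqrt (2 * exp 1 * pi)"
    proof (rule real_le_rsqrt)
      have "5 / 2 \<le> exp (1::real)" using exp_lower_Taylor_quadratic[of "1::real"] by simp
      then have "2 * (5 / 2) * 3 \<le> 2 * exp 1 * pi" using pi_gt3 by (intro mult_mono) auto
      then show "(380 / 100)\<^sup>2 \<le> 2 * exp 1 * pi" by (simp add: power2_eq_square)
    qed
    ultimately show ?thesis by linarith
  qed
  have e1: "sqrt (2 * ?T * logdim) = 2 * A"
  proof -
    have "2 * ?T * logdim = 4 * (?d * ?T * L)" by (simp add: logdim_def L_def)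
    then have "sqrt (2 * ?T * logdim) = sqrt (4 * (?d * ?T * L))" by (rule arg_cong)
    also have "\<dots> = 2 * A" by (simp add: real_sqrt_mult A_def)
    finally show ?thesis .
  qed
  have e2: "sqrt (2 * exp 1 * pi * ?d * ?T * L * ln (4 * ?T ^ 2)) = sqrt (2 * exp 1 * pi) * (A * rho0)"
    unfolding A_def rho0_def real_sqrt_mult[symmetric] by (simp add: mult_ac)
  \<comment> \<open>\<open>102\<close> is \<open>51\<close> times the factor \<open>2\<close> of
    \<open>e1\<close>; the stray \<open>1\<close> and the absorbed \<open>rho0\<close> amount to at
    most \<open>3/2 * rho0\<close>, since \<open>rho0 \<ge> 2\<close>.\<close>
  have "gbar * (expl * (51 * rho + 1 / 2)) * sqrt (2 * ?T * logdim) + 2 * \<sigma>bar * sqrt ?T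
      \<le> gbar * expl * (A * (102 * sqrt 2 * rho0 + 1)) + gbar * expl * (A * rho0)"
    unfolding e1 using s\<sigma> by (simp add: rho_def algebra_simps)
  also have "\<dots> \<le> gbar * expl * (A * ((102 * sqrt 2 + 3 / 2) * rho0))"
  proof -
    have "A * (102 * sqrt 2 * rho0 + 1) + A * rho0 \<le> A * ((102 * sqrt 2 + 3 / 2) * rho0)"
      unfolding distrib_left[symmetric] using rho0_ge A0 by (intro mult_left_mono) (auto simp: algebra_simps)
    from mult_left_mono[OF this, of "gbar * expl"] show ?thesis
      using gbar_pos expl_pos by (simp only: distrib_left mult_nonneg_nonneg less_imp_le)
  qed
  also have "\<dots> \<le> gbar * expl * (A * (40 * sqrt (2 * exp 1 * pi) * rho0))"
    using c1 gbar_pos expl_pos A0 rho0_ge by (intro mult_left_mono mult_right_mono) auto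
  also have "\<dots> = 40 * gbar * expl * sqrt (2 * exp 1 * pi * ?d * ?T * L * ln (4 * ?T ^ 2))"
    unfolding e2 by simp
  finally have "pbar * (gbar * (expl * (51 * rho + 1 / 2)) * sqrt (2 * ?T * logdim) + 2 * \<sigma>bar * sqrt ?T)
      \<le> pbar * (40 * gbar * expl * sqrt (2 * exp 1 * pi * ?d * ?T * L * ln (4 * ?T ^ 2)))"
    using pbar_nonneg by (rule mult_left_mono)
  then have main: "pbar * gbar * (expl * (51 * rho + 1 / 2)) * sqrt (2 * ?T * logdim) + 2 * pbar * \<sigma>bar * sqrt ?T
      \<le> 40 * gbar * pbar * expl * sqrt (2 * exp 1 * pi * ?d * ?T * L * ln (4 * ?T ^ 2))"
    by (simp add: algebra_simps)
  have "lip * ?W \<le> sqrt 2 * (lip * ?W)"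
    using mult_right_mono[of 1 "sqrt 2" "lip * ?W"] lip_nonneg variation_nonneg by simp
  then have W: "lip * ?W \<le> sqrt 2 * (pbar + pbar\<^sup>2) * gbar * \<theta>bar * ?W" by (simp add: lip_def mult.assoc)
  \<comment> \<open>Two units of \<open>pbar * Dbar\<close> come from the exceptional events and one
    from each overshoot.\<close>
  have D: "4 * (pbar * Dbar) \<le> 7 * (pbar * Dbar)"
    using pbar_nonneg Dbar_pos by (intro mult_right_mono) auto
  have "expl = 2 * \<theta>bar + 2 * \<sigma>bar / glow * sqrt (2 * ln ?T + 2 * ?d * L)"
    by (simp add: expl_eq logdim_def L_def)
  then show "lip * ?W + loss_bound + pbar * Sq + 2 * pbar * (Dbar + \<sigma>bar * sqrt ?T)
      \<le> regret_bound gbar glow pbar \<theta>bar \<sigma>bar Dbar CARD('n) T ?W"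
    unfolding regret_bound_def Let_def L_def[symmetric] loss_bound_def Sq_def
    using main W D by (simp add: algebra_simps)
qed

end

theorem theorem5:
  fixes M :: "'a measure"
    and T :: nat
    and XX :: "(real^'n::finite) set"
    and P :: "nat \<Rightarrow> (real^'n) measure"
    and X :: "nat \<Rightarrow> 'a \<Rightarrow> real^'n"
    and \<epsilon> :: "nat \<Rightarrow> 'a \<Rightarrow> real"
    and \<eta> :: "nat \<Rightarrow> 'a \<Rightarrow> real^2"
    and \<theta>hat :: "nat \<Rightarrow> 'a \<Rightarrow> real^('n + 'n)"
    and p D :: "nat \<Rightarrow> 'a \<Rightarrow> real"
    and \<theta>star :: "real^('n + 'n)"
    and g :: "real \<Rightarrow> real"
    and plo pbar \<theta>bar Dbar \<sigma>bar glow gbar c C :: real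
  assumes M: "prob_space M"
    and T: "T \<ge> 6"
    and prices: "0 \<le> plo" "plo \<le> pbar"
    and C: "C = c * real T"
    \<comment> \<open>random variables and demand\<close>
    and X_meas: "\<And>t. t \<in> {1..T} \<Longrightarrow> X t \<in> borel_measurable M"
    and eps_meas: "\<And>t. t \<in> {1..T} \<Longrightarrow> \<epsilon> t \<in> borel_measurable M"
    and demand: "\<And>t \<omega>. D t \<omega> = g (lin_index \<theta>star (X t \<omega>) (p t \<omega>)) + \<epsilon> t \<omega>"
    \<comment> \<open>independent covariates\<close>
    and X_law: "\<And>t. t \<in> {1..T} \<Longrightarrow> distr M borel (X t) = P t"
    and X_supp: "\<And>t. t \<in> {1..T} \<Longrightarrow> AE x in P t. x \<in> XX"
    and X_indep: "prob_space.indep_vars M (\<lambda>_. borel) X {1..T}"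
    and X_eps_indep: "prob_space.indep_set M
           (sigma_sets (space M) (cyl M X {1..T})) (sigma_sets (space M) (cyl M \<epsilon> {1..T}))"
    \<comment> \<open>boundedness\<close>
    and theta_bar: "\<theta>bar > 0"
    and theta_star: "norm \<theta>star \<le> \<theta>bar"
    and g_bounded: "\<And>x q. x \<in> XX \<Longrightarrow> q \<in> {plo..pbar} \<Longrightarrow>
           0 \<le> g (lin_index \<theta>star x q) \<and> g (lin_index \<theta>star x q) \<le> Dbar"
    and z_bounded: "\<And>x q. x \<in> XX \<Longrightarrow> q \<in> {plo..pbar} \<Longrightarrow> norm (stack x (q *\<^sub>R x)) \<le> 1"
    \<comment> \<open>enlarged link-function assumption\<close>
    and g_mono: "strict_mono g"
    and g_diff: "\<And>z. g differentiable (at z)"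
    and glow: "glow > 0"
    and g_deriv: "\<And>x \<theta> q. x \<in> XX \<Longrightarrow> \<theta> \<in> Theta_enlarged \<theta>bar \<sigma>bar glow T \<Longrightarrow> q \<in> {plo..pbar} \<Longrightarrow>
           glow \<le> deriv g (lin_index \<theta> x q) \<and> deriv g (lin_index \<theta> x q) \<le> gbar"
    \<comment> \<open>demand shocks\<close>
    and sigma_bar: "\<sigma>bar \<ge> 0"
    and eps_integrable: "\<And>t. t \<in> {1..T} \<Longrightarrow> integrable M (\<epsilon> t)"
    and eps_mean: "\<And>t. t \<in> {1..T} \<Longrightarrow>
           AE \<omega> in M. real_cond_exp M (shock_filtration M p \<epsilon> X (t - 1)) (\<epsilon> t) \<omega> = 0"
    and eps_exp_integrable: "\<And>t s. t \<in> {1..T} \<Longrightarrow> integrable M (\<lambda>\<omega>. exp (s * \<epsilon> t \<omega>))"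
    and eps_subgaussian: "\<And>t s. t \<in> {1..T} \<Longrightarrow>
           AE \<omega> in M. ln (real_cond_exp M (shock_filtration M p \<epsilon> X (t - 1))
                             (\<lambda>\<omega>. exp (s * \<epsilon> t \<omega>)) \<omega>) \<le> \<sigma>bar\<^sup>2 * s\<^sup>2 / 2"
    \<comment> \<open>feasibility and tractability\<close>
    and c: "c \<in> {0..Dbar}"
    and beta_neg: "\<And>x. x \<in> XX \<Longrightarrow> x \<bullet> beta_part \<theta>star < 0"
    and feasible: "\<And>x. x \<in> XX \<Longrightarrow> g (lin_index \<theta>star x pbar) < c"
    and g_range: "{0..Dbar} \<subseteq> range g"
    and g_inv_convex: "convex_on {0..Dbar} (\<lambda>y. y * inv g y)"
    \<comment> \<open>randomization of the algorithm\<close>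
    and eta_normal: "\<And>t. t \<in> {1..T} \<Longrightarrow> distributed M lborel (\<eta> t) std_normal2"
    and eta_indep: "\<And>t. t \<in> {1..T} \<Longrightarrow> prob_space.indep_set M
           (sigma_sets (space M) (cyl M \<eta> {t}))
           (sigma_sets (space M) (cyl M X {1..T} \<union> cyl M \<epsilon> {1..T} \<union> cyl M \<eta> {1..<t}))"
    \<comment> \<open>estimates and prices are functions of the information available when they are chosen\<close>
    and theta_hat_meas: "\<And>t. t < T \<Longrightarrow> \<theta>hat t \<in> borel_measurable
           (sigma (space M) (cyl M X {1..t} \<union> cyl M p {1..t} \<union> cyl M D {1..t}))"
    and p_meas: "\<And>t. t \<in> {1..T} \<Longrightarrow> p t \<in> borel_measurable
           (sigma (space M)
             (cyl M X {1..t} \<union> cyl M p {1..<t} \<union> cyl M D {1..<t} \<union> cyl M \<eta> {1..t}))"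
    \<comment> \<open>the prices are those of the algorithm with regularization parameter 1\<close>
    and algorithm: "AE \<omega> in M. inventory_TS g glow \<theta>bar \<sigma>bar Dbar plo pbar T C 1
           (\<lambda>t. X t \<omega>) (\<lambda>t. D t \<omega>) (\<lambda>t. \<eta> t \<omega>) (\<lambda>t. \<theta>hat t \<omega>) (\<lambda>t. p t \<omega>)"
  shows "regret M g \<theta>star plo pbar T C X \<epsilon> p D
           \<le> ereal (regret_bound gbar glow pbar \<theta>bar \<sigma>bar Dbar CARD('n) T (variation T P))
       \<and> (\<exists>K k. \<forall>d T' W. d \<ge> 1 \<longrightarrow> T' \<ge> 6 \<longrightarrow> W \<ge> 0 \<longrightarrow>
             regret_bound gbar glow pbar \<theta>bar \<sigma>bar Dbar d T' W
               \<le> K * ln (real T') ^ k * (real d * sqrt (real T') + W))"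
proof -
  interpret prob_space M by (rule M)
  interpret inventory_model M T XX P X \<epsilon> \<eta> \<theta>hat p D \<theta>star g plo pbar \<theta>bar Dbar \<sigma>bar glow gbar c C
    by unfold_locales (fact T prices C X_meas eps_meas demand X_law X_supp X_indep X_eps_indep theta_bar theta_star
      g_bounded z_bounded g_mono g_diff glow g_deriv sigma_bar eps_exp_integrable eps_subgaussian c feasible
      eta_normal eta_indep theta_hat_meas p_meas algorithm)+
  show ?thesis
    using regret_le_regret_bound regret_bound_growth[of gbar glow pbar \<theta>bar \<sigma>bar Dbar]
      gbar_pos glow pbar_nonneg theta_bar sigma_bar Dbar_pos by (simp add: less_imp_le)
qed

end
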